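(* Let $p>3$ be a prime, $X$ a nonempty totally ordered set, and $S$ the free profinite group on $X$. Then the homomorphism $$\begin{aligned}\bigoplus_{x\in X}\mathbb{Z}/p&\oplus\Bigl(\bigl(\bigoplus_{x,y\in X}\mathbb{Z}(xy)\bigr)/\langle (xy)+(yx)\ |\ x,y\in X\rangle\Bigr)\otimes(\mathbb{Z}/p)\\&\oplus\Bigl(\bigl(\bigoplus_{x,y,z\in X}\mathbb{Z}(xyz)\bigr)/\langle (xyz)+(xzy)+(zxy)\ |\ x,y,z\in X\rangle\Bigr)\otimes(\mathbb{Z}/p)\to H^2(S^{[3,p]},\mathbb{Z}/p),\end{aligned}$$ given by $(\bar r_w)_w\mapsto\sum_w r_w\alpha_{w,3}$ (with $w$ ranging over the words of length $1,2,3$ in $X$), is an isomorphism. Thus all relations in $H^2(S^{[3,p]},\mathbb{Z}/p)$ (that is, all $\mathbb{Z}/p$-linear relations among the elements $\alpha_{w,3}$, $w$ a word in $X$ of length $1\le|w|\le3$) are consequences of the shuffle relations $\sum_{w}(u\,ш\,v)_w\alpha_{w,3}=0$, for nonempty words $u,v$ with $|u|+|v|\leq 3$ and with $w$ ranging over words of length $|u|+|v|$.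
   Context: $\langle\cdots\rangle$ denotes the $\mathbb{Z}$-submodule generated by the given elements, and $\mathbb{Z}(xy)$, $\mathbb{Z}(xyz)$ are free rank-one modules on the corresponding words. That the map above is well defined (and surjective) is known. $u\,ш\,v$ is the shuffle product: the sum in $\mathbb{Z}\langle X\rangle$, counted with multiplicity, over all partitions $\{1,\ldots,|u|+|v|\}=I\sqcup J$ with $|I|=|u|$, $|J|=|v|$, of the word whose restriction to the positions in $I$ is $u$ and to those in $J$ is $v$; $(\cdot)_w$ is the coefficient at $w$. For a profinite group $G$: $G^{(1,p)}=G$, $G^{(n+1,p)}=(G^{(n,p)})^p[G,G^{(n,p)}]$ (closed subgroup generated by all $h^p$ and $[g,h]=g^{-1}h^{-1}gh$, $g\in G$, $h\in G^{(n,p)}$), and $G^{[n,p]}=G/G^{(n,p)}$. Cohomology is profinite cohomology with trivial action on $\mathbb{Z}/p$. The free profinite group $S=S_X$ on basis $X$: $X\subseteq S$ generates $S$ topologically, the inclusion converges to $1$ (every open normal subgroup contains all but finitely many elements of $X$), and every map $X\to G$ to a profinite group converging to $1$ extends uniquely to a continuous homomorphism $S\to G$. For a profinite commutative ring $R$, $\Lambda_R\colon S\to R\langle\langle X\rangle\rangle^\times$ is the continuous (Magnus) homomorphism into the units of the ring of non-commuting formal power series with $\Lambda_R(x)=1+x$, $x\in X$; $\epsilon_{w,R}(\sigma)$ is the coefficient of $w$ in $\Lambda_R(\sigma)$. For $n=3$ and $1\leq s\leq n$ let $\mathbb{U}=\mathbb{U}_{s+1}(\mathbb{Z}/p^{n-s+1})$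 be the group of unipotent upper-triangular $(s+1)\times(s+1)$ matrices over $\mathbb{Z}/p^{n-s+1}$. It is known that $\mathbb{U}^{(n,p)}=I_{s+1}+\mathbb{Z}p^{n-s}E_{1,s+1}$ is central in $\mathbb{U}$; identify it with $\mathbb{Z}/p$ via $I_{s+1}+ap^{n-s}E_{1,s+1}\mapsto a\pmod p$. Let $\gamma_{n,s}\in H^2(\mathbb{U}^{[n,p]},\mathbb{Z}/p)$ be the class of the central extension $0\to\mathbb{Z}/p\to\mathbb{U}\to\mathbb{U}^{[n,p]}\to1$. For a word $w=(x_1\cdots x_s)$, let $\rho^w\colon S\to\mathbb{U}$ be the continuous homomorphism with $(i,j)$ entry $\epsilon_{(x_i\cdots x_{j-1}),\mathbb{Z}/p^{n-s+1}}(\sigma)$ for $i<j$, $\bar\rho^w\colon S^{[n,p]}\to\mathbb{U}^{[n,p]}$ the induced map, and $\alpha_{w,n}=(\bar\rho^w)^*\gamma_{n,s}\in H^2(S^{[n,p]},\mathbb{Z}/p)$. *)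

theory Defs
  imports
    "HOL-Analysis.Analysis"
    "HOL-Algebra.Free_Abelian_Groups"
    "HOL-Number_Theory.Residues"
    "HOL-Library.Infinite_Typeclass"
begin

section \<open>Topological and profinite groups\<close>

text \<open>A topological group is a pair of a group \<open>G\<close> (in the sense of HOL-Algebra) and a topology
  \<open>T\<close> whose underlying set is the carrier of \<open>G\<close>.\<close>

definition topological_group :: "('a, 'm) monoid_scheme \<Rightarrow> 'a topology \<Rightarrow> bool" where
  "topological_group G T \<longleftrightarrow>
     group G \<and> topspace T = carrier G \<and>
     continuous_map (prod_topology T T) T (\<lambda>(g, h). g \<otimes>\<^bsub>G\<^esub> h) \<and>
     continuous_map T T (\<lambda>g. inv\<^bsub>G\<^esub> g)"

definition profinite_group :: "('a, 'm) monoid_scheme \<Rightarrow> 'a topology \<Rightarrow> bool" where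
  "profinite_group G T \<longleftrightarrow>
     topological_group G T \<and> compact_space T \<and> Hausdorff_space T \<and>
     (\<forall>C. connectedin T C \<longrightarrow> (\<exists>a. C \<subseteq> {a}))"

definition closed_subgroup_generated ::
  "('a, 'm) monoid_scheme \<Rightarrow> 'a topology \<Rightarrow> 'a set \<Rightarrow> 'a set" where
  "closed_subgroup_generated G T A = \<Inter> {H. subgroup H G \<and> closedin T H \<and> A \<subseteq> H}"

definition converges_to_one ::
  "('a, 'm) monoid_scheme \<Rightarrow> 'a topology \<Rightarrow> 'x set \<Rightarrow> ('x \<Rightarrow> 'a) \<Rightarrow> bool" where
  "converges_to_one G T X f \<longleftrightarrow>
     (\<forall>N. N \<lhd> G \<and> openin T N \<longrightarrow> finite {x \<in> X. f x \<notin> N})"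

text \<open>The universal property of the free profinite group on the basis \<open>X\<close>.  HOL cannot quantify
  over types inside a formula, so the test groups are the profinite groups on an arbitrary
  infinite type \<open>'g\<close>, given as a parameter.  The universal property with respect to profinite
  groups of arbitrary size implies the one for each \<open>'g\<close>; conversely, every finite group has a
  copy on any infinite type \<open>'g\<close>, and profinite groups are inverse limits of finite ones.\<close>

definition free_profinite_group ::
  "'g::infinite itself \<Rightarrow> ('a, 'm) monoid_scheme \<Rightarrow> 'a topology \<Rightarrow> 'a set \<Rightarrow> bool" where
  "free_profinite_group _ S T X \<longleftrightarrow>
     profinite_group S T \<and> X \<subseteq> carrier S \<and>
     closed_subgroup_generated S T X = carrier S \<and>
     converges_to_one S T X (\<lambda>x. x) \<and>
     (\<forall>(G :: 'g monoid) TG f.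
        profinite_group G TG \<and> f \<in> X \<rightarrow> carrier G \<and> converges_to_one G TG X f \<longrightarrow>
        (\<exists>!\<phi>. \<phi> \<in> extensional (carrier S) \<and> \<phi> \<in> hom S G \<and> continuous_map T TG \<phi> \<and>
              (\<forall>x\<in>X. \<phi> x = f x)))"

section \<open>Quotients and the lower p-central filtration\<close>

definition quotient_topology :: "'a topology \<Rightarrow> ('a \<Rightarrow> 'b) \<Rightarrow> 'b topology" where
  "quotient_topology T f =
     topology (\<lambda>V. V \<subseteq> f ` topspace T \<and> openin T {x \<in> topspace T. f x \<in> V})"

lemma openin_quotient_topology:
  "openin (quotient_topology T f) V \<longleftrightarrow>
     V \<subseteq> f ` topspace T \<and> openin T {x \<in> topspace T. f x \<in> V}"
proof -
  have "istopology (\<lambda>V. V \<subseteq> f ` topspace T \<and> openin T {x \<in> topspace T. f x \<in> V})"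
    unfolding istopology_def
  proof (intro conjI allI impI)
    fix V W
    assume *: "V \<subseteq> f ` topspace T \<and> openin T {x \<in> topspace T. f x \<in> V}"
              "W \<subseteq> f ` topspace T \<and> openin T {x \<in> topspace T. f x \<in> W}"
    show "V \<inter> W \<subseteq> f ` topspace T" using * by blast
    have "{x \<in> topspace T. f x \<in> V \<inter> W} =
          {x \<in> topspace T. f x \<in> V} \<inter> {x \<in> topspace T. f x \<in> W}" by blast
    then show "openin T {x \<in> topspace T. f x \<in> V \<inter> W}" using * by (simp add: openin_Int)
  next
    fix \<V>
    assume *: "\<forall>V\<in>\<V>. V \<subseteq> f ` topspace T \<and> openin T {x \<in> topspace T. f x \<in> V}"
    then show "\<Union> \<V> \<subseteq> f ` topspace T" by blast
    have "{x \<in> topspace T. f x \<in> \<Union> \<V>} = (\<Union>V\<in>\<V>. {x \<in> topspace T. f x \<in> V})" by blast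
    then show "openin T {x \<in> topspace T. f x \<in> \<Union> \<V>}" using * by auto
  qed
  then show ?thesis
    by (simp add: quotient_topology_def)
qed

definition coset_topology ::
  "('a, 'm) monoid_scheme \<Rightarrow> 'a topology \<Rightarrow> 'a set \<Rightarrow> 'a set topology" where
  "coset_topology G T N = quotient_topology T (\<lambda>g. N #>\<^bsub>G\<^esub> g)"

definition induced_quotient_map ::
  "('a \<Rightarrow> 'b) \<Rightarrow> ('a, 'm) monoid_scheme \<Rightarrow> 'a set \<Rightarrow> ('b, 'n) monoid_scheme \<Rightarrow> 'b set
     \<Rightarrow> 'a set \<Rightarrow> 'b set" where
  "induced_quotient_map h G N H M =
     (\<lambda>C\<in>carrier (G Mod N). the_elem ((\<lambda>g. M #>\<^bsub>H\<^esub> h g) ` C))"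

text \<open>The filtration is indexed from \<open>1\<close>; the value at \<open>0\<close> is irrelevant.\<close>

fun lower_p_central ::
  "('a, 'm) monoid_scheme \<Rightarrow> 'a topology \<Rightarrow> nat \<Rightarrow> nat \<Rightarrow> 'a set" where
  "lower_p_central G T p 0 = carrier G"
| "lower_p_central G T p (Suc 0) = carrier G"
| "lower_p_central G T p (Suc (Suc n)) =
     closed_subgroup_generated G T
       ({h [^]\<^bsub>G\<^esub> p | h. h \<in> lower_p_central G T p (Suc n)} \<union>
        {inv\<^bsub>G\<^esub> g \<otimes>\<^bsub>G\<^esub> inv\<^bsub>G\<^esub> h \<otimes>\<^bsub>G\<^esub> g \<otimes>\<^bsub>G\<^esub> h | g h.
           g \<in> carrier G \<and> h \<in> lower_p_central G T p (Suc n)})"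

definition p_quotient ::
  "('a, 'm) monoid_scheme \<Rightarrow> 'a topology \<Rightarrow> nat \<Rightarrow> nat \<Rightarrow> 'a set monoid" where
  "p_quotient G T p n = G Mod lower_p_central G T p n"

definition p_quotient_topology ::
  "('a, 'm) monoid_scheme \<Rightarrow> 'a topology \<Rightarrow> nat \<Rightarrow> nat \<Rightarrow> 'a set topology" where
  "p_quotient_topology G T p n = coset_topology G T (lower_p_central G T p n)"

section \<open>Continuous cohomology in degree 2\<close>

text \<open>\<open>A\<close> is a discrete abelian group with trivial action, written multiplicatively as a record of
  HOL-Algebra.  Cochains are inhomogeneous and extensional.\<close>

definition continuous_cochains_1 ::
  "('a, 'm) monoid_scheme \<Rightarrow> 'a topology \<Rightarrow> ('c, 'k) monoid_scheme \<Rightarrow> ('a \<Rightarrow> 'c) set" where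
  "continuous_cochains_1 G T A =
     {b \<in> extensional (carrier G). continuous_map T (discrete_topology (carrier A)) b}"

definition continuous_cochains_2 ::
  "('a, 'm) monoid_scheme \<Rightarrow> 'a topology \<Rightarrow> ('c, 'k) monoid_scheme \<Rightarrow> ('a \<times> 'a \<Rightarrow> 'c) set" where
  "continuous_cochains_2 G T A =
     {f \<in> extensional (carrier G \<times> carrier G).
        continuous_map (prod_topology T T) (discrete_topology (carrier A)) f}"

definition cocycles_2 ::
  "('a, 'm) monoid_scheme \<Rightarrow> 'a topology \<Rightarrow> ('c, 'k) monoid_scheme \<Rightarrow> ('a \<times> 'a \<Rightarrow> 'c) set" where
  "cocycles_2 G T A =
     {f \<in> continuous_cochains_2 G T A.
        \<forall>g\<in>carrier G. \<forall>h\<in>carrier G. \<forall>k\<in>carrier G.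
          f (h, k) \<otimes>\<^bsub>A\<^esub> inv\<^bsub>A\<^esub> f (g \<otimes>\<^bsub>G\<^esub> h, k) \<otimes>\<^bsub>A\<^esub> f (g, h \<otimes>\<^bsub>G\<^esub> k) \<otimes>\<^bsub>A\<^esub> inv\<^bsub>A\<^esub> f (g, h)
            = \<one>\<^bsub>A\<^esub>}"

definition coboundary_2 ::
  "('a, 'm) monoid_scheme \<Rightarrow> ('c, 'k) monoid_scheme \<Rightarrow> ('a \<Rightarrow> 'c) \<Rightarrow> 'a \<times> 'a \<Rightarrow> 'c" where
  "coboundary_2 G A b =
     (\<lambda>(g, h)\<in>carrier G \<times> carrier G. b h \<otimes>\<^bsub>A\<^esub> inv\<^bsub>A\<^esub> b (g \<otimes>\<^bsub>G\<^esub> h) \<otimes>\<^bsub>A\<^esub> b g)"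

definition coboundaries_2 ::
  "('a, 'm) monoid_scheme \<Rightarrow> 'a topology \<Rightarrow> ('c, 'k) monoid_scheme \<Rightarrow> ('a \<times> 'a \<Rightarrow> 'c) set" where
  "coboundaries_2 G T A = coboundary_2 G A ` continuous_cochains_1 G T A"

definition cocycle_group_2 ::
  "('a, 'm) monoid_scheme \<Rightarrow> 'a topology \<Rightarrow> ('c, 'k) monoid_scheme \<Rightarrow> ('a \<times> 'a \<Rightarrow> 'c) monoid" where
  "cocycle_group_2 G T A =
     (product_group (carrier G \<times> carrier G) (\<lambda>_. A))\<lparr>carrier := cocycles_2 G T A\<rparr>"

definition H2 ::
  "('a, 'm) monoid_scheme \<Rightarrow> 'a topology \<Rightarrow> ('c, 'k) monoid_scheme
     \<Rightarrow> ('a \<times> 'a \<Rightarrow> 'c) set monoid" where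
  "H2 G T A = cocycle_group_2 G T A Mod coboundaries_2 G T A"

definition H2_pullback ::
  "('a, 'm) monoid_scheme \<Rightarrow> 'a topology \<Rightarrow> ('b, 'n) monoid_scheme \<Rightarrow> 'b topology
     \<Rightarrow> ('c, 'k) monoid_scheme \<Rightarrow> ('a \<Rightarrow> 'b) \<Rightarrow> ('b \<times> 'b \<Rightarrow> 'c) set \<Rightarrow> ('a \<times> 'a \<Rightarrow> 'c) set" where
  "H2_pullback G T Q TQ A \<phi> =
     induced_quotient_map (\<lambda>f. \<lambda>(g, h)\<in>carrier G \<times> carrier G. f (\<phi> g, \<phi> h))
       (cocycle_group_2 Q TQ A) (coboundaries_2 Q TQ A)
       (cocycle_group_2 G T A) (coboundaries_2 G T A)"

text \<open>The class of a central extension of \<open>Q\<close> by \<open>A\<close> with maps \<open>\<iota>\<close> from \<open>A\<close> to \<open>U\<close> and \<open>\<pi>\<close> from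
  \<open>U\<close> to \<open>Q\<close>: a continuous set-theoretic section \<open>s\<close> of \<open>\<pi>\<close> has the factor set \<open>f\<close> with
  \<open>s q \<cdot> s q' = \<iota> (f (q, q')) \<cdot> s (q \<cdot> q')\<close>, and the class of \<open>f\<close> does not depend on \<open>s\<close>.\<close>

definition factor_set ::
  "('c \<Rightarrow> 'a) \<Rightarrow> ('a, 'm) monoid_scheme \<Rightarrow> 'a topology \<Rightarrow> ('a \<Rightarrow> 'b)
     \<Rightarrow> ('b, 'n) monoid_scheme \<Rightarrow> 'b topology \<Rightarrow> ('b \<times> 'b \<Rightarrow> 'c) \<Rightarrow> bool" where
  "factor_set \<iota> U TU \<pi> Q TQ f \<longleftrightarrow>
     (\<exists>s. continuous_map TQ TU s \<and> (\<forall>q\<in>carrier Q. \<pi> (s q) = q) \<and>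
          (\<forall>q\<in>carrier Q. \<forall>q'\<in>carrier Q.
             s q \<otimes>\<^bsub>U\<^esub> s q' = \<iota> (f (q, q')) \<otimes>\<^bsub>U\<^esub> s (q \<otimes>\<^bsub>Q\<^esub> q')))"

definition extension_class ::
  "('c, 'k) monoid_scheme \<Rightarrow> ('c \<Rightarrow> 'a) \<Rightarrow> ('a, 'm) monoid_scheme \<Rightarrow> 'a topology \<Rightarrow> ('a \<Rightarrow> 'b)
     \<Rightarrow> ('b, 'n) monoid_scheme \<Rightarrow> 'b topology \<Rightarrow> ('b \<times> 'b \<Rightarrow> 'c) set" where
  "extension_class A \<iota> U TU \<pi> Q TQ =
     (THE c. c \<in> carrier (H2 Q TQ A) \<and> (\<exists>f\<in>c. factor_set \<iota> U TU \<pi> Q TQ f))"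

section \<open>The Magnus homomorphism\<close>

text \<open>Words are lists.  A formal power series in the non-commuting variables \<open>X\<close> over \<open>R\<close> is an
  extensional function on \<open>lists X\<close> with values in \<open>R\<close>; the ring of power series carries the
  product topology.\<close>

definition nc_power_series :: "('r, 'm) ring_scheme \<Rightarrow> 'x set \<Rightarrow> ('x list \<Rightarrow> 'r) ring" where
  "nc_power_series R X =
     \<lparr>carrier = lists X \<rightarrow>\<^sub>E carrier R,
      monoid.mult = (\<lambda>f g. \<lambda>w\<in>lists X.
        \<Oplus>\<^bsub>R\<^esub>k\<in>{..length w}. f (take k w) \<otimes>\<^bsub>R\<^esub> g (drop k w)),
      one = (\<lambda>w\<in>lists X. if w = [] then \<one>\<^bsub>R\<^esub> else \<zero>\<^bsub>R\<^esub>),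
      zero = (\<lambda>w\<in>lists X. \<zero>\<^bsub>R\<^esub>),
      add = (\<lambda>f g. \<lambda>w\<in>lists X. f w \<oplus>\<^bsub>R\<^esub> g w)\<rparr>"

definition nc_variable :: "('r, 'm) ring_scheme \<Rightarrow> 'x set \<Rightarrow> 'x \<Rightarrow> 'x list \<Rightarrow> 'r" where
  "nc_variable R X x = (\<lambda>w\<in>lists X. if w = [x] then \<one>\<^bsub>R\<^esub> else \<zero>\<^bsub>R\<^esub>)"

definition magnus_hom ::
  "('a, 'm) monoid_scheme \<Rightarrow> 'a topology \<Rightarrow> 'a set \<Rightarrow> ('r, 'k) ring_scheme \<Rightarrow> 'r topology
     \<Rightarrow> 'a \<Rightarrow> 'a list \<Rightarrow> 'r" where
  "magnus_hom S T X R TR =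
     (THE \<Lambda>. \<Lambda> \<in> extensional (carrier S) \<and>
             \<Lambda> \<in> hom S (units_of (nc_power_series R X)) \<and>
             continuous_map T (product_topology (\<lambda>_. TR) (lists X)) \<Lambda> \<and>
             (\<forall>x\<in>X. \<Lambda> x = \<one>\<^bsub>nc_power_series R X\<^esub> \<oplus>\<^bsub>nc_power_series R X\<^esub> nc_variable R X x))"

definition magnus_coeff ::
  "('a, 'm) monoid_scheme \<Rightarrow> 'a topology \<Rightarrow> 'a set \<Rightarrow> ('r, 'k) ring_scheme \<Rightarrow> 'r topology
     \<Rightarrow> 'a list \<Rightarrow> 'a \<Rightarrow> 'r" where
  "magnus_coeff S T X R TR w \<sigma> = magnus_hom S T X R TR \<sigma> w"

section \<open>Unitriangular groups and the classes attached to words\<close>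

text \<open>An \<open>m \<times> m\<close> matrix is an extensional function on \<open>{1..m} \<times> {1..m}\<close>.\<close>

definition unitriangular_group :: "('r, 'm) ring_scheme \<Rightarrow> nat \<Rightarrow> (nat \<times> nat \<Rightarrow> 'r) monoid" where
  "unitriangular_group R m =
     \<lparr>carrier = {A \<in> {1..m} \<times> {1..m} \<rightarrow>\<^sub>E carrier R.
                   (\<forall>i\<in>{1..m}. A (i, i) = \<one>\<^bsub>R\<^esub>) \<and>
                   (\<forall>i\<in>{1..m}. \<forall>j\<in>{1..m}. j < i \<longrightarrow> A (i, j) = \<zero>\<^bsub>R\<^esub>)},
      monoid.mult = (\<lambda>A B. \<lambda>(i, j)\<in>{1..m} \<times> {1..m}.
        \<Oplus>\<^bsub>R\<^esub>k\<in>{1..m}. A (i, k) \<otimes>\<^bsub>R\<^esub> B (k, j)),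
      one = (\<lambda>(i, j)\<in>{1..m} \<times> {1..m}. if i = j then \<one>\<^bsub>R\<^esub> else \<zero>\<^bsub>R\<^esub>)\<rparr>"

definition word_ring :: "nat \<Rightarrow> nat \<Rightarrow> nat \<Rightarrow> int ring" where
  "word_ring p n s = residue_ring (int p ^ (n - s + 1))"

definition word_unitriangular :: "nat \<Rightarrow> nat \<Rightarrow> nat \<Rightarrow> (nat \<times> nat \<Rightarrow> int) monoid" where
  "word_unitriangular p n s = unitriangular_group (word_ring p n s) (s + 1)"

text \<open>The identification of \<open>\<int>/p\<close> with \<open>I + \<int> p\<^bsup>n-s\<^esup> E\<^bsub>1,s+1\<^esub>\<close>, as a map from \<open>\<int>/p\<close>
  to the unitriangular group.\<close>

definition central_embedding :: "nat \<Rightarrow> nat \<Rightarrow> nat \<Rightarrow> int \<Rightarrow> nat \<times> nat \<Rightarrow> int" where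
  "central_embedding p n s a =
     (\<lambda>(i, j)\<in>{1..s+1} \<times> {1..s+1}.
        if i = j then 1
        else if i = 1 \<and> j = s + 1 then (a * int p ^ (n - s)) mod (int p ^ (n - s + 1))
        else 0)"

definition gamma_class :: "nat \<Rightarrow> nat \<Rightarrow> nat \<Rightarrow>
    ((nat \<times> nat \<Rightarrow> int) set \<times> (nat \<times> nat \<Rightarrow> int) set \<Rightarrow> int) set" where
  "gamma_class p n s =
     (let U = word_unitriangular p n s; TU = discrete_topology (carrier U)
      in extension_class (integer_mod_group p) (central_embedding p n s) U TU
           (\<lambda>u. lower_p_central U TU p n #>\<^bsub>U\<^esub> u)
           (p_quotient U TU p n) (p_quotient_topology U TU p n))"

text \<open>For \<open>w = x\<^sub>1 \<dots> x\<^sub>s\<close> the word \<open>x\<^sub>i \<dots> x\<^bsub>j-1\<^esub>\<close> is \<open>take (j - i) (drop (i - 1) w)\<close>.\<close>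

definition rho_word ::
  "nat \<Rightarrow> nat \<Rightarrow> ('a, 'm) monoid_scheme \<Rightarrow> 'a topology \<Rightarrow> 'a set \<Rightarrow> 'a list
     \<Rightarrow> 'a \<Rightarrow> nat \<times> nat \<Rightarrow> int" where
  "rho_word p n S T X w \<sigma> =
     (let s = length w; R = word_ring p n s in
      (\<lambda>(i, j)\<in>{1..s+1} \<times> {1..s+1}.
         if i < j then
           magnus_coeff S T X R (discrete_topology (carrier R)) (take (j - i) (drop (i - 1) w)) \<sigma>
         else if i = j then \<one>\<^bsub>R\<^esub> else \<zero>\<^bsub>R\<^esub>))"

definition alpha_class ::
  "nat \<Rightarrow> nat \<Rightarrow> ('a, 'm) monoid_scheme \<Rightarrow> 'a topology \<Rightarrow> 'a set \<Rightarrow> 'a list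
     \<Rightarrow> ('a set \<times> 'a set \<Rightarrow> int) set" where
  "alpha_class p n S T X w =
     (let U = word_unitriangular p n (length w); TU = discrete_topology (carrier U);
          rho_bar = induced_quotient_map (rho_word p n S T X w)
                      S (lower_p_central S T p n) U (lower_p_central U TU p n)
      in H2_pullback (p_quotient S T p n) (p_quotient_topology S T p n)
           (p_quotient U TU p n) (p_quotient_topology U TU p n)
           (integer_mod_group p) rho_bar (gamma_class p n (length w)))"

section \<open>The shuffle product and the indexing groups\<close>

text \<open>\<open>(u \<squnion> v)\<^sub>w\<close>.  Positions in a word are counted from \<open>0\<close>, and \<open>nths w I\<close> is the restriction of
  \<open>w\<close> to the positions in \<open>I\<close>.\<close>

definition shuffle_coeff :: "'x list \<Rightarrow> 'x list \<Rightarrow> 'x list \<Rightarrow> nat" where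
  "shuffle_coeff u v w =
     (if length w = length u + length v
      then card {(I, J). I \<union> J = {..<length u + length v} \<and> I \<inter> J = {} \<and>
                         card I = length u \<and> card J = length v \<and> nths w I = u \<and> nths w J = v}
      else 0)"

definition words :: "'x set \<Rightarrow> nat \<Rightarrow> 'x list set" where
  "words X n = {w \<in> lists X. length w = n}"

definition tensor_relations ::
  "('a, 'm) monoid_scheme \<Rightarrow> ('b, 'n) monoid_scheme \<Rightarrow> ('a \<times> 'b \<Rightarrow>\<^sub>0 int) set" where
  "tensor_relations G H =
     generate (free_Abelian_group (carrier G \<times> carrier H))
       ({frag_of (g \<otimes>\<^bsub>G\<^esub> g', h) - frag_of (g, h) - frag_of (g', h) | g g' h.
           g \<in> carrier G \<and> g' \<in> carrier G \<and> h \<in> carrier H} \<union>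
        {frag_of (g, h \<otimes>\<^bsub>H\<^esub> h') - frag_of (g, h) - frag_of (g, h') | g h h'.
           g \<in> carrier G \<and> h \<in> carrier H \<and> h' \<in> carrier H})"

definition tensor_product ::
  "('a, 'm) monoid_scheme \<Rightarrow> ('b, 'n) monoid_scheme \<Rightarrow> ('a \<times> 'b \<Rightarrow>\<^sub>0 int) set monoid" where
  "tensor_product G H =
     free_Abelian_group (carrier G \<times> carrier H) Mod tensor_relations G H"

definition pure_tensor ::
  "('a, 'm) monoid_scheme \<Rightarrow> ('b, 'n) monoid_scheme \<Rightarrow> 'a \<Rightarrow> 'b \<Rightarrow> ('a \<times> 'b \<Rightarrow>\<^sub>0 int) set" where
  "pure_tensor G H g h =
     tensor_relations G H #>\<^bsub>free_Abelian_group (carrier G \<times> carrier H)\<^esub> frag_of (g, h)"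

definition relations_2 :: "'x set \<Rightarrow> ('x list \<Rightarrow>\<^sub>0 int) set" where
  "relations_2 X =
     generate (free_Abelian_group (words X 2))
       {frag_of [x, y] + frag_of [y, x] | x y. x \<in> X \<and> y \<in> X}"

definition relations_3 :: "'x set \<Rightarrow> ('x list \<Rightarrow>\<^sub>0 int) set" where
  "relations_3 X =
     generate (free_Abelian_group (words X 3))
       {frag_of [x, y, z] + frag_of [x, z, y] + frag_of [z, x, y] | x y z.
          x \<in> X \<and> y \<in> X \<and> z \<in> X}"

definition word_module_2 :: "'x set \<Rightarrow> ('x list \<Rightarrow>\<^sub>0 int) set monoid" where
  "word_module_2 X = free_Abelian_group (words X 2) Mod relations_2 X"

definition word_module_3 :: "'x set \<Rightarrow> ('x list \<Rightarrow>\<^sub>0 int) set monoid" where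
  "word_module_3 X = free_Abelian_group (words X 3) Mod relations_3 X"

definition indexing_group ::
  "nat \<Rightarrow> 'x set \<Rightarrow>
     (('x \<Rightarrow> int) \<times> (('x list \<Rightarrow>\<^sub>0 int) set \<times> int \<Rightarrow>\<^sub>0 int) set
                \<times> (('x list \<Rightarrow>\<^sub>0 int) set \<times> int \<Rightarrow>\<^sub>0 int) set) monoid" where
  "indexing_group p X =
     sum_group X (\<lambda>_. integer_mod_group p) \<times>\<times>
       (tensor_product (word_module_2 X) (integer_mod_group p) \<times>\<times>
        tensor_product (word_module_3 X) (integer_mod_group p))"

definition word_component :: "nat \<Rightarrow> ('x list \<Rightarrow>\<^sub>0 int) \<Rightarrow> ('x list \<Rightarrow>\<^sub>0 int)" where
  "word_component k r =
     (\<Sum>w\<in>{w \<in> Poly_Mapping.keys r. length w = k}. frag_cmul (Poly_Mapping.lookup r w) (frag_of w))"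

text \<open>The element \<open>(\<bar>r\<bar>\<^sub>w)\<^sub>w\<close> of the indexing group given by a family \<open>r\<close> of integers with finite
  support, indexed by the words of length 1, 2 and 3.  In degrees 2 and 3 an element of
  \<open>M \<otimes> \<int>/p\<close> is represented as \<open>m \<otimes> 1\<close>.\<close>

definition indexing_element ::
  "nat \<Rightarrow> 'x set \<Rightarrow> ('x list \<Rightarrow>\<^sub>0 int) \<Rightarrow>
     ('x \<Rightarrow> int) \<times> (('x list \<Rightarrow>\<^sub>0 int) set \<times> int \<Rightarrow>\<^sub>0 int) set
                \<times> (('x list \<Rightarrow>\<^sub>0 int) set \<times> int \<Rightarrow>\<^sub>0 int) set" where
  "indexing_element p X r =
     ((\<lambda>x\<in>X. Poly_Mapping.lookup r [x] mod int p),
      pure_tensor (word_module_2 X) (integer_mod_group p)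
        (relations_2 X #>\<^bsub>free_Abelian_group (words X 2)\<^esub> word_component 2 r) 1,
      pure_tensor (word_module_3 X) (integer_mod_group p)
        (relations_3 X #>\<^bsub>free_Abelian_group (words X 3)\<^esub> word_component 3 r) 1)"

definition word_relation_group :: "nat \<Rightarrow> 'x list set \<Rightarrow> ('x list \<Rightarrow> int) monoid" where
  "word_relation_group p W = sum_group W (\<lambda>_. integer_mod_group p)"

definition shuffle_relation :: "nat \<Rightarrow> 'x list set \<Rightarrow> 'x list \<Rightarrow> 'x list \<Rightarrow> 'x list \<Rightarrow> int" where
  "shuffle_relation p W u v = (\<lambda>w\<in>W. int (shuffle_coeff u v w) mod int p)"

end

theory Submission
  imports Defs
begin

text \<open>Write \<open>N = S\<^bsup>(3,p)\<^esup>\<close>.  As \<open>H\<^sup>2(S, \<int>/p) = 0\<close>, a class in \<open>H\<^sup>2(S/N, \<int>/p)\<close> is determined by its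
  transgression, a continuous \<open>S\<close>-invariant homomorphism \<open>\<psi>\<close> from \<open>N\<close> to \<open>\<int>/p\<close>.  By commutator
  calculus such a \<open>\<psi>\<close> is determined by its values on \<open>x\<^bsup>p\<^sup>2\<^esup>\<close>, \<open>[x, y]\<^bsup>p\<^esup>\<close> and \<open>[[x, y], z]\<close> for
  \<open>x, y, z \<in> X\<close>, which are antisymmetric and satisfy the Jacobi identity.  The transgression of
  \<open>\<alpha>\<^sub>w\<close> is the upper right entry of the representation \<open>\<rho>\<^sup>w\<close>, so its values are, up to a constant, the
  coefficients of \<open>w\<close> in the Lie polynomials \<open>x\<close>, \<open>[x, y]\<close> and \<open>[[x, y], z]\<close>.  Hence
  \<open>\<Sum>\<^sub>w c\<^sub>w \<alpha>\<^sub>w = 0\<close> if and only if \<open>c\<close> is orthogonal modulo \<open>p\<close> to the Lie polynomials of degree at most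
  \<open>3\<close>.  Since \<open>2\<close> and \<open>3\<close> are invertible modulo \<open>p\<close>, the Dynkin operator shows that this orthogonal space is
  spanned by the shuffles, and that every \<open>\<psi>\<close> comes from a combination of the \<open>\<alpha>\<^sub>w\<close>.\<close>

section \<open>Commutators modulo a central subgroup\<close>

text \<open>Each basic element is a commutator of degree s in the letters raised to the power
  p^(3-s). That power multiplies the coefficient of a word of length s by p^(3-s), up to binomial
  terms that vanish because p > 3; over Z/p^(4-s) the result lies exactly in the central subgroup
  that is identified with Z/p. This is the constant of the overview. That an invariant homomorphism
  on N is determined by its basic values cannot be seen in S itself, where maps such as g ->
  [g, y]^p are not multiplicative. They become so modulo the kernel of the homomorphism, where N is
  central of exponent p; g -> g^(p^2) follows once p-th powers of commutators are known to vanish.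
  Each entry of a commutator is then freed from X by a closed subgroup argument, for which
  continuity enters as closedness of the kernel. Freeness is given for test groups on one type and
  is used through finite groups, which have copies there. Hence H^2(S, Z/p) = 0 is proved over a
  finite quotient of S, and the Magnus homomorphism is assembled from matrices over finite
  rings.\<close>

definition grp_comm :: "('a, 'm) monoid_scheme \<Rightarrow> 'a \<Rightarrow> 'a \<Rightarrow> 'a" where
  "grp_comm G g h = inv\<^bsub>G\<^esub> g \<otimes>\<^bsub>G\<^esub> inv\<^bsub>G\<^esub> h \<otimes>\<^bsub>G\<^esub> g \<otimes>\<^bsub>G\<^esub> h"

context group
begin

lemma inv_cancel_left:
  "\<lbrakk>x \<in> carrier G; y \<in> carrier G\<rbrakk> \<Longrightarrow> inv x \<otimes> (x \<otimes> y) = y"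
  by (simp add: m_assoc[symmetric])

lemma cancel_inv_left:
  "\<lbrakk>x \<in> carrier G; y \<in> carrier G\<rbrakk> \<Longrightarrow> x \<otimes> (inv x \<otimes> y) = y"
  by (simp add: m_assoc[symmetric])

text \<open>Together with the simplification rules for groups these bring a word into a
  right-associated reduced form, so identities of free groups are settled by simplification.\<close>

lemmas grp_norm = m_assoc inv_mult_group inv_cancel_left cancel_inv_left

lemma grp_comm_closed [simp]:
  "\<lbrakk>x \<in> carrier G; y \<in> carrier G\<rbrakk> \<Longrightarrow> grp_comm G x y \<in> carrier G"
  by (simp add: grp_comm_def)

lemma mult_grp_comm:
  "\<lbrakk>x \<in> carrier G; y \<in> carrier G\<rbrakk> \<Longrightarrow> y \<otimes> x \<otimes> grp_comm G x y = x \<otimes> y"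
  by (simp add: grp_comm_def grp_norm)

lemma inv_grp_comm:
  "\<lbrakk>x \<in> carrier G; y \<in> carrier G\<rbrakk> \<Longrightarrow> inv (grp_comm G x y) = grp_comm G y x"
  by (simp add: grp_comm_def grp_norm)

lemma grp_comm_eq_one_iff:
  "\<lbrakk>x \<in> carrier G; y \<in> carrier G\<rbrakk> \<Longrightarrow> grp_comm G x y = \<one> \<longleftrightarrow> x \<otimes> y = y \<otimes> x"
  using mult_grp_comm[of x y] l_cancel_one[of "y \<otimes> x" "grp_comm G x y"] by auto

lemma grp_comm_mult_left:
  "\<lbrakk>x \<in> carrier G; y \<in> carrier G; z \<in> carrier G\<rbrakk> \<Longrightarrow>
     grp_comm G (x \<otimes> y) z = inv y \<otimes> grp_comm G x z \<otimes> y \<otimes> grp_comm G y z"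
  by (simp add: grp_comm_def grp_norm)

text \<open>An identity of the free group on three letters: after expansion everything cancels. It
  is the source of the Jacobi identity below.\<close>

lemma hall_witt:
  assumes [simp]: "x \<in> carrier G" "y \<in> carrier G" "z \<in> carrier G"
  shows "inv y \<otimes> grp_comm G (grp_comm G x (inv y)) z \<otimes> y \<otimes>
         (inv z \<otimes> grp_comm G (grp_comm G y (inv z)) x \<otimes> z) \<otimes>
         (inv x \<otimes> grp_comm G (grp_comm G z (inv x)) y \<otimes> x) = \<one>"
  by (simp add: grp_comm_def grp_norm)

lemma conj_eq_mult_grp_comm:
  "\<lbrakk>x \<in> carrier G; y \<in> carrier G\<rbrakk> \<Longrightarrow> inv y \<otimes> x \<otimes> y = x \<otimes> grp_comm G x y"
  by (simp add: grp_comm_def grp_norm)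

lemma pow_commute:
  fixes k :: nat
  assumes "x \<in> carrier G" "y \<in> carrier G" "x \<otimes> y = y \<otimes> x"
  shows "x [^] k \<otimes> y = y \<otimes> x [^] k"
proof (induction k)
  case (Suc k)
  have "x [^] Suc k \<otimes> y = x [^] k \<otimes> (x \<otimes> y)" using assms by (simp add: m_assoc)
  also have "\<dots> = (x [^] k \<otimes> y) \<otimes> x" using assms by (simp add: m_assoc)
  also have "\<dots> = y \<otimes> x [^] Suc k" using assms Suc by (simp add: m_assoc)
  finally show ?case .
qed (use assms in simp)

text \<open>Collecting in class two: each new \<open>x\<close> passes \<open>y [^] k\<close> and
  leaves \<open>c [^] k\<close> behind, so the exponents 0, ..., k-1 of \<open>c\<close> add up to
  the binomial coefficient (k choose 2).\<close>

lemma mult_pow_twisted: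
  fixes k :: nat
  assumes [simp]: "x \<in> carrier G" "y \<in> carrier G" "c \<in> carrier G"
    and yx: "y \<otimes> x = x \<otimes> y \<otimes> c" and cx: "c \<otimes> x = x \<otimes> c" and cy: "c \<otimes> y = y \<otimes> c"
  shows "(x \<otimes> y) [^] k = x [^] k \<otimes> y [^] k \<otimes> c [^] (\<Sum>{..<k})"
proof -
  have yk: "y [^] k \<otimes> x = x \<otimes> y [^] k \<otimes> c [^] k" for k :: nat
  proof (induction k)
    case (Suc k)
    have "y [^] Suc k \<otimes> x = y [^] k \<otimes> (x \<otimes> y \<otimes> c)" by (simp add: m_assoc yx[symmetric])
    also have "\<dots> = (y [^] k \<otimes> x) \<otimes> (y \<otimes> c)" by (simp add: m_assoc)
    also have "\<dots> = x \<otimes> y [^] k \<otimes> (c [^] k \<otimes> y) \<otimes> c" by (simp add: Suc m_assoc)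
    also have "\<dots> = x \<otimes> y [^] k \<otimes> (y \<otimes> c [^] k) \<otimes> c" using pow_commute[OF _ _ cy] by simp
    finally show ?case by (simp add: m_assoc)
  qed simp
  show ?thesis
  proof (induction k)
    case (Suc k)
    let ?t = "\<Sum>{..<k}"
    have cx': "c [^] ?t \<otimes> x = x \<otimes> c [^] ?t" and cy': "c [^] ?t \<otimes> y = y \<otimes> c [^] ?t"
      and cy'': "c [^] k \<otimes> y = y \<otimes> c [^] k"
      using pow_commute[OF _ _ cx] pow_commute[OF _ _ cy] by auto
    have "(x \<otimes> y) [^] Suc k = x [^] k \<otimes> y [^] k \<otimes> (c [^] ?t \<otimes> x) \<otimes> y"
      by (simp add: Suc m_assoc)
    also have "\<dots> = x [^] k \<otimes> (y [^] k \<otimes> x) \<otimes> (c [^] ?t \<otimes> y)" by (simp add: cx' m_assoc)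
    also have "\<dots> = x [^] Suc k \<otimes> y [^] k \<otimes> (c [^] k \<otimes> y) \<otimes> c [^] ?t"
      by (simp add: yk cy' m_assoc)
    also have "\<dots> = x [^] Suc k \<otimes> y [^] Suc k \<otimes> (c [^] k \<otimes> c [^] ?t)"
      by (simp add: cy'' m_assoc)
    also have "\<dots> = x [^] Suc k \<otimes> y [^] Suc k \<otimes> c [^] (\<Sum>{..<Suc k})"
      by (simp add: nat_pow_mult add.commute)
    finally show ?case .
  qed simp
qed

lemma pow_eq_one_dvd:
  fixes p q :: nat
  assumes "c \<in> carrier G" "c [^] p = \<one>" "p dvd q"
  shows "c [^] q = \<one>"
proof -
  from assms(3) obtain r where "q = p * r" by auto
  then show ?thesis using assms(1,2) by (simp add: nat_pow_pow[symmetric])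
qed

text \<open>The commutator occurs with exponent p(p-1)/2. This is a multiple of \<open>p\<close> as
  \<open>p\<close> is odd, so the correction is killed by its exponent.\<close>

lemma mult_pow_odd:
  fixes p :: nat
  assumes xy[simp]: "x \<in> carrier G" "y \<in> carrier G" and "odd p"
    and c: "grp_comm G y x [^] p = \<one>"
    and cx: "grp_comm G y x \<otimes> x = x \<otimes> grp_comm G y x"
    and cy: "grp_comm G y x \<otimes> y = y \<otimes> grp_comm G y x"
  shows "(x \<otimes> y) [^] p = x [^] p \<otimes> y [^] p"
proof -
  have "p dvd (\<Sum>{..<p})"
  proof -
    have s: "2 * (\<Sum>{..<n}) = n * (n - 1)" for n :: nat
    proof (induction n)
      case (Suc n) then show ?case by (cases n) auto
    qed simp
    obtain q where "p = 2 * q + 1" using \<open>odd p\<close> oddE by blast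
    then have "\<Sum>{..<p} = p * q" using s[of p] by simp
    then show ?thesis by simp
  qed
  then have 1: "grp_comm G y x [^] (\<Sum>{..<p}) = \<one>"
    using pow_eq_one_dvd[OF _ c] by simp
  show ?thesis
    using mult_pow_twisted[OF xy _ mult_grp_comm[OF xy(2,1), symmetric] cx cy, of p] 1 by simp
qed

end

text \<open>The situation of \<open>S\<close> modulo the kernel of an invariant homomorphism on \<open>S\<^bsup>(3,p)\<^esup>\<close>:
  \<open>H\<close> and \<open>Z\<close> are the images of \<open>S\<^bsup>(2,p)\<^esup>\<close> and \<open>S\<^bsup>(3,p)\<^esup>\<close>.\<close>

locale p_central_3 = group G for G (structure) +
  fixes p :: nat and H Z :: "'a set"
  assumes odd_p: "odd p"
    and H: "subgroup H G" and Z_carrier: "Z \<subseteq> carrier G"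
    and central: "\<And>z g. \<lbrakk>z \<in> Z; g \<in> carrier G\<rbrakk> \<Longrightarrow> z \<otimes> g = g \<otimes> z"
    and exponent: "\<And>z. z \<in> Z \<Longrightarrow> z [^] p = \<one>"
    and pow_H: "\<And>g. g \<in> carrier G \<Longrightarrow> g [^] p \<in> H"
    and comm_H: "\<And>g h. \<lbrakk>g \<in> carrier G; h \<in> carrier G\<rbrakk> \<Longrightarrow> grp_comm G g h \<in> H"
    and pow_Z: "\<And>h. h \<in> H \<Longrightarrow> h [^] p \<in> Z"
    and comm_Z: "\<And>g h. \<lbrakk>g \<in> carrier G; h \<in> H\<rbrakk> \<Longrightarrow> grp_comm G g h \<in> Z"
    and comm_Z': "\<And>g h. \<lbrakk>g \<in> carrier G; h \<in> H\<rbrakk> \<Longrightarrow> grp_comm G h g \<in> Z"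
begin

lemma H_carrier: "h \<in> H \<Longrightarrow> h \<in> carrier G"
  using H subgroup.mem_carrier by fast

lemma Z_in: "z \<in> Z \<Longrightarrow> z \<in> carrier G"
  using Z_carrier by auto

lemma conj_central: "\<lbrakk>z \<in> Z; g \<in> carrier G\<rbrakk> \<Longrightarrow> inv g \<otimes> z \<otimes> g = z"
  using central[of z g] Z_in[of z] by (simp add: m_assoc inv_cancel_left)

text \<open>The commutator of two elements of \<open>H\<close> lies in \<open>Z\<close>, hence is
  central and killed by \<open>p\<close>, which is what the odd power formula asks for.\<close>

lemma pow_mult_H:
  assumes "h \<in> H" "h' \<in> H" shows "(h \<otimes> h') [^] p = h [^] p \<otimes> h' [^] p"
proof -
  have z: "grp_comm G h' h \<in> Z" by (rule comm_Z[OF H_carrier[OF assms(2)] assms(1)])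
  show ?thesis
    using H_carrier[OF assms(1)] H_carrier[OF assms(2)]
    by (intro mult_pow_odd odd_p exponent[OF z] central[OF z])
qed

lemma comm_mult_H:
  assumes "h \<in> H" "h' \<in> H" "g \<in> carrier G"
  shows "grp_comm G (h \<otimes> h') g = grp_comm G h g \<otimes> grp_comm G h' g"
proof -
  have z: "grp_comm G h g \<in> Z" by (rule comm_Z'[OF assms(3,1)])
  show ?thesis
    unfolding grp_comm_mult_left[OF H_carrier[OF assms(1)] H_carrier[OF assms(2)] assms(3)]
      conj_central[OF z H_carrier[OF assms(2)]] by (rule refl)
qed

lemma comm_Z_one:
  assumes "z \<in> Z" "g \<in> carrier G" shows "grp_comm G z g = \<one>"
  using central[OF assms] Z_in[OF assms(1)] assms(2) by (simp add: grp_comm_eq_one_iff)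

lemma comm_mult_left_Z:
  assumes "g \<in> carrier G" "g' \<in> carrier G" "x \<in> carrier G"
  shows "grp_comm G (g \<otimes> g') x =
           grp_comm G g x \<otimes> grp_comm G (grp_comm G g x) g' \<otimes> grp_comm G g' x"
  using assms by (simp add: grp_comm_mult_left conj_eq_mult_grp_comm)

text \<open>Expanding [gg', x] produces the extra factor [[g, x], g']. It lies in \<open>Z\<close>,
  so a further commutator with \<open>y\<close> removes it.\<close>

lemma triple_comm_mult_left:
  assumes "g \<in> carrier G" "g' \<in> carrier G" "x \<in> carrier G" "y \<in> carrier G"
  shows "grp_comm G (grp_comm G (g \<otimes> g') x) y =
           grp_comm G (grp_comm G g x) y \<otimes> grp_comm G (grp_comm G g' x) y"
proof -
  note [simp] = assms
  define z where "z = grp_comm G (grp_comm G g x) g'"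
  have z: "z \<in> Z" unfolding z_def by (rule comm_Z'[OF _ comm_H]) simp_all
  have zH: "z \<in> H" unfolding z_def by (intro comm_H) simp_all
  have hH: "grp_comm G g x \<in> H" "grp_comm G g' x \<in> H" by (simp_all add: comm_H)
  have "grp_comm G (grp_comm G (g \<otimes> g') x) y
      = grp_comm G (grp_comm G g x \<otimes> z) y \<otimes> grp_comm G (grp_comm G g' x) y"
    unfolding comm_mult_left_Z[OF assms(1-3)] z_def[symmetric]
    by (rule comm_mult_H[OF subgroup.m_closed[OF H hH(1) zH] hH(2) assms(4)])
  also have "grp_comm G (grp_comm G g x \<otimes> z) y = grp_comm G (grp_comm G g x) y"
    using comm_mult_H[OF hH(1) zH, of y] comm_Z_one[OF z, of y] by simp
  finally show ?thesis .
qed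

lemma comm_inv_H:
  assumes "h \<in> H" "g \<in> carrier G"
  shows "grp_comm G (inv h) g = inv (grp_comm G h g)"
proof -
  have ih: "inv h \<in> H" using assms H by (simp add: subgroup.m_inv_closed)
  have "grp_comm G (inv h) g \<otimes> grp_comm G h g = grp_comm G (inv h \<otimes> h) g"
    using comm_mult_H[OF ih assms(1,2)] by simp
  also have "\<dots> = \<one>" using assms H_carrier by (simp add: grp_comm_eq_one_iff)
  finally show ?thesis using assms H_carrier ih by (simp add: inv_equality)
qed

lemma triple_comm_swap:
  assumes "x \<in> carrier G" "y \<in> carrier G" "z \<in> carrier G"
  shows "grp_comm G (grp_comm G y x) z = inv (grp_comm G (grp_comm G x y) z)"
  using comm_inv_H[OF comm_H[OF assms(1,2)] assms(3)] assms by (simp add: inv_grp_comm)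

text \<open>Multiplicativity in the first entry is applied to the product of \<open>y\<close> and
  its inverse; two swaps then move the inverse to the second entry.\<close>

lemma comm_inv_right:
  assumes "x \<in> carrier G" "y \<in> carrier G" "z \<in> carrier G"
  shows "grp_comm G (grp_comm G x (inv y)) z = inv (grp_comm G (grp_comm G x y) z)"
proof -
  note [simp] = assms
  have "\<one> = grp_comm G (grp_comm G (y \<otimes> inv y) x) z"
    by (simp add: grp_comm_eq_one_iff grp_comm_def)
  also have "\<dots> = grp_comm G (grp_comm G y x) z \<otimes> grp_comm G (grp_comm G (inv y) x) z"
    by (rule triple_comm_mult_left) simp_all
  finally have "grp_comm G (grp_comm G (inv y) x) z = inv (grp_comm G (grp_comm G y x) z)"
    by (metis assms grp_comm_closed inv_closed inv_equality inv_inv)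
  then show ?thesis
    by (simp add: triple_comm_swap[of x y] triple_comm_swap[of x "inv y"])
      (metis assms grp_comm_closed inv_closed inv_inv)
qed

lemma jacobi:
  assumes "x \<in> carrier G" "y \<in> carrier G" "z \<in> carrier G"
  shows "grp_comm G (grp_comm G x y) z \<otimes> grp_comm G (grp_comm G y z) x \<otimes>
         grp_comm G (grp_comm G z x) y = \<one>"
proof -
  note [simp] = assms
  define a b c where "a = grp_comm G (grp_comm G x y) z" and "b = grp_comm G (grp_comm G y z) x"
    and "c = grp_comm G (grp_comm G z x) y"
  \<comment> \<open>\<open>Z\<close> is just a set here. The inverses belong to it because each is
    again a triple commutator, with the second entry inverted.\<close>
  have Z: "a \<in> Z" "b \<in> Z" "c \<in> Z" "inv a \<in> Z" "inv b \<in> Z" "inv c \<in> Z"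
    unfolding a_def b_def c_def
    unfolding comm_inv_right[symmetric, OF assms] comm_inv_right[symmetric, OF assms(2,3,1)]
      comm_inv_right[symmetric, OF assms(3,1,2)]
    by (simp_all add: comm_Z' comm_H)
  note [simp] = Z_in[OF Z(1)] Z_in[OF Z(2)] Z_in[OF Z(3)]
  \<comment> \<open>In the Hall-Witt identity the conjugations act on central elements and
    disappear, and the inverted second entries invert all three factors.\<close>
  have "inv a \<otimes> inv b \<otimes> inv c = \<one>"
    using hall_witt[OF assms] conj_central[OF Z(4), of y] conj_central[OF Z(5), of z]
      conj_central[OF Z(6), of x]
    by (simp add: comm_inv_right a_def[symmetric] b_def[symmetric] c_def[symmetric])
  then have "c \<otimes> b \<otimes> a = \<one>"
    using inv_mult_group[of "c \<otimes> b" a] inv_mult_group[of c b]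
    by (simp add: m_assoc)
  then show ?thesis
    unfolding a_def[symmetric] b_def[symmetric] c_def[symmetric]
    using central[OF Z(1), of "b \<otimes> c"] central[OF Z(2), of c] by (simp add: m_assoc)
qed

text \<open>Conjugating g^p by \<open>x\<close> gives (g[g, x])^p, and [g, x] commutes with
  \<open>g\<close> up to an element of \<open>Z\<close>; so the power splits as g^p
  [g, x]^p.\<close>

lemma comm_pow:
  assumes "g \<in> carrier G" "x \<in> carrier G"
  shows "grp_comm G (g [^] p) x = grp_comm G g x [^] p"
proof -
  note [simp] = assms
  define h where "h = grp_comm G g x"
  have hH: "h \<in> H" unfolding h_def by (simp add: comm_H)
  note [simp] = H_carrier[OF hH]
  have z: "grp_comm G h g \<in> Z" using comm_Z'[OF _ hH] by simp
  have conj: "inv x \<otimes> (g [^] k) \<otimes> x = (g \<otimes> h) [^] k" for k :: nat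
  proof (induction k)
    case (Suc k)
    have "inv x \<otimes> (g [^] Suc k) \<otimes> x = (inv x \<otimes> (g [^] k) \<otimes> x) \<otimes> (inv x \<otimes> g \<otimes> x)"
      by (simp add: grp_norm)
    then show ?case using Suc by (simp add: conj_eq_mult_grp_comm h_def)
  qed simp
  have "inv x \<otimes> (g [^] p) \<otimes> x = g [^] p \<otimes> h [^] p"
    unfolding conj by (intro mult_pow_odd odd_p exponent[OF z] central[OF z]) simp_all
  then have "g [^] p \<otimes> grp_comm G (g [^] p) x = g [^] p \<otimes> h [^] p"
    by (simp add: conj_eq_mult_grp_comm)
  then show ?thesis by (simp add: h_def[symmetric])
qed

lemma comm_pow_mult_left:
  assumes "g \<in> carrier G" "g' \<in> carrier G" "x \<in> carrier G"
  shows "grp_comm G (g \<otimes> g') x [^] p = grp_comm G g x [^] p \<otimes> grp_comm G g' x [^] p"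
proof -
  note [simp] = assms
  define z where "z = grp_comm G (grp_comm G g x) g'"
  have z: "z \<in> Z" unfolding z_def by (rule comm_Z'[OF _ comm_H]) simp_all
  have zH: "z \<in> H" unfolding z_def by (intro comm_H) simp_all
  have hH: "grp_comm G g x \<in> H" "grp_comm G g' x \<in> H" by (simp_all add: comm_H)
  show ?thesis
    unfolding comm_mult_left_Z[OF assms] z_def[symmetric]
    using pow_mult_H[OF _ hH(2), of "grp_comm G g x \<otimes> z"] pow_mult_H[OF hH(1) zH]
      subgroup.m_closed[OF H hH(1) zH] exponent[OF z] by simp
qed

text \<open>The terms collected in the p-th power of gg' are products of commutators, hence of order
  dividing \<open>p\<close> by \<open>comm1\<close>. They disappear in the second p-th power, which
  is multiplicative on \<open>H\<close>.\<close>

lemma pow_pow_mult: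
  assumes comm1: "\<And>g h. \<lbrakk>g \<in> carrier G; h \<in> carrier G\<rbrakk> \<Longrightarrow> grp_comm G g h [^] p = \<one>"
    and g: "g \<in> carrier G" "g' \<in> carrier G"
  shows "(g \<otimes> g') [^] (p * p) = g [^] (p * p) \<otimes> g' [^] (p * p)"
proof -
  note [simp] = g
  \<comment> \<open>All commutators lie in \<open>P\<close>, and \<open>P\<close> is closed under
    products because the p-th power is multiplicative on \<open>H\<close>; so it absorbs every
    correction term of the induction below.\<close>
  define P where "P = {h \<in> H. h [^] p = \<one>}"
  have PH: "h \<in> H" and Pc[simp]: "h \<in> carrier G" if "h \<in> P" for h
    using that H_carrier by (auto simp: P_def)
  have P_mult: "h \<otimes> h' \<in> P" if "h \<in> P" "h' \<in> P" for h h'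
    using that pow_mult_H[of h h'] subgroup.m_closed[OF H] by (auto simp: P_def)
  have P_comm: "grp_comm G x y \<in> P" if "x \<in> carrier G" "y \<in> carrier G" for x y
    using comm_H[OF that] comm1[OF that] by (simp add: P_def)
  have "\<exists>h\<in>P. (g \<otimes> g') [^] k = g [^] k \<otimes> g' [^] k \<otimes> h" for k :: nat
  proof (induction k)
    case 0
    have "\<one> \<in> P" using subgroup.one_closed[OF H] by (simp add: P_def)
    then show ?case by (intro bexI[of _ \<one>]) auto
  next
    case (Suc k)
    then obtain h where h: "h \<in> P" "(g \<otimes> g') [^] k = g [^] k \<otimes> g' [^] k \<otimes> h" by blast
    note [simp] = Pc[OF h(1)]
    define c where "c = grp_comm G (g' [^] k \<otimes> h) g"
    define d where "d = grp_comm G (h \<otimes> c) g'"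
    have c: "c \<in> P" "c \<in> carrier G" unfolding c_def by (simp_all add: P_comm)
    have d: "d \<in> P" "d \<in> carrier G" unfolding d_def using c by (simp_all add: P_comm)
    note [simp] = c(2) d(2)
    have e1: "(g' [^] k \<otimes> h) \<otimes> g = g \<otimes> (g' [^] k \<otimes> h) \<otimes> c"
      unfolding c_def by (rule mult_grp_comm[symmetric]) simp_all
    have e2: "(h \<otimes> c) \<otimes> g' = g' \<otimes> (h \<otimes> c) \<otimes> d"
      unfolding d_def by (rule mult_grp_comm[symmetric]) simp_all
    have "(g \<otimes> g') [^] Suc k = g [^] k \<otimes> ((g' [^] k \<otimes> h) \<otimes> g) \<otimes> g'"
      by (simp add: h(2) m_assoc)
    also have "\<dots> = g [^] Suc k \<otimes> g' [^] k \<otimes> ((h \<otimes> c) \<otimes> g')"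
      unfolding e1 by (simp add: m_assoc)
    also have "\<dots> = g [^] Suc k \<otimes> g' [^] Suc k \<otimes> (h \<otimes> c \<otimes> d)"
      unfolding e2 by (simp add: m_assoc)
    finally show ?case using P_mult h(1) c(1) d(1) by blast
  qed
  then obtain h where h: "h \<in> P" "(g \<otimes> g') [^] p = g [^] p \<otimes> g' [^] p \<otimes> h" by blast
  have "(g \<otimes> g') [^] (p * p) = (g [^] p \<otimes> g' [^] p \<otimes> h) [^] p"
    using h(2) by (simp add: nat_pow_pow[symmetric])
  also have "\<dots> = (g [^] p) [^] p \<otimes> (g' [^] p) [^] p \<otimes> h [^] p"
    using pow_mult_H[OF subgroup.m_closed[OF H pow_H[OF g(1)] pow_H[OF g(2)]] PH[OF h(1)]]
      pow_mult_H[OF pow_H[OF g(1)] pow_H[OF g(2)]] by simp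
  also have "\<dots> = g [^] (p * p) \<otimes> g' [^] (p * p)"
    using h(1) by (simp add: P_def nat_pow_pow)
  finally show ?thesis .
qed

end

section \<open>Topological groups\<close>

locale top_group = group G for G (structure) +
  fixes T :: "'a topology"
  assumes topological: "topological_group G T"
begin

lemma topspace_eq [simp]: "topspace T = carrier G"
  using topological by (simp add: topological_group_def)

lemma continuous_map_mult:
  assumes "continuous_map Y T f" "continuous_map Y T g"
  shows "continuous_map Y T (\<lambda>y. f y \<otimes> g y)"
proof -
  have "continuous_map (prod_topology T T) T (\<lambda>(g, h). g \<otimes> h)"
    using topological by (simp add: topological_group_def)
  from continuous_map_compose[OF continuous_map_pairedI[OF assms] this] show ?thesis
    by (simp add: o_def)
qed

lemma continuous_map_m_inv:
  assumes "continuous_map Y T f"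
  shows "continuous_map Y T (\<lambda>y. inv (f y))"
proof -
  have "continuous_map T T (\<lambda>g. inv g)"
    using topological by (simp add: topological_group_def)
  from continuous_map_compose[OF assms this] show ?thesis by (simp add: o_def)
qed

lemma continuous_map_nat_pow:
  fixes k :: nat
  assumes "continuous_map Y T f"
  shows "continuous_map Y T (\<lambda>y. f y [^] k)"
  by (induction k) (auto intro: continuous_map_mult assms)

lemma continuous_map_grp_comm:
  assumes "continuous_map Y T f" "continuous_map Y T g"
  shows "continuous_map Y T (\<lambda>y. grp_comm G (f y) (g y))"
  unfolding grp_comm_def by (intro continuous_map_mult continuous_map_m_inv assms)

lemma continuous_map_id_T: "continuous_map T T (\<lambda>g. g)"
  using continuous_map_id[of T] by (simp add: id_def)

lemma closed_subgroup_generated: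
  assumes "A \<subseteq> carrier G"
  shows "subgroup (closed_subgroup_generated G T A) G"
    and "closedin T (closed_subgroup_generated G T A)"
    and "A \<subseteq> closed_subgroup_generated G T A"
proof -
  let ?F = "{H. subgroup H G \<and> closedin T H \<and> A \<subseteq> H}"
  have "closedin T (carrier G)" using closedin_topspace[of T] by simp
  then have ne: "carrier G \<in> ?F" using assms subgroup_self by auto
  show "subgroup (closed_subgroup_generated G T A) G"
    unfolding closed_subgroup_generated_def by (rule subgroups_Inter) (use ne in auto)
  show "closedin T (closed_subgroup_generated G T A)"
    unfolding closed_subgroup_generated_def by (rule closedin_Inter) (use ne in auto)
  show "A \<subseteq> closed_subgroup_generated G T A"
    unfolding closed_subgroup_generated_def by auto
qed

lemma closed_subgroup_generated_least:
  assumes "subgroup H G" "closedin T H" "A \<subseteq> H"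
  shows "closed_subgroup_generated G T A \<subseteq> H"
  unfolding closed_subgroup_generated_def using assms by auto

lemma closedin_preimage:
  assumes "continuous_map T T f" "closedin T C"
  shows "closedin T {g \<in> carrier G. f g \<in> C}"
  using closedin_continuous_map_preimage[OF assms] by simp

lemma subgroup_conj_preimage:
  assumes "subgroup H G" "x \<in> carrier G"
  shows "subgroup {g \<in> carrier G. x \<otimes> g \<otimes> inv x \<in> H} G"
proof (rule subgroupI)
  show "{g \<in> carrier G. x \<otimes> g \<otimes> inv x \<in> H} \<noteq> {}"
    using assms subgroup.one_closed by (auto intro!: exI[of _ \<one>])
next
  fix a assume a: "a \<in> {g \<in> carrier G. x \<otimes> g \<otimes> inv x \<in> H}"
  have "x \<otimes> inv a \<otimes> inv x = inv (x \<otimes> a \<otimes> inv x)" using a assms by (simp add: grp_norm)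
  then show "inv a \<in> {g \<in> carrier G. x \<otimes> g \<otimes> inv x \<in> H}"
    using a assms(1) subgroup.m_inv_closed by fastforce
next
  fix a b assume ab: "a \<in> {g \<in> carrier G. x \<otimes> g \<otimes> inv x \<in> H}"
    "b \<in> {g \<in> carrier G. x \<otimes> g \<otimes> inv x \<in> H}"
  have "x \<otimes> (a \<otimes> b) \<otimes> inv x = (x \<otimes> a \<otimes> inv x) \<otimes> (x \<otimes> b \<otimes> inv x)"
    using ab assms by (simp add: grp_norm)
  then show "a \<otimes> b \<in> {g \<in> carrier G. x \<otimes> g \<otimes> inv x \<in> H}"
    using ab assms(1) subgroup.m_closed by fastforce
qed auto

text \<open>The preimage of the generated subgroup under a conjugation is again a closed subgroup
  containing \<open>A\<close>, so it contains the whole generated subgroup.\<close>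

lemma closed_subgroup_generated_normal:
  assumes A: "A \<subseteq> carrier G" and conj: "\<And>x a. \<lbrakk>x \<in> carrier G; a \<in> A\<rbrakk> \<Longrightarrow> x \<otimes> a \<otimes> inv x \<in> A"
  shows "closed_subgroup_generated G T A \<lhd> G"
proof -
  let ?C = "closed_subgroup_generated G T A"
  note C = closed_subgroup_generated[OF A]
  have "x \<otimes> h \<otimes> inv x \<in> ?C" if "x \<in> carrier G" "h \<in> ?C" for x h
  proof -
    have "?C \<subseteq> {g \<in> carrier G. x \<otimes> g \<otimes> inv x \<in> ?C}"
    proof (rule closed_subgroup_generated_least)
      show "subgroup {g \<in> carrier G. x \<otimes> g \<otimes> inv x \<in> ?C} G"
        by (rule subgroup_conj_preimage[OF C(1) that(1)])
      show "closedin T {g \<in> carrier G. x \<otimes> g \<otimes> inv x \<in> ?C}"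
        by (rule closedin_preimage[OF _ C(2)])
          (intro continuous_map_mult continuous_map_id_T, use that in auto)
      show "A \<subseteq> {g \<in> carrier G. x \<otimes> g \<otimes> inv x \<in> ?C}"
        using A conj[OF that(1)] C(3) by auto
    qed
    then show ?thesis using that by auto
  qed
  then show ?thesis using C(1) by (simp add: normal_inv_iff)
qed

text \<open>Multiplicativity is asked on a subgroup \<open>H\<close>, so that the lemma also serves
  maps built from powers and commutators that are multiplicative on S^(2,p) only.\<close>

lemma subgroup_kernel:
  assumes H: "subgroup H G" and K: "group K" and \<phi>: "\<And>h. h \<in> H \<Longrightarrow> \<phi> h \<in> carrier K"
    and mult: "\<And>h h'. \<lbrakk>h \<in> H; h' \<in> H\<rbrakk> \<Longrightarrow> \<phi> (h \<otimes> h') = \<phi> h \<otimes>\<^bsub>K\<^esub> \<phi> h'"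
  shows "subgroup {h \<in> H. \<phi> h = \<one>\<^bsub>K\<^esub>} G"
proof -
  interpret K: group K by (rule K)
  note inH = subgroup.one_closed[OF H] subgroup.m_closed[OF H] subgroup.m_inv_closed[OF H]
  have one: "\<phi> \<one> = \<one>\<^bsub>K\<^esub>"
    using mult[OF inH(1) inH(1)] \<phi>[OF inH(1)] by simp
  show ?thesis
  proof (rule subgroupI)
    show "{h \<in> H. \<phi> h = \<one>\<^bsub>K\<^esub>} \<subseteq> carrier G" using H subgroup.subset by blast
    show "{h \<in> H. \<phi> h = \<one>\<^bsub>K\<^esub>} \<noteq> {}" using one inH by blast
  next
    fix a assume a: "a \<in> {h \<in> H. \<phi> h = \<one>\<^bsub>K\<^esub>}"
    then have "\<phi> (inv a \<otimes> a) = \<phi> (inv a) \<otimes>\<^bsub>K\<^esub> \<phi> a" using mult inH by simp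
    then show "inv a \<in> {h \<in> H. \<phi> h = \<one>\<^bsub>K\<^esub>}"
      using a one inH \<phi>[of "inv a"] subgroup.mem_carrier[OF H] by simp
  next
    fix a b assume "a \<in> {h \<in> H. \<phi> h = \<one>\<^bsub>K\<^esub>}" "b \<in> {h \<in> H. \<phi> h = \<one>\<^bsub>K\<^esub>}"
    then show "a \<otimes> b \<in> {h \<in> H. \<phi> h = \<one>\<^bsub>K\<^esub>}" using mult inH by simp
  qed
qed

lemma discrete_preimage:
  assumes "continuous_map T (discrete_topology D) \<phi>"
  shows "closedin T {g \<in> carrier G. \<phi> g \<in> C}" and "openin T {g \<in> carrier G. \<phi> g \<in> C}"
proof -
  have *: "{g \<in> carrier G. \<phi> g \<in> C} = {g \<in> topspace T. \<phi> g \<in> C \<inter> D}"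
    using continuous_map_image_subset_topspace[OF assms] by auto
  show "closedin T {g \<in> carrier G. \<phi> g \<in> C}"
    unfolding * by (rule closedin_continuous_map_preimage[OF assms]) simp
  show "openin T {g \<in> carrier G. \<phi> g \<in> C}"
    unfolding * by (rule openin_continuous_map_preimage[OF assms]) simp
qed

text \<open>The set of agreement is a subgroup, is closed since the target is Hausdorff, and
  contains the topological generators.\<close>

lemma continuous_homs_agree:
  assumes X: "closed_subgroup_generated G T X = carrier G" "X \<subseteq> carrier G"
    and K: "group K" and \<phi>: "\<phi> \<in> hom G K" "\<psi> \<in> hom G K"
    and TK: "Hausdorff_space TK" and cont: "continuous_map T TK \<phi>" "continuous_map T TK \<psi>"
    and agree: "\<And>x. x \<in> X \<Longrightarrow> \<phi> x = \<psi> x" and g: "g \<in> carrier G"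
  shows "\<phi> g = \<psi> g"
proof -
  interpret p: group_hom G K \<phi>
    by (intro group_hom.intro group_hom_axioms.intro is_group K \<phi>)
  interpret q: group_hom G K \<psi>
    by (intro group_hom.intro group_hom_axioms.intro is_group K \<phi>)
  have "closed_subgroup_generated G T X \<subseteq> {g \<in> carrier G. \<phi> g = \<psi> g}"
  proof (rule closed_subgroup_generated_least)
    show "subgroup {g \<in> carrier G. \<phi> g = \<psi> g} G"
      by (rule subgroupI) auto
    show "closedin T {g \<in> carrier G. \<phi> g = \<psi> g}"
      using closedin_continuous_maps_eq[OF TK cont] by simp
    show "X \<subseteq> {g \<in> carrier G. \<phi> g = \<psi> g}" using X(2) agree by auto
  qed
  then show ?thesis using X(1) g by auto
qed

text \<open>The complement of \<open>V\<close> is the projection of a closed set along a compact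
  factor, hence closed. Allowing factors \<open>a\<close> and \<open>c\<close> on both sides of
  \<open>v\<close> makes \<open>V\<close> normal. The lemma serves to factor locally constant
  functions through finite quotients.\<close>

lemma open_invariance_subgroup:
  assumes T: "compact_space T" and Y: "compact_space Y"
    and \<phi>: "continuous_map (prod_topology T Y) (discrete_topology D) \<phi>"
  defines "V \<equiv> {v \<in> carrier G. \<forall>a\<in>carrier G. \<forall>c\<in>carrier G. \<forall>y\<in>topspace Y.
                  \<phi> (a \<otimes> v \<otimes> c, y) = \<phi> (a \<otimes> c, y)}"
  shows "V \<lhd> G" and "openin T V"
proof -
  have sub: "subgroup V G"
  proof (rule subgroupI)
    show "V \<noteq> {}" by (auto simp: V_def intro!: exI[of _ \<one>])
  next
    fix v assume v: "v \<in> V"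
    have "\<phi> (a \<otimes> inv v \<otimes> c, y) = \<phi> (a \<otimes> c, y)"
      if "a \<in> carrier G" "c \<in> carrier G" "y \<in> topspace Y" for a c y
    proof -
      have "\<phi> (a \<otimes> v \<otimes> (inv v \<otimes> c), y) = \<phi> (a \<otimes> (inv v \<otimes> c), y)"
        using v that by (simp add: V_def)
      then show ?thesis using v that by (simp add: V_def grp_norm)
    qed
    then show "inv v \<in> V" using v by (simp add: V_def)
  next
    fix v w assume vw: "v \<in> V" "w \<in> V"
    have "\<phi> (a \<otimes> (v \<otimes> w) \<otimes> c, y) = \<phi> (a \<otimes> c, y)"
      if "a \<in> carrier G" "c \<in> carrier G" "y \<in> topspace Y" for a c y
    proof -
      have "\<phi> (a \<otimes> v \<otimes> (w \<otimes> c), y) = \<phi> (a \<otimes> (w \<otimes> c), y)" using vw that by (simp add: V_def)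
      also have "\<dots> = \<phi> (a \<otimes> w \<otimes> c, y)" using vw that by (simp add: V_def m_assoc)
      also have "\<dots> = \<phi> (a \<otimes> c, y)" using vw that by (simp add: V_def)
      finally show ?thesis using vw that by (simp add: V_def m_assoc)
    qed
    then show "v \<otimes> w \<in> V" using vw by (simp add: V_def)
  qed (auto simp: V_def)
  show "V \<lhd> G"
    unfolding normal_inv_iff
  proof (intro conjI ballI)
    fix x v assume xv: "x \<in> carrier G" "v \<in> V"
    have "\<phi> (a \<otimes> (x \<otimes> v \<otimes> inv x) \<otimes> c, y) = \<phi> (a \<otimes> c, y)"
      if "a \<in> carrier G" "c \<in> carrier G" "y \<in> topspace Y" for a c y
    proof -
      have "\<phi> ((a \<otimes> x) \<otimes> v \<otimes> (inv x \<otimes> c), y) = \<phi> ((a \<otimes> x) \<otimes> (inv x \<otimes> c), y)"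
        using xv that by (simp add: V_def)
      then show ?thesis using xv that by (simp add: V_def grp_norm)
    qed
    then show "x \<otimes> v \<otimes> inv x \<in> V" using xv by (simp add: V_def)
  qed (rule sub)
  let ?P = "prod_topology T (prod_topology T Y)"
  let ?f = "\<lambda>(v, a, c, y). (\<phi> (a \<otimes> v \<otimes> c, y), \<phi> (a \<otimes> c, y))"
  let ?R = "prod_topology T (prod_topology T (prod_topology T Y))"
  have p: "continuous_map ?R T (\<lambda>z. fst z)" "continuous_map ?R T (\<lambda>z. fst (snd z))"
    "continuous_map ?R T (\<lambda>z. fst (snd (snd z)))" "continuous_map ?R Y (\<lambda>z. snd (snd (snd z)))"
    using continuous_map_compose[of ?R "prod_topology T (prod_topology T Y)" snd T fst]
      continuous_map_compose[OF continuous_map_compose[of ?R "prod_topology T (prod_topology T Y)" snd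
        "prod_topology T Y" snd], of T fst]
      continuous_map_compose[OF continuous_map_compose[of ?R "prod_topology T (prod_topology T Y)" snd
        "prod_topology T Y" snd], of Y snd]
    by (simp_all add: continuous_map_fst continuous_map_snd o_def)
  have "continuous_map ?R (discrete_topology D) (\<lambda>z. \<phi> (fst (snd z) \<otimes> fst z \<otimes> fst (snd (snd z)), snd (snd (snd z))))"
    using continuous_map_compose[OF continuous_map_pairedI[OF continuous_map_mult[OF
        continuous_map_mult[OF p(2) p(1)] p(3)] p(4)] \<phi>] by (simp add: o_def)
  moreover have "continuous_map ?R (discrete_topology D) (\<lambda>z. \<phi> (fst (snd z) \<otimes> fst (snd (snd z)), snd (snd (snd z))))"
    using continuous_map_compose[OF continuous_map_pairedI[OF continuous_map_mult[OF
        p(2) p(3)] p(4)] \<phi>] by (simp add: o_def)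
  ultimately have f: "continuous_map ?R (discrete_topology (D \<times> D)) ?f"
    using continuous_map_pairedI[of ?R "discrete_topology D" _ "discrete_topology D"]
    by (force simp: prod_topology_discrete_topology split_def)
  have "closedin ?R {z \<in> topspace ?R. ?f z \<in> {(a, b). a \<noteq> b} \<inter> D \<times> D}"
    by (rule closedin_continuous_map_preimage[OF f]) simp
  moreover have "compact_space (prod_topology T (prod_topology T Y))"
    using T Y by (simp add: compact_space_prod_topology)
  ultimately have "closedin T (fst ` {z \<in> topspace ?R. ?f z \<in> {(a, b). a \<noteq> b} \<inter> D \<times> D})"
    using closed_map_fst[of "prod_topology T (prod_topology T Y)" T] unfolding closed_map_def by blast
  moreover have "fst ` {z \<in> topspace ?R. ?f z \<in> {(a, b). a \<noteq> b} \<inter> D \<times> D} = carrier G - V"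
  proof -
    have D: "\<phi> z \<in> D" if "z \<in> carrier G \<times> topspace Y" for z
      using continuous_map_image_subset_topspace[OF \<phi>] that by auto
    show ?thesis
    proof (intro equalityI subsetI)
      fix v assume "v \<in> carrier G - V"
      then obtain a c y where *: "v \<in> carrier G" "a \<in> carrier G" "c \<in> carrier G" "y \<in> topspace Y"
        "\<phi> (a \<otimes> v \<otimes> c, y) \<noteq> \<phi> (a \<otimes> c, y)"
        unfolding V_def by blast
      then have "(v, a, c, y) \<in> {z \<in> topspace ?R. ?f z \<in> {(a, b). a \<noteq> b} \<inter> D \<times> D}"
        using D by simp
      then show "v \<in> fst ` {z \<in> topspace ?R. ?f z \<in> {(a, b). a \<noteq> b} \<inter> D \<times> D}"
        by (metis (no_types, lifting) fst_conv image_eqI)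
    qed (auto simp: V_def; blast)
  qed
  ultimately have "closedin T (topspace T - V)" by simp
  then show "openin T V"
    using openin_closedin_eq[of T V] by (auto simp: V_def)
qed

text \<open>A finite subcover of the cover by open cosets must contain every coset, because distinct
  cosets are disjoint.\<close>

lemma finite_rcosets_open:
  assumes T: "compact_space T" and V: "subgroup V G" "openin T V"
  shows "finite (rcosets V)"
proof -
  have op: "openin T C" if C: "C \<in> rcosets V" for C
  proof -
    obtain g where g: "g \<in> carrier G" "C = V #> g" using C by (auto simp: RCOSETS_def)
    have "C = {x \<in> topspace T. x \<otimes> inv g \<in> V}"
      using g(2) subgroup.rcos_module[OF V(1) is_group g(1)]
        r_coset_subset_G[OF subgroup.subset[OF V(1)] g(1)] by auto
    also have "openin T \<dots>"
      by (rule openin_continuous_map_preimage[OF _ V(2)])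
        (intro continuous_map_mult continuous_map_id_T, use g in auto)
    finally show ?thesis .
  qed
  have "topspace T \<subseteq> \<Union>(rcosets V)" using rcosets_part_G[OF V(1)] by simp
  then have "\<exists>F. finite F \<and> F \<subseteq> rcosets V \<and> topspace T \<subseteq> \<Union>F"
    using T[unfolded compact_space_alt, THEN spec, of "rcosets V"] op by simp
  then obtain F where F: "finite F" "F \<subseteq> rcosets V" "topspace T \<subseteq> \<Union>F" by blast
  have "C \<in> F" if C: "C \<in> rcosets V" for C
  proof -
    obtain g where g: "g \<in> carrier G" "C = V #> g" using C by (auto simp: RCOSETS_def)
    then have "g \<in> C" using V(1) rcos_self by simp
    obtain C' where C': "C' \<in> F" "g \<in> C'" using F(3) g(1) by auto
    have "C' \<in> rcosets V" using C'(1) F(2) by blast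
    have "C' = C"
      using pairwiseD[OF rcos_disjoint[OF V(1)] \<open>C' \<in> rcosets V\<close> C] \<open>g \<in> C\<close> C'(2)
      by (auto simp: disjnt_def)
    then show ?thesis using C'(1) by simp
  qed
  then show ?thesis by (intro finite_subset[OF subsetI F(1)])
qed

end

section \<open>The lower p-central filtration\<close>

context top_group
begin

lemma lower_p_central_Suc:
  "lower_p_central G T p (Suc (Suc n)) = closed_subgroup_generated G T
     ({h [^] p | h. h \<in> lower_p_central G T p (Suc n)} \<union>
      {grp_comm G g h | g h. g \<in> carrier G \<and> h \<in> lower_p_central G T p (Suc n)})"
  by (simp add: grp_comm_def)

lemma conj_nat_pow:
  fixes k :: nat
  assumes "x \<in> carrier G" "h \<in> carrier G"
  shows "x \<otimes> h [^] k \<otimes> inv x = (x \<otimes> h \<otimes> inv x) [^] k"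
proof (induction k)
  case (Suc k)
  have "x \<otimes> h [^] Suc k \<otimes> inv x = (x \<otimes> h [^] k \<otimes> inv x) \<otimes> (x \<otimes> h \<otimes> inv x)"
    using assms by (simp add: grp_norm)
  then show ?case using Suc by simp
qed (use assms in simp)

lemma conj_grp_comm:
  assumes "x \<in> carrier G" "g \<in> carrier G" "h \<in> carrier G"
  shows "x \<otimes> grp_comm G g h \<otimes> inv x = grp_comm G (x \<otimes> g \<otimes> inv x) (x \<otimes> h \<otimes> inv x)"
  using assms by (simp add: grp_comm_def grp_norm)

lemma lower_p_central_subset:
  assumes "lower_p_central G T p n \<lhd> G"
  shows "{h [^] p | h. h \<in> lower_p_central G T p n} \<union>
     {grp_comm G g h | g h. g \<in> carrier G \<and> h \<in> lower_p_central G T p n} \<subseteq> carrier G"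
  using subgroup.mem_carrier[OF normal_imp_subgroup[OF assms]] by auto

text \<open>The generating set of the next term is stable under conjugation: a conjugate of a power
  or commutator is the power or commutator of the conjugates.\<close>

lemma lower_p_central:
  shows lower_p_central_normal: "lower_p_central G T p n \<lhd> G"
    and lower_p_central_closed: "closedin T (lower_p_central G T p n)"
proof (induction n rule: less_induct)
  case (less n)
  have cG: "carrier G \<lhd> G" "closedin T (carrier G)"
    using subgroup_self closedin_topspace[of T] by (auto simp: normal_inv_iff)
  consider "n = 0" | "n = Suc 0" | m where "n = Suc (Suc m)" using nat.exhaust by metis
  then show "lower_p_central G T p n \<lhd> G" "closedin T (lower_p_central G T p n)"
  proof (atomize(full), cases)
    case (3 m)
    define L where "L = lower_p_central G T p (Suc m)"
    have L: "L \<lhd> G" unfolding L_def using less(1)[of "Suc m"] 3 by simp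
    note Lin = subgroup.mem_carrier[OF normal_imp_subgroup[OF L]]
    let ?A = "{h [^] p | h. h \<in> L} \<union> {grp_comm G g h | g h. g \<in> carrier G \<and> h \<in> L}"
    have A: "?A \<subseteq> carrier G" using Lin by auto
    have conj: "x \<otimes> h \<otimes> inv x \<in> L" if "x \<in> carrier G" "h \<in> L" for x h
      using L that by (simp add: normal_inv_iff)
    have "x \<otimes> a \<otimes> inv x \<in> ?A" if "x \<in> carrier G" "a \<in> ?A" for x a
    proof -
      from that(2) consider h where "a = h [^] p" "h \<in> L"
        | g h where "a = grp_comm G g h" "g \<in> carrier G" "h \<in> L" by blast
      then show ?thesis
      proof cases
        case 1
        then show ?thesis
          using that(1) conj_nat_pow[of x h p] conj[of x h] Lin[of h] by auto
      next
        case 2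
        then show ?thesis
          using that(1) conj_grp_comm[of x g h] conj[of x h] Lin[of h]
          by (intro UnI2 CollectI exI[of _ "x \<otimes> g \<otimes> inv x"] exI[of _ "x \<otimes> h \<otimes> inv x"]) auto
      qed
    qed
    then show "lower_p_central G T p n \<lhd> G \<and> closedin T (lower_p_central G T p n)"
      unfolding 3 lower_p_central_Suc L_def[symmetric]
      by (intro conjI closed_subgroup_generated_normal[OF A] closed_subgroup_generated(2)[OF A])
  qed (use cG in simp_all)
qed

lemmas lower_p_central_subgroup = normal_imp_subgroup[OF lower_p_central_normal]

lemma lower_p_central_generators:
  shows "h \<in> lower_p_central G T p (Suc n) \<Longrightarrow> h [^] p \<in> lower_p_central G T p (Suc (Suc n))"
    and "\<lbrakk>g \<in> carrier G; h \<in> lower_p_central G T p (Suc n)\<rbrakk> \<Longrightarrow>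
           grp_comm G g h \<in> lower_p_central G T p (Suc (Suc n))"
    and "\<lbrakk>g \<in> carrier G; h \<in> lower_p_central G T p (Suc n)\<rbrakk> \<Longrightarrow>
           grp_comm G h g \<in> lower_p_central G T p (Suc (Suc n))"
proof -
  note * = closed_subgroup_generated(3)[OF lower_p_central_subset[OF lower_p_central_normal,
      of p "Suc n"], folded lower_p_central_Suc]
  show "h \<in> lower_p_central G T p (Suc n) \<Longrightarrow> h [^] p \<in> lower_p_central G T p (Suc (Suc n))"
    using * by blast
  show c: "grp_comm G g h \<in> lower_p_central G T p (Suc (Suc n))"
    if "g \<in> carrier G" "h \<in> lower_p_central G T p (Suc n)" for g h using * that by blast
  assume gh: "g \<in> carrier G" "h \<in> lower_p_central G T p (Suc n)"
  have "grp_comm G h g = inv (grp_comm G g h)"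
    using inv_grp_comm[OF gh(1) subgroup.mem_carrier[OF lower_p_central_subgroup gh(2)]] by simp
  then show "grp_comm G h g \<in> lower_p_central G T p (Suc (Suc n))"
    using subgroup.m_inv_closed[OF lower_p_central_subgroup c[OF gh]] by metis
qed

lemma lower_p_central_least:
  assumes "subgroup H G" "closedin T H"
    and "\<And>h. h \<in> lower_p_central G T p (Suc n) \<Longrightarrow> h [^] p \<in> H"
    and "\<And>g h. \<lbrakk>g \<in> carrier G; h \<in> lower_p_central G T p (Suc n)\<rbrakk> \<Longrightarrow> grp_comm G g h \<in> H"
  shows "lower_p_central G T p (Suc (Suc n)) \<subseteq> H"
  unfolding lower_p_central_Suc
  by (rule closed_subgroup_generated_least) (use assms in auto)

lemma lower_p_central_decreasing:
  "lower_p_central G T p (Suc (Suc n)) \<subseteq> lower_p_central G T p (Suc n)"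
proof (rule lower_p_central_least[OF lower_p_central_subgroup lower_p_central_closed])
  let ?L = "lower_p_central G T p (Suc n)"
  note Lin = subgroup.mem_carrier[OF lower_p_central_subgroup[of p "Suc n"]]
  have "h [^] (k::nat) \<in> ?L" if "h \<in> ?L" for h k
    using subgroup.m_closed[OF lower_p_central_subgroup[of p "Suc n"]]
      subgroup.one_closed[OF lower_p_central_subgroup[of p "Suc n"]] that
    by (induction k) auto
  then show "h [^] p \<in> ?L" if "h \<in> ?L" for h using that .
  show "grp_comm G g h \<in> ?L" if g: "g \<in> carrier G" and h: "h \<in> ?L" for g h
  proof -
    have "inv g \<otimes> inv h \<otimes> inv (inv g) \<in> ?L"
      using lower_p_central_normal[of p "Suc n"] inv_closed[OF g]
        subgroup.m_inv_closed[OF lower_p_central_subgroup[of p "Suc n"] h]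
      unfolding normal_inv_iff by blast
    then show ?thesis
      using subgroup.m_closed[OF lower_p_central_subgroup[of p "Suc n"] _ h, of "inv g \<otimes> inv h \<otimes> g"] g
      by (simp add: grp_comm_def)
  qed
qed

end

lemma (in group_hom) hom_grp_comm:
  "\<lbrakk>x \<in> carrier G; y \<in> carrier G\<rbrakk> \<Longrightarrow> h (grp_comm G x y) = grp_comm H (h x) (h y)"
  by (simp add: grp_comm_def)

text \<open>The preimage of a term of the filtration is a closed subgroup, and by induction it
  contains the powers and commutators that generate the term in \<open>G\<close>.\<close>

lemma hom_lower_p_central:
  assumes G: "top_group G T" and K: "top_group K TK"
    and hom: "\<phi> \<in> hom G K" and cont: "continuous_map T TK \<phi>"
    and g: "g \<in> lower_p_central G T p (Suc n)"
  shows "\<phi> g \<in> lower_p_central K TK p (Suc n)"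
  using g
proof (induction n arbitrary: g)
  interpret G: top_group G T by (rule G)
  interpret K: top_group K TK by (rule K)
  interpret \<phi>: group_hom G K \<phi> by unfold_locales (rule hom)
  case 0
  then show ?case by simp
next
  interpret G: top_group G T by (rule G)
  interpret K: top_group K TK by (rule K)
  interpret \<phi>: group_hom G K \<phi> by unfold_locales (rule hom)
  case (Suc n)
  let ?L = "lower_p_central K TK p (Suc (Suc n))"
  note Lin = subgroup.mem_carrier[OF G.lower_p_central_subgroup[of p "Suc n"]]
  have "lower_p_central G T p (Suc (Suc n)) \<subseteq> {g \<in> carrier G. \<phi> g \<in> ?L}"
  proof (rule G.lower_p_central_least)
    show "subgroup {g \<in> carrier G. \<phi> g \<in> ?L} G"
      using K.lower_p_central_subgroup[of p "Suc (Suc n)"]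
      by (intro G.subgroupI) (auto simp: subgroup.one_closed subgroup.m_closed subgroup.m_inv_closed
          intro!: exI[of _ "\<one>\<^bsub>G\<^esub>"])
    show "closedin T {g \<in> carrier G. \<phi> g \<in> ?L}"
      using closedin_continuous_map_preimage[OF cont K.lower_p_central_closed[of p "Suc (Suc n)"]]
      by (simp del: lower_p_central.simps)
    show "h [^]\<^bsub>G\<^esub> p \<in> {g \<in> carrier G. \<phi> g \<in> ?L}" if "h \<in> lower_p_central G T p (Suc n)" for h
      using K.lower_p_central_generators(1)[OF Suc.IH[OF that]] Lin[OF that] \<phi>.hom_nat_pow by auto
    show "grp_comm G g h \<in> {g \<in> carrier G. \<phi> g \<in> ?L}"
      if "g \<in> carrier G" "h \<in> lower_p_central G T p (Suc n)" for g h
      using K.lower_p_central_generators(2)[OF \<phi>.hom_closed[OF that(1)] Suc.IH[OF that(2)]]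
        Lin[OF that(2)] that(1) by (auto simp: \<phi>.hom_grp_comm)
  qed
  then show ?case using Suc.prems by auto
qed

lemma top_group_discrete:
  assumes "group G" shows "top_group G (discrete_topology (carrier G))"
proof -
  interpret group G by (rule assms)
  show ?thesis
    by unfold_locales
      (auto simp: topological_group_def assms prod_topology_discrete_topology[symmetric])
qed

section \<open>Free profinite groups\<close>

locale free_profinite = top_group S T for S :: "('a, 'm) monoid_scheme" (structure) and T +
  fixes X :: "'a set" and g_type :: "'g::infinite itself"
  assumes free: "free_profinite_group g_type S T X"
begin

lemma compact_T: "compact_space T"
  using free by (simp add: free_profinite_group_def profinite_group_def)

lemma X_carrier: "X \<subseteq> carrier S"
  using free by (simp add: free_profinite_group_def)

lemma X_generates: "closed_subgroup_generated S T X = carrier S"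
  using free by (simp add: free_profinite_group_def)

lemma finite_outside_open_normal:
  assumes "N \<lhd> S" "openin T N" shows "finite {x \<in> X. x \<notin> N}"
  using free assms by (simp add: free_profinite_group_def converges_to_one_def)

lemma homs_agree:
  assumes "group K" "\<phi> \<in> hom S K" "\<psi> \<in> hom S K"
    "Hausdorff_space TK" "continuous_map T TK \<phi>" "continuous_map T TK \<psi>"
    "\<And>x. x \<in> X \<Longrightarrow> \<phi> x = \<psi> x" "g \<in> carrier S"
  shows "\<phi> g = \<psi> g"
  using continuous_homs_agree[OF X_generates X_carrier assms(1-6)] assms(7,8) by simp

lemma universal:
  fixes G :: "'g monoid"
  assumes "profinite_group G TG" "f \<in> X \<rightarrow> carrier G" "converges_to_one G TG X f"
  obtains \<psi> where "\<psi> \<in> hom S G" "continuous_map T TG \<psi>" "\<forall>x\<in>X. \<psi> x = f x"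
proof -
  have *: "\<forall>(G :: 'g monoid) TG f.
        profinite_group G TG \<and> f \<in> X \<rightarrow> carrier G \<and> converges_to_one G TG X f \<longrightarrow>
        (\<exists>!\<phi>. \<phi> \<in> extensional (carrier S) \<and> \<phi> \<in> hom S G \<and> continuous_map T TG \<phi> \<and>
              (\<forall>x\<in>X. \<phi> x = f x))"
    using free unfolding free_profinite_group_def by (elim conjE)
  show thesis
    using *[rule_format, OF conjI[OF assms(1) conjI[OF assms(2,3)]]] that by (elim ex1E conjE)
qed

text \<open>Freeness speaks about test groups on the type 'g, while \<open>K\<close> lives on its
  own type. A finite group has a copy on any infinite type, and the finite support of
  \<open>f\<close> gives convergence to 1.\<close>

lemma extend_to_finite_group:
  assumes K: "group K" "finite (carrier K)" and f: "\<And>x. x \<in> X \<Longrightarrow> f x \<in> carrier K"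
    and fin: "finite {x \<in> X. f x \<noteq> \<one>\<^bsub>K\<^esub>}"
  shows "\<exists>\<phi>. \<phi> \<in> hom S K \<and> continuous_map T (discrete_topology (carrier K)) \<phi> \<and> (\<forall>x\<in>X. \<phi> x = f x)"
proof -
  interpret K: group K by (rule K)
  obtain B :: "'g set" where "finite B" "card B = card (carrier K)"
    using infinite_arbitrarily_large[OF infinite_UNIV] by metis
  then obtain e :: "_ \<Rightarrow> 'g" where e: "bij_betw e (carrier K) B"
    using finite_same_card_bij K(2) by metis
  define d where "d = inv_into (carrier K) e"
  have de: "d (e k) = k" if "k \<in> carrier K" for k
    using e that by (simp add: d_def bij_betw_def inv_into_f_f)
  have eB: "e k \<in> B" if "k \<in> carrier K" for k using e that by (auto simp: bij_betw_def)
  have dK: "d b \<in> carrier K" and ed: "e (d b) = b" if "b \<in> B" for b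
    using e that by (auto simp: d_def bij_betw_def inv_into_into f_inv_into_f)
  define G :: "'g monoid" where
    "G = \<lparr>carrier = B, monoid.mult = (\<lambda>a b. e (d a \<otimes>\<^bsub>K\<^esub> d b)), one = e \<one>\<^bsub>K\<^esub>\<rparr>"
  have car: "carrier G = B" and mul: "a \<otimes>\<^bsub>G\<^esub> b = e (d a \<otimes>\<^bsub>K\<^esub> d b)" and one: "\<one>\<^bsub>G\<^esub> = e \<one>\<^bsub>K\<^esub>" for a b
    by (simp_all add: G_def)
  have G: "group G"
  proof (rule groupI)
    fix x assume x: "x \<in> carrier G"
    show "\<exists>y\<in>carrier G. y \<otimes>\<^bsub>G\<^esub> x = \<one>\<^bsub>G\<^esub>"
      using x by (intro bexI[of _ "e (inv\<^bsub>K\<^esub> (d x))"]) (simp_all add: car mul one de dK eB)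
  qed (simp_all add: car mul one eB dK de ed K.m_assoc)
  interpret tG: top_group G "discrete_topology (carrier G)" by (rule top_group_discrete[OF G])
  have prof: "profinite_group G (discrete_topology (carrier G))"
    using tG.topological \<open>finite B\<close>
    by (auto simp: profinite_group_def compact_space_discrete_topology connectedin_discrete_topology car)
  moreover have "e \<circ> f \<in> X \<rightarrow> carrier G" using f eB by (auto simp: car)
  moreover have "converges_to_one G (discrete_topology (carrier G)) X (e \<circ> f)"
    unfolding converges_to_one_def
  proof (intro allI impI)
    fix N assume "N \<lhd> G \<and> openin (discrete_topology (carrier G)) N"
    then have "\<one>\<^bsub>G\<^esub> \<in> N" using subgroup.one_closed[OF normal_imp_subgroup] by metis
    then have "{x \<in> X. (e \<circ> f) x \<notin> N} \<subseteq> {x \<in> X. f x \<noteq> \<one>\<^bsub>K\<^esub>}" by (auto simp: one)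
    then show "finite {x \<in> X. (e \<circ> f) x \<notin> N}" using fin finite_subset by metis
  qed
  ultimately obtain \<psi> where \<psi>: "\<psi> \<in> hom S G"
    "continuous_map T (discrete_topology (carrier G)) \<psi>" "\<forall>x\<in>X. \<psi> x = (e \<circ> f) x"
    by (rule universal)
  have "continuous_map (discrete_topology (carrier G)) (discrete_topology (carrier K)) d"
    using dK by (auto simp: car)
  then have "continuous_map T (discrete_topology (carrier K)) (d \<circ> \<psi>)"
    by (rule continuous_map_compose[OF \<psi>(2)])
  moreover have "d \<circ> \<psi> \<in> hom S K"
    using \<psi>(1) dK by (auto simp: hom_def car mul de Pi_def)
  moreover have "\<forall>x\<in>X. (d \<circ> \<psi>) x = f x" using \<psi>(3) f de by simp
  ultimately show ?thesis by blast
qed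

end

section \<open>Unitriangular matrices\<close>

lemma finsum_residue_ring:
  assumes "m > 1" "\<And>i. i \<in> I \<Longrightarrow> f i \<in> {0..<m}"
  shows "finsum (residue_ring m) f I = (\<Sum>i\<in>I. f i) mod m"
  using assms(2)
proof (induction I rule: infinite_finite_induct)
  interpret residues m "residue_ring m" by unfold_locales (rule assms(1), simp)
  interpret cring "residue_ring m" by (rule cring)
  {
    case (infinite A)
    then show ?case by (simp add: finsum_infinite) (simp add: residue_ring_def)
  next
    case empty
    show ?case by (simp) (simp add: residue_ring_def)
  next
    case (insert x F)
    have "f \<in> F \<rightarrow> carrier (residue_ring m)" "f x \<in> carrier (residue_ring m)"
      using insert by (force simp: residue_ring_def)+
    then have "finsum (residue_ring m) f (insert x F) = f x \<oplus>\<^bsub>residue_ring m\<^esub> finsum (residue_ring m) f F"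
      using insert by simp
    also have "\<dots> = (f x + (\<Sum>i\<in>F. f i) mod m) mod m"
      using insert by (simp add: residue_ring_def)
    also have "\<dots> = (\<Sum>i\<in>insert x F. f i) mod m" using insert by (simp add: mod_add_right_eq)
    finally show ?case .
  }
qed

lemma residue_ring_simps:
  "carrier (residue_ring m) = {0..m-1}" "x \<otimes>\<^bsub>residue_ring m\<^esub> y = (x * y) mod m"
  "\<one>\<^bsub>residue_ring m\<^esub> = 1" "\<zero>\<^bsub>residue_ring m\<^esub> = 0" "x \<oplus>\<^bsub>residue_ring m\<^esub> y = (x + y) mod m"
  by (simp_all add: residue_ring_def)

abbreviation unitri :: "int \<Rightarrow> nat \<Rightarrow> (nat \<times> nat \<Rightarrow> int) monoid" where
  "unitri m k \<equiv> unitriangular_group (residue_ring m) k"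

lemma unitri_carrier:
  "A \<in> carrier (unitri m k) \<longleftrightarrow>
     A \<in> {1..k} \<times> {1..k} \<rightarrow>\<^sub>E {0..m-1} \<and> (\<forall>i\<in>{1..k}. A (i, i) = 1) \<and>
     (\<forall>i\<in>{1..k}. \<forall>j\<in>{1..k}. j < i \<longrightarrow> A (i, j) = 0)"
  by (simp add: unitriangular_group_def residue_ring_def)

lemma unitri_entry:
  "\<lbrakk>A \<in> carrier (unitri m k); 1 \<le> i; i \<le> k; 1 \<le> j; j \<le> k\<rbrakk> \<Longrightarrow> 0 \<le> A (i, j) \<and> A (i, j) < m"
  unfolding unitri_carrier by (auto dest!: PiE_mem[of A _ _ "(i, j)"])

lemma unitri_extensional: "A \<in> carrier (unitri m k) \<Longrightarrow> A \<in> extensional ({1..k} \<times> {1..k})"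
  by (simp add: unitri_carrier PiE_def)

lemma extensional_pairs_eqI:
  assumes "A \<in> extensional (I \<times> J)" "B \<in> extensional (I \<times> J)"
    and "\<And>i j. \<lbrakk>i \<in> I; j \<in> J\<rbrakk> \<Longrightarrow> A (i, j) = B (i, j)"
  shows "A = B"
proof (rule extensionalityI[OF assms(1,2)])
  fix z assume "z \<in> I \<times> J"
  then show "A z = B z" using assms(3)[of "fst z" "snd z"] by (cases z) simp
qed

lemma unitri_one:
  "\<one>\<^bsub>unitri m k\<^esub> = (\<lambda>(i, j)\<in>{1..k} \<times> {1..k}. if i = j then 1 else 0)"
  unfolding unitriangular_group_def residue_ring_simps by simp

lemma unitri_mult:
  assumes "m > 1"
  shows "A \<otimes>\<^bsub>unitri m k\<^esub> B = (\<lambda>(i, j)\<in>{1..k} \<times> {1..k}. (\<Sum>l\<in>{1..k}. A (i, l) * B (l, j)) mod m)"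
proof -
  have "finsum (residue_ring m) (\<lambda>l. A (i, l) \<otimes>\<^bsub>residue_ring m\<^esub> B (l, j)) {1..k} =
        (\<Sum>l\<in>{1..k}. A (i, l) * B (l, j)) mod m" for i j
    by (subst finsum_residue_ring[OF assms])
      (use assms in \<open>simp_all add: residue_ring_def mod_sum_eq\<close>)
  then show ?thesis by (simp add: unitriangular_group_def)
qed

lemma unitri_mult_closed:
  assumes m: "m > 1" and A: "A \<in> carrier (unitri m k)" and B: "B \<in> carrier (unitri m k)"
  shows "A \<otimes>\<^bsub>unitri m k\<^esub> B \<in> carrier (unitri m k)"
proof -
  have low: "A (i, j) = 0" "B (i, j) = 0" if "1 \<le> j" "j < i" "i \<le> k" for i j
    using A B that unfolding unitri_carrier by auto
  have dia: "A (i, i) = 1" "B (i, i) = 1" if "1 \<le> i" "i \<le> k" for i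
    using A B that unfolding unitri_carrier by auto
  have "(\<Sum>l\<in>{1..k}. A (i, l) * B (l, i)) = (\<Sum>l\<in>{i}. A (i, l) * B (l, i))" if "1 \<le> i" "i \<le> k" for i
    by (rule sum.mono_neutral_right) (use that low in \<open>auto simp: nat_neq_iff\<close>)
  moreover have "(\<Sum>l\<in>{1..k}. A (i, l) * B (l, j)) = 0" if "1 \<le> j" "j < i" "i \<le> k" for i j
  proof (rule sum.neutral, rule ballI)
    fix l assume "l \<in> {1..k}"
    then show "A (i, l) * B (l, j) = 0" using low[of l i] low[of j l] that by (cases "l < i") auto
  qed
  ultimately show ?thesis
    unfolding unitri_carrier unitri_mult[OF m] using m dia by auto
qed

lemma mod_sum_cong:
  fixes m :: int
  shows "(\<And>i. i \<in> I \<Longrightarrow> f i mod m = g i mod m) \<Longrightarrow> sum f I mod m = sum g I mod m"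
  by (metis (mono_tags, lifting) mod_sum_eq sum.cong)

lemma unitri_assoc:
  assumes m: "m > 1"
  shows "A \<otimes>\<^bsub>unitri m k\<^esub> B \<otimes>\<^bsub>unitri m k\<^esub> C = A \<otimes>\<^bsub>unitri m k\<^esub> (B \<otimes>\<^bsub>unitri m k\<^esub> C)"
proof -
  have "(\<Sum>l\<in>{1..k}. (\<Sum>r\<in>{1..k}. A (i, r) * B (r, l)) mod m * C (l, j)) mod m =
        (\<Sum>l\<in>{1..k}. A (i, l) * ((\<Sum>r\<in>{1..k}. B (l, r) * C (r, j)) mod m)) mod m" for i j
  proof -
    have "(\<Sum>l\<in>{1..k}. (\<Sum>r\<in>{1..k}. A (i, r) * B (r, l)) mod m * C (l, j)) mod m =
          (\<Sum>l\<in>{1..k}. (\<Sum>r\<in>{1..k}. A (i, r) * B (r, l)) * C (l, j)) mod m"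
      by (rule mod_sum_cong) (simp add: mod_mult_left_eq)
    also have "(\<Sum>l\<in>{1..k}. (\<Sum>r\<in>{1..k}. A (i, r) * B (r, l)) * C (l, j)) =
               (\<Sum>r\<in>{1..k}. \<Sum>l\<in>{1..k}. A (i, r) * (B (r, l) * C (l, j)))"
      by (subst sum.swap) (simp add: sum_distrib_right mult.assoc)
    also have "\<dots> = (\<Sum>l\<in>{1..k}. A (i, l) * (\<Sum>r\<in>{1..k}. B (l, r) * C (r, j)))"
      by (simp add: sum_distrib_left)
    also have "\<dots> mod m = (\<Sum>l\<in>{1..k}. A (i, l) * ((\<Sum>r\<in>{1..k}. B (l, r) * C (r, j)) mod m)) mod m"
      by (rule mod_sum_cong) (simp add: mod_mult_right_eq)
    finally show ?thesis .
  qed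
  then show ?thesis unfolding unitri_mult[OF m] by (intro restrict_ext) auto
qed

lemma unitri_one_closed: "m > 1 \<Longrightarrow> \<one>\<^bsub>unitri m k\<^esub> \<in> carrier (unitri m k)"
  by (auto simp: unitri_carrier unitri_one)

lemma unitri_one_mult:
  assumes m: "m > 1" and A: "A \<in> carrier (unitri m k)"
  shows "\<one>\<^bsub>unitri m k\<^esub> \<otimes>\<^bsub>unitri m k\<^esub> A = A" and "A \<otimes>\<^bsub>unitri m k\<^esub> \<one>\<^bsub>unitri m k\<^esub> = A"
proof -
  note ext = unitri_extensional[OF A]
  show "\<one>\<^bsub>unitri m k\<^esub> \<otimes>\<^bsub>unitri m k\<^esub> A = A"
  proof (rule extensionalityI[OF _ ext])
    show "\<one>\<^bsub>unitri m k\<^esub> \<otimes>\<^bsub>unitri m k\<^esub> A \<in> extensional ({1..k} \<times> {1..k})" by (simp add: unitri_mult[OF m])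
    fix z assume "z \<in> {1..k} \<times> {1..k}"
    then obtain i j where z: "z = (i, j)" "i \<in> {1..k}" "j \<in> {1..k}" by auto
    have "(\<Sum>l\<in>{1..k}. \<one>\<^bsub>unitri m k\<^esub> (i, l) * A (l, j)) = (\<Sum>l\<in>{1..k}. if i = l then A (l, j) else 0)"
      using z by (intro sum.cong) (auto simp: unitri_one)
    then show "(\<one>\<^bsub>unitri m k\<^esub> \<otimes>\<^bsub>unitri m k\<^esub> A) z = A z"
      using z unitri_entry[OF A, of i j] by (simp add: unitri_mult[OF m])
  qed
  show "A \<otimes>\<^bsub>unitri m k\<^esub> \<one>\<^bsub>unitri m k\<^esub> = A"
  proof (rule extensionalityI[OF _ ext])
    show "A \<otimes>\<^bsub>unitri m k\<^esub> \<one>\<^bsub>unitri m k\<^esub> \<in> extensional ({1..k} \<times> {1..k})" by (simp add: unitri_mult[OF m])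
    fix z assume "z \<in> {1..k} \<times> {1..k}"
    then obtain i j where z: "z = (i, j)" "i \<in> {1..k}" "j \<in> {1..k}" by auto
    have "(\<Sum>l\<in>{1..k}. A (i, l) * \<one>\<^bsub>unitri m k\<^esub> (l, j)) = (\<Sum>l\<in>{1..k}. if l = j then A (i, l) else 0)"
      using z by (intro sum.cong) (auto simp: unitri_one)
    then show "(A \<otimes>\<^bsub>unitri m k\<^esub> \<one>\<^bsub>unitri m k\<^esub>) z = A z"
      using z unitri_entry[OF A, of i j] by (simp add: unitri_mult[OF m])
  qed
qed

text \<open>Rows are compared from the bottom upwards: row \<open>i\<close> of the product is row
  \<open>i\<close> of the right factor plus a combination of its later rows, where \<open>B\<close>
  and \<open>C\<close> already agree.\<close>

lemma unitri_left_cancel: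
  assumes m: "m > 1" and A: "A \<in> carrier (unitri m k)" and B: "B \<in> carrier (unitri m k)"
    and C: "C \<in> carrier (unitri m k)" and eq: "A \<otimes>\<^bsub>unitri m k\<^esub> B = A \<otimes>\<^bsub>unitri m k\<^esub> C"
  shows "B = C"
proof -
  have "B (i, j) = C (i, j)" if "1 \<le> i" "i \<le> k" "1 \<le> j" "j \<le> k" for i j
    using that(1,2)
  proof (induction "k - i" arbitrary: i rule: less_induct)
    case less
    have split: "(\<Sum>l\<in>{1..k}. A (i, l) * D (l, j)) = D (i, j) + (\<Sum>l\<in>{i<..k}. A (i, l) * D (l, j))" for D :: "nat \<times> nat \<Rightarrow> int"
    proof -
      have "(\<Sum>l\<in>{1..k}. A (i, l) * D (l, j)) = (\<Sum>l\<in>insert i {i<..k}. A (i, l) * D (l, j))"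
        by (rule sum.mono_neutral_right) (use less.prems A in \<open>auto simp: unitri_carrier\<close>)
      also have "\<dots> = D (i, j) + (\<Sum>l\<in>{i<..k}. A (i, l) * D (l, j))"
        using less.prems A by (simp add: unitri_carrier)
      finally show ?thesis .
    qed
    have "(A \<otimes>\<^bsub>unitri m k\<^esub> B) (i, j) = (A \<otimes>\<^bsub>unitri m k\<^esub> C) (i, j)" using eq by simp
    then have "(B (i, j) + (\<Sum>l\<in>{i<..k}. A (i, l) * B (l, j))) mod m =
               (C (i, j) + (\<Sum>l\<in>{i<..k}. A (i, l) * C (l, j))) mod m"
      using less.prems that(3,4) by (simp add: unitri_mult[OF m] split[unfolded One_nat_def])
    moreover have "(\<Sum>l\<in>{i<..k}. A (i, l) * B (l, j)) = (\<Sum>l\<in>{i<..k}. A (i, l) * C (l, j))"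
      using less by (intro sum.cong) auto
    ultimately have "B (i, j) mod m = C (i, j) mod m"
      by (simp add: mod_eq_dvd_iff)
    then show ?case
      using unitri_entry[OF B, of i j] unitri_entry[OF C, of i j] less.prems that(3,4) by simp
  qed
  then show ?thesis
    by (intro extensional_pairs_eqI[OF unitri_extensional[OF B] unitri_extensional[OF C]]) simp
qed

lemma finite_unitri: "finite (carrier (unitri m k))"
proof (rule finite_subset)
  show "carrier (unitri m k) \<subseteq> ({1..k} \<times> {1..k} \<rightarrow>\<^sub>E {0..m-1})"
    by (rule subsetI) (simp add: unitri_carrier)
  show "finite ({1..k} \<times> {1..k} \<rightarrow>\<^sub>E {0..m-1})" by (rule finite_PiE) simp_all
qed

text \<open>Left multiplication by a unitriangular matrix is injective, hence surjective on the finite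
  set of unitriangular matrices, which gives right inverses.\<close>

lemma group_unitri:
  assumes m: "m > 1" shows "group (unitri m k)"
proof -
  let ?U = "unitri m k"
  note closed = unitri_mult_closed[OF m, where k = k] and one = unitri_one_closed[OF m, of k]
    and om = unitri_one_mult[OF m, where k = k] and ass = unitri_assoc[OF m, where k = k]
  have right: "\<exists>B\<in>carrier ?U. A \<otimes>\<^bsub>?U\<^esub> B = \<one>\<^bsub>?U\<^esub>" if A: "A \<in> carrier ?U" for A
  proof -
    have "inj_on (\<lambda>B. A \<otimes>\<^bsub>?U\<^esub> B) (carrier ?U)"
      by (rule inj_onI) (rule unitri_left_cancel[OF m A])
    then have "(\<lambda>B. A \<otimes>\<^bsub>?U\<^esub> B) ` carrier ?U = carrier ?U"
      using closed[OF A] by (intro endo_inj_surj finite_unitri image_subsetI)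
    then have "\<one>\<^bsub>?U\<^esub> \<in> (\<lambda>B. A \<otimes>\<^bsub>?U\<^esub> B) ` carrier ?U" using one by simp
    then show ?thesis by (elim imageE) (simp add: bexI)
  qed
  show ?thesis
  proof (rule groupI)
    fix A assume A: "A \<in> carrier ?U"
    obtain B where B: "B \<in> carrier ?U" "A \<otimes>\<^bsub>?U\<^esub> B = \<one>\<^bsub>?U\<^esub>" using right[OF A] by blast
    obtain C where C: "C \<in> carrier ?U" "B \<otimes>\<^bsub>?U\<^esub> C = \<one>\<^bsub>?U\<^esub>" using right[OF B(1)] by blast
    have "A = C" using ass[of A B C] B(2) C(2) om[OF A] om[OF C(1)] by simp
    then show "\<exists>B\<in>carrier ?U. B \<otimes>\<^bsub>?U\<^esub> A = \<one>\<^bsub>?U\<^esub>" using B(1) C(2) by (intro bexI[of _ B]) simp_all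
  qed (simp_all add: closed one ass om)
qed

text \<open>The image of the letter \<open>x\<close> under the representation whose entries are
  Magnus coefficients of subwords of \<open>w\<close>: the series 1 + x has coefficient 1 at the
  empty word and at the word x, and 0 elsewhere.\<close>

definition letter_matrix :: "'x list \<Rightarrow> 'x \<Rightarrow> nat \<times> nat \<Rightarrow> int" where
  "letter_matrix w x = (\<lambda>(i, j)\<in>{1..length w + 1} \<times> {1..length w + 1}.
     if i = j then 1 else if j = i + 1 \<and> w ! (i - 1) = x then 1 else 0)"

lemma letter_matrix_carrier: "m > 1 \<Longrightarrow> letter_matrix w x \<in> carrier (unitri m (length w + 1))"
  by (auto simp: unitri_carrier letter_matrix_def)

lemma letter_matrix_one:
  assumes "x \<notin> set w" shows "letter_matrix w x = \<one>\<^bsub>unitri m (length w + 1)\<^esub>"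
proof -
  have "w ! (i - 1) \<noteq> x" if "1 \<le> i" "i + 1 \<le> length w + 1" for i
    using assms nth_mem[of "i - 1" w] that by auto
  then show ?thesis unfolding letter_matrix_def unitri_one by (intro restrict_ext) auto
qed

definition block :: "nat \<Rightarrow> nat \<Rightarrow> (nat \<times> nat \<Rightarrow> int) \<Rightarrow> nat \<times> nat \<Rightarrow> int" where
  "block i k A = (\<lambda>(a, b)\<in>{1..k} \<times> {1..k}. A (i + a, i + b))"

text \<open>Terms of the matrix product whose summation index lies outside the block vanish, since
  one of the two factors is below the diagonal.\<close>

lemma block_hom:
  assumes m: "m > 1" and ik: "i + k \<le> n"
  shows "block i k \<in> hom (unitri m n) (unitri m k)"
proof (rule homI)
  fix A assume A: "A \<in> carrier (unitri m n)"
  show "block i k A \<in> carrier (unitri m k)"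
    using A ik unitri_entry[OF A] by (auto simp: unitri_carrier block_def)
next
  fix A B assume A: "A \<in> carrier (unitri m n)" and B: "B \<in> carrier (unitri m n)"
  show "block i k (A \<otimes>\<^bsub>unitri m n\<^esub> B) = block i k A \<otimes>\<^bsub>unitri m k\<^esub> block i k B"
    unfolding unitri_mult[OF m]
  proof (subst block_def, rule restrict_ext, clarify)
    fix a b assume ab: "a \<in> {1..k}" "b \<in> {1..k}"
    have "(\<Sum>l\<in>{1..n}. A (i + a, l) * B (l, i + b)) = (\<Sum>l\<in>{1+i..k+i}. A (i + a, l) * B (l, i + b))"
    proof (rule sum.mono_neutral_right)
      show "\<forall>l\<in>{1..n} - {1+i..k+i}. A (i + a, l) * B (l, i + b) = 0"
      proof
        fix l assume "l \<in> {1..n} - {1+i..k+i}"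
        then show "A (i + a, l) * B (l, i + b) = 0"
          using A B ab ik unfolding unitri_carrier by (cases "l \<le> i") auto
      qed
    qed (use ik in auto)
    also have "\<dots> = (\<Sum>l\<in>{1..k}. A (i + a, l + i) * B (l + i, i + b))"
      by (rule sum.shift_bounds_cl_nat_ivl)
    also have "\<dots> = (\<Sum>l\<in>{1..k}. block i k A (a, l) * block i k B (l, b))"
      using ab by (intro sum.cong) (auto simp: block_def add.commute)
    finally show "(\<lambda>(i, j)\<in>{1..n} \<times> {1..n}. (\<Sum>l\<in>{1..n}. A (i, l) * B (l, j)) mod m) (i + a, i + b) =
       (\<Sum>l\<in>{1..k}. block i k A (a, l) * block i k B (l, b)) mod m"
      using ab ik by simp
  qed
qed

lemma block_letter_matrix:
  assumes "i + k \<le> length w"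
  shows "block i (k + 1) (letter_matrix w x) = letter_matrix (take k (drop i w)) x"
  using assms unfolding block_def letter_matrix_def
  by (intro ext) (auto simp: restrict_def)

section \<open>The Magnus representation\<close>

lemma nc_power_series_mult:
  assumes "m > 1"
  shows "f \<otimes>\<^bsub>nc_power_series (residue_ring m) X\<^esub> g =
    (\<lambda>w\<in>lists X. (\<Sum>k\<le>length w. f (take k w) * g (drop k w)) mod m)"
proof -
  have "finsum (residue_ring m) (\<lambda>k. f (take k w) \<otimes>\<^bsub>residue_ring m\<^esub> g (drop k w)) {..length w} =
        (\<Sum>k\<le>length w. f (take k w) * g (drop k w)) mod m" for w
    by (subst finsum_residue_ring[OF assms])
      (use assms in \<open>simp_all add: residue_ring_def mod_sum_eq\<close>)
  then show ?thesis by (simp add: nc_power_series_def)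
qed

lemma nc_power_series_carrier:
  "carrier (nc_power_series (residue_ring m) X) = lists X \<rightarrow>\<^sub>E {0..m-1}"
  by (simp add: nc_power_series_def residue_ring_simps)

lemma nc_power_series_one:
  "\<one>\<^bsub>nc_power_series (residue_ring m) X\<^esub> = (\<lambda>w\<in>lists X. if w = [] then 1 else 0)"
  unfolding nc_power_series_def residue_ring_simps by simp

lemma take_lists: "w \<in> lists X \<Longrightarrow> take k w \<in> lists X"
  by (auto simp: in_lists_conv_set dest: in_set_takeD)

lemma drop_lists: "w \<in> lists X \<Longrightarrow> drop k w \<in> lists X"
  by (auto simp: in_lists_conv_set dest: in_set_dropD)

text \<open>Both sides run over the factorizations of \<open>w\<close> into three words; the
  triangle of index pairs is summed along its two directions.\<close>

lemma nc_power_series_assoc_sum: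
  fixes f g h :: "'x list \<Rightarrow> int"
  shows "(\<Sum>k\<le>length w. (\<Sum>l\<le>k. f (take l w) * g (take (k - l) (drop l w))) * h (drop k w)) =
         (\<Sum>l\<le>length w. f (take l w) * (\<Sum>r\<le>length w - l. g (take r (drop l w)) * h (drop (l + r) w)))"
proof -
  let ?n = "length w"
  define F where "F l r = f (take l w) * g (take r (drop l w)) * h (drop (l + r) w)" for l r
  have "(\<Sum>k\<le>?n. (\<Sum>l\<le>k. f (take l w) * g (take (k - l) (drop l w))) * h (drop k w)) =
        (\<Sum>k\<le>?n. \<Sum>l\<le>k. F l (k - l))"
    unfolding F_def sum_distrib_right by (intro sum.cong refl) simp
  also have "\<dots> = (\<Sum>(l, r)\<in>{(l, r). l + r \<le> ?n}. F l r)"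
    by (rule sum.triangle_reindex_eq[symmetric])
  also have "{(l, r). l + r \<le> ?n} = Sigma {..?n} (\<lambda>l. {..?n - l})" by auto
  also have "(\<Sum>(l, r)\<in>Sigma {..?n} (\<lambda>l. {..?n - l}). F l r) = (\<Sum>l\<le>?n. \<Sum>r\<le>?n - l. F l r)"
    by (rule sum.Sigma[symmetric]) auto
  also have "\<dots> = (\<Sum>l\<le>?n. f (take l w) * (\<Sum>r\<le>?n - l. g (take r (drop l w)) * h (drop (l + r) w)))"
    unfolding F_def sum_distrib_left by (simp add: mult.assoc)
  finally show ?thesis .
qed

lemma monoid_nc_power_series:
  assumes m: "m > 1" shows "monoid (nc_power_series (residue_ring m) X)"
proof
  let ?P = "nc_power_series (residue_ring m) X"
  fix f g assume "f \<in> carrier ?P" "g \<in> carrier ?P"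
  show "f \<otimes>\<^bsub>?P\<^esub> g \<in> carrier ?P"
    using m by (simp add: nc_power_series_carrier nc_power_series_mult PiE_def Pi_def)
next
  let ?P = "nc_power_series (residue_ring m) X"
  show "\<one>\<^bsub>?P\<^esub> \<in> carrier ?P"
    using m by (simp add: nc_power_series_carrier nc_power_series_one PiE_def Pi_def)
next
  let ?P = "nc_power_series (residue_ring m) X"
  fix f assume f: "f \<in> carrier ?P"
  have fm: "f w mod m = f w" if "w \<in> lists X" for w
    using f that m by (auto simp: nc_power_series_carrier dest!: PiE_mem)
  have ext: "f \<in> extensional (lists X)" using f by (simp add: nc_power_series_carrier PiE_def)
  show "\<one>\<^bsub>?P\<^esub> \<otimes>\<^bsub>?P\<^esub> f = f"
  proof (rule extensionalityI[OF _ ext])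
    fix w assume w: "w \<in> lists X"
    have "(\<Sum>k\<le>length w. \<one>\<^bsub>?P\<^esub> (take k w) * f (drop k w)) = (\<Sum>k\<le>length w. if k = 0 then f w else 0)"
      using w by (intro sum.cong) (auto simp: nc_power_series_one take_lists)
    then show "(\<one>\<^bsub>?P\<^esub> \<otimes>\<^bsub>?P\<^esub> f) w = f w" using w fm by (simp add: nc_power_series_mult[OF m])
  qed (simp add: nc_power_series_mult[OF m])
  show "f \<otimes>\<^bsub>?P\<^esub> \<one>\<^bsub>?P\<^esub> = f"
  proof (rule extensionalityI[OF _ ext])
    fix w assume w: "w \<in> lists X"
    have "(\<Sum>k\<le>length w. f (take k w) * \<one>\<^bsub>?P\<^esub> (drop k w)) = (\<Sum>k\<le>length w. if k = length w then f w else 0)"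
      using w by (intro sum.cong) (auto simp: nc_power_series_one drop_lists)
    then show "(f \<otimes>\<^bsub>?P\<^esub> \<one>\<^bsub>?P\<^esub>) w = f w" using w fm by (simp add: nc_power_series_mult[OF m])
  qed (simp add: nc_power_series_mult[OF m])
next
  let ?P = "nc_power_series (residue_ring m) X"
  fix f g h :: "'a list \<Rightarrow> int"
  show "f \<otimes>\<^bsub>?P\<^esub> g \<otimes>\<^bsub>?P\<^esub> h = f \<otimes>\<^bsub>?P\<^esub> (g \<otimes>\<^bsub>?P\<^esub> h)"
  proof (rule extensionalityI[of _ "lists X"])
    fix w assume w: "w \<in> lists X"
    let ?n = "length w"
    have "(f \<otimes>\<^bsub>?P\<^esub> g \<otimes>\<^bsub>?P\<^esub> h) w =
      (\<Sum>k\<le>?n. ((\<Sum>l\<le>k. f (take l w) * g (take (k - l) (drop l w))) mod m) * h (drop k w)) mod m"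
    proof -
      have "(f \<otimes>\<^bsub>?P\<^esub> g) (take k w) = (\<Sum>l\<le>k. f (take l w) * g (take (k - l) (drop l w))) mod m"
        if "k \<le> ?n" for k
      proof -
        have "(f \<otimes>\<^bsub>?P\<^esub> g) (take k w) =
          (\<Sum>l\<le>k. f (take l (take k w)) * g (drop l (take k w))) mod m"
          using w that by (simp add: nc_power_series_mult[OF m] take_lists min_absorb2)
        also have "(\<Sum>l\<le>k. f (take l (take k w)) * g (drop l (take k w))) =
          (\<Sum>l\<le>k. f (take l w) * g (take (k - l) (drop l w)))"
          by (intro sum.cong refl) (simp add: drop_take min_absorb1)
        finally show ?thesis .
      qed
      then show ?thesis using w by (simp add: nc_power_series_mult[OF m, where f = "f \<otimes>\<^bsub>?P\<^esub> g"])
    qed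
    also have "\<dots> = (\<Sum>k\<le>?n. (\<Sum>l\<le>k. f (take l w) * g (take (k - l) (drop l w))) * h (drop k w)) mod m"
      by (rule mod_sum_cong) (simp add: mod_mult_left_eq)
    also have "\<dots> = (\<Sum>l\<le>?n. f (take l w) * (\<Sum>r\<le>?n - l. g (take r (drop l w)) * h (drop (l + r) w))) mod m"
      by (simp only: nc_power_series_assoc_sum)
    also have "\<dots> = (\<Sum>l\<le>?n. f (take l w) * ((\<Sum>r\<le>?n - l. g (take r (drop l w)) * h (drop (l + r) w)) mod m)) mod m"
      by (rule mod_sum_cong) (simp add: mod_mult_right_eq)
    also have "\<dots> = (f \<otimes>\<^bsub>?P\<^esub> (g \<otimes>\<^bsub>?P\<^esub> h)) w"
      using w by (simp add: nc_power_series_mult[OF m] drop_lists add.commute)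
    finally show "(f \<otimes>\<^bsub>?P\<^esub> g \<otimes>\<^bsub>?P\<^esub> h) w = (f \<otimes>\<^bsub>?P\<^esub> (g \<otimes>\<^bsub>?P\<^esub> h)) w" .
  qed (simp_all add: nc_power_series_mult[OF m])
qed

context free_profinite
begin

text \<open>The matrices come before the power series: freeness is available for finite targets, and
  unitriangular groups over a residue ring are finite. The Magnus homomorphism is then read off from
  their corners.\<close>

definition magnus_rep :: "int \<Rightarrow> 'a list \<Rightarrow> 'a \<Rightarrow> nat \<times> nat \<Rightarrow> int" where
  "magnus_rep m w = (SOME \<phi>. \<phi> \<in> hom S (unitri m (length w + 1)) \<and>
     continuous_map T (discrete_topology (carrier (unitri m (length w + 1)))) \<phi> \<and>
     (\<forall>x\<in>X. \<phi> x = letter_matrix w x))"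

lemma magnus_rep:
  assumes "m > 1"
  shows magnus_rep_hom: "magnus_rep m w \<in> hom S (unitri m (length w + 1))"
    and magnus_rep_continuous:
      "continuous_map T (discrete_topology (carrier (unitri m (length w + 1)))) (magnus_rep m w)"
    and magnus_rep_letter: "\<And>x. x \<in> X \<Longrightarrow> magnus_rep m w x = letter_matrix w x"
proof -
  let ?U = "unitri m (length w + 1)"
  have fin: "finite {x \<in> X. letter_matrix w x \<noteq> \<one>\<^bsub>?U\<^esub>}"
    by (rule finite_subset[of _ "set w"]) (use letter_matrix_one[of _ w m] in blast, simp)
  have "\<exists>\<phi>. \<phi> \<in> hom S ?U \<and> continuous_map T (discrete_topology (carrier ?U)) \<phi> \<and>
     (\<forall>x\<in>X. \<phi> x = letter_matrix w x)"
    by (rule extend_to_finite_group[OF group_unitri[OF assms] finite_unitri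
          letter_matrix_carrier[OF assms] fin])
  then have *: "magnus_rep m w \<in> hom S ?U \<and>
     continuous_map T (discrete_topology (carrier ?U)) (magnus_rep m w) \<and>
     (\<forall>x\<in>X. magnus_rep m w x = letter_matrix w x)"
    unfolding magnus_rep_def by (rule someI_ex)
  show "magnus_rep m w \<in> hom S ?U" "continuous_map T (discrete_topology (carrier ?U)) (magnus_rep m w)"
    using * by simp_all
  show "magnus_rep m w x = letter_matrix w x" if "x \<in> X" for x using * that by simp
qed

lemma magnus_rep_carrier:
  "\<lbrakk>m > 1; \<sigma> \<in> carrier S\<rbrakk> \<Longrightarrow> magnus_rep m w \<sigma> \<in> carrier (unitri m (length w + 1))"
  using magnus_rep_hom hom_in_carrier by metis

text \<open>Both sides are continuous homomorphisms with the same values on letters. Hence an entry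
  depends only on the subword between its row and its column.\<close>

lemma magnus_rep_block:
  assumes m: "m > 1" and ik: "i + k \<le> length w" and \<sigma>: "\<sigma> \<in> carrier S"
  shows "block i (k + 1) (magnus_rep m w \<sigma>) = magnus_rep m (take k (drop i w)) \<sigma>"
proof -
  let ?U = "unitri m (length w + 1)" and ?V = "unitri m (k + 1)" and ?v = "take k (drop i w)"
  have len: "length ?v = k" using ik by simp
  have hom: "block i (k + 1) \<in> hom ?U ?V" by (rule block_hom[OF m]) (use ik in simp)
  have "(block i (k + 1) \<circ> magnus_rep m w) \<sigma> = magnus_rep m ?v \<sigma>"
  proof (rule homs_agree[OF group_unitri[OF m, of "k + 1"] _ _ Hausdorff_space_discrete_topology[of "carrier ?V"] _ _ _ \<sigma>])
    show "block i (k + 1) \<circ> magnus_rep m w \<in> hom S ?V"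
      by (rule Group.hom_compose[OF magnus_rep_hom[OF m] hom])
    show "magnus_rep m ?v \<in> hom S ?V" using magnus_rep_hom[OF m, of ?v] len by simp
    show "continuous_map T (discrete_topology (carrier ?V)) (magnus_rep m ?v)"
      using magnus_rep_continuous[OF m, of ?v] len by simp
    have "continuous_map (discrete_topology (carrier ?U)) (discrete_topology (carrier ?V)) (block i (k + 1))"
      using hom by (simp add: hom_def)
    then show "continuous_map T (discrete_topology (carrier ?V)) (block i (k + 1) \<circ> magnus_rep m w)"
      by (rule continuous_map_compose[OF magnus_rep_continuous[OF m]])
    show "(block i (k + 1) \<circ> magnus_rep m w) x = magnus_rep m ?v x" if "x \<in> X" for x
      using magnus_rep_letter[OF m that] block_letter_matrix[OF ik] by simp
  qed
  then show ?thesis by simp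
qed

definition magnus_entry :: "int \<Rightarrow> 'a \<Rightarrow> 'a list \<Rightarrow> int" where
  "magnus_entry m \<sigma> w = magnus_rep m w \<sigma> (1, length w + 1)"

lemma magnus_rep_entry:
  assumes m: "m > 1" and ij: "1 \<le> i" "i \<le> j" "j \<le> length w + 1" and \<sigma>: "\<sigma> \<in> carrier S"
  shows "magnus_rep m w \<sigma> (i, j) = magnus_entry m \<sigma> (take (j - i) (drop (i - 1) w))"
proof -
  have "i - 1 + (j - i) \<le> length w" using ij by simp
  from magnus_rep_block[OF m this \<sigma>]
  have "magnus_rep m (take (j - i) (drop (i - 1) w)) \<sigma> (1, j - i + 1) =
        block (i - 1) (j - i + 1) (magnus_rep m w \<sigma>) (1, j - i + 1)" by simp
  also have "\<dots> = magnus_rep m w \<sigma> (i, j)" using ij by (simp add: block_def)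
  finally show ?thesis using ij by (simp add: magnus_entry_def)
qed

lemma magnus_entry_bounds:
  "\<lbrakk>m > 1; \<sigma> \<in> carrier S\<rbrakk> \<Longrightarrow> magnus_entry m \<sigma> w \<in> {0..m-1}"
  using unitri_entry[OF magnus_rep_carrier[of m \<sigma> w], of 1 "length w + 1"] by (simp add: magnus_entry_def)

text \<open>The matrix product in the top right corner runs over the ways to cut \<open>w\<close> in
  two, which is the product rule for power series.\<close>

lemma magnus_entry_mult:
  assumes m: "m > 1" and \<sigma>: "\<sigma> \<in> carrier S" and \<tau>: "\<tau> \<in> carrier S"
  shows "magnus_entry m (\<sigma> \<otimes> \<tau>) w =
    (\<Sum>k\<le>length w. magnus_entry m \<sigma> (take k w) * magnus_entry m \<tau> (drop k w)) mod m"
proof -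
  let ?n = "length w"
  have "magnus_entry m (\<sigma> \<otimes> \<tau>) w =
      (\<Sum>l\<in>{Suc 0..Suc ?n}. magnus_rep m w \<sigma> (1, l) * magnus_rep m w \<tau> (l, ?n + 1)) mod m"
    using hom_mult[OF magnus_rep_hom[OF m] \<sigma> \<tau>] by (simp add: magnus_entry_def unitri_mult[OF m])
  also have "(\<Sum>l\<in>{Suc 0..Suc ?n}. magnus_rep m w \<sigma> (1, l) * magnus_rep m w \<tau> (l, ?n + 1)) =
      (\<Sum>k\<in>{0..?n}. magnus_rep m w \<sigma> (1, Suc k) * magnus_rep m w \<tau> (Suc k, ?n + 1))"
    by (rule sum.shift_bounds_cl_Suc_ivl)
  also have "\<dots> = (\<Sum>k\<in>{0..?n}. magnus_entry m \<sigma> (take k w) * magnus_entry m \<tau> (drop k w))"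
    using magnus_rep_entry[OF m _ _ _ \<sigma>, of 1 _ w] magnus_rep_entry[OF m _ _ _ \<tau>, of _ "?n + 1" w]
    by (intro sum.cong) auto
  finally show ?thesis by (simp add: atMost_atLeast0)
qed

lemma magnus_entry_letter:
  "\<lbrakk>m > 1; x \<in> X\<rbrakk> \<Longrightarrow> magnus_entry m x w = (if w = [] then 1 else if w = [x] then 1 else 0)"
  by (cases w) (auto simp: magnus_entry_def magnus_rep_letter letter_matrix_def)

text \<open>The corners over all words form a homomorphism into the units, the inverse series being
  supplied by the inverse group element. It is the only continuous one with these values, as the
  letters generate topologically.\<close>

lemma magnus_hom_eq:
  assumes m: "m > 1"
  shows "magnus_hom S T X (residue_ring m) (discrete_topology (carrier (residue_ring m))) =
    (\<lambda>\<sigma>\<in>carrier S. \<lambda>w\<in>lists X. magnus_entry m \<sigma> w)"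
proof -
  let ?P = "nc_power_series (residue_ring m) X"
  let ?TR = "discrete_topology (carrier (residue_ring m))"
  let ?TP = "product_topology (\<lambda>_. ?TR) (lists X)"
  interpret P: monoid ?P by (rule monoid_nc_power_series[OF m])
  define \<Lambda> where "\<Lambda> = (\<lambda>\<sigma>\<in>carrier S. \<lambda>w\<in>lists X. magnus_entry m \<sigma> w)"
  have app: "\<Lambda> \<sigma> = (\<lambda>w\<in>lists X. magnus_entry m \<sigma> w)" if "\<sigma> \<in> carrier S" for \<sigma>
    using that by (simp add: \<Lambda>_def)
  have car: "\<Lambda> \<sigma> \<in> carrier ?P" if "\<sigma> \<in> carrier S" for \<sigma>
    using magnus_entry_bounds[OF m that] that by (simp add: app nc_power_series_carrier)
  have mult: "\<Lambda> (\<sigma> \<otimes> \<tau>) = \<Lambda> \<sigma> \<otimes>\<^bsub>?P\<^esub> \<Lambda> \<tau>" if "\<sigma> \<in> carrier S" "\<tau> \<in> carrier S" for \<sigma> \<tau>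
    using that by (simp add: app nc_power_series_mult[OF m] magnus_entry_mult[OF m] take_lists drop_lists
        cong: restrict_cong)
  have one: "\<Lambda> \<one> = \<one>\<^bsub>?P\<^esub>"
  proof -
    have "magnus_rep m w \<one> = \<one>\<^bsub>unitri m (length w + 1)\<^esub>" for w
      by (rule hom_one[OF magnus_rep_hom[OF m] is_group group_unitri[OF m]])
    then have "magnus_entry m \<one> w = (if w = [] then 1 else 0)" for w
      by (simp add: magnus_entry_def unitri_one)
    then show ?thesis by (simp add: app nc_power_series_one)
  qed
  have unit: "\<Lambda> \<sigma> \<in> Units ?P" if "\<sigma> \<in> carrier S" for \<sigma>
    unfolding Units_def
    using that car[OF that] car[OF inv_closed[OF that]] mult[of \<sigma> "inv \<sigma>"] mult[of "inv \<sigma>" \<sigma>] one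
    by (auto intro!: bexI[of _ "\<Lambda> (inv \<sigma>)"])
  have hom: "\<Lambda> \<in> hom S (units_of ?P)"
    using unit mult by (simp add: hom_def units_of_carrier units_of_mult)
  have cont: "continuous_map T ?TP \<Lambda>"
    unfolding continuous_map_componentwise
  proof (intro conjI ballI)
    show "\<Lambda> ` topspace T \<subseteq> extensional (lists X)" by (auto simp: app)
    fix w assume w: "w \<in> lists X"
    have "continuous_map T ?TR ((\<lambda>A. A (1, length w + 1)) \<circ> magnus_rep m w)"
      by (rule continuous_map_compose[OF magnus_rep_continuous[OF m]])
        (use unitri_entry in \<open>force simp: residue_ring_simps\<close>)
    then show "continuous_map T ?TR (\<lambda>\<sigma>. \<Lambda> \<sigma> w)"
      by (rule continuous_map_eq) (use w in \<open>simp add: app magnus_entry_def\<close>)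
  qed
  have letter: "\<Lambda> x = \<one>\<^bsub>?P\<^esub> \<oplus>\<^bsub>?P\<^esub> nc_variable (residue_ring m) X x" if "x \<in> X" for x
  proof -
    have xS: "x \<in> carrier S" using that X_carrier by auto
    show ?thesis
      unfolding app[OF xS] using m that
      by (intro extensionalityI[of _ "lists X"])
        (simp_all add: nc_power_series_def nc_variable_def residue_ring_simps magnus_entry_letter)
  qed
  have uniq: "\<Lambda>' = \<Lambda>" if L: "\<Lambda>' \<in> extensional (carrier S)" "\<Lambda>' \<in> hom S (units_of ?P)"
    "continuous_map T ?TP \<Lambda>'"
    "\<forall>x\<in>X. \<Lambda>' x = \<one>\<^bsub>?P\<^esub> \<oplus>\<^bsub>?P\<^esub> nc_variable (residue_ring m) X x" for \<Lambda>'
  proof (rule extensionalityI[OF L(1)])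
    show "\<Lambda> \<in> extensional (carrier S)" by (simp add: \<Lambda>_def)
    fix \<sigma> assume "\<sigma> \<in> carrier S"
    have H: "Hausdorff_space ?TP" by (simp add: Hausdorff_space_product_topology)
    show "\<Lambda>' \<sigma> = \<Lambda> \<sigma>"
      by (rule homs_agree[OF P.units_group L(2) hom H L(3) cont _ \<open>\<sigma> \<in> carrier S\<close>])
        (use L(4) letter in auto)
  qed
  show ?thesis
    unfolding magnus_hom_def \<Lambda>_def[symmetric]
  proof (rule the_equality)
    show "\<Lambda> \<in> extensional (carrier S) \<and> \<Lambda> \<in> hom S (units_of ?P) \<and> continuous_map T ?TP \<Lambda> \<and>
      (\<forall>x\<in>X. \<Lambda> x = \<one>\<^bsub>?P\<^esub> \<oplus>\<^bsub>?P\<^esub> nc_variable (residue_ring m) X x)"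
      using hom cont letter by (auto simp: \<Lambda>_def)
  qed (use uniq in auto)
qed

lemma rho_word_eq:
  assumes p: "p > 1" and w: "w \<in> lists X" and \<sigma>: "\<sigma> \<in> carrier S"
  shows "rho_word p n S T X w \<sigma> = magnus_rep (int p ^ (n - length w + 1)) w \<sigma>"
proof -
  define m where "m = int p ^ (n - length w + 1)"
  have m: "m > 1" unfolding m_def using p by (intro one_less_power) auto
  note car = magnus_rep_carrier[OF m \<sigma>, of w]
  have wr: "word_ring p n (length w) = residue_ring m" by (simp add: word_ring_def m_def)
  have coeff: "magnus_coeff S T X (residue_ring m) (discrete_topology (carrier (residue_ring m))) v \<sigma>
      = magnus_entry m \<sigma> v" if "v \<in> lists X" for v
    using that \<sigma> by (simp add: magnus_coeff_def magnus_hom_eq[OF m])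
  show ?thesis
  proof (rule extensional_pairs_eqI[OF _ unitri_extensional[OF car[unfolded m_def]]])
    show "rho_word p n S T X w \<sigma> \<in> extensional ({1..length w + 1} \<times> {1..length w + 1})"
      by (simp add: rho_word_def Let_def)
    fix i j assume "i \<in> {1..length w + 1}" "j \<in> {1..length w + 1}"
    then show "rho_word p n S T X w \<sigma> (i, j) = magnus_rep (int p ^ (n - length w + 1)) w \<sigma> (i, j)"
      unfolding m_def[symmetric]
      using car w coeff[OF take_lists[OF drop_lists[OF w]], of "j - i" "i - 1"]
        magnus_rep_entry[OF m _ _ _ \<sigma>, of i j w]
      by (auto simp: rho_word_def Let_def wr residue_ring_simps unitri_carrier not_less)
  qed
qed

end

section \<open>Entries of unitriangular matrices of size at most four\<close>

text \<open>The entries of a \<open>4 \<times> 4\<close> unitriangular matrix over \<open>\<int>/m\<close> as functions on a group: \<open>a\<close>, \<open>b\<close>,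
  \<open>c\<close> on the superdiagonal, \<open>d\<close>, \<open>e\<close> above them and \<open>f\<close> in the corner.  Smaller matrices are
  covered by putting the superfluous functions equal to \<open>0\<close>.\<close>

locale unitri_entries = group G for G (structure) +
  fixes m :: int and a b c d e f :: "'a \<Rightarrow> int"
  assumes a_mult: "\<And>g h. \<lbrakk>g \<in> carrier G; h \<in> carrier G\<rbrakk> \<Longrightarrow> [a (g \<otimes> h) = a g + a h] (mod m)"
    and b_mult: "\<And>g h. \<lbrakk>g \<in> carrier G; h \<in> carrier G\<rbrakk> \<Longrightarrow> [b (g \<otimes> h) = b g + b h] (mod m)"
    and c_mult: "\<And>g h. \<lbrakk>g \<in> carrier G; h \<in> carrier G\<rbrakk> \<Longrightarrow> [c (g \<otimes> h) = c g + c h] (mod m)"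
    and d_mult: "\<And>g h. \<lbrakk>g \<in> carrier G; h \<in> carrier G\<rbrakk> \<Longrightarrow> [d (g \<otimes> h) = d g + a g * b h + d h] (mod m)"
    and e_mult: "\<And>g h. \<lbrakk>g \<in> carrier G; h \<in> carrier G\<rbrakk> \<Longrightarrow> [e (g \<otimes> h) = e g + b g * c h + e h] (mod m)"
    and f_mult: "\<And>g h. \<lbrakk>g \<in> carrier G; h \<in> carrier G\<rbrakk> \<Longrightarrow>
                   [f (g \<otimes> h) = f g + a g * e h + d g * c h + f h] (mod m)"
begin

text \<open>The lower right 3 by 3 block is itself unitriangular, so facts about \<open>a\<close>,
  \<open>b\<close>, \<open>d\<close> carry over to \<open>b\<close>, \<open>c\<close>,
  \<open>e\<close>.\<close>

lemma bc_entries: "unitri_entries G m b c (\<lambda>_. 0) e (\<lambda>_. 0) (\<lambda>_. 0)"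
  by unfold_locales (simp_all add: b_mult c_mult e_mult)

lemma c_entries: "unitri_entries G m c (\<lambda>_. 0) (\<lambda>_. 0) (\<lambda>_. 0) (\<lambda>_. 0) (\<lambda>_. 0)"
  by unfold_locales (simp_all add: c_mult)

lemma ab_one: "[a \<one> = 0] (mod m)" "[b \<one> = 0] (mod m)" "[d \<one> = 0] (mod m)"
proof -
  show a1: "[a \<one> = 0] (mod m)" and b1: "[b \<one> = 0] (mod m)"
    using a_mult[of \<one> \<one>] b_mult[of \<one> \<one>] by (simp_all add: cong_iff_dvd_diff)
  have "[d \<one> = d \<one> + a \<one> * b \<one> + d \<one>] (mod m)" using d_mult[of \<one> \<one>] by simp
  also have "[d \<one> + a \<one> * b \<one> + d \<one> = d \<one> + 0 * b \<one> + d \<one>] (mod m)"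
    using a1 by (intro cong_add cong_mult cong_refl)
  finally show "[d \<one> = 0] (mod m)" by (simp add: cong_iff_dvd_diff)
qed

lemma a_inv: "g \<in> carrier G \<Longrightarrow> [a (inv g) = - a g] (mod m)"
proof -
  assume g: "g \<in> carrier G"
  have "[a (inv g) + a g = 0] (mod m)"
    using cong_trans[OF cong_sym[OF a_mult[OF inv_closed[OF g] g]], of 0] ab_one(1) g by simp
  then show ?thesis by (simp add: cong_iff_dvd_diff)
qed

lemma a_pow: "g \<in> carrier G \<Longrightarrow> [a (g [^] k) = int k * a g] (mod m)" for k :: nat
proof (induction k)
  case (Suc k)
  have "[a (g [^] Suc k) = a (g [^] k) + a g] (mod m)" using a_mult[of "g [^] k" g] Suc.prems by simp
  also have "[a (g [^] k) + a g = int k * a g + a g] (mod m)"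
    using Suc by (intro cong_add cong_refl)
  finally show ?case by (simp add: algebra_simps)
qed (use ab_one in simp)

lemma d_pow: "g \<in> carrier G \<Longrightarrow> [d (g [^] k) = int k * d g + int (k choose 2) * (a g * b g)] (mod m)" for k :: nat
proof (induction k)
  case (Suc k)
  have "[d (g [^] Suc k) = d (g [^] k) + a (g [^] k) * b g + d g] (mod m)"
    using d_mult[of "g [^] k" g] Suc.prems by simp
  also have "[d (g [^] k) + a (g [^] k) * b g + d g =
      (int k * d g + int (k choose 2) * (a g * b g)) + (int k * a g) * b g + d g] (mod m)"
    using Suc a_pow by (intro cong_add cong_mult cong_refl)
  also have "(int k * d g + int (k choose 2) * (a g * b g)) + (int k * a g) * b g + d g =
      int (Suc k) * d g + int (Suc k choose 2) * (a g * b g)"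
    by (simp add: numeral_2_eq_2 algebra_simps)
  finally show ?case .
qed (use ab_one in \<open>simp add: numeral_2_eq_2\<close>)

lemma f_one: "[f \<one> = 0] (mod m)"
proof -
  interpret bc: unitri_entries G m b c "\<lambda>_. 0" e "\<lambda>_. 0" "\<lambda>_. 0" by (rule bc_entries)
  have "[f \<one> = f \<one> + a \<one> * e \<one> + d \<one> * c \<one> + f \<one>] (mod m)" using f_mult[of \<one> \<one>] by simp
  also have "[f \<one> + a \<one> * e \<one> + d \<one> * c \<one> + f \<one> = f \<one> + 0 * e \<one> + 0 * c \<one> + f \<one>] (mod m)"
    using ab_one by (intro cong_add cong_mult cong_refl)
  finally show ?thesis by (simp add: cong_iff_dvd_diff)
qed

text \<open>The binomial expansion of the k-th power of 1 + n with n nilpotent: n^2 contributes two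
  paths to the corner, n^3 a single one.\<close>

lemma f_pow: "g \<in> carrier G \<Longrightarrow> [f (g [^] k) = int k * f g + int (k choose 2) * (a g * e g + d g * c g) +
    int (k choose 3) * (a g * b g * c g)] (mod m)" for k :: nat
proof (induction k)
  case (Suc k)
  have "[f (g [^] Suc k) = f (g [^] k) + a (g [^] k) * e g + d (g [^] k) * c g + f g] (mod m)"
    using f_mult[of "g [^] k" g] Suc.prems by simp
  also have "[f (g [^] k) + a (g [^] k) * e g + d (g [^] k) * c g + f g =
      (int k * f g + int (k choose 2) * (a g * e g + d g * c g) + int (k choose 3) * (a g * b g * c g)) +
      (int k * a g) * e g + (int k * d g + int (k choose 2) * (a g * b g)) * c g + f g] (mod m)"
    using Suc a_pow d_pow by (intro cong_add cong_mult cong_refl)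
  also have "(int k * f g + int (k choose 2) * (a g * e g + d g * c g) + int (k choose 3) * (a g * b g * c g)) +
      (int k * a g) * e g + (int k * d g + int (k choose 2) * (a g * b g)) * c g + f g =
      int (Suc k) * f g + int (Suc k choose 2) * (a g * e g + d g * c g) +
      int (Suc k choose 3) * (a g * b g * c g)"
    by (simp add: numeral_2_eq_2 numeral_3_eq_3 algebra_simps)
  finally show ?case .
qed (use f_one in \<open>simp add: numeral_2_eq_2 numeral_3_eq_3\<close>)

lemma a_comm:
  assumes "g \<in> carrier G" "h \<in> carrier G" shows "[a (grp_comm G g h) = 0] (mod m)"
proof -
  have "[a (h \<otimes> g) + a (grp_comm G g h) = a (g \<otimes> h)] (mod m)"
    using a_mult[of "h \<otimes> g" "grp_comm G g h"] assms by (simp add: mult_grp_comm cong_sym)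
  then have "[a (h \<otimes> g) + a (grp_comm G g h) - a (h \<otimes> g) = a (g \<otimes> h) - a (h \<otimes> g)] (mod m)"
    by (intro cong_diff cong_refl)
  also have "[a (g \<otimes> h) - a (h \<otimes> g) = (a g + a h) - (a h + a g)] (mod m)"
    using assms by (intro cong_diff a_mult)
  finally show ?thesis by simp
qed

lemma d_comm:
  assumes "g \<in> carrier G" "h \<in> carrier G"
  shows "[d (grp_comm G g h) = a g * b h - a h * b g] (mod m)"
proof -
  interpret bc: unitri_entries G m b c "\<lambda>_. 0" e "\<lambda>_. 0" "\<lambda>_. 0" by (rule bc_entries)
  let ?q = "grp_comm G g h"
  have "[d (h \<otimes> g) + a (h \<otimes> g) * b ?q + d ?q = d (g \<otimes> h)] (mod m)"
    using d_mult[of "h \<otimes> g" ?q] assms by (simp add: mult_grp_comm cong_sym)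
  moreover have "[d (h \<otimes> g) + a (h \<otimes> g) * 0 + d ?q = d (h \<otimes> g) + a (h \<otimes> g) * b ?q + d ?q] (mod m)"
    using bc.a_comm[OF assms] by (intro cong_add cong_mult cong_refl) (rule cong_sym)
  ultimately have "[d (h \<otimes> g) + a (h \<otimes> g) * 0 + d ?q = d (g \<otimes> h)] (mod m)"
    by (rule cong_trans[rotated])
  then have "[d (h \<otimes> g) + a (h \<otimes> g) * 0 + d ?q - d (h \<otimes> g) = d (g \<otimes> h) - d (h \<otimes> g)] (mod m)"
    by (intro cong_diff cong_refl)
  also have "[d (g \<otimes> h) - d (h \<otimes> g) = (d g + a g * b h + d h) - (d h + a h * b g + d g)] (mod m)"
    using assms by (intro cong_diff d_mult)
  finally show ?thesis by (simp add: algebra_simps)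
qed

text \<open>In the difference of the corners of qz and zq only products of an entry of
  \<open>q\<close> two steps above the diagonal with a superdiagonal entry of \<open>z\<close>
  survive. The hypotheses hold when \<open>q\<close> is itself a commutator.\<close>

lemma f_comm:
  assumes q: "q \<in> carrier G" and z: "z \<in> carrier G"
    and 0: "[a q = 0] (mod m)" "[b q = 0] (mod m)" "[c q = 0] (mod m)"
  shows "[f (grp_comm G q z) = d q * c z - a z * e q] (mod m)"
proof -
  interpret bc: unitri_entries G m b c "\<lambda>_. 0" e "\<lambda>_. 0" "\<lambda>_. 0" by (rule bc_entries)
  interpret cc: unitri_entries G m c "\<lambda>_. 0" "\<lambda>_. 0" "\<lambda>_. 0" "\<lambda>_. 0" "\<lambda>_. 0" by (rule c_entries)
  let ?r = "grp_comm G q z"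
  have e0: "[e ?r = 0] (mod m)"
  proof -
    have "[b q * c z - b z * c q = 0 * c z - b z * 0] (mod m)"
      using 0 by (intro cong_diff cong_mult cong_refl)
    then show ?thesis using cong_trans[OF bc.d_comm[OF q z]] by simp
  qed
  have "[f (z \<otimes> q) + a (z \<otimes> q) * e ?r + d (z \<otimes> q) * c ?r + f ?r = f (q \<otimes> z)] (mod m)"
    using f_mult[of "z \<otimes> q" ?r] q z by (simp add: mult_grp_comm cong_sym)
  moreover have "[f (z \<otimes> q) + a (z \<otimes> q) * 0 + d (z \<otimes> q) * 0 + f ?r =
      f (z \<otimes> q) + a (z \<otimes> q) * e ?r + d (z \<otimes> q) * c ?r + f ?r] (mod m)"
    using cong_sym[OF e0] cong_sym[OF cc.a_comm[OF q z]] by (intro cong_add cong_mult cong_refl)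
  ultimately have "[f (z \<otimes> q) + a (z \<otimes> q) * 0 + d (z \<otimes> q) * 0 + f ?r = f (q \<otimes> z)] (mod m)"
    by (rule cong_trans[rotated])
  then have "[f (z \<otimes> q) + a (z \<otimes> q) * 0 + d (z \<otimes> q) * 0 + f ?r - f (z \<otimes> q) = f (q \<otimes> z) - f (z \<otimes> q)] (mod m)"
    by (intro cong_diff cong_refl)
  also have "[f (q \<otimes> z) - f (z \<otimes> q) =
      (f q + a q * e z + d q * c z + f z) - (f z + a z * e q + d z * c q + f q)] (mod m)"
    using q z by (intro cong_diff f_mult)
  also have "[(f q + a q * e z + d q * c z + f z) - (f z + a z * e q + d z * c q + f q) =
      (f q + 0 * e z + d q * c z + f z) - (f z + a z * e q + d z * 0 + f q)] (mod m)"
    using 0 by (intro cong_diff cong_add cong_mult cong_refl)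
  finally show ?thesis by (simp add: algebra_simps)
qed

end

lemma prime_dvd_choose_small:
  fixes p :: nat
  assumes "prime p" "0 < k" "k < p" shows "int p dvd int (p choose k)"
  using dvd_choose_prime[of k p] assms by simp

lemma unitri_mult_entry:
  assumes m: "m > 1" and A: "A \<in> carrier (unitri m k)" and B: "B \<in> carrier (unitri m k)"
    and ij: "1 \<le> i" "i \<le> j" "j \<le> k"
  shows "(A \<otimes>\<^bsub>unitri m k\<^esub> B) (i, j) = (\<Sum>l\<in>{i..j}. A (i, l) * B (l, j)) mod m"
proof -
  have "(\<Sum>l\<in>{1..k}. A (i, l) * B (l, j)) = (\<Sum>l\<in>{i..j}. A (i, l) * B (l, j))"
    by (rule sum.mono_neutral_right) (use A B ij in \<open>auto simp: unitri_carrier\<close>)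
  then show ?thesis using ij by (simp add: unitri_mult[OF m])
qed

lemma unitri_mult_entries:
  assumes m: "m > 1" and A: "A \<in> carrier (unitri m k)" and B: "B \<in> carrier (unitri m k)" and i: "1 \<le> i"
  shows "i + 1 \<le> k \<Longrightarrow> [(A \<otimes>\<^bsub>unitri m k\<^esub> B) (i, i + 1) = A (i, i + 1) + B (i, i + 1)] (mod m)"
    and "i + 2 \<le> k \<Longrightarrow> [(A \<otimes>\<^bsub>unitri m k\<^esub> B) (i, i + 2) =
           A (i, i + 2) + A (i, i + 1) * B (i + 1, i + 2) + B (i, i + 2)] (mod m)"
    and "i + 3 \<le> k \<Longrightarrow> [(A \<otimes>\<^bsub>unitri m k\<^esub> B) (i, i + 3) =
           A (i, i + 3) + A (i, i + 1) * B (i + 1, i + 3) + A (i, i + 2) * B (i + 2, i + 3) + B (i, i + 3)] (mod m)"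
proof -
  have dia: "A (j, j) = 1" "B (j, j) = 1" if "1 \<le> j" "j \<le> k" for j
    using A B that by (auto simp: unitri_carrier)
  have s: "{i..i+1} = {i, i+1}" "{i..i+2} = {i, i+1, i+2}" "{i..i+3} = {i, i+1, i+2, i+3}" by auto
  show "i + 1 \<le> k \<Longrightarrow> [(A \<otimes>\<^bsub>unitri m k\<^esub> B) (i, i + 1) = A (i, i + 1) + B (i, i + 1)] (mod m)"
    using unitri_mult_entry[OF m A B i, of "i + 1"] i dia[of i] dia[of "i + 1"]
    by (simp only: s) (simp add: cong_def algebra_simps)
  show "i + 2 \<le> k \<Longrightarrow> [(A \<otimes>\<^bsub>unitri m k\<^esub> B) (i, i + 2) =
           A (i, i + 2) + A (i, i + 1) * B (i + 1, i + 2) + B (i, i + 2)] (mod m)"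
    using unitri_mult_entry[OF m A B i, of "i + 2"] i dia[of i] dia[of "i + 2"]
    by (simp only: s) (simp add: cong_def algebra_simps)
  show "i + 3 \<le> k \<Longrightarrow> [(A \<otimes>\<^bsub>unitri m k\<^esub> B) (i, i + 3) =
           A (i, i + 3) + A (i, i + 1) * B (i + 1, i + 3) + A (i, i + 2) * B (i + 2, i + 3) + B (i, i + 3)] (mod m)"
    using unitri_mult_entry[OF m A B i, of "i + 3"] i dia[of i] dia[of "i + 3"]
    by (simp only: s) (simp add: cong_def algebra_simps)
qed

lemma unitri_entries_2:
  "m > 1 \<Longrightarrow> unitri_entries (unitri m 2) m (\<lambda>A. A (1, 2)) (\<lambda>_. 0) (\<lambda>_. 0) (\<lambda>_. 0) (\<lambda>_. 0) (\<lambda>_. 0)"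
  using unitri_mult_entries[of m _ 2 _ 1] group_unitri[of m 2]
  by (simp add: unitri_entries_def unitri_entries_axioms_def numeral_eq_Suc)

lemma unitri_entries_3:
  "m > 1 \<Longrightarrow> unitri_entries (unitri m 3) m (\<lambda>A. A (1, 2)) (\<lambda>A. A (2, 3)) (\<lambda>_. 0)
     (\<lambda>A. A (1, 3)) (\<lambda>_. 0) (\<lambda>_. 0)"
  using unitri_mult_entries[of m _ 3 _ 1] unitri_mult_entries[of m _ 3 _ 2] group_unitri[of m 3]
  by (simp add: unitri_entries_def unitri_entries_axioms_def numeral_eq_Suc)

lemma unitri_entries_4:
  "m > 1 \<Longrightarrow> unitri_entries (unitri m 4) m (\<lambda>A. A (1, 2)) (\<lambda>A. A (2, 3)) (\<lambda>A. A (3, 4))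
     (\<lambda>A. A (1, 3)) (\<lambda>A. A (2, 4)) (\<lambda>A. A (1, 4))"
  using unitri_mult_entries[of m _ 4 _ 1] unitri_mult_entries[of m _ 4 _ 2]
    unitri_mult_entries[of m _ 4 _ 3] group_unitri[of m 4]
  by (simp add: unitri_entries_def unitri_entries_axioms_def numeral_eq_Suc)

section \<open>The lower p-central filtration of the unitriangular groups\<close>

context unitri_entries
begin

lemma dvd_a_mult:
  "\<lbrakk>q dvd m; g \<in> carrier G; h \<in> carrier G\<rbrakk> \<Longrightarrow> q dvd a (g \<otimes> h) \<longleftrightarrow> q dvd a g + a h"
  using cong_dvd_iff[OF cong_dvd_modulus[OF a_mult]] by simp

lemma dvd_a_inv: "\<lbrakk>q dvd m; g \<in> carrier G\<rbrakk> \<Longrightarrow> q dvd a (inv g) \<longleftrightarrow> q dvd a g"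
  using cong_dvd_iff[OF cong_dvd_modulus[OF a_inv]] by simp

lemma dvd_d_mult:
  "\<lbrakk>q dvd m; g \<in> carrier G; h \<in> carrier G\<rbrakk> \<Longrightarrow> q dvd d (g \<otimes> h) \<longleftrightarrow> q dvd d g + a g * b h + d h"
  using cong_dvd_iff[OF cong_dvd_modulus[OF d_mult]] by simp

lemma dvd_d_inv:
  assumes q: "q dvd m" "g \<in> carrier G" "q dvd a g" "q dvd d g" shows "q dvd d (inv g)"
proof -
  have "q dvd d (g \<otimes> inv g)"
    using cong_dvd_iff[OF cong_dvd_modulus[OF ab_one(3) q(1)]] q(2) by simp
  then have "q dvd d g + a g * b (inv g) + d (inv g)" using dvd_d_mult[of q g "inv g"] q by simp
  then show ?thesis using q by (simp add: dvd_add_right_iff)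
qed

lemma subgroup_a: "q dvd m \<Longrightarrow> subgroup {g \<in> carrier G. q dvd a g} G"
  using cong_dvd_iff[OF cong_dvd_modulus[OF ab_one(1)], of q]
  by (intro subgroupI) (auto simp: dvd_a_mult dvd_a_inv intro!: exI[of _ \<one>])

text \<open>The cross term \<open>a\<close> times \<open>b\<close> in the product rule for
  \<open>d\<close> is a multiple of \<open>q\<close> because \<open>a\<close> is one of
  \<open>q'\<close>; this ties the two conditions together.\<close>

lemma subgroup_ad:
  assumes "q dvd m" "q dvd q'" "q' dvd m" shows "subgroup {g \<in> carrier G. q' dvd a g \<and> q dvd d g} G"
  using cong_dvd_iff[OF cong_dvd_modulus[OF ab_one(1) assms(3)]]
    cong_dvd_iff[OF cong_dvd_modulus[OF ab_one(3) assms(1)]] assms dvd_trans[OF assms(2)]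
  by (intro subgroupI) (auto simp: dvd_a_mult dvd_a_inv dvd_d_mult dvd_d_inv intro!: exI[of _ \<one>])

lemma dvd_a_pow: "\<lbrakk>q dvd m; g \<in> carrier G\<rbrakk> \<Longrightarrow> q dvd a (g [^] k) \<longleftrightarrow> q dvd int k * a g" for k :: nat
  using cong_dvd_iff[OF cong_dvd_modulus[OF a_pow]] by simp

lemma dvd_d_pow: "\<lbrakk>q dvd m; g \<in> carrier G\<rbrakk> \<Longrightarrow>
    q dvd d (g [^] k) \<longleftrightarrow> q dvd int k * d g + int (k choose 2) * (a g * b g)" for k :: nat
  using cong_dvd_iff[OF cong_dvd_modulus[OF d_pow]] by simp

lemma dvd_a_comm: "\<lbrakk>q dvd m; g \<in> carrier G; h \<in> carrier G\<rbrakk> \<Longrightarrow> q dvd a (grp_comm G g h)"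
  using cong_dvd_iff[OF cong_dvd_modulus[OF a_comm]] by simp

lemma dvd_d_comm: "\<lbrakk>q dvd m; g \<in> carrier G; h \<in> carrier G\<rbrakk> \<Longrightarrow>
    q dvd d (grp_comm G g h) \<longleftrightarrow> q dvd a g * b h - a h * b g"
  using cong_dvd_iff[OF cong_dvd_modulus[OF d_comm]] by simp

lemma lower_p_central_2:
  fixes p :: nat
  assumes "int p dvd m" "h \<in> lower_p_central G (discrete_topology (carrier G)) p 2"
  shows "int p dvd a h"
proof -
  interpret tG: top_group G "discrete_topology (carrier G)" by (rule top_group_discrete[OF is_group])
  have "lower_p_central G (discrete_topology (carrier G)) p (Suc (Suc 0)) \<subseteq> {g \<in> carrier G. int p dvd a g}"
    by (rule tG.lower_p_central_least[OF subgroup_a])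
      (use assms(1) in \<open>auto simp: dvd_a_pow dvd_a_comm\<close>)
  then show ?thesis using assms(2) by (auto simp: numeral_2_eq_2 simp del: lower_p_central.simps)
qed

text \<open>\<open>q' = p\<^sup>2\<close> for \<open>2 \<times> 2\<close> and \<open>3 \<times> 3\<close> matrices and \<open>q' = p\<close> for \<open>4 \<times> 4\<close> matrices.\<close>

lemma lower_p_central_3:
  fixes p :: nat
  assumes p: "int p dvd m" "prime p" "p > 3" and q': "int p dvd q'" "q' dvd m" "q' dvd int p * int p"
    and h: "h \<in> lower_p_central G (discrete_topology (carrier G)) p 3"
  shows "q' dvd a h" and "int p dvd d h"
proof -
  let ?T = "discrete_topology (carrier G)"
  interpret tG: top_group G ?T by (rule top_group_discrete[OF is_group])
  interpret bc: unitri_entries G m b c "\<lambda>_. 0" e "\<lambda>_. 0" "\<lambda>_. 0" by (rule bc_entries)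
  have ch: "int p dvd int (p choose 2)" using p by (intro prime_dvd_choose_small) auto
  have "lower_p_central G ?T p (Suc (Suc (Suc 0))) \<subseteq> {g \<in> carrier G. q' dvd a g \<and> int p dvd d g}"
  proof (rule tG.lower_p_central_least[OF subgroup_ad[OF p(1) q'(1,2)]])
    fix h assume "h \<in> lower_p_central G ?T p (Suc (Suc 0))"
    then have h2: "h \<in> lower_p_central G ?T p 2" by (simp only: numeral_2_eq_2)
    have hG: "h \<in> carrier G" using h2 subgroup.mem_carrier[OF tG.lower_p_central_subgroup] by metis
    have a: "int p dvd a h" and b: "int p dvd b h"
      using lower_p_central_2[OF p(1) h2] bc.lower_p_central_2[OF p(1) h2] .
    \<comment> \<open>Since \<open>p\<close> divides a(h), the entry p a(h) is a multiple of p^2 and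
      so of \<open>q'\<close>; in the formula for d(h^p) both p d(h) and the binomial term are
      multiples of \<open>p\<close>.\<close>
    show "h [^] p \<in> {g \<in> carrier G. q' dvd a g \<and> int p dvd d g}"
      using hG p ch dvd_trans[OF q'(3) mult_dvd_mono[OF dvd_refl a]] q'(2)
      by (simp add: dvd_a_pow dvd_d_pow)
    show "grp_comm G g h \<in> {g \<in> carrier G. q' dvd a g \<and> int p dvd d g}" if "g \<in> carrier G" for g
      using that hG p q'(2) a b by (simp add: dvd_a_comm dvd_d_comm)
  qed simp
  then have "h \<in> {g \<in> carrier G. q' dvd a g \<and> int p dvd d g}"
    using h by (auto simp: numeral_3_eq_3 simp del: lower_p_central.simps)
  then show "q' dvd a h" "int p dvd d h" by auto
qed

end

lemma word_unitriangular_eq: "word_unitriangular p 3 s = unitri (int p ^ (3 - s + 1)) (s + 1)"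
  by (simp add: word_unitriangular_def word_ring_def)

section \<open>Coefficients of Lie polynomials and corners of powers and commutators of
  letters\<close>

definition letter_pairing :: "'x list \<Rightarrow> 'x \<Rightarrow> int" where
  "letter_pairing w x = of_bool (w = [x])"

definition comm_pairing :: "'x list \<Rightarrow> 'x \<Rightarrow> 'x \<Rightarrow> int" where
  "comm_pairing w x y = of_bool (w = [x, y]) - of_bool (w = [y, x])"

text \<open>The coefficient of \<open>w\<close> in [[x, y], z] = xyz - yxz - zxy + zyx, computed in
  the free associative ring.\<close>

definition triple_comm_pairing :: "'x list \<Rightarrow> 'x \<Rightarrow> 'x \<Rightarrow> 'x \<Rightarrow> int" where
  "triple_comm_pairing w x y z = of_bool (w = [x, y, z]) - of_bool (w = [y, x, z])
     - of_bool (w = [z, x, y]) + of_bool (w = [z, y, x])"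

text \<open>\<open>U\<close> and \<open>TU\<close> are parameters, so that a second word of the same
  length can be placed over the very same group, as happens in the proof of
  \<open>\<iota>_U3\<close>.\<close>

locale small_word =
  fixes p :: nat and w :: "'x list" and U and TU
  assumes p: "prime p" "p > 3" and w: "length w \<in> {1, 2, 3}"
  defines U_def: "U \<equiv> word_unitriangular p 3 (length w)"
    and TU_def: "TU \<equiv> discrete_topology (carrier U)"
begin

definition modulus :: int where "modulus = int p ^ (3 - length w + 1)"

lemma modulus: "modulus > 1" "int p dvd modulus"
proof -
  show "modulus > 1" unfolding modulus_def by (rule one_less_power) (use p in auto)
qed (simp add: modulus_def)

lemma U_eq: "U = unitri modulus (length w + 1)"
  by (simp add: U_def modulus_def word_unitriangular_eq)

sublocale U: group U
  unfolding U_eq by (rule group_unitri[OF modulus(1)])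

sublocale tU: top_group U TU
  unfolding TU_def by (rule top_group_discrete) (rule U.is_group)

abbreviation corner :: "(nat \<times> nat \<Rightarrow> int) \<Rightarrow> int" where
  "corner A \<equiv> A (1, length w + 1)"

abbreviation letter :: "'x \<Rightarrow> nat \<times> nat \<Rightarrow> int" where
  "letter x \<equiv> letter_matrix w x"

lemma letter_carrier: "letter x \<in> carrier U"
  unfolding U_eq by (rule letter_matrix_carrier[OF modulus(1)])

text \<open>A word of length 1 gives the additive group of Z/p^3. Commutators are trivial there, and
  the p^2-th power of the letter produces the factor p^2.\<close>

lemma corner_values_1:
  assumes w1: "length w = 1"
  shows "[corner (letter x [^]\<^bsub>U\<^esub> (p * p)) = int p ^ (3 - length w) * letter_pairing w x] (mod modulus)"
    and "[corner (grp_comm U (letter x) (letter y) [^]\<^bsub>U\<^esub> p) = int p ^ (3 - length w) * comm_pairing w x y] (mod modulus)"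
    and "[corner (grp_comm U (grp_comm U (letter x) (letter y)) (letter z)) =
            int p ^ (3 - length w) * triple_comm_pairing w x y z] (mod modulus)"
proof -
  have U: "U = unitri modulus 2" using w1 by (simp add: U_eq numeral_2_eq_2)
  interpret E: unitri_entries U modulus "\<lambda>A. A (1, 2)" "\<lambda>_. 0" "\<lambda>_. 0" "\<lambda>_. 0" "\<lambda>_. 0" "\<lambda>_. 0"
    unfolding U by (rule unitri_entries_2[OF modulus(1)])
  obtain u where wu: "w = [u]" using w1 by (cases w) auto
  have A: "letter x (1, 2) = of_bool (u = x)" for x by (simp add: letter_matrix_def wu)
  have n: "length w + 1 = 2" "3 - length w = 2" using w1 by simp_all
  have pair: "letter_pairing w x = of_bool (u = x)" "comm_pairing w x y = 0" "triple_comm_pairing w x y z = 0"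
    by (simp_all add: wu letter_pairing_def comm_pairing_def triple_comm_pairing_def)
  show "[corner (letter x [^]\<^bsub>U\<^esub> (p * p)) = int p ^ (3 - length w) * letter_pairing w x] (mod modulus)"
    unfolding n pair using E.a_pow[OF letter_carrier[of x], of "p * p"]
    by (simp add: A power2_eq_square del: One_nat_def)
  have "[(grp_comm U (letter x) (letter y) [^]\<^bsub>U\<^esub> p) (1, 2) = int p * 0] (mod modulus)"
    by (rule cong_trans[OF E.a_pow[OF U.grp_comm_closed] cong_scalar_left[OF E.a_comm]])
      (simp_all add: letter_carrier)
  then show "[corner (grp_comm U (letter x) (letter y) [^]\<^bsub>U\<^esub> p) = int p ^ (3 - length w) * comm_pairing w x y] (mod modulus)"
    unfolding n pair by simp
  show "[corner (grp_comm U (grp_comm U (letter x) (letter y)) (letter z)) =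
            int p ^ (3 - length w) * triple_comm_pairing w x y z] (mod modulus)"
    unfolding n pair using E.a_comm[of "grp_comm U (letter x) (letter y)" "letter z"]
    by (simp add: letter_carrier)
qed

text \<open>In the Heisenberg group over Z/p^2 a commutator is central and its p-th power multiplies
  the corner by \<open>p\<close>, while the p^2-th power of a letter has trivial corner.\<close>

lemma corner_values_2:
  assumes w2: "length w = 2"
  shows "[corner (letter x [^]\<^bsub>U\<^esub> (p * p)) = int p ^ (3 - length w) * letter_pairing w x] (mod modulus)"
    and "[corner (grp_comm U (letter x) (letter y) [^]\<^bsub>U\<^esub> p) = int p ^ (3 - length w) * comm_pairing w x y] (mod modulus)"
    and "[corner (grp_comm U (grp_comm U (letter x) (letter y)) (letter z)) =
            int p ^ (3 - length w) * triple_comm_pairing w x y z] (mod modulus)"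
proof -
  have U: "U = unitri modulus 3" using w2 by (simp add: U_eq)
  have m: "modulus = int p * int p" using w2 by (simp add: modulus_def)
  interpret E: unitri_entries U modulus "\<lambda>A. A (1, 2)" "\<lambda>A. A (2, 3)" "\<lambda>_. 0" "\<lambda>A. A (1, 3)" "\<lambda>_. 0" "\<lambda>_. 0"
    unfolding U by (rule unitri_entries_3[OF modulus(1)])
  interpret B: unitri_entries U modulus "\<lambda>A. A (2, 3)" "\<lambda>_. 0" "\<lambda>_. 0" "\<lambda>_. 0" "\<lambda>_. 0" "\<lambda>_. 0"
    by (rule E.bc_entries)
  obtain u v where wu: "w = [u, v]" using w2 by (auto simp: length_Suc_conv numeral_2_eq_2)
  have A: "letter x (1, 2) = of_bool (u = x)" "letter x (2, 3) = of_bool (v = x)" for x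
    by (simp_all add: letter_matrix_def wu)
  have n: "length w + 1 = 3" "3 - length w = 1" using w2 by simp_all
  have pair: "letter_pairing w x = 0" "triple_comm_pairing w x y z = 0"
    "comm_pairing w x y = of_bool (u = x) * of_bool (v = y) - of_bool (u = y) * of_bool (v = x)"
    unfolding wu letter_pairing_def comm_pairing_def triple_comm_pairing_def
    by (simp_all only: list.inject list.distinct of_bool_conj of_bool_eq simp_thms mult_1_right
        diff_self add_0_right)
  have ch: "int p dvd int (p choose 2)" using p by (intro prime_dvd_choose_small) auto
  \<comment> \<open>The p^2-th power is taken in two steps: all entries of \<open>h\<close> above
    the diagonal are multiples of \<open>p\<close>, and the second power contributes another factor
    \<open>p\<close> to the corner.\<close>
  define h where "h = letter x [^]\<^bsub>U\<^esub> p"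
  have hU: "h \<in> carrier U" by (simp add: h_def letter_carrier)
  have hd: "int p dvd h (1, 2)" "int p dvd h (2, 3)" "int p dvd h (1, 3)"
    unfolding h_def
    by (rule iffD2[OF E.dvd_a_pow[OF modulus(2) letter_carrier]] dvd_triv_left
        iffD2[OF B.dvd_a_pow[OF modulus(2) letter_carrier]])+
      (rule iffD2[OF E.dvd_d_pow[OF modulus(2) letter_carrier]], intro dvd_add dvd_triv_left dvd_mult2 ch)
  have "modulus dvd int p * h (1, 3) + int (p choose 2) * (h (1, 2) * h (2, 3))"
    unfolding m by (intro dvd_add mult_dvd_mono dvd_refl hd(3) ch dvd_mult2 hd(1))
  then have "modulus dvd (h [^]\<^bsub>U\<^esub> p) (1, 3)" by (rule iffD2[OF E.dvd_d_pow[OF dvd_refl hU]])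
  moreover have "h [^]\<^bsub>U\<^esub> p = letter x [^]\<^bsub>U\<^esub> (p * p)"
    unfolding h_def by (rule U.nat_pow_pow[OF letter_carrier])
  ultimately show "[corner (letter x [^]\<^bsub>U\<^esub> (p * p)) = int p ^ (3 - length w) * letter_pairing w x] (mod modulus)"
    unfolding n pair by (simp add: cong_0_iff)
  let ?q = "grp_comm U (letter x) (letter y)"
  have q: "?q \<in> carrier U" by (simp add: letter_carrier)
  note c = letter_carrier[of x] letter_carrier[of y]
  have "[(?q [^]\<^bsub>U\<^esub> p) (1, 3) = int p * ?q (1, 3) + int (p choose 2) * (?q (1, 2) * ?q (2, 3))] (mod modulus)"
    by (rule E.d_pow[OF q])
  also have "[int p * ?q (1, 3) + int (p choose 2) * (?q (1, 2) * ?q (2, 3)) =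
      int p * (letter x (1, 2) * letter y (2, 3) - letter y (1, 2) * letter x (2, 3)) +
      int (p choose 2) * (0 * ?q (2, 3))] (mod modulus)"
    by (intro cong_add cong_mult cong_refl E.d_comm E.a_comm c)
  finally show "[corner (?q [^]\<^bsub>U\<^esub> p) = int p ^ (3 - length w) * comm_pairing w x y] (mod modulus)"
    unfolding n pair A by simp
  have "[grp_comm U ?q (letter z) (1, 3) = ?q (1, 2) * letter z (2, 3) - letter z (1, 2) * ?q (2, 3)] (mod modulus)"
    by (rule E.d_comm[OF q letter_carrier])
  also have "[?q (1, 2) * letter z (2, 3) - letter z (1, 2) * ?q (2, 3) =
      0 * letter z (2, 3) - letter z (1, 2) * 0] (mod modulus)"
    by (intro cong_diff cong_mult cong_refl E.a_comm B.a_comm c)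
  finally show "[corner (grp_comm U ?q (letter z)) = int p ^ (3 - length w) * triple_comm_pairing w x y z] (mod modulus)"
    unfolding n pair by simp
qed

text \<open>Over Z/p the corner of every p-th power vanishes, because \<open>p\<close> > 3 divides
  (p choose 2) and (p choose 3). Only the triple commutator survives, and the two terms of its
  corner reflect [x, y] z - z [x, y].\<close>

lemma corner_values_3:
  assumes w3: "length w = 3"
  shows "[corner (letter x [^]\<^bsub>U\<^esub> (p * p)) = int p ^ (3 - length w) * letter_pairing w x] (mod modulus)"
    and "[corner (grp_comm U (letter x) (letter y) [^]\<^bsub>U\<^esub> p) = int p ^ (3 - length w) * comm_pairing w x y] (mod modulus)"
    and "[corner (grp_comm U (grp_comm U (letter x) (letter y)) (letter z)) =
            int p ^ (3 - length w) * triple_comm_pairing w x y z] (mod modulus)"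
proof -
  have U: "U = unitri modulus 4" using w3 by (simp add: U_eq)
  have m: "modulus = int p" using w3 by (simp add: modulus_def)
  interpret E: unitri_entries U modulus "\<lambda>A. A (1, 2)" "\<lambda>A. A (2, 3)" "\<lambda>A. A (3, 4)" "\<lambda>A. A (1, 3)" "\<lambda>A. A (2, 4)" "\<lambda>A. A (1, 4)"
    unfolding U by (rule unitri_entries_4[OF modulus(1)])
  interpret B: unitri_entries U modulus "\<lambda>A. A (2, 3)" "\<lambda>A. A (3, 4)" "\<lambda>_. 0" "\<lambda>A. A (2, 4)" "\<lambda>_. 0" "\<lambda>_. 0"
    by (rule E.bc_entries)
  interpret C: unitri_entries U modulus "\<lambda>A. A (3, 4)" "\<lambda>_. 0" "\<lambda>_. 0" "\<lambda>_. 0" "\<lambda>_. 0" "\<lambda>_. 0"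
    by (rule E.c_entries)
  obtain u v t where wu: "w = [u, v, t]" using w3 by (auto simp: length_Suc_conv numeral_3_eq_3)
  have A: "letter x (1, 2) = of_bool (u = x)" "letter x (2, 3) = of_bool (v = x)"
    "letter x (3, 4) = of_bool (t = x)" for x
    by (simp_all add: letter_matrix_def wu)
  have n: "length w + 1 = 4" "3 - length w = 0" using w3 by simp_all
  have pair: "letter_pairing w x = 0" "comm_pairing w x y = 0"
    "triple_comm_pairing w x y z =
      (of_bool (u = x) * of_bool (v = y) - of_bool (u = y) * of_bool (v = x)) * of_bool (t = z) -
      of_bool (u = z) * (of_bool (v = x) * of_bool (t = y) - of_bool (v = y) * of_bool (t = x))"
    unfolding wu letter_pairing_def comm_pairing_def triple_comm_pairing_def
    by (simp_all only: list.inject list.distinct of_bool_conj of_bool_eq simp_thms mult_1_right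
        diff_self) (simp only: algebra_simps)
  have ch: "int p dvd int (p choose 2)" "int p dvd int (p choose 3)"
    using p by (intro prime_dvd_choose_small; simp)+
  have pow0: "[(h [^]\<^bsub>U\<^esub> p) (1, 4) = 0] (mod modulus)" if "h \<in> carrier U" for h
    by (rule cong_trans[OF E.f_pow[OF that]]) (use ch in \<open>simp add: cong_0_iff m\<close>)
  have "letter x [^]\<^bsub>U\<^esub> (p * p) = (letter x [^]\<^bsub>U\<^esub> p) [^]\<^bsub>U\<^esub> p"
    by (rule U.nat_pow_pow[OF letter_carrier, symmetric])
  then have "[(letter x [^]\<^bsub>U\<^esub> (p * p)) (1, 4) = 0] (mod modulus)"
    using pow0[OF U.nat_pow_closed[OF letter_carrier], of x p] by simp
  then show "[corner (letter x [^]\<^bsub>U\<^esub> (p * p)) = int p ^ (3 - length w) * letter_pairing w x] (mod modulus)"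
    unfolding n pair by simp
  let ?q = "grp_comm U (letter x) (letter y)"
  have q: "?q \<in> carrier U" by (simp add: letter_carrier)
  note c = letter_carrier[of x] letter_carrier[of y]
  show "[corner (?q [^]\<^bsub>U\<^esub> p) = int p ^ (3 - length w) * comm_pairing w x y] (mod modulus)"
    unfolding n pair using pow0[OF q] by simp
  have "[grp_comm U ?q (letter z) (1, 4) = ?q (1, 3) * letter z (3, 4) - letter z (1, 2) * ?q (2, 4)] (mod modulus)"
    by (rule E.f_comm[OF q letter_carrier E.a_comm[OF c] B.a_comm[OF c] C.a_comm[OF c]])
  also have "[?q (1, 3) * letter z (3, 4) - letter z (1, 2) * ?q (2, 4) =
      (letter x (1, 2) * letter y (2, 3) - letter y (1, 2) * letter x (2, 3)) * letter z (3, 4) -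
      letter z (1, 2) * (letter x (2, 3) * letter y (3, 4) - letter y (2, 3) * letter x (3, 4))] (mod modulus)"
    by (intro cong_diff cong_mult cong_refl E.d_comm B.d_comm c)
  also have "(letter x (1, 2) * letter y (2, 3) - letter y (1, 2) * letter x (2, 3)) * letter z (3, 4) -
      letter z (1, 2) * (letter x (2, 3) * letter y (3, 4) - letter y (2, 3) * letter x (3, 4)) =
      triple_comm_pairing w x y z"
    unfolding A pair ..
  finally show "[corner (grp_comm U ?q (letter z)) = int p ^ (3 - length w) * triple_comm_pairing w x y z] (mod modulus)"
    unfolding n by simp
qed

lemma corner_values:
  "[corner (letter x [^]\<^bsub>U\<^esub> (p * p)) = int p ^ (3 - length w) * letter_pairing w x] (mod modulus)"
  "[corner (grp_comm U (letter x) (letter y) [^]\<^bsub>U\<^esub> p) = int p ^ (3 - length w) * comm_pairing w x y] (mod modulus)"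
  "[corner (grp_comm U (grp_comm U (letter x) (letter y)) (letter z)) =
      int p ^ (3 - length w) * triple_comm_pairing w x y z] (mod modulus)"
  using corner_values_1 corner_values_2 corner_values_3 w by auto

end

lemma (in top_group) lower_p_central_3_elements:
  shows "x \<in> carrier G \<Longrightarrow> x [^] (p * p) \<in> lower_p_central G T p 3"
    and "\<lbrakk>x \<in> carrier G; y \<in> carrier G\<rbrakk> \<Longrightarrow> grp_comm G x y [^] p \<in> lower_p_central G T p 3"
    and "\<lbrakk>x \<in> carrier G; y \<in> carrier G; z \<in> carrier G\<rbrakk> \<Longrightarrow>
           grp_comm G (grp_comm G x y) z \<in> lower_p_central G T p 3"
proof -
  have 2: "x [^] p \<in> lower_p_central G T p (Suc (Suc 0))" if "x \<in> carrier G" for x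
    by (rule lower_p_central_generators(1)) (use that in simp)
  have c2: "grp_comm G x y \<in> lower_p_central G T p (Suc (Suc 0))" if "x \<in> carrier G" "y \<in> carrier G" for x y
    by (rule lower_p_central_generators(2)) (use that in simp_all)
  show "x \<in> carrier G \<Longrightarrow> x [^] (p * p) \<in> lower_p_central G T p 3"
    using lower_p_central_generators(1)[OF 2] by (simp only: numeral_3_eq_3 nat_pow_pow)
  show "\<lbrakk>x \<in> carrier G; y \<in> carrier G\<rbrakk> \<Longrightarrow> grp_comm G x y [^] p \<in> lower_p_central G T p 3"
    using lower_p_central_generators(1)[OF c2] by (simp only: numeral_3_eq_3)
  show "\<lbrakk>x \<in> carrier G; y \<in> carrier G; z \<in> carrier G\<rbrakk> \<Longrightarrow>
           grp_comm G (grp_comm G x y) z \<in> lower_p_central G T p 3"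
    using lower_p_central_generators(3)[OF _ c2] by (simp only: numeral_3_eq_3)
qed

section \<open>The third term of the filtration of the unitriangular group as a central copy of
  Z/p\<close>

context small_word
begin

abbreviation \<iota> :: "int \<Rightarrow> nat \<times> nat \<Rightarrow> int" where
  "\<iota> \<equiv> central_embedding p 3 (length w)"

abbreviation U3 where "U3 \<equiv> lower_p_central U TU p 3"

lemma modulus_eq: "modulus = int p ^ (3 - length w) * int p"
  by (simp add: modulus_def)

lemma \<iota>_entry:
  "\<lbrakk>i \<in> {1..length w + 1}; j \<in> {1..length w + 1}\<rbrakk> \<Longrightarrow>
     \<iota> t (i, j) = (if i = j then 1 else if i = 1 \<and> j = length w + 1 then (t * int p ^ (3 - length w)) mod modulus else 0)"
  by (simp add: central_embedding_def modulus_def)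

lemma length_pos: "length w > 0" using w by auto

lemma corner_\<iota>: "corner (\<iota> t) = (t * int p ^ (3 - length w)) mod modulus"
  using \<iota>_entry[of 1 "length w + 1" t] length_pos by simp

lemma \<iota>_extensional: "\<iota> t \<in> extensional ({1..length w + 1} \<times> {1..length w + 1})"
  by (simp add: central_embedding_def)

lemma \<iota>_carrier: "\<iota> t \<in> carrier U"
  unfolding U_eq unitri_carrier PiE_def using \<iota>_extensional modulus(1)
  by (auto simp: \<iota>_entry)

lemma U_extensional: "A \<in> carrier U \<Longrightarrow> A \<in> extensional ({1..length w + 1} \<times> {1..length w + 1})"
  unfolding U_eq by (rule unitri_extensional)

text \<open>The only nonzero entry of \<open>\<iota> t\<close> off the diagonal is the corner. In a
  product it meets the first column or the last row of \<open>A\<close>, where only a diagonal 1 is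
  nonzero, so both products just add it to the corner of \<open>A\<close>.\<close>

lemma mult_\<iota>:
  assumes A: "A \<in> carrier U" and ij: "i \<in> {1..length w + 1}" "j \<in> {1..length w + 1}"
  shows "(A \<otimes>\<^bsub>U\<^esub> \<iota> t) (i, j) = (A (i, j) + (if i = 1 \<and> j = length w + 1 then corner (\<iota> t) else 0)) mod modulus"
    and "(\<iota> t \<otimes>\<^bsub>U\<^esub> A) (i, j) = (A (i, j) + (if i = 1 \<and> j = length w + 1 then corner (\<iota> t) else 0)) mod modulus"
proof -
  let ?I = "{1..length w + 1}" and ?n = "length w + 1" and ?c = "corner (\<iota> t)"
  have A1: "A (l, 1) = (if l = 1 then 1 else 0)" "A (?n, l) = (if l = ?n then 1 else 0)" if "l \<in> ?I" for l
    using A that unfolding U_eq unitri_carrier by (auto simp: le_less)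
  have n1: "?n \<noteq> 1" "1 \<in> ?I" "?n \<in> ?I" using length_pos by simp_all
  have e: "\<iota> t (l, k) = (if l = k then 1 else if l = 1 \<and> k = ?n then ?c else 0)" if "l \<in> ?I" "k \<in> ?I" for l k
    unfolding \<iota>_entry[OF that] corner_\<iota> ..
  have "(\<Sum>l\<in>?I. A (i, l) * \<iota> t (l, j)) =
      (\<Sum>l\<in>?I. (if l = j then A (i, l) else 0) + (if l = 1 then A (i, l) * (if j = ?n then ?c else 0) else 0))"
    using e[OF _ ij(2)] n1 by (intro sum.cong) (auto simp: not_less_eq_eq)
  also have "\<dots> = A (i, j) + A (i, 1) * (if j = ?n then ?c else 0)"
    using ij by (simp add: sum.distrib not_less_eq_eq)
  also have "\<dots> = A (i, j) + (if i = 1 \<and> j = ?n then ?c else 0)"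
    unfolding A1(1)[OF ij(1)] by simp
  finally show "(A \<otimes>\<^bsub>U\<^esub> \<iota> t) (i, j) = (A (i, j) + (if i = 1 \<and> j = ?n then ?c else 0)) mod modulus"
    using ij by (simp add: U_eq unitri_mult[OF modulus(1)])
  have "(\<Sum>l\<in>?I. \<iota> t (i, l) * A (l, j)) =
      (\<Sum>l\<in>?I. (if l = i then A (l, j) else 0) + (if l = ?n then (if i = 1 then ?c else 0) * A (l, j) else 0))"
    using e[OF ij(1)] n1 by (intro sum.cong) (auto simp: not_less_eq_eq)
  also have "\<dots> = A (i, j) + (if i = 1 then ?c else 0) * A (?n, j)"
    using ij by (simp add: sum.distrib not_less_eq_eq)
  also have "\<dots> = A (i, j) + (if i = 1 \<and> j = ?n then ?c else 0)"
    unfolding A1(2)[OF ij(2)] by simp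
  finally show "(\<iota> t \<otimes>\<^bsub>U\<^esub> A) (i, j) = (A (i, j) + (if i = 1 \<and> j = ?n then ?c else 0)) mod modulus"
    using ij by (simp add: U_eq unitri_mult[OF modulus(1)])
qed

lemma \<iota>_central:
  assumes A: "A \<in> carrier U" shows "\<iota> t \<otimes>\<^bsub>U\<^esub> A = A \<otimes>\<^bsub>U\<^esub> \<iota> t"
proof (rule extensional_pairs_eqI[OF U_extensional[OF U.m_closed[OF \<iota>_carrier A]]
      U_extensional[OF U.m_closed[OF A \<iota>_carrier]]])
  fix i j assume ij: "i \<in> {1..length w + 1}" "j \<in> {1..length w + 1}"
  show "(\<iota> t \<otimes>\<^bsub>U\<^esub> A) (i, j) = (A \<otimes>\<^bsub>U\<^esub> \<iota> t) (i, j)" by (simp only: mult_\<iota>[OF A ij])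
qed

lemma scale_mod: "(t * int p ^ (3 - length w)) mod modulus = (t mod int p) * int p ^ (3 - length w)"
proof -
  have "modulus = int p * int p ^ (3 - length w)" unfolding modulus_eq by (rule mult.commute)
  then show ?thesis by (simp only: mult_mod_left)
qed

lemma \<iota>_mult: "\<iota> t \<otimes>\<^bsub>U\<^esub> \<iota> u = \<iota> ((t + u) mod int p)"
proof (rule extensional_pairs_eqI[OF U_extensional[OF U.m_closed[OF \<iota>_carrier \<iota>_carrier]] \<iota>_extensional])
  fix i j assume ij: "i \<in> {1..length w + 1}" "j \<in> {1..length w + 1}"
  have "(t mod int p * int p ^ (3 - length w) + u mod int p * int p ^ (3 - length w)) mod modulus =
        ((t + u) mod int p) * int p ^ (3 - length w)"
    by (simp add: distrib_right[symmetric] scale_mod mod_simps)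
  then have sc: "(t mod int p * int p ^ (3 - length w) + u mod int p * int p ^ (3 - length w)) mod modulus =
        ((t + u) mod int p) mod int p * int p ^ (3 - length w)" by (simp only: mod_mod_trivial)
  have n1: "length w + 1 \<noteq> 1" using length_pos by simp
  have 1: "1 mod modulus = 1" using modulus(1) by simp
  show "(\<iota> t \<otimes>\<^bsub>U\<^esub> \<iota> u) (i, j) = \<iota> ((t + u) mod int p) (i, j)"
    unfolding mult_\<iota>(1)[OF \<iota>_carrier ij] corner_\<iota> \<iota>_entry[OF ij] scale_mod
    using n1 1 sc by (cases "i = j"; cases "i = 1"; cases "j = length w + 1") (simp_all del: One_nat_def)
qed

lemma \<iota>_zero: "\<iota> 0 = \<one>\<^bsub>U\<^esub>"
proof -
  have "\<iota> 0 \<otimes>\<^bsub>U\<^esub> \<iota> 0 = \<iota> 0" by (simp add: \<iota>_mult)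
  then show ?thesis using U.l_cancel_one[OF \<iota>_carrier \<iota>_carrier, of 0 0] by simp
qed

lemma U3_entries:
  assumes A: "A \<in> U3"
  shows "int p ^ (3 - length w) dvd corner A"
    and "\<And>i j. \<lbrakk>1 \<le> i; i < j; j \<le> length w + 1; \<not> (i = 1 \<and> j = length w + 1)\<rbrakk> \<Longrightarrow> A (i, j) = 0"
proof -
  have AU: "A \<in> carrier U" using A subgroup.mem_carrier[OF tU.lower_p_central_subgroup] by metis
  \<comment> \<open>Entries are residues from 0 to \<open>modulus\<close> - 1, so divisibility by
    the modulus means being 0.\<close>
  have zero: "A (i, j) = 0" if "modulus dvd A (i, j)" "1 \<le> i" "i \<le> length w + 1" "1 \<le> j" "j \<le> length w + 1" for i j
    using unitri_entry[OF AU[unfolded U_eq] that(2-5)] that(1) zdvd_not_zless[of "A (i, j)" modulus]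
    by (cases "0 < A (i, j)") simp_all
  have "int p ^ (3 - length w) dvd corner A \<and>
    (\<forall>i j. 1 \<le> i \<and> i < j \<and> j \<le> length w + 1 \<and> \<not> (i = 1 \<and> j = length w + 1) \<longrightarrow> A (i, j) = 0)"
  proof -
    consider "length w = 1" | "length w = 2" | "length w = 3" using w by auto
    then show ?thesis
    proof cases
      case 1
      have U: "U = unitri modulus 2" using 1 by (simp add: U_eq numeral_2_eq_2)
      interpret E: unitri_entries U modulus "\<lambda>A. A (1, 2)" "\<lambda>_. 0" "\<lambda>_. 0" "\<lambda>_. 0" "\<lambda>_. 0" "\<lambda>_. 0"
        unfolding U by (rule unitri_entries_2[OF modulus(1)])
      have m: "modulus = int p ^ 2 * int p" using 1 by (simp add: modulus_eq numeral_2_eq_2)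
      \<comment> \<open>The divisor \<open>q'\<close> of \<open>lower_p_central_3\<close> is p^2
        here, where the modulus is p^3; in the two cases below it is the full modulus.\<close>
      have "int p ^ 2 dvd A (1, 2)"
        by (rule E.lower_p_central_3(1)[OF modulus(2) p _ _ _ A[unfolded TU_def]])
          (simp_all add: m power2_eq_square)
      then show ?thesis using 1 by (auto simp: numeral_2_eq_2)
    next
      case 2
      have U: "U = unitri modulus 3" using 2 by (simp add: U_eq)
      have m: "modulus = int p * int p" using 2 by (simp add: modulus_eq)
      interpret E: unitri_entries U modulus "\<lambda>A. A (1, 2)" "\<lambda>A. A (2, 3)" "\<lambda>_. 0" "\<lambda>A. A (1, 3)" "\<lambda>_. 0" "\<lambda>_. 0"
        unfolding U by (rule unitri_entries_3[OF modulus(1)])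
      interpret B: unitri_entries U modulus "\<lambda>A. A (2, 3)" "\<lambda>_. 0" "\<lambda>_. 0" "\<lambda>_. 0" "\<lambda>_. 0" "\<lambda>_. 0"
        by (rule E.bc_entries)
      have "modulus dvd A (1, 2)" "modulus dvd A (2, 3)" "int p dvd A (1, 3)"
        using E.lower_p_central_3[OF modulus(2) p _ _ _ A[unfolded TU_def], of modulus]
          B.lower_p_central_3(1)[OF modulus(2) p _ _ _ A[unfolded TU_def], of modulus]
        by (simp_all add: m)
      then have *: "A (1, 2) = 0" "A (2, 3) = 0" "int p dvd A (1, 3)"
        using zero[of 1 2] zero[of 2 3] 2 by simp_all
      have "A (i, j) = 0" if "1 \<le> i" "i < j" "j \<le> 3" "\<not> (i = 1 \<and> j = 3)" for i j
      proof -
        have "i = 1 \<and> j = 2 \<or> i = 2 \<and> j = 3" using that by arith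
        then show ?thesis using * by auto
      qed
      then show ?thesis using 2 * by simp
    next
      case 3
      have U: "U = unitri modulus 4" using 3 by (simp add: U_eq)
      have m: "modulus = int p" using 3 by (simp add: modulus_eq)
      interpret E: unitri_entries U modulus "\<lambda>A. A (1, 2)" "\<lambda>A. A (2, 3)" "\<lambda>A. A (3, 4)" "\<lambda>A. A (1, 3)" "\<lambda>A. A (2, 4)" "\<lambda>A. A (1, 4)"
        unfolding U by (rule unitri_entries_4[OF modulus(1)])
      interpret B: unitri_entries U modulus "\<lambda>A. A (2, 3)" "\<lambda>A. A (3, 4)" "\<lambda>_. 0" "\<lambda>A. A (2, 4)" "\<lambda>_. 0" "\<lambda>_. 0"
        by (rule E.bc_entries)
      interpret C: unitri_entries U modulus "\<lambda>A. A (3, 4)" "\<lambda>_. 0" "\<lambda>_. 0" "\<lambda>_. 0" "\<lambda>_. 0" "\<lambda>_. 0"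
        by (rule E.c_entries)
      have "modulus dvd A (1, 2)" "modulus dvd A (2, 3)" "modulus dvd A (3, 4)"
        "modulus dvd A (1, 3)" "modulus dvd A (2, 4)"
        using E.lower_p_central_3[OF modulus(2) p _ _ _ A[unfolded TU_def], of modulus]
          B.lower_p_central_3[OF modulus(2) p _ _ _ A[unfolded TU_def], of modulus]
          C.lower_p_central_3(1)[OF modulus(2) p _ _ _ A[unfolded TU_def], of modulus]
        by (simp_all add: m)
      then have *: "A (1, 2) = 0" "A (2, 3) = 0" "A (3, 4) = 0" "A (1, 3) = 0" "A (2, 4) = 0"
        using zero[of 1 2] zero[of 2 3] zero[of 3 4] zero[of 1 3] zero[of 2 4] 3 by simp_all
      have "A (i, j) = 0" if "1 \<le> i" "i < j" "j \<le> 4" "\<not> (i = 1 \<and> j = 4)" for i j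
      proof -
        have "i = 1 \<and> j = 2 \<or> i = 2 \<and> j = 3 \<or> i = 3 \<and> j = 4 \<or> i = 1 \<and> j = 3 \<or> i = 2 \<and> j = 4"
          using that by arith
        then show ?thesis using * by auto
      qed
      then show ?thesis using 3 * by simp
    qed
  qed
  then show "int p ^ (3 - length w) dvd corner A"
    and "\<And>i j. \<lbrakk>1 \<le> i; i < j; j \<le> length w + 1; \<not> (i = 1 \<and> j = length w + 1)\<rbrakk> \<Longrightarrow> A (i, j) = 0"
    by simp_all
qed

lemma U3_\<iota>:
  assumes A: "A \<in> U3" shows "\<exists>t\<in>{0..<int p}. A = \<iota> t"
proof -
  have AU: "A \<in> carrier U" using A subgroup.mem_carrier[OF tU.lower_p_central_subgroup] by metis
  obtain t where t: "corner A = int p ^ (3 - length w) * t" using U3_entries(1)[OF A] by (elim dvdE)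
  have q0: "int p ^ (3 - length w) > 0" using p by simp
  have "0 \<le> corner A \<and> corner A < modulus"
    by (rule unitri_entry[OF AU[unfolded U_eq]]) simp_all
  then have "0 \<le> t \<and> t < int p"
    unfolding t modulus_eq using q0 by (simp add: zero_le_mult_iff)
  then have tp: "t \<in> {0..<int p}" by simp
  have "A = \<iota> t"
  proof (rule extensional_pairs_eqI[OF U_extensional[OF AU] \<iota>_extensional])
    fix i j assume ij: "i \<in> {1..length w + 1}" "j \<in> {1..length w + 1}"
    have "A (i, i) = 1" and low: "j < i \<Longrightarrow> A (i, j) = 0"
      using AU ij unfolding U_eq unitri_carrier by auto
    have cor: "\<iota> t (1, length w + 1) = corner A"
      unfolding corner_\<iota> scale_mod t using tp by (simp add: mult.commute)
    consider "i = 1 \<and> j = length w + 1" | "i = j" | "j < i"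
      | "i < j" "\<not> (i = 1 \<and> j = length w + 1)" by linarith
    then show "A (i, j) = \<iota> t (i, j)"
    proof cases
      case 1
      then show ?thesis using cor by simp
    next
      case 2
      then show ?thesis unfolding \<iota>_entry[OF ij] using \<open>A (i, i) = 1\<close> by simp
    next
      case 3
      then show ?thesis unfolding \<iota>_entry[OF ij] using low ij by simp
    next
      case 4
      then show ?thesis using U3_entries(2)[OF A, of i j] ij unfolding \<iota>_entry[OF ij] by auto
    qed
  qed
  then show ?thesis using tp by auto
qed

text \<open>For a word with distinct letters, the matching power or commutator of its letters pairs
  to 1 and yields \<open>\<iota> 1\<close>, whereas a word with repeated letters may pair to 0.
  Hence the auxiliary word \<open>v\<close> over the natural numbers, whose group is the
  same.\<close>

lemma \<iota>_U3: "\<iota> t \<in> U3"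
proof -
  define v :: "nat list" where "v = [0..<length w]"
  have lv: "length v = length w" by (simp add: v_def)
  interpret V: small_word p v U TU
    by unfold_locales (use p w U_def TU_def lv in simp_all)
  have m: "V.modulus = modulus" by (simp add: V.modulus_def modulus_def lv)
  have "\<exists>A\<in>U3. [corner A = int p ^ (3 - length w)] (mod modulus)"
  proof -
    consider "length w = 1" | "length w = 2" | "length w = 3" using w by auto
    then show ?thesis
    proof cases
      case 1
      then have "v = [0]" by (simp add: v_def)
      then have pair: "letter_pairing v 0 = 1" by (simp add: letter_pairing_def)
      show ?thesis
        by (rule bexI, rule V.corner_values(1)[of 0, unfolded m lv pair mult_1_right],
            rule tU.lower_p_central_3_elements(1)[OF V.letter_carrier[of 0]])
    next
      case 2
      then have "v = [0, 1]" by (simp add: v_def upt_rec)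
      then have pair: "comm_pairing v 0 1 = 1" by (simp add: comm_pairing_def)
      show ?thesis
        by (rule bexI, rule V.corner_values(2)[of 0 1, unfolded m lv pair mult_1_right],
            rule tU.lower_p_central_3_elements(2)[OF V.letter_carrier[of 0] V.letter_carrier[of 1]])
    next
      case 3
      then have "v = [0, 1, 2]" by (simp add: v_def upt_rec)
      then have pair: "triple_comm_pairing v 0 1 2 = 1" by (simp add: triple_comm_pairing_def)
      show ?thesis
        by (rule bexI, rule V.corner_values(3)[of 0 1 2, unfolded m lv pair mult_1_right],
            rule tU.lower_p_central_3_elements(3)[OF V.letter_carrier[of 0] V.letter_carrier[of 1] V.letter_carrier[of 2]])
    qed
  qed
  then obtain A where A: "A \<in> U3" "[corner A = int p ^ (3 - length w)] (mod modulus)" by auto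
  obtain u where u: "u \<in> {0..<int p}" "A = \<iota> u" using U3_\<iota>[OF A(1)] by auto
  have "((u mod int p) * int p ^ (3 - length w)) mod modulus = (1 * int p ^ (3 - length w)) mod modulus"
    using A(2) unfolding u(2) cong_def corner_\<iota> scale_mod mult_1_left by simp
  then have "u = 1" unfolding scale_mod using p u(1) by simp
  then have 1: "\<iota> 1 \<in> U3" using A u by simp
  have U3: "subgroup U3 U" by (rule tU.lower_p_central_subgroup)
  have nat: "\<iota> (int n mod int p) \<in> U3" for n
  proof (induction n)
    case 0
    then show ?case using subgroup.one_closed[OF U3] by (simp add: \<iota>_zero)
  next
    case (Suc n)
    have "\<iota> (int n mod int p) \<otimes>\<^bsub>U\<^esub> \<iota> 1 = \<iota> (int (Suc n) mod int p)" by (simp add: \<iota>_mult mod_simps add.commute)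
    then show ?case using subgroup.m_closed[OF U3 Suc 1] by simp
  qed
  have "\<iota> t = \<iota> (t mod int p)"
    by (rule extensional_pairs_eqI[OF \<iota>_extensional \<iota>_extensional])
      (simp only: \<iota>_entry scale_mod mod_mod_trivial)
  also have "t mod int p = int (nat (t mod int p)) mod int p" using p by simp
  finally show ?thesis using nat by metis
qed

end

declare one_FactGroup [simp del] mult_FactGroup [simp del] lower_p_central.simps(3) [simp del]

section \<open>Invariant homomorphisms on the third term of the filtration\<close>

lemma (in p_central_3) comm_mult_left_H:
  assumes "g \<in> carrier G" "g' \<in> carrier G" "h \<in> H"
  shows "grp_comm G (g \<otimes> g') h = grp_comm G g h \<otimes> grp_comm G g' h"
  unfolding grp_comm_mult_left[OF assms(1,2) H_carrier[OF assms(3)]]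
    conj_central[OF comm_Z[OF assms(1,3)] assms(2)] ..

text \<open>Continuity is encoded as closedness of the kernel, the form in which the density
  arguments use it. Values outside the third term of the filtration are left unconstrained.\<close>

locale invariant_hom = free_profinite S T X g_type
  for S :: "('a, 'm) monoid_scheme" (structure) and T X and g_type :: "'g::infinite itself" +
  fixes p :: nat and \<psi> :: "'a \<Rightarrow> int"
  assumes odd_p: "odd p"
    and \<psi>_range: "\<And>n. n \<in> lower_p_central S T p 3 \<Longrightarrow> \<psi> n \<in> {0..<int p}"
    and \<psi>_mult: "\<And>n n'. \<lbrakk>n \<in> lower_p_central S T p 3; n' \<in> lower_p_central S T p 3\<rbrakk> \<Longrightarrow>
                   \<psi> (n \<otimes> n') = (\<psi> n + \<psi> n') mod int p"
    and \<psi>_conj: "\<And>g n. \<lbrakk>g \<in> carrier S; n \<in> lower_p_central S T p 3\<rbrakk> \<Longrightarrow> \<psi> (g \<otimes> n \<otimes> inv g) = \<psi> n"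
    and \<psi>_closed: "closedin T {n \<in> lower_p_central S T p 3. \<psi> n = 0}"
begin

abbreviation N where "N \<equiv> lower_p_central S T p 3"
abbreviation L2 where "L2 \<equiv> lower_p_central S T p (Suc (Suc 0))"

text \<open>Factoring out this kernel makes the image of \<open>N\<close> central of exponent
  dividing \<open>p\<close>, so the commutator identities of \<open>p_central_3\<close> hold without
  error terms.\<close>

definition M where "M = {n \<in> N. \<psi> n = 0}"

lemma N_subgroup: "subgroup N S" by (rule lower_p_central_subgroup)

lemma N_carrier: "n \<in> N \<Longrightarrow> n \<in> carrier S" by (rule subgroup.mem_carrier[OF N_subgroup])

lemma L2_carrier: "n \<in> L2 \<Longrightarrow> n \<in> carrier S" by (rule subgroup.mem_carrier[OF lower_p_central_subgroup])

lemma N_conj: "\<lbrakk>g \<in> carrier S; n \<in> N\<rbrakk> \<Longrightarrow> g \<otimes> n \<otimes> inv g \<in> N"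
  using lower_p_central_normal[of p 3] by (simp add: normal_inv_iff)

lemma pow_L2: "g \<in> carrier S \<Longrightarrow> g [^] p \<in> L2"
  by (rule lower_p_central_generators(1)) simp

lemma comm_L2: "\<lbrakk>g \<in> carrier S; h \<in> carrier S\<rbrakk> \<Longrightarrow> grp_comm S g h \<in> L2"
  by (rule lower_p_central_generators(2)) simp_all

lemma pow_N: "h \<in> L2 \<Longrightarrow> h [^] p \<in> N"
  using lower_p_central_generators(1)[of h p "Suc 0"] by (simp only: numeral_3_eq_3)

lemma comm_N: "\<lbrakk>g \<in> carrier S; h \<in> L2\<rbrakk> \<Longrightarrow> grp_comm S g h \<in> N"
  using lower_p_central_generators(2)[of g h p "Suc 0"] by (simp only: numeral_3_eq_3)

lemma comm_N': "\<lbrakk>g \<in> carrier S; h \<in> L2\<rbrakk> \<Longrightarrow> grp_comm S h g \<in> N"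
  using lower_p_central_generators(3)[of g h p "Suc 0"] by (simp only: numeral_3_eq_3)

lemma \<psi>_one: "\<psi> \<one> = 0"
proof -
  have "\<one> \<in> N" by (rule subgroup.one_closed[OF N_subgroup])
  then have r: "\<psi> \<one> \<in> {0..<int p}" and "\<psi> \<one> = (\<psi> \<one> + \<psi> \<one>) mod int p"
    using \<psi>_range \<psi>_mult[of \<one> \<one>] by simp_all
  then have "(\<psi> \<one> + \<psi> \<one>) mod int p = (\<psi> \<one> + 0) mod int p" by simp
  then have "int p dvd \<psi> \<one>" by (simp only: mod_eq_dvd_iff) simp
  then show ?thesis using r zdvd_not_zless[of "\<psi> \<one>" "int p"] by (cases "0 < \<psi> \<one>") simp_all
qed

lemma \<psi>_inv:
  assumes n: "n \<in> N" shows "(\<psi> n + \<psi> (inv n)) mod int p = 0"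
  using \<psi>_mult[OF n subgroup.m_inv_closed[OF N_subgroup n]] N_carrier[OF n] \<psi>_one by simp

lemma M_subgroup: "subgroup M S"
proof (rule subgroupI)
  show "M \<subseteq> carrier S" using N_carrier by (auto simp: M_def)
  show "M \<noteq> {}" using \<psi>_one subgroup.one_closed[OF N_subgroup] by (auto simp: M_def)
  show "inv a \<in> M" if "a \<in> M" for a
    using that \<psi>_inv[of a] \<psi>_range[of "inv a"] subgroup.m_inv_closed[OF N_subgroup] by (simp add: M_def)
  show "a \<otimes> b \<in> M" if "a \<in> M" "b \<in> M" for a b
    using that \<psi>_mult[of a b] subgroup.m_closed[OF N_subgroup] by (simp add: M_def)
qed

lemma M_normal: "M \<lhd> S"
  unfolding normal_inv_iff using M_subgroup N_conj \<psi>_conj by (simp add: M_def)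

lemma M_carrier: "n \<in> M \<Longrightarrow> n \<in> carrier S" by (rule subgroup.mem_carrier[OF M_subgroup])

abbreviation Q where "Q \<equiv> S Mod M"
abbreviation \<pi> where "\<pi> g \<equiv> M #> g"

sublocale Q: group Q by (rule normal.factorgroup_is_group[OF M_normal])

sublocale \<pi>: group_hom S Q "\<lambda>g. M #> g"
  by (intro group_hom.intro is_group Q.is_group group_hom_axioms.intro normal.r_coset_hom_Mod[OF M_normal])

lemma Q_carrier: "C \<in> carrier Q \<Longrightarrow> \<exists>g\<in>carrier S. C = \<pi> g"
  by (auto simp: FactGroup_def RCOSETS_def)

lemma \<pi>_one: "g \<in> carrier S \<Longrightarrow> \<pi> g = \<one>\<^bsub>Q\<^esub> \<longleftrightarrow> g \<in> M"
  using coset_join1[of M g] coset_join2[of g M] M_subgroup M_carrier by (auto simp: FactGroup_def)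

lemma pow_M: "n \<in> N \<Longrightarrow> n [^] p \<in> M"
proof -
  assume n: "n \<in> N"
  have "n [^] k \<in> N \<and> \<psi> (n [^] k) = (int k * \<psi> n) mod int p" for k :: nat
  proof (induction k)
    case 0
    then show ?case using subgroup.one_closed[OF N_subgroup] by (simp add: \<psi>_one)
  next
    case (Suc k)
    then show ?case using n \<psi>_mult[of "n [^] k" n] subgroup.m_closed[OF N_subgroup]
      by (simp add: mod_simps algebra_simps)
  qed
  from this[of p] show ?thesis by (simp add: M_def)
qed

text \<open>Centrality is invariance: \<psi> takes the same value on \<open>n\<close> and on its
  conjugates, so n g n^-1 g^-1 lies in the kernel. The exponent is bounded by \<open>p\<close>
  because \<psi> has values modulo \<open>p\<close>.\<close>

sublocale P: p_central_3 Q p "\<pi> ` L2" "\<pi> ` N"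
proof (intro p_central_3.intro p_central_3_axioms.intro Q.is_group odd_p)
  show "subgroup (\<pi> ` L2) Q" by (rule \<pi>.subgroup_img_is_subgroup[OF lower_p_central_subgroup])
  show "\<pi> ` N \<subseteq> carrier Q" using N_carrier by auto
next
  fix z C assume "z \<in> \<pi> ` N" "C \<in> carrier Q"
  then obtain g where g: "g \<in> carrier S" "C = \<pi> g" using Q_carrier by metis
  obtain n where n: "n \<in> N" "z = \<pi> n" using \<open>z \<in> \<pi> ` N\<close> by (elim imageE)
  note nS = N_carrier[OF n(1)] and inN = subgroup.m_inv_closed[OF N_subgroup n(1)]
  have "\<psi> (n \<otimes> (g \<otimes> inv n \<otimes> inv g)) = 0"
    using \<psi>_mult[OF n(1) N_conj[OF g(1) inN]] \<psi>_conj[OF g(1) inN] \<psi>_inv[OF n(1)] by simp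
  then have "n \<otimes> (g \<otimes> inv n \<otimes> inv g) \<in> M"
    using subgroup.m_closed[OF N_subgroup n(1) N_conj[OF g(1) inN]] by (simp add: M_def)
  then have "\<pi> (n \<otimes> (g \<otimes> inv n \<otimes> inv g)) = \<one>\<^bsub>Q\<^esub>" using \<pi>_one[of "n \<otimes> (g \<otimes> inv n \<otimes> inv g)"] nS g(1) by simp
  moreover have "\<pi> (n \<otimes> g) = \<pi> (n \<otimes> (g \<otimes> inv n \<otimes> inv g)) \<otimes>\<^bsub>Q\<^esub> \<pi> (g \<otimes> n)"
  proof -
    have "n \<otimes> g = (n \<otimes> (g \<otimes> inv n \<otimes> inv g)) \<otimes> (g \<otimes> n)" using nS g(1) by (simp add: grp_norm)
    then show ?thesis using nS g(1) by (metis \<pi>.hom_mult inv_closed m_closed)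
  qed
  ultimately show "z \<otimes>\<^bsub>Q\<^esub> C = C \<otimes>\<^bsub>Q\<^esub> z" using n(2) g nS by simp
next
  fix z assume "z \<in> \<pi> ` N"
  then obtain n where n: "n \<in> N" "z = \<pi> n" by (elim imageE)
  have "\<pi> (n [^] p) = \<one>\<^bsub>Q\<^esub>" using \<pi>_one[of "n [^] p"] pow_M[OF n(1)] N_carrier[OF n(1)] by simp
  then show "z [^]\<^bsub>Q\<^esub> p = \<one>\<^bsub>Q\<^esub>" unfolding n(2) \<pi>.hom_nat_pow[OF N_carrier[OF n(1)]] .
next
  fix C assume "C \<in> carrier Q"
  then obtain g where g: "g \<in> carrier S" "C = \<pi> g" using Q_carrier by metis
  show "C [^]\<^bsub>Q\<^esub> p \<in> \<pi> ` L2"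
    unfolding g(2) \<pi>.hom_nat_pow[OF g(1), symmetric] by (rule imageI[OF pow_L2[OF g(1)]])
next
  fix C D assume CD: "C \<in> carrier Q" "D \<in> carrier Q"
  obtain g where g: "g \<in> carrier S" "C = \<pi> g" using Q_carrier[OF CD(1)] by metis
  obtain h where h: "h \<in> carrier S" "D = \<pi> h" using Q_carrier[OF CD(2)] by metis
  show "grp_comm Q C D \<in> \<pi> ` L2"
    unfolding g(2) h(2) \<pi>.hom_grp_comm[OF g(1) h(1), symmetric]
    by (rule imageI[OF comm_L2[OF g(1) h(1)]])
next
  fix C assume "C \<in> \<pi> ` L2"
  then obtain h where h: "h \<in> L2" "C = \<pi> h" by (elim imageE)
  show "C [^]\<^bsub>Q\<^esub> p \<in> \<pi> ` N"
    unfolding h(2) \<pi>.hom_nat_pow[OF L2_carrier[OF h(1)], symmetric] by (rule imageI[OF pow_N[OF h(1)]])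
next
  fix C D assume CD: "C \<in> carrier Q" "D \<in> \<pi> ` L2"
  obtain g where g: "g \<in> carrier S" "C = \<pi> g" using Q_carrier[OF CD(1)] by metis
  obtain h where h: "h \<in> L2" "D = \<pi> h" using CD(2) by (elim imageE)
  show "grp_comm Q C D \<in> \<pi> ` N"
    unfolding g(2) h(2) \<pi>.hom_grp_comm[OF g(1) L2_carrier[OF h(1)], symmetric]
    by (rule imageI[OF comm_N[OF g(1) h(1)]])
  show "grp_comm Q D C \<in> \<pi> ` N"
    unfolding g(2) h(2) \<pi>.hom_grp_comm[OF L2_carrier[OF h(1)] g(1), symmetric]
    by (rule imageI[OF comm_N'[OF g(1) h(1)]])
qed

text \<open>If \<phi> is multiplicative modulo \<open>M\<close>, the elements that it sends into
  \<open>M\<close> form a closed subgroup, so looking at the letters is enough. This is how one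
  entry of a commutator is freed from \<open>X\<close>.\<close>

lemma dense:
  assumes cont: "continuous_map T T \<phi>"
    and mult: "\<And>g h. \<lbrakk>g \<in> carrier S; h \<in> carrier S\<rbrakk> \<Longrightarrow> \<pi> (\<phi> (g \<otimes> h)) = \<pi> (\<phi> g) \<otimes>\<^bsub>Q\<^esub> \<pi> (\<phi> h)"
    and X: "\<And>x. x \<in> X \<Longrightarrow> \<phi> x \<in> M" and g: "g \<in> carrier S"
  shows "\<phi> g \<in> M"
proof -
  have \<phi>S: "\<phi> g \<in> carrier S" if "g \<in> carrier S" for g
    using continuous_map_image_subset_topspace[OF cont] that by auto
  have eq: "{g \<in> carrier S. \<pi> (\<phi> g) = \<one>\<^bsub>Q\<^esub>} = {g \<in> carrier S. \<phi> g \<in> M}" using \<phi>S \<pi>_one by blast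
  have "subgroup {g \<in> carrier S. \<phi> g \<in> M} S"
    unfolding eq[symmetric]
    by (rule subgroup_kernel[where \<phi> = "\<lambda>g. \<pi> (\<phi> g)", OF subgroup_self Q.is_group _ mult])
      (use \<phi>S in auto)
  moreover have "closedin T {g \<in> carrier S. \<phi> g \<in> M}"
    unfolding M_def by (rule closedin_preimage[OF cont \<psi>_closed])
  moreover have "X \<subseteq> {g \<in> carrier S. \<phi> g \<in> M}" using X X_carrier by auto
  ultimately have "closed_subgroup_generated S T X \<subseteq> {g \<in> carrier S. \<phi> g \<in> M}"
    by (rule closed_subgroup_generated_least)
  then show ?thesis using g X_generates by auto
qed

text \<open>The same argument on S^(2,p), whose topological generators are the p-th powers and
  commutators of arbitrary elements.\<close>

lemma dense_L2:
  assumes cont: "continuous_map T T \<phi>"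
    and mult: "\<And>g h. \<lbrakk>g \<in> L2; h \<in> L2\<rbrakk> \<Longrightarrow> \<pi> (\<phi> (g \<otimes> h)) = \<pi> (\<phi> g) \<otimes>\<^bsub>Q\<^esub> \<pi> (\<phi> h)"
    and pow: "\<And>g. g \<in> carrier S \<Longrightarrow> \<phi> (g [^] p) \<in> M"
    and comm: "\<And>g h. \<lbrakk>g \<in> carrier S; h \<in> carrier S\<rbrakk> \<Longrightarrow> \<phi> (grp_comm S g h) \<in> M" and g: "g \<in> L2"
  shows "\<phi> g \<in> M"
proof -
  have \<phi>S: "\<phi> g \<in> carrier S" if "g \<in> carrier S" for g
    using continuous_map_image_subset_topspace[OF cont] that by auto
  have eq: "{g \<in> L2. \<pi> (\<phi> g) = \<one>\<^bsub>Q\<^esub>} = {g \<in> L2. \<phi> g \<in> M}" using \<phi>S \<pi>_one L2_carrier by blast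
  have "subgroup {g \<in> L2. \<phi> g \<in> M} S"
    unfolding eq[symmetric]
    by (rule subgroup_kernel[where \<phi> = "\<lambda>g. \<pi> (\<phi> g)", OF lower_p_central_subgroup Q.is_group _ mult])
      (rule \<pi>.hom_closed[OF \<phi>S[OF L2_carrier]])
  moreover have "{g \<in> L2. \<phi> g \<in> M} = L2 \<inter> {g \<in> carrier S. \<phi> g \<in> M}" using L2_carrier by auto
  then have cl: "closedin T {g \<in> L2. \<phi> g \<in> M}"
    using closedin_Int[OF lower_p_central_closed closedin_preimage[OF cont \<psi>_closed]]
    by (simp only: M_def)
  ultimately have "L2 \<subseteq> {g \<in> L2. \<phi> g \<in> M}"
    by (intro lower_p_central_least[OF _ cl]) (simp_all add: pow comm pow_L2 comm_L2)
  then show ?thesis using g by auto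
qed

lemma grp_comm_M_swap: "\<lbrakk>g \<in> carrier S; h \<in> carrier S; grp_comm S g h \<in> M\<rbrakk> \<Longrightarrow> grp_comm S h g \<in> M"
  using subgroup.m_inv_closed[OF M_subgroup] inv_grp_comm by metis

lemma continuous_const: "g \<in> carrier S \<Longrightarrow> continuous_map T T (\<lambda>_. g)"
  by simp

lemmas cont_rules = continuous_map_grp_comm continuous_map_nat_pow continuous_map_id_T continuous_const

text \<open>Entries in \<open>X\<close> are freed one at a time. The identities are multiplicative
  in the first entry, so a swap brings the next entry there. Commutators come before p^2-th powers,
  which become multiplicative only after them, and these data finally cover the generators of
  \<open>N\<close>.\<close>

theorem vanish:
  assumes pp: "\<And>x. x \<in> X \<Longrightarrow> \<psi> (x [^] (p * p)) = 0"
    and cp: "\<And>x y. \<lbrakk>x \<in> X; y \<in> X\<rbrakk> \<Longrightarrow> \<psi> (grp_comm S x y [^] p) = 0"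
    and cc: "\<And>x y z. \<lbrakk>x \<in> X; y \<in> X; z \<in> X\<rbrakk> \<Longrightarrow> \<psi> (grp_comm S (grp_comm S x y) z) = 0"
    and n: "n \<in> N"
  shows "\<psi> n = 0"
proof -
  note XS = subsetD[OF X_carrier]
  note hom = \<pi>.hom_grp_comm \<pi>.hom_nat_pow
  have a1: "grp_comm S (grp_comm S g y) z \<in> M" if g: "g \<in> carrier S" and yz: "y \<in> X" "z \<in> X" for g y z
  proof (rule dense[OF _ _ _ g, where \<phi> = "\<lambda>g. grp_comm S (grp_comm S g y) z"])
    show "continuous_map T T (\<lambda>g. grp_comm S (grp_comm S g y) z)" by (intro cont_rules XS yz)
    show "\<pi> (grp_comm S (grp_comm S (g \<otimes> h) y) z) =
        \<pi> (grp_comm S (grp_comm S g y) z) \<otimes>\<^bsub>Q\<^esub> \<pi> (grp_comm S (grp_comm S h y) z)"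
      if "g \<in> carrier S" "h \<in> carrier S" for g h
      using P.triple_comm_mult_left[of "\<pi> g" "\<pi> h" "\<pi> y" "\<pi> z"] that XS yz by (simp add: hom)
    show "grp_comm S (grp_comm S x y) z \<in> M" if "x \<in> X" for x
      using cc[OF that yz] lower_p_central_3_elements(3)[OF XS[OF that] XS[OF yz(1)] XS[OF yz(2)]]
      by (simp add: M_def)
  qed
  have swap: "grp_comm S (grp_comm S h g) z \<in> M"
    if "g \<in> carrier S" "h \<in> carrier S" "z \<in> carrier S" "grp_comm S (grp_comm S g h) z \<in> M" for g h z
    using P.triple_comm_swap[of "\<pi> g" "\<pi> h" "\<pi> z"] that
      \<pi>_one[of "grp_comm S (grp_comm S h g) z"] \<pi>_one[of "grp_comm S (grp_comm S g h) z"]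
    by (simp add: hom)
  have a2: "grp_comm S (grp_comm S h g) z \<in> M" if h: "h \<in> carrier S" and g: "g \<in> carrier S" and z: "z \<in> X" for g h z
  proof (rule dense[OF _ _ _ h, where \<phi> = "\<lambda>h. grp_comm S (grp_comm S h g) z"])
    show "continuous_map T T (\<lambda>h. grp_comm S (grp_comm S h g) z)" by (intro cont_rules XS g z)
    show "\<pi> (grp_comm S (grp_comm S (h \<otimes> k) g) z) =
        \<pi> (grp_comm S (grp_comm S h g) z) \<otimes>\<^bsub>Q\<^esub> \<pi> (grp_comm S (grp_comm S k g) z)"
      if "h \<in> carrier S" "k \<in> carrier S" for h k
      using P.triple_comm_mult_left[of "\<pi> h" "\<pi> k" "\<pi> g" "\<pi> z"] that XS g z by (simp add: hom)
    show "grp_comm S (grp_comm S x g) z \<in> M" if "x \<in> X" for x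
      by (rule swap[OF g XS[OF that] XS[OF z] a1[OF g that z]])
  qed
  \<comment> \<open>The inner commutator lies in S^(2,p), and against such an element commutation is
    multiplicative in the argument \<open>z\<close>.\<close>
  have a3: "grp_comm S z (grp_comm S h g) \<in> M"
    if z: "z \<in> carrier S" and h: "h \<in> carrier S" and g: "g \<in> carrier S" for g h z
  proof (rule dense[OF _ _ _ z, where \<phi> = "\<lambda>z. grp_comm S z (grp_comm S h g)"])
    show "continuous_map T T (\<lambda>z. grp_comm S z (grp_comm S h g))" by (intro cont_rules grp_comm_closed g h)
    have m: "grp_comm Q (\<pi> h) (\<pi> g) \<in> \<pi> ` L2"
      using imageI[OF comm_L2[OF h g], of "\<lambda>g. M #> g"] unfolding hom(1)[OF h g] .
    show "\<pi> (grp_comm S (z \<otimes> k) (grp_comm S h g)) =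
        \<pi> (grp_comm S z (grp_comm S h g)) \<otimes>\<^bsub>Q\<^esub> \<pi> (grp_comm S k (grp_comm S h g))"
      if "z \<in> carrier S" "k \<in> carrier S" for z k
      using P.comm_mult_left_H[OF _ _ m, of "\<pi> z" "\<pi> k"] that g h
      by (simp add: hom)
    show "grp_comm S x (grp_comm S h g) \<in> M" if "x \<in> X" for x
      by (rule grp_comm_M_swap[OF grp_comm_closed[OF h g] XS[OF that] a2[OF h g that]])
  qed
  have b1: "grp_comm S g y [^] p \<in> M" if g: "g \<in> carrier S" and y: "y \<in> X" for g y
  proof (rule dense[OF _ _ _ g, where \<phi> = "\<lambda>g. grp_comm S g y [^] p"])
    show "continuous_map T T (\<lambda>g. grp_comm S g y [^] p)" by (intro cont_rules XS y)
    show "\<pi> (grp_comm S (g \<otimes> h) y [^] p) = \<pi> (grp_comm S g y [^] p) \<otimes>\<^bsub>Q\<^esub> \<pi> (grp_comm S h y [^] p)"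
      if "g \<in> carrier S" "h \<in> carrier S" for g h
      using P.comm_pow_mult_left[of "\<pi> g" "\<pi> h" "\<pi> y"] that XS y by (simp add: hom)
    show "grp_comm S x y [^] p \<in> M" if "x \<in> X" for x
      using cp[OF that y] lower_p_central_3_elements(2)[OF XS[OF that] XS[OF y]] by (simp add: M_def)
  qed
  have b2: "grp_comm S h g [^] p \<in> M" if h: "h \<in> carrier S" and g: "g \<in> carrier S" for g h
  proof (rule dense[OF _ _ _ h, where \<phi> = "\<lambda>h. grp_comm S h g [^] p"])
    show "continuous_map T T (\<lambda>h. grp_comm S h g [^] p)" by (intro cont_rules g)
    show "\<pi> (grp_comm S (h \<otimes> k) g [^] p) = \<pi> (grp_comm S h g [^] p) \<otimes>\<^bsub>Q\<^esub> \<pi> (grp_comm S k g [^] p)"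
      if "h \<in> carrier S" "k \<in> carrier S" for h k
      using P.comm_pow_mult_left[of "\<pi> h" "\<pi> k" "\<pi> g"] that g by (simp add: hom)
    show "grp_comm S x g [^] p \<in> M" if "x \<in> X" for x
      using subgroup.m_inv_closed[OF M_subgroup b1[OF g that]] g XS[OF that]
      by (simp add: nat_pow_inv[symmetric] inv_grp_comm)
  qed
  \<comment> \<open>Only now does \<open>pow_pow_mult\<close> apply, since \<open>b2\<close> makes
    the p-th powers of all commutators trivial in \<open>Q\<close>.\<close>
  have c: "g [^] (p * p) \<in> M" if g: "g \<in> carrier S" for g
  proof (rule dense[OF _ _ _ g, where \<phi> = "\<lambda>g. g [^] (p * p)"])
    show "continuous_map T T (\<lambda>g. g [^] (p * p))" by (intro cont_rules)
    show "\<pi> ((g \<otimes> h) [^] (p * p)) = \<pi> (g [^] (p * p)) \<otimes>\<^bsub>Q\<^esub> \<pi> (h [^] (p * p))"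
      if "g \<in> carrier S" "h \<in> carrier S" for g h
    proof -
      have "grp_comm Q C D [^]\<^bsub>Q\<^esub> p = \<one>\<^bsub>Q\<^esub>" if "C \<in> carrier Q" "D \<in> carrier Q" for C D
      proof -
        obtain g h where gh: "g \<in> carrier S" "C = \<pi> g" "h \<in> carrier S" "D = \<pi> h"
          using Q_carrier \<open>C \<in> carrier Q\<close> \<open>D \<in> carrier Q\<close> by metis
        have "\<pi> (grp_comm S g h [^] p) = \<one>\<^bsub>Q\<^esub>"
          using \<pi>_one[of "grp_comm S g h [^] p"] b2[OF gh(1,3)] gh by simp
        then show ?thesis using gh by (simp add: hom)
      qed
      from P.pow_pow_mult[OF this, of "\<pi> g" "\<pi> h"] show ?thesis using that by (simp add: hom)
    qed
    show "x [^] (p * p) \<in> M" if "x \<in> X" for x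
      using pp[OF that] lower_p_central_3_elements(1)[OF XS[OF that]] by (simp add: M_def)
  qed
  have d: "h [^] p \<in> M" if h: "h \<in> L2" for h
  proof (rule dense_L2[OF _ _ _ _ h, where \<phi> = "\<lambda>h. h [^] p"])
    show "continuous_map T T (\<lambda>h. h [^] p)" by (intro cont_rules)
    show "\<pi> ((g \<otimes> h) [^] p) = \<pi> (g [^] p) \<otimes>\<^bsub>Q\<^esub> \<pi> (h [^] p)" if "g \<in> L2" "h \<in> L2" for g h
      using P.pow_mult_H[of "\<pi> g" "\<pi> h"] that L2_carrier by (simp add: hom)
    show "(g [^] p) [^] p \<in> M" if "g \<in> carrier S" for g using c[OF that] that by (simp add: nat_pow_pow)
  qed (rule b2)
  have e: "grp_comm S h g \<in> M" if h: "h \<in> L2" and g: "g \<in> carrier S" for g h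
  proof (rule dense_L2[OF _ _ _ _ h, where \<phi> = "\<lambda>h. grp_comm S h g"])
    show "continuous_map T T (\<lambda>h. grp_comm S h g)" by (intro cont_rules g)
    show "\<pi> (grp_comm S (h \<otimes> k) g) = \<pi> (grp_comm S h g) \<otimes>\<^bsub>Q\<^esub> \<pi> (grp_comm S k g)" if "h \<in> L2" "k \<in> L2" for h k
      using P.comm_mult_H[of "\<pi> h" "\<pi> k" "\<pi> g"] that g L2_carrier by (simp add: hom)
    show "grp_comm S (k [^] p) g \<in> M" if "k \<in> carrier S" for k
      using P.comm_pow[of "\<pi> k" "\<pi> g"] b2[OF that g] that g
        \<pi>_one[of "grp_comm S (k [^] p) g"] \<pi>_one[of "grp_comm S k g [^] p"] by (simp add: hom)
    show "grp_comm S (grp_comm S k l) g \<in> M" if "k \<in> carrier S" "l \<in> carrier S" for k l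
      by (rule grp_comm_M_swap[OF g _ a3[OF g that]]) (use that in simp)
  qed
  have "lower_p_central S T p (Suc (Suc (Suc 0))) \<subseteq> M"
  proof (rule lower_p_central_least[OF M_subgroup])
    show "closedin T M" using \<psi>_closed by (simp add: M_def)
    show "h [^] p \<in> M" if "h \<in> L2" for h by (rule d[OF that])
    show "grp_comm S g h \<in> M" if "g \<in> carrier S" "h \<in> L2" for g h
      by (rule grp_comm_M_swap[OF L2_carrier[OF that(2)] that(1) e[OF that(2,1)]])
  qed
  then show ?thesis using n by (auto simp: M_def numeral_3_eq_3 simp del: lower_p_central.simps)
qed

lemma \<psi>_mult3:
  assumes "n \<in> N" "n' \<in> N" "n'' \<in> N" "\<pi> (n \<otimes> n' \<otimes> n'') = \<one>\<^bsub>Q\<^esub>"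
  shows "[\<psi> n + \<psi> n' + \<psi> n'' = 0] (mod int p)"
proof -
  have "n \<otimes> n' \<otimes> n'' \<in> M" using assms \<pi>_one[of "n \<otimes> n' \<otimes> n''"] N_carrier by simp
  then have "((\<psi> n + \<psi> n') mod int p + \<psi> n'') mod int p = 0"
    using assms \<psi>_mult[of "n \<otimes> n'" n''] \<psi>_mult[of n n'] subgroup.m_closed[OF N_subgroup] by (simp add: M_def)
  then show ?thesis by (simp add: cong_def mod_simps)
qed

lemma \<psi>_comm_swap:
  assumes "x \<in> carrier S" "y \<in> carrier S"
  shows "[\<psi> (grp_comm S x y [^] p) + \<psi> (grp_comm S y x [^] p) = 0] (mod int p)"
proof -
  have i: "grp_comm S y x [^] p = inv (grp_comm S x y [^] p)"
    using assms by (simp add: nat_pow_inv[symmetric] inv_grp_comm)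
  show ?thesis
    unfolding i using \<psi>_inv[OF lower_p_central_3_elements(2)[OF assms]] by (simp add: cong_def)
qed

lemma \<psi>_triple_swap:
  assumes "x \<in> carrier S" "y \<in> carrier S" "z \<in> carrier S"
  shows "[\<psi> (grp_comm S (grp_comm S x y) z) + \<psi> (grp_comm S (grp_comm S y x) z) = 0] (mod int p)"
proof -
  have "\<pi> (grp_comm S (grp_comm S x y) z \<otimes> grp_comm S (grp_comm S y x) z \<otimes> \<one>) = \<one>\<^bsub>Q\<^esub>"
    using P.triple_comm_swap[of "\<pi> x" "\<pi> y" "\<pi> z"] assms by (simp add: \<pi>.hom_grp_comm)
  from \<psi>_mult3[OF lower_p_central_3_elements(3) lower_p_central_3_elements(3) subgroup.one_closed[OF N_subgroup] this] assms
  show ?thesis by (simp add: \<psi>_one)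
qed

lemma \<psi>_jacobi:
  assumes "x \<in> carrier S" "y \<in> carrier S" "z \<in> carrier S"
  shows "[\<psi> (grp_comm S (grp_comm S x y) z) + \<psi> (grp_comm S (grp_comm S y z) x) +
    \<psi> (grp_comm S (grp_comm S z x) y) = 0] (mod int p)"
proof -
  have "\<pi> (grp_comm S (grp_comm S x y) z \<otimes> grp_comm S (grp_comm S y z) x \<otimes> grp_comm S (grp_comm S z x) y) = \<one>\<^bsub>Q\<^esub>"
    using P.jacobi[of "\<pi> x" "\<pi> y" "\<pi> z"] assms by (simp add: \<pi>.hom_grp_comm)
  from \<psi>_mult3[OF _ _ _ this] show ?thesis using lower_p_central_3_elements(3) assms by simp
qed

end

section \<open>Quotients of topological groups\<close>

lemma openin_coset_topology:
  "openin (coset_topology G T N) V \<longleftrightarrow>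
     V \<subseteq> (\<lambda>g. N #>\<^bsub>G\<^esub> g) ` topspace T \<and> openin T {x \<in> topspace T. N #>\<^bsub>G\<^esub> x \<in> V}"
  by (simp add: coset_topology_def openin_quotient_topology)

lemma topspace_coset_topology: "topspace (coset_topology G T N) = (\<lambda>g. N #>\<^bsub>G\<^esub> g) ` topspace T"
proof (rule subset_antisym)
  show "topspace (coset_topology G T N) \<subseteq> (\<lambda>g. N #>\<^bsub>G\<^esub> g) ` topspace T"
    using openin_topspace[of "coset_topology G T N"] unfolding openin_coset_topology by simp
  have "{x \<in> topspace T. N #>\<^bsub>G\<^esub> x \<in> (\<lambda>g. N #>\<^bsub>G\<^esub> g) ` topspace T} = topspace T" by auto
  then have "openin (coset_topology G T N) ((\<lambda>g. N #>\<^bsub>G\<^esub> g) ` topspace T)"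
    unfolding openin_coset_topology by simp
  then show "(\<lambda>g. N #>\<^bsub>G\<^esub> g) ` topspace T \<subseteq> topspace (coset_topology G T N)"
    by (rule openin_subset)
qed

lemma quotient_map_coset: "quotient_map T (coset_topology G T N) (\<lambda>g. N #>\<^bsub>G\<^esub> g)"
  unfolding quotient_map_def topspace_coset_topology openin_coset_topology by auto

lemma open_map_prod:
  assumes f: "open_map X X' f" and g: "open_map Y Y' g"
  shows "open_map (prod_topology X Y) (prod_topology X' Y') (\<lambda>(x, y). (f x, g y))"
  unfolding open_map_def
proof (intro allI impI)
  fix W assume W: "openin (prod_topology X Y) W"
  show "openin (prod_topology X' Y') ((\<lambda>(x, y). (f x, g y)) ` W)"
    unfolding openin_prod_topology_alt
  proof (intro allI impI)
    fix a b assume "(a, b) \<in> (\<lambda>(x, y). (f x, g y)) ` W"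
    then obtain x y where xy: "(x, y) \<in> W" "a = f x" "b = g y" by auto
    then obtain U V where UV: "openin X U" "openin Y V" "x \<in> U" "y \<in> V" "U \<times> V \<subseteq> W"
      using W unfolding openin_prod_topology_alt by meson
    have "f ` U \<times> g ` V \<subseteq> (\<lambda>(x, y). (f x, g y)) ` W" using UV(5) by force
    then show "\<exists>U V. openin X' U \<and> openin Y' V \<and> a \<in> U \<and> b \<in> V \<and> U \<times> V \<subseteq> (\<lambda>(x, y). (f x, g y)) ` W"
      using f g UV xy unfolding open_map_def by (intro exI[of _ "f ` U"] exI[of _ "g ` V"]) simp
  qed
qed

context top_group
begin

text \<open>The saturation of an open set is the union of its translates by elements of
  \<open>N\<close>, hence open.\<close>

lemma open_map_coset:
  assumes N: "N \<lhd> G" shows "open_map T (coset_topology G T N) (\<lambda>g. N #> g)"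
  unfolding open_map_def openin_coset_topology
proof (intro allI impI conjI)
  note sub = normal_imp_subgroup[OF N]
  fix O' assume O: "openin T O'"
  have OG: "O' \<subseteq> carrier G" using openin_subset[OF O] by simp
  then show "(\<lambda>g. N #> g) ` O' \<subseteq> (\<lambda>g. N #> g) ` topspace T" by auto
  have "{x \<in> topspace T. N #> x \<in> (\<lambda>g. N #> g) ` O'} = (\<Union>n\<in>N. {x \<in> topspace T. n \<otimes> x \<in> O'})"
  proof (intro equalityI subsetI)
    fix x assume "x \<in> {x \<in> topspace T. N #> x \<in> (\<lambda>g. N #> g) ` O'}"
    then obtain g where x: "x \<in> carrier G" and g: "g \<in> O'" "N #> x = N #> g" by auto
    have "g \<in> N #> x" using repr_independenceD[OF sub _ g(2)] g(1) OG by auto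
    then show "x \<in> (\<Union>n\<in>N. {x \<in> topspace T. n \<otimes> x \<in> O'})" using x g(1) by (auto simp: r_coset_def)
  next
    fix x assume "x \<in> (\<Union>n\<in>N. {x \<in> topspace T. n \<otimes> x \<in> O'})"
    then obtain n where n: "n \<in> N" "x \<in> carrier G" "n \<otimes> x \<in> O'" by auto
    have "n \<otimes> x \<in> N #> x" using n by (auto simp: r_coset_def)
    then have "N #> x = N #> (n \<otimes> x)" using repr_independence[OF _ n(2) sub] by simp
    then show "x \<in> {x \<in> topspace T. N #> x \<in> (\<lambda>g. N #> g) ` O'}" using n by auto
  qed
  moreover have "openin T (\<Union>n\<in>N. {x \<in> topspace T. n \<otimes> x \<in> O'})"
  proof (rule openin_Union, clarify)
    fix n assume n: "n \<in> N"
    have "continuous_map T T (\<lambda>x. n \<otimes> x)"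
      using subgroup.mem_carrier[OF sub n] by (intro continuous_map_mult continuous_map_id_T) simp
    then show "openin T {x \<in> topspace T. n \<otimes> x \<in> O'}" by (rule openin_continuous_map_preimage[OF _ O])
  qed
  ultimately show "openin T {x \<in> topspace T. N #> x \<in> (\<lambda>g. N #> g) ` O'}" by simp
qed

text \<open>A product of quotient maps need not be a quotient map. Projections to cosets are open,
  however, and openness passes to products.\<close>

lemma quotient_map_prod_coset:
  assumes N: "N \<lhd> G"
  shows "quotient_map (prod_topology T T) (prod_topology (coset_topology G T N) (coset_topology G T N))
    (\<lambda>(g, h). (N #> g, N #> h))"
proof (rule continuous_open_imp_quotient_map)
  have c: "continuous_map T (coset_topology G T N) (\<lambda>g. N #> g)"
    by (rule quotient_imp_continuous_map[OF quotient_map_coset])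
  show "continuous_map (prod_topology T T) (prod_topology (coset_topology G T N) (coset_topology G T N))
      (\<lambda>(g, h). (N #> g, N #> h))"
    using continuous_map_pairedI[OF continuous_map_compose[OF continuous_map_fst[of T T] c]
        continuous_map_compose[OF continuous_map_snd[of T T] c]] by (simp add: o_def split_def)
  show "open_map (prod_topology T T) (prod_topology (coset_topology G T N) (coset_topology G T N))
      (\<lambda>(g, h). (N #> g, N #> h))"
    by (rule open_map_prod[OF open_map_coset[OF N] open_map_coset[OF N]])
  show "(\<lambda>(g, h). (N #> g, N #> h)) ` topspace (prod_topology T T) =
      topspace (prod_topology (coset_topology G T N) (coset_topology G T N))"
    by (force simp: topspace_coset_topology)
qed

lemma top_group_quotient:
  assumes N: "N \<lhd> G" shows "top_group (G Mod N) (coset_topology G T N)"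
proof -
  interpret N: normal N G by (rule N)
  let ?Q = "coset_topology G T N"
  interpret Q: group "G Mod N" by (rule N.factorgroup_is_group)
  interpret \<pi>: group_hom G "G Mod N" "\<lambda>g. N #> g"
    by (intro group_hom.intro is_group Q.is_group group_hom_axioms.intro N.r_coset_hom_Mod)
  have c: "continuous_map T ?Q (\<lambda>g. N #> g)"
    by (rule quotient_imp_continuous_map[OF quotient_map_coset])
  have ts: "topspace ?Q = carrier (G Mod N)"
    by (simp add: topspace_coset_topology carrier_FactGroup)
  show ?thesis
  proof (intro top_group.intro Q.is_group top_group_axioms.intro)
    show "topological_group (G Mod N) ?Q"
      unfolding topological_group_def
    proof (intro conjI Q.is_group ts)
      have "continuous_map (prod_topology T T) ?Q (\<lambda>z. N #> (fst z \<otimes> snd z))"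
        using continuous_map_compose[OF continuous_map_mult[OF continuous_map_fst continuous_map_snd] c]
        by (simp add: o_def)
      then have "continuous_map (prod_topology T T) ?Q
          ((\<lambda>(C, D). C \<otimes>\<^bsub>G Mod N\<^esub> D) \<circ> (\<lambda>(g, h). (N #> g, N #> h)))"
        by (rule continuous_map_eq) (auto simp: \<pi>.hom_mult)
      then show "continuous_map (prod_topology ?Q ?Q) ?Q (\<lambda>(C, D). C \<otimes>\<^bsub>G Mod N\<^esub> D)"
        by (rule continuous_compose_quotient_map[OF quotient_map_prod_coset[OF N]])
      have "continuous_map T ?Q (\<lambda>g. N #> inv g)"
        using continuous_map_compose[OF continuous_map_m_inv[OF continuous_map_id_T] c] by (simp add: o_def)
      then have "continuous_map T ?Q ((\<lambda>C. inv\<^bsub>G Mod N\<^esub> C) \<circ> (\<lambda>g. N #> g))"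
        by (rule continuous_map_eq) (auto simp: \<pi>.hom_inv)
      then show "continuous_map ?Q ?Q (\<lambda>C. inv\<^bsub>G Mod N\<^esub> C)"
        by (rule continuous_compose_quotient_map[OF quotient_map_coset])
    qed
  qed
qed

end

section \<open>The second cohomology group with coefficients modulo p\<close>

lemma continuous_map_discrete_op:
  assumes f: "continuous_map Z (discrete_topology D) f" and g: "continuous_map Z (discrete_topology E) g"
    and h: "\<And>d e. \<lbrakk>d \<in> D; e \<in> E\<rbrakk> \<Longrightarrow> h d e \<in> K"
  shows "continuous_map Z (discrete_topology K) (\<lambda>z. h (f z) (g z))"
proof -
  have fg: "continuous_map Z (discrete_topology (D \<times> E)) (\<lambda>z. (f z, g z))"
    using continuous_map_pairedI[OF f g] by (simp add: prod_topology_discrete_topology)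
  have "continuous_map (discrete_topology (D \<times> E)) (discrete_topology K) (\<lambda>(d, e). h d e)"
    using h by auto
  from continuous_map_compose[OF fg this] show ?thesis by (simp add: o_def)
qed

lemma neg_sum_mod:
  fixes x y z q :: int
  shows "(((- x) mod q + (- y) mod q - (- z) mod q) mod q + (x + y - z) mod q) mod q = 0"
proof -
  have "[((- x) mod q + (- y) mod q - (- z) mod q) mod q + (x + y - z) mod q =
      (- x + - y - - z) + (x + y - z)] (mod q)"
    by (intro cong_add cong_diff iffD2[OF cong_mod_left] cong_refl)
  then show ?thesis by (simp add: cong_def)
qed

locale coho2 = top_group G T for G (structure) and T +
  fixes p :: nat
  assumes p_pos: "p > 1"
begin

abbreviation A where "A \<equiv> integer_mod_group p"
abbreviation D where "D \<equiv> discrete_topology {0..<int p}"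
abbreviation C2 where "C2 \<equiv> cocycle_group_2 G T A"
abbreviation B2 where "B2 \<equiv> coboundaries_2 G T A"

lemma A_carrier: "carrier A = {0..<int p}"
  using p_pos by (simp add: carrier_integer_mod_group)

lemma cochains_1: "b \<in> continuous_cochains_1 G T A \<longleftrightarrow> b \<in> extensional (carrier G) \<and> continuous_map T D b"
  by (simp add: continuous_cochains_1_def A_carrier)

lemma cochain_range:
  "\<lbrakk>continuous_map (prod_topology T T) D f; g \<in> carrier G; h \<in> carrier G\<rbrakk> \<Longrightarrow> f (g, h) \<in> {0..<int p}"
  using subsetD[OF continuous_map_image_subset_topspace[of "prod_topology T T" D f] imageI, of "(g, h)"]
  by simp

lemma cochain_1_range: "\<lbrakk>continuous_map T D b; g \<in> carrier G\<rbrakk> \<Longrightarrow> b g \<in> {0..<int p}"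
  using subsetD[OF continuous_map_image_subset_topspace[of T D b] imageI, of g] by simp

text \<open>Coefficients are residues 0, ..., p - 1, so the equation in the coefficient group is
  traded for a congruence of integers, with which all later computations are done.\<close>

lemma cocycles: "f \<in> cocycles_2 G T A \<longleftrightarrow> f \<in> extensional (carrier G \<times> carrier G) \<and>
   continuous_map (prod_topology T T) D f \<and>
   (\<forall>g\<in>carrier G. \<forall>h\<in>carrier G. \<forall>k\<in>carrier G.
      [f (h, k) + f (g, h \<otimes> k) = f (g \<otimes> h, k) + f (g, h)] (mod int p))"
proof -
  have "f (h, k) \<otimes>\<^bsub>A\<^esub> inv\<^bsub>A\<^esub> f (g \<otimes> h, k) \<otimes>\<^bsub>A\<^esub> f (g, h \<otimes> k) \<otimes>\<^bsub>A\<^esub> inv\<^bsub>A\<^esub> f (g, h) = \<one>\<^bsub>A\<^esub> \<longleftrightarrow>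
      [f (h, k) + f (g, h \<otimes> k) = f (g \<otimes> h, k) + f (g, h)] (mod int p)"
    if c: "continuous_map (prod_topology T T) D f" and "g \<in> carrier G" "h \<in> carrier G" "k \<in> carrier G" for g h k
  proof -
    have 1: "f (g \<otimes> h, k) \<in> carrier A" "f (g, h) \<in> carrier A"
      unfolding A_carrier using cochain_range[OF c] that by simp_all
    have "f (h, k) \<otimes>\<^bsub>A\<^esub> inv\<^bsub>A\<^esub> f (g \<otimes> h, k) \<otimes>\<^bsub>A\<^esub> f (g, h \<otimes> k) \<otimes>\<^bsub>A\<^esub> inv\<^bsub>A\<^esub> f (g, h) =
        (f (h, k) + f (g, h \<otimes> k) - (f (g \<otimes> h, k) + f (g, h))) mod int p"
      unfolding inv_integer_mod_group[OF 1(1)] inv_integer_mod_group[OF 1(2)]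
      by (simp add: mod_simps; simp add: algebra_simps)
    then show ?thesis unfolding cong_iff_dvd_diff dvd_eq_mod_eq_0 by (simp only: one_integer_mod_group)
  qed
  then have *: "(\<forall>g\<in>carrier G. \<forall>h\<in>carrier G. \<forall>k\<in>carrier G.
      f (h, k) \<otimes>\<^bsub>A\<^esub> inv\<^bsub>A\<^esub> f (g \<otimes> h, k) \<otimes>\<^bsub>A\<^esub> f (g, h \<otimes> k) \<otimes>\<^bsub>A\<^esub> inv\<^bsub>A\<^esub> f (g, h) = \<one>\<^bsub>A\<^esub>) \<longleftrightarrow>
      (\<forall>g\<in>carrier G. \<forall>h\<in>carrier G. \<forall>k\<in>carrier G.
      [f (h, k) + f (g, h \<otimes> k) = f (g \<otimes> h, k) + f (g, h)] (mod int p))"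
    if "continuous_map (prod_topology T T) D f"
    using that by (intro ball_cong refl)
  show ?thesis
    unfolding cocycles_2_def continuous_cochains_2_def A_carrier mem_Collect_eq using * by argo
qed

lemma cocycleD:
  assumes "f \<in> cocycles_2 G T A"
  shows cocycle_extensional: "f \<in> extensional (carrier G \<times> carrier G)"
    and cocycle_continuous: "continuous_map (prod_topology T T) D f"
    and cocycle_cong: "\<And>g h k. \<lbrakk>g \<in> carrier G; h \<in> carrier G; k \<in> carrier G\<rbrakk> \<Longrightarrow>
           [f (h, k) + f (g, h \<otimes> k) = f (g \<otimes> h, k) + f (g, h)] (mod int p)"
  using assms unfolding cocycles by simp_all

lemma coboundary: "b \<in> continuous_cochains_1 G T A \<Longrightarrow>
   coboundary_2 G A b = (\<lambda>(g, h)\<in>carrier G \<times> carrier G. (b g + b h - b (g \<otimes> h)) mod int p)"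
  unfolding coboundary_2_def
proof (rule restrict_ext, clarify)
  fix g h assume b: "b \<in> continuous_cochains_1 G T A" and gh: "g \<in> carrier G" "h \<in> carrier G"
  have "b (g \<otimes> h) \<in> carrier A"
    unfolding A_carrier using b gh cochain_1_range[of b "g \<otimes> h"] by (simp add: cochains_1)
  from inv_integer_mod_group[OF this]
  show "b h \<otimes>\<^bsub>A\<^esub> inv\<^bsub>A\<^esub> b (g \<otimes> h) \<otimes>\<^bsub>A\<^esub> b g = (b g + b h - b (g \<otimes> h)) mod int p"
    by (simp add: mod_simps; simp add: algebra_simps)
qed

lemma C2_mult: "f \<otimes>\<^bsub>C2\<^esub> f' = (\<lambda>z\<in>carrier G \<times> carrier G. (f z + f' z) mod int p)"
  by (simp add: cocycle_group_2_def)

lemma C2_carrier: "carrier C2 = cocycles_2 G T A"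
  by (simp add: cocycle_group_2_def)

lemma cocycle_mult:
  assumes "f \<in> cocycles_2 G T A" "f' \<in> cocycles_2 G T A"
  shows "f \<otimes>\<^bsub>C2\<^esub> f' \<in> cocycles_2 G T A"
  unfolding cocycles C2_mult
proof (intro conjI ballI)
  have "continuous_map (prod_topology T T) D (\<lambda>z. (f z + f' z) mod int p)"
    by (rule continuous_map_discrete_op[OF cocycle_continuous[OF assms(1)] cocycle_continuous[OF assms(2)]])
      (use p_pos in simp)
  then show "continuous_map (prod_topology T T) D (\<lambda>z\<in>carrier G \<times> carrier G. (f z + f' z) mod int p)"
    by (rule continuous_map_eq) simp
next
  fix g h k assume ghk: "g \<in> carrier G" "h \<in> carrier G" "k \<in> carrier G"
  have "[(f (h, k) + f (g, h \<otimes> k)) + (f' (h, k) + f' (g, h \<otimes> k)) =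
         (f (g \<otimes> h, k) + f (g, h)) + (f' (g \<otimes> h, k) + f' (g, h))] (mod int p)"
    by (rule cong_add[OF cocycle_cong[OF assms(1) ghk] cocycle_cong[OF assms(2) ghk]])
  then show "[(\<lambda>z\<in>carrier G \<times> carrier G. (f z + f' z) mod int p) (h, k) +
      (\<lambda>z\<in>carrier G \<times> carrier G. (f z + f' z) mod int p) (g, h \<otimes> k) =
      (\<lambda>z\<in>carrier G \<times> carrier G. (f z + f' z) mod int p) (g \<otimes> h, k) +
      (\<lambda>z\<in>carrier G \<times> carrier G. (f z + f' z) mod int p) (g, h)] (mod int p)"
    using ghk by (simp add: cong_def mod_simps; simp add: algebra_simps)
qed simp

lemma cocycles_product: "cocycles_2 G T A \<subseteq> carrier (product_group (carrier G \<times> carrier G) (\<lambda>_. A))"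
proof
  fix f assume f: "f \<in> cocycles_2 G T A"
  show "f \<in> carrier (product_group (carrier G \<times> carrier G) (\<lambda>_. A))"
    unfolding carrier_product_group A_carrier
  proof (rule PiE_I)
    fix z assume "z \<in> carrier G \<times> carrier G"
    then show "f z \<in> {0..<int p}"
      using cochain_range[OF cocycle_continuous[OF f], of "fst z" "snd z"] by (cases z) simp
  qed (rule extensional_arb[OF cocycle_extensional[OF f]])
qed

lemma C2_subgroup: "subgroup (cocycles_2 G T A) (product_group (carrier G \<times> carrier G) (\<lambda>_. A))"
proof (rule group.subgroupI[OF _ cocycles_product])
  show "group (product_group (carrier G \<times> carrier G) (\<lambda>_. A))" by simp
  have "(\<lambda>z\<in>carrier G \<times> carrier G. 0) \<in> cocycles_2 G T A"
    unfolding cocycles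
  proof (intro conjI ballI)
    have "continuous_map (prod_topology T T) D (\<lambda>z. 0)" using p_pos by simp
    then show "continuous_map (prod_topology T T) D (\<lambda>z\<in>carrier G \<times> carrier G. 0)"
      by (rule continuous_map_eq) simp
  qed simp_all
  then show "cocycles_2 G T A \<noteq> {}" by auto
next
  fix f assume f: "f \<in> cocycles_2 G T A"
  have inv: "inv\<^bsub>product_group (carrier G \<times> carrier G) (\<lambda>_. A)\<^esub> f = (\<lambda>z\<in>carrier G \<times> carrier G. (- f z) mod int p)"
  proof -
    have f': "f \<in> (\<Pi>\<^sub>E i\<in>carrier G \<times> carrier G. carrier A)" using subsetD[OF cocycles_product f] by simp
    show ?thesis
      unfolding inv_product_group[OF f' group_integer_mod_group]
      by (rule restrict_ext) (rule inv_integer_mod_group[OF PiE_mem[OF f']])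
  qed
  show "inv\<^bsub>product_group (carrier G \<times> carrier G) (\<lambda>_. A)\<^esub> f \<in> cocycles_2 G T A"
    unfolding inv cocycles
  proof (intro conjI ballI)
    have "continuous_map (prod_topology T T) D (\<lambda>z. (- f z) mod int p)"
      by (rule continuous_map_discrete_op[OF cocycle_continuous[OF f] cocycle_continuous[OF f],
            where h = "\<lambda>x y. (- x) mod int p"]) (use p_pos in simp)
    then show "continuous_map (prod_topology T T) D (\<lambda>z\<in>carrier G \<times> carrier G. (- f z) mod int p)"
      by (rule continuous_map_eq) simp
  next
    fix g h k assume ghk: "g \<in> carrier G" "h \<in> carrier G" "k \<in> carrier G"
    have "[- (f (h, k) + f (g, h \<otimes> k)) = - (f (g \<otimes> h, k) + f (g, h))] (mod int p)"
      by (rule cong_uminus[OF cocycle_cong[OF f ghk]])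
    then show "[(\<lambda>z\<in>carrier G \<times> carrier G. (- f z) mod int p) (h, k) +
        (\<lambda>z\<in>carrier G \<times> carrier G. (- f z) mod int p) (g, h \<otimes> k) =
        (\<lambda>z\<in>carrier G \<times> carrier G. (- f z) mod int p) (g \<otimes> h, k) +
        (\<lambda>z\<in>carrier G \<times> carrier G. (- f z) mod int p) (g, h)] (mod int p)"
      using ghk by (simp add: cong_def mod_simps; simp add: algebra_simps)
  qed simp
next
  fix f f' assume "f \<in> cocycles_2 G T A" "f' \<in> cocycles_2 G T A"
  then show "f \<otimes>\<^bsub>product_group (carrier G \<times> carrier G) (\<lambda>_. A)\<^esub> f' \<in> cocycles_2 G T A"
    using cocycle_mult by (simp add: cocycle_group_2_def)
qed

lemma C2_comm_group: "comm_group C2"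
proof (rule group.group_comm_groupI)
  show "group C2"
    unfolding cocycle_group_2_def by (rule subgroup.subgroup_is_group[OF C2_subgroup]) simp
qed (simp add: C2_mult add.commute)

sublocale C2: comm_group C2 by (rule C2_comm_group)

lemma C2_one: "\<one>\<^bsub>C2\<^esub> = (\<lambda>z\<in>carrier G \<times> carrier G. 0)"
  by (simp add: cocycle_group_2_def)

lemma coboundary_cocycle:
  assumes b: "b \<in> continuous_cochains_1 G T A"
  shows "coboundary_2 G A b \<in> cocycles_2 G T A"
  unfolding coboundary[OF b] cocycles
proof (intro conjI ballI)
  have c: "continuous_map T D b" using b by (simp add: cochains_1)
  have c1: "continuous_map (prod_topology T T) D (\<lambda>z. b (fst z))"
    using continuous_map_compose[OF continuous_map_fst[of T T] c] by (simp add: o_def)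
  have c2: "continuous_map (prod_topology T T) D (\<lambda>z. b (snd z))"
    using continuous_map_compose[OF continuous_map_snd[of T T] c] by (simp add: o_def)
  have c3: "continuous_map (prod_topology T T) D (\<lambda>z. b (fst z \<otimes> snd z))"
    using continuous_map_compose[OF continuous_map_mult[OF continuous_map_fst[of T T] continuous_map_snd] c]
    by (simp add: o_def)
  have c4: "continuous_map (prod_topology T T) D (\<lambda>z. (b (fst z) + b (snd z)) mod int p)"
    by (rule continuous_map_discrete_op[OF c1 c2]) (use p_pos in simp)
  have "continuous_map (prod_topology T T) D (\<lambda>z. ((b (fst z) + b (snd z)) mod int p - b (fst z \<otimes> snd z)) mod int p)"
    by (rule continuous_map_discrete_op[OF c4 c3]) (use p_pos in simp)
  then show "continuous_map (prod_topology T T) D (\<lambda>(g, h)\<in>carrier G \<times> carrier G. (b g + b h - b (g \<otimes> h)) mod int p)"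
    by (rule continuous_map_eq) (simp add: mod_simps split_def mem_Times_iff)
next
  fix g h k assume "g \<in> carrier G" "h \<in> carrier G" "k \<in> carrier G"
  then show "[(\<lambda>(g, h)\<in>carrier G \<times> carrier G. (b g + b h - b (g \<otimes> h)) mod int p) (h, k) +
      (\<lambda>(g, h)\<in>carrier G \<times> carrier G. (b g + b h - b (g \<otimes> h)) mod int p) (g, h \<otimes> k) =
      (\<lambda>(g, h)\<in>carrier G \<times> carrier G. (b g + b h - b (g \<otimes> h)) mod int p) (g \<otimes> h, k) +
      (\<lambda>(g, h)\<in>carrier G \<times> carrier G. (b g + b h - b (g \<otimes> h)) mod int p) (g, h)] (mod int p)"
    by (simp add: cong_def mod_simps m_assoc; simp add: algebra_simps)
qed simp

text \<open>Here \<open>b\<close> is any continuous function; its restriction to the carrier is the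
  extensional cochain of the definition.\<close>

lemma coboundaries_iff: "f \<in> B2 \<longleftrightarrow> f \<in> extensional (carrier G \<times> carrier G) \<and>
   (\<exists>b. continuous_map T D b \<and> (\<forall>g\<in>carrier G. \<forall>h\<in>carrier G. f (g, h) = (b g + b h - b (g \<otimes> h)) mod int p))"
proof
  assume "f \<in> B2"
  then obtain b where b: "b \<in> continuous_cochains_1 G T A" "f = coboundary_2 G A b"
    by (auto simp: coboundaries_2_def)
  then show "f \<in> extensional (carrier G \<times> carrier G) \<and> (\<exists>b. continuous_map T D b \<and>
      (\<forall>g\<in>carrier G. \<forall>h\<in>carrier G. f (g, h) = (b g + b h - b (g \<otimes> h)) mod int p))"
    by (intro conjI exI[of _ b]) (simp_all add: coboundary cochains_1)
next
  assume R: "f \<in> extensional (carrier G \<times> carrier G) \<and> (\<exists>b. continuous_map T D b \<and>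
      (\<forall>g\<in>carrier G. \<forall>h\<in>carrier G. f (g, h) = (b g + b h - b (g \<otimes> h)) mod int p))"
  then obtain b where b: "continuous_map T D b"
    "\<forall>g\<in>carrier G. \<forall>h\<in>carrier G. f (g, h) = (b g + b h - b (g \<otimes> h)) mod int p" by blast
  define b' where "b' = restrict b (carrier G)"
  have "continuous_map T D b'" by (rule continuous_map_eq[OF b(1)]) (simp add: b'_def)
  then have b': "b' \<in> continuous_cochains_1 G T A" by (simp add: cochains_1 b'_def)
  have "f = coboundary_2 G A b'"
    unfolding coboundary[OF b'] using conjunct1[OF R] b(2)
    by (intro extensional_pairs_eqI[of f "carrier G" "carrier G"]) (simp_all add: b'_def)
  then show "f \<in> B2" unfolding coboundaries_2_def using b' by (rule image_eqI)
qed

lemma B2_subset: "B2 \<subseteq> cocycles_2 G T A"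
  using coboundary_cocycle by (auto simp: coboundaries_2_def)

lemma B2_subgroup: "subgroup B2 C2"
proof (rule C2.subgroupI)
  show "B2 \<subseteq> carrier C2" using B2_subset by (simp add: C2_carrier)
  have "continuous_map T D (\<lambda>_. 0)" using p_pos by simp
  then have "\<one>\<^bsub>C2\<^esub> \<in> B2" unfolding coboundaries_iff C2_one by (intro conjI exI[of _ "\<lambda>_. 0"]) simp_all
  then show "B2 \<noteq> {}" by auto
next
  fix f f' assume "f \<in> B2" "f' \<in> B2"
  then obtain b b' where b: "continuous_map T D b" "\<forall>g\<in>carrier G. \<forall>h\<in>carrier G. f (g, h) = (b g + b h - b (g \<otimes> h)) mod int p"
    and b': "continuous_map T D b'" "\<forall>g\<in>carrier G. \<forall>h\<in>carrier G. f' (g, h) = (b' g + b' h - b' (g \<otimes> h)) mod int p"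
    unfolding coboundaries_iff by blast
  have "continuous_map T D (\<lambda>g. (b g + b' g) mod int p)"
    by (rule continuous_map_discrete_op[OF b(1) b'(1)]) (use p_pos in simp)
  moreover have "(f \<otimes>\<^bsub>C2\<^esub> f') (g, h) =
      ((b g + b' g) mod int p + (b h + b' h) mod int p - (b (g \<otimes> h) + b' (g \<otimes> h)) mod int p) mod int p"
    if "g \<in> carrier G" "h \<in> carrier G" for g h
  proof -
    have "(f \<otimes>\<^bsub>C2\<^esub> f') (g, h) = ((b g + b h - b (g \<otimes> h)) + (b' g + b' h - b' (g \<otimes> h))) mod int p"
      using b(2) b'(2) that by (simp add: C2_mult mod_simps)
    also have "\<dots> = ((b g + b' g) + (b h + b' h) - (b (g \<otimes> h) + b' (g \<otimes> h))) mod int p"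
      by (rule arg_cong[of _ _ "\<lambda>x. x mod int p"]) simp
    finally show ?thesis by (simp only: mod_diff_right_eq) (metis mod_add_eq mod_diff_left_eq)
  qed
  ultimately show "f \<otimes>\<^bsub>C2\<^esub> f' \<in> B2"
    unfolding coboundaries_iff
    by (intro conjI exI[of _ "\<lambda>g. (b g + b' g) mod int p"] ballI) (simp_all add: C2_mult)
next
  fix f assume f: "f \<in> B2"
  then obtain b where b: "continuous_map T D b" "\<forall>g\<in>carrier G. \<forall>h\<in>carrier G. f (g, h) = (b g + b h - b (g \<otimes> h)) mod int p"
    unfolding coboundaries_iff by blast
  let ?b = "\<lambda>g. (- b g) mod int p"
  have c: "continuous_map T D ?b"
    by (rule continuous_map_discrete_op[OF b(1) b(1), where h = "\<lambda>x y. (- x) mod int p"])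
      (use p_pos in simp)
  let ?f = "\<lambda>(g, h)\<in>carrier G \<times> carrier G. (?b g + ?b h - ?b (g \<otimes> h)) mod int p"
  have f': "?f \<in> B2" unfolding coboundaries_iff by (intro conjI exI[of _ ?b] c) simp_all
  have "?f \<otimes>\<^bsub>C2\<^esub> f = \<one>\<^bsub>C2\<^esub>"
  proof (rule extensional_pairs_eqI[of _ "carrier G" "carrier G"])
    fix g h assume "g \<in> carrier G" "h \<in> carrier G"
    then show "(?f \<otimes>\<^bsub>C2\<^esub> f) (g, h) = \<one>\<^bsub>C2\<^esub> (g, h)"
      using b(2) neg_sum_mod[of "b g" "int p" "b h" "b (g \<otimes> h)"] by (simp add: C2_mult C2_one)
  qed (simp_all add: C2_mult C2_one)
  then have "inv\<^bsub>C2\<^esub> f = ?f"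
    using f f' B2_subset by (intro C2.inv_equality) (auto simp: C2_carrier)
  then show "inv\<^bsub>C2\<^esub> f \<in> B2" using f' by simp
qed

lemma B2_normal: "B2 \<lhd> C2" by (rule C2.subgroup_imp_normal[OF B2_subgroup])

abbreviation H where "H \<equiv> H2 G T A"

lemma H_comm_group: "comm_group H"
  unfolding H2_def by (rule C2.abelian_FactGroup[OF B2_subgroup])

sublocale H: comm_group H by (rule H_comm_group)

definition cls :: "('a \<times> 'a \<Rightarrow> int) \<Rightarrow> ('a \<times> 'a \<Rightarrow> int) set" where
  "cls f = B2 #>\<^bsub>C2\<^esub> f"

lemma cls_hom: "cls \<in> hom C2 H"
  unfolding H2_def cls_def[abs_def] by (rule normal.r_coset_hom_Mod[OF B2_normal])

sublocale cls: group_hom C2 H cls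
  by (intro group_hom.intro C2.is_group H.is_group group_hom_axioms.intro cls_hom)

lemma H_carrier: "carrier H = cls ` cocycles_2 G T A"
  unfolding H2_def cls_def carrier_FactGroup C2_carrier ..

lemma cls_one_iff: "f \<in> cocycles_2 G T A \<Longrightarrow> cls f = \<one>\<^bsub>H\<^esub> \<longleftrightarrow> f \<in> B2"
  unfolding cls_def H2_def one_FactGroup
  using C2.coset_join1[of B2 f] C2.coset_join2[of f B2] B2_subgroup B2_subset by (auto simp: C2_carrier)

lemma mem_cls: "f \<in> cocycles_2 G T A \<Longrightarrow> f \<in> cls f"
  unfolding cls_def by (rule C2.rcos_self) (simp_all add: B2_subgroup C2_carrier)

lemma cls_eq: "\<lbrakk>f \<in> cocycles_2 G T A; f' \<in> cls f\<rbrakk> \<Longrightarrow> f' \<in> cocycles_2 G T A \<and> cls f' = cls f"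
  unfolding cls_def
  using C2.repr_independence[of f' B2 f] B2_subgroup C2.r_coset_subset_G[of B2 f] B2_subset by (auto simp: C2_carrier)

lemma cls_eqI:
  assumes f: "f \<in> cocycles_2 G T A" and f': "f' \<in> cocycles_2 G T A" and b: "continuous_map T D b"
    and eq: "\<And>g h. \<lbrakk>g \<in> carrier G; h \<in> carrier G\<rbrakk> \<Longrightarrow> [f (g, h) = f' (g, h) + (b g + b h - b (g \<otimes> h))] (mod int p)"
  shows "cls f = cls f'"
proof -
  let ?d = "\<lambda>(g, h)\<in>carrier G \<times> carrier G. (b g + b h - b (g \<otimes> h)) mod int p"
  have d: "?d \<in> B2" unfolding coboundaries_iff by (intro conjI exI[of _ b] b) simp_all
  have "f = f' \<otimes>\<^bsub>C2\<^esub> ?d"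
  proof (rule extensional_pairs_eqI[of f "carrier G" "carrier G"])
    show "f \<in> extensional (carrier G \<times> carrier G)" using f by (simp add: cocycles)
    fix g h assume gh: "g \<in> carrier G" "h \<in> carrier G"
    have "f (g, h) = f (g, h) mod int p" using cochain_range[of f g h] f gh by (simp add: cocycles)
    then show "f (g, h) = (f' \<otimes>\<^bsub>C2\<^esub> ?d) (g, h)" using eq[OF gh] gh by (simp add: C2_mult cong_def mod_simps)
  qed (simp add: C2_mult)
  then have "cls f = cls f' \<otimes>\<^bsub>H\<^esub> cls ?d" using f' d B2_subset by (auto simp: C2_carrier)
  also have "cls ?d = \<one>\<^bsub>H\<^esub>" using d B2_subset cls_one_iff by blast
  finally show ?thesis using f' by (simp add: C2_carrier)
qed

end

section \<open>Transgression\<close>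

lemma (in top_group) openin_rcoset:
  assumes V: "subgroup V G" "openin T V" and g: "g \<in> carrier G" shows "openin T (V #> g)"
proof -
  have "V #> g = {x \<in> topspace T. x \<otimes> inv g \<in> V}"
    using subgroup.rcos_module[OF V(1) is_group g] r_coset_subset_G[OF subgroup.subset[OF V(1)] g] by auto
  also have "openin T \<dots>"
    by (rule openin_continuous_map_preimage[OF _ V(2)])
      (intro continuous_map_mult continuous_map_id_T, use g in auto)
  finally show ?thesis .
qed

lemma (in top_group) continuous_map_coset_discrete:
  assumes V: "subgroup V G" "openin T V"
  shows "continuous_map T (discrete_topology (carrier (G Mod V))) (\<lambda>g. V #> g)"
  unfolding continuous_map
proof (intro conjI allI impI)
  show "(\<lambda>g. V #> g) ` topspace T \<subseteq> topspace (discrete_topology (carrier (G Mod V)))"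
    by (simp add: carrier_FactGroup)
  fix W assume "openin (discrete_topology (carrier (G Mod V))) W"
  have "{x \<in> topspace T. V #> x \<in> W} = (\<Union>x\<in>{x \<in> carrier G. V #> x \<in> W}. V #> x)"
  proof (intro equalityI subsetI)
    fix x assume "x \<in> {x \<in> topspace T. V #> x \<in> W}"
    then show "x \<in> (\<Union>x\<in>{x \<in> carrier G. V #> x \<in> W}. V #> x)" using rcos_self[OF _ V(1), of x] by auto
  next
    fix y assume "y \<in> (\<Union>x\<in>{x \<in> carrier G. V #> x \<in> W}. V #> x)"
    then obtain x where x: "x \<in> carrier G" "V #> x \<in> W" "y \<in> V #> x" by auto
    have "y \<in> carrier G" using x r_coset_subset_G[OF subgroup.subset[OF V(1)] x(1)] by auto
    then show "y \<in> {x \<in> topspace T. V #> x \<in> W}" using repr_independence[OF x(3,1) V(1)] x(2) by simp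
  qed
  also have "openin T \<dots>" by (rule openin_Union) (use openin_rcoset[OF V] in auto)
  finally show "openin T {x \<in> topspace T. V #> x \<in> W}" .
qed

text \<open>The extension with factor set \<open>f\<close>. The cocycle may be unnormalized, so the
  identity carries the correction - f(1, 1), and the inverses are corrected accordingly.\<close>

lemma (in group) twisted_product_group:
  fixes q :: int
  assumes q: "q > 0"
    and f: "\<And>g h k. \<lbrakk>g \<in> carrier G; h \<in> carrier G; k \<in> carrier G\<rbrakk> \<Longrightarrow>
              [f (h, k) + f (g, h \<otimes> k) = f (g \<otimes> h, k) + f (g, h)] (mod q)"
  defines "E \<equiv> \<lparr>carrier = carrier G \<times> {0..<q},
             monoid.mult = (\<lambda>(g, a) (h, b). (g \<otimes> h, (a + b + f (g, h)) mod q)),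
             one = (\<one>, (- f (\<one>, \<one>)) mod q)\<rparr>"
  shows "group E"
proof (rule groupI)
  have E: "carrier E = carrier G \<times> {0..<q}" "\<one>\<^bsub>E\<^esub> = (\<one>, (- f (\<one>, \<one>)) mod q)"
    "(g, a) \<otimes>\<^bsub>E\<^esub> (h, b) = (g \<otimes> h, (a + b + f (g, h)) mod q)" for g a h b
    by (simp_all add: E_def)
  \<comment> \<open>The cocycle relation for the triple 1, 1, g.\<close>
  have f1: "[f (\<one>, g) = f (\<one>, \<one>)] (mod q)" if "g \<in> carrier G" for g
    using f[of \<one> \<one> g] that by (simp add: cong_iff_dvd_diff)
  {
    fix x y assume "x \<in> carrier E" "y \<in> carrier E"
    then show "x \<otimes>\<^bsub>E\<^esub> y \<in> carrier E" using q by (cases x; cases y) (simp add: E)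
  next
    show "\<one>\<^bsub>E\<^esub> \<in> carrier E" using q by (simp add: E)
  next
    fix x y z assume xyz: "x \<in> carrier E" "y \<in> carrier E" "z \<in> carrier E"
    obtain g a where x: "x = (g, a)" by (cases x)
    obtain h b where y: "y = (h, b)" by (cases y)
    obtain k c where z: "z = (k, c)" by (cases z)
    have ghk: "g \<in> carrier G" "h \<in> carrier G" "k \<in> carrier G" using xyz by (auto simp: x y z E)
    have "[(a + b + f (g, h)) mod q + c + f (g \<otimes> h, k) = (a + b + f (g, h)) + c + f (g \<otimes> h, k)] (mod q)"
      by (intro cong_add iffD2[OF cong_mod_left] cong_refl)
    also have "(a + b + f (g, h)) + c + f (g \<otimes> h, k) = a + b + c + (f (g \<otimes> h, k) + f (g, h))" by simp
    also have "[a + b + c + (f (g \<otimes> h, k) + f (g, h)) = a + b + c + (f (h, k) + f (g, h \<otimes> k))] (mod q)"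
      by (intro cong_add cong_refl cong_sym[OF f[OF ghk]])
    also have "a + b + c + (f (h, k) + f (g, h \<otimes> k)) = a + (b + c + f (h, k)) + f (g, h \<otimes> k)" by simp
    also have "[a + (b + c + f (h, k)) + f (g, h \<otimes> k) = a + (b + c + f (h, k)) mod q + f (g, h \<otimes> k)] (mod q)"
      by (intro cong_add iffD2[OF cong_mod_right] cong_refl)
    finally show "x \<otimes>\<^bsub>E\<^esub> y \<otimes>\<^bsub>E\<^esub> z = x \<otimes>\<^bsub>E\<^esub> (y \<otimes>\<^bsub>E\<^esub> z)"
      using ghk by (simp only: x y z E m_assoc cong_def)
  next
    fix x assume x: "x \<in> carrier E"
    obtain g a where xa: "x = (g, a)" by (cases x)
    have g: "g \<in> carrier G" and a: "a \<in> {0..<q}" using x by (auto simp: xa E)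
    have "[(- f (\<one>, \<one>)) mod q + a + f (\<one>, g) = - f (\<one>, \<one>) + a + f (\<one>, \<one>)] (mod q)"
      by (intro cong_add iffD2[OF cong_mod_left] cong_refl f1 g)
    then show "\<one>\<^bsub>E\<^esub> \<otimes>\<^bsub>E\<^esub> x = x" using a g by (simp add: xa E cong_def)
  next
    fix x assume x: "x \<in> carrier E"
    obtain g a where xa: "x = (g, a)" by (cases x)
    have g: "g \<in> carrier G" using x by (auto simp: xa E)
    let ?y = "(inv g, (- a - f (inv g, g) - f (\<one>, \<one>)) mod q)"
    have "[(- a - f (inv g, g) - f (\<one>, \<one>)) mod q + a + f (inv g, g) =
        (- a - f (inv g, g) - f (\<one>, \<one>)) + a + f (inv g, g)] (mod q)"
      by (intro cong_add iffD2[OF cong_mod_left] cong_refl)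
    then have "?y \<otimes>\<^bsub>E\<^esub> x = \<one>\<^bsub>E\<^esub>" using g by (simp add: xa E cong_def)
    moreover have "?y \<in> carrier E" using g q by (simp add: E)
    ultimately show "\<exists>y\<in>carrier E. y \<otimes>\<^bsub>E\<^esub> x = \<one>\<^bsub>E\<^esub>" by (intro bexI[of _ ?y])
  }
qed

locale free_mod_p = free_profinite S T X g_type
  for S :: "('a, 'm) monoid_scheme" (structure) and T and X and g_type :: "'g::infinite itself" +
  fixes p :: nat
  assumes prime_p: "prime p" and p3: "p > 3"
begin

abbreviation N where "N \<equiv> lower_p_central S T p 3"
abbreviation Q where "Q \<equiv> p_quotient S T p 3"
abbreviation TQ where "TQ \<equiv> p_quotient_topology S T p 3"
abbreviation \<pi> where "\<pi> g \<equiv> N #> g"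

lemma Q_eq: "Q = S Mod N" "TQ = coset_topology S T N"
  by (simp_all add: p_quotient_def p_quotient_topology_def)

sublocale Q: coho2 Q TQ p
proof (intro coho2.intro coho2_axioms.intro)
  show "top_group Q TQ" unfolding Q_eq by (rule top_group_quotient[OF lower_p_central_normal])
qed (use p3 in simp)

sublocale \<pi>: group_hom S Q "\<lambda>g. N #> g"
  unfolding Q_eq
  by (intro group_hom.intro is_group normal.factorgroup_is_group group_hom_axioms.intro
      normal.r_coset_hom_Mod lower_p_central_normal)

lemma Q_carrier: "C \<in> carrier Q \<Longrightarrow> \<exists>g\<in>carrier S. C = \<pi> g"
  by (auto simp: Q_eq carrier_FactGroup)

lemma N_subgroup: "subgroup N S" by (rule lower_p_central_subgroup)

lemma N_carrier: "n \<in> N \<Longrightarrow> n \<in> carrier S" by (rule subgroup.mem_carrier[OF N_subgroup])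

lemma \<pi>_N: "n \<in> N \<Longrightarrow> \<pi> n = \<one>\<^bsub>Q\<^esub>"
  using coset_join2[OF N_carrier N_subgroup] by (simp add: Q_eq one_FactGroup)

lemma \<pi>_quotient: "quotient_map T TQ (\<lambda>g. N #> g)"
  unfolding Q_eq by (rule quotient_map_coset)

text \<open>The cochain \<open>b\<close> on \<open>S\<close> bounds the inflation of
  \<open>f\<close>. Its restriction to \<open>N\<close> is, up to sign and a constant, the
  transgression of the class of \<open>f\<close>.\<close>

definition trans_cochain :: "('a set \<times> 'a set \<Rightarrow> int) \<Rightarrow> ('a \<Rightarrow> int) \<Rightarrow> bool" where
  "trans_cochain f b \<longleftrightarrow> continuous_map T Q.D b \<and>
     (\<forall>\<sigma>\<in>carrier S. \<forall>\<tau>\<in>carrier S. [f (\<pi> \<sigma>, \<pi> \<tau>) = b \<sigma> + b \<tau> - b (\<sigma> \<otimes> \<tau>)] (mod int p))"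

lemma trans_cochainD:
  assumes "trans_cochain f b"
  shows "continuous_map T Q.D b"
    and "\<And>\<sigma> \<tau>. \<lbrakk>\<sigma> \<in> carrier S; \<tau> \<in> carrier S\<rbrakk> \<Longrightarrow> [f (\<pi> \<sigma>, \<pi> \<tau>) = b \<sigma> + b \<tau> - b (\<sigma> \<otimes> \<tau>)] (mod int p)"
    and "\<And>\<sigma>. \<sigma> \<in> carrier S \<Longrightarrow> b \<sigma> \<in> {0..<int p}"
proof -
  show c: "continuous_map T Q.D b" and "\<And>\<sigma> \<tau>. \<lbrakk>\<sigma> \<in> carrier S; \<tau> \<in> carrier S\<rbrakk> \<Longrightarrow>
      [f (\<pi> \<sigma>, \<pi> \<tau>) = b \<sigma> + b \<tau> - b (\<sigma> \<otimes> \<tau>)] (mod int p)"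
    using assms by (simp_all add: trans_cochain_def)
  show "b \<sigma> \<in> {0..<int p}" if "\<sigma> \<in> carrier S" for \<sigma>
    using subsetD[OF continuous_map_image_subset_topspace[OF c] imageI, of \<sigma>] that by simp
qed

text \<open>Surjectivity of the transgression, that is \<open>H\<^sup>2(S, \<int>/p) = 0\<close>: the inflation of the cocycle
  factors through a finite quotient \<open>S/V\<close>, and the extension of \<open>S/V\<close> it defines can be
  lifted to \<open>S\<close> by freeness.\<close>

lemma trans_cochain_exists:
  assumes f: "f \<in> cocycles_2 Q TQ (integer_mod_group p)"
  shows "\<exists>b. trans_cochain f b"
proof -
  define F where "F = (\<lambda>z. f (\<pi> (fst z), \<pi> (snd z)))"
  have cpi: "continuous_map T TQ (\<lambda>g. N #> g)" by (rule quotient_imp_continuous_map[OF \<pi>_quotient])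
  have c1: "continuous_map (prod_topology T T) TQ (\<lambda>z. \<pi> (fst z))"
    using continuous_map_compose[OF continuous_map_fst[of T T] cpi] by (simp add: o_def)
  have c2: "continuous_map (prod_topology T T) TQ (\<lambda>z. \<pi> (snd z))"
    using continuous_map_compose[OF continuous_map_snd[of T T] cpi] by (simp add: o_def)
  have F1: "continuous_map (prod_topology T T) Q.D F"
    using continuous_map_compose[OF continuous_map_pairedI[OF c1 c2] Q.cocycle_continuous[OF f]]
    by (simp add: o_def F_def)
  have F2: "continuous_map (prod_topology T T) Q.D (\<lambda>z. F (snd z, fst z))"
    using continuous_map_compose[OF continuous_map_pairedI[OF continuous_map_snd continuous_map_fst] F1]
    by (simp add: o_def)
  have Fc: "[F (h, k) + F (g, h \<otimes> k) = F (g \<otimes> h, k) + F (g, h)] (mod int p)"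
    if "g \<in> carrier S" "h \<in> carrier S" "k \<in> carrier S" for g h k
    using Q.cocycle_cong[OF f \<pi>.hom_closed[OF that(1)] \<pi>.hom_closed[OF that(2)] \<pi>.hom_closed[OF that(3)]] that
    by (simp add: F_def \<pi>.hom_mult)
  \<comment> \<open>The inflated cocycle is locally constant on a compact space, so each of its
    arguments may be changed by an open normal subgroup; the intersection of the two subgroups
    serves both arguments.\<close>
  define V1 where "V1 = {v \<in> carrier S. \<forall>a\<in>carrier S. \<forall>c\<in>carrier S. \<forall>y\<in>topspace T. F (a \<otimes> v \<otimes> c, y) = F (a \<otimes> c, y)}"
  define V2 where "V2 = {v \<in> carrier S. \<forall>a\<in>carrier S. \<forall>c\<in>carrier S. \<forall>y\<in>topspace T.
      (\<lambda>z. F (snd z, fst z)) (a \<otimes> v \<otimes> c, y) = (\<lambda>z. F (snd z, fst z)) (a \<otimes> c, y)}"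
  have V1: "V1 \<lhd> S" "openin T V1"
    unfolding V1_def by (rule open_invariance_subgroup[OF compact_T compact_T F1])+
  have V2: "V2 \<lhd> S" "openin T V2"
    unfolding V2_def by (rule open_invariance_subgroup[OF compact_T compact_T F2])+
  define V where "V = V1 \<inter> V2"
  have V: "V \<lhd> S" "openin T V"
    using V1 V2 by (simp_all add: V_def normal_inv_iff subgroup_Int openin_Int)
  note Vsub = normal_imp_subgroup[OF V(1)]
  have inv: "F (v \<otimes> g, y) = F (g, y)" "F (y, v \<otimes> g) = F (y, g)"
    if "v \<in> V" "g \<in> carrier S" "y \<in> carrier S" for v g y
  proof -
    have v: "v \<in> carrier S" using subgroup.mem_carrier[OF Vsub that(1)] .
    have vV: "v \<in> V1" "v \<in> V2" using that(1) by (simp_all add: V_def)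
    show "F (v \<otimes> g, y) = F (g, y)"
      using vV(1)[unfolded V1_def mem_Collect_eq, THEN conjunct2, rule_format, of \<one> g y] v that by simp
    show "F (y, v \<otimes> g) = F (y, g)"
      using vV(2)[unfolded V2_def mem_Collect_eq, THEN conjunct2, rule_format, of \<one> g y] v that by simp
  qed
  interpret Vn: normal V S by (rule V(1))
  let ?K = "S Mod V"
  interpret K: group ?K by (rule Vn.factorgroup_is_group)
  interpret \<kappa>: group_hom S ?K "\<lambda>g. V #> g"
    by (intro group_hom.intro is_group K.is_group group_hom_axioms.intro Vn.r_coset_hom_Mod)
  have Kc: "\<exists>g\<in>carrier S. C = V #> g" if "C \<in> carrier ?K" for C
    using that by (auto simp: carrier_FactGroup)
  define rep where "rep C = (SOME g. g \<in> carrier S \<and> C = V #> g)" for C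
  have rep: "rep C \<in> carrier S \<and> C = V #> rep C" if "C \<in> carrier ?K" for C
    unfolding rep_def by (rule someI_ex) (use Kc[OF that] in blast)
  define F' where "F' = (\<lambda>(C, D). F (rep C, rep D))"
  have F': "F' (V #> g, V #> h) = F (g, h)" if gh: "g \<in> carrier S" "h \<in> carrier S" for g h
  proof -
    have r: "\<exists>v\<in>V. rep (V #> g) = v \<otimes> g" if g: "g \<in> carrier S" for g
    proof -
      have "rep (V #> g) \<in> V #> g"
        using rep[OF \<kappa>.hom_closed[OF g]] rcos_self[OF _ Vsub, of "rep (V #> g)"] by simp
      then show ?thesis unfolding r_coset_def by auto
    qed
    obtain v where v: "v \<in> V" "rep (V #> g) = v \<otimes> g" using r[OF gh(1)] by auto
    obtain u where u: "u \<in> V" "rep (V #> h) = u \<otimes> h" using r[OF gh(2)] by auto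
    have uh: "u \<otimes> h \<in> carrier S" using subgroup.mem_carrier[OF Vsub u(1)] gh by simp
    show ?thesis unfolding F'_def case_prod_conv v(2) u(2) inv(1)[OF v(1) gh(1) uh] inv(2)[OF u(1) gh(2) gh(1)] ..
  qed
  have F'c: "[F' (D, E) + F' (C, D \<otimes>\<^bsub>?K\<^esub> E) = F' (C \<otimes>\<^bsub>?K\<^esub> D, E) + F' (C, D)] (mod int p)"
    if CDE: "C \<in> carrier ?K" "D \<in> carrier ?K" "E \<in> carrier ?K" for C D E
  proof -
    obtain g where g: "g \<in> carrier S" "C = V #> g" using Kc[OF CDE(1)] by auto
    obtain h where h: "h \<in> carrier S" "D = V #> h" using Kc[OF CDE(2)] by auto
    obtain k where k: "k \<in> carrier S" "E = V #> k" using Kc[OF CDE(3)] by auto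
    have m: "D \<otimes>\<^bsub>?K\<^esub> E = V #> (h \<otimes> k)" "C \<otimes>\<^bsub>?K\<^esub> D = V #> (g \<otimes> h)"
      using g h k by (simp_all add: \<kappa>.hom_mult)
    show ?thesis
      unfolding m unfolding g(2) h(2) k(2) F'[OF h(1) k(1)] F'[OF g(1) m_closed[OF h(1) k(1)]]
        F'[OF m_closed[OF g(1) h(1)] k(1)] F'[OF g(1) h(1)] by (rule Fc[OF g(1) h(1) k(1)])
  qed
  define E where "E = \<lparr>carrier = carrier ?K \<times> {0..<int p},
             monoid.mult = (\<lambda>(g, a) (h, b). (g \<otimes>\<^bsub>?K\<^esub> h, (a + b + F' (g, h)) mod int p)),
             one = (\<one>\<^bsub>?K\<^esub>, (- F' (\<one>\<^bsub>?K\<^esub>, \<one>\<^bsub>?K\<^esub>)) mod int p)\<rparr>"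
  have E: "group E"
    unfolding E_def by (rule K.twisted_product_group[OF _ F'c]) (use p3 in auto)
  have Ec: "carrier E = carrier ?K \<times> {0..<int p}" and E1: "fst \<one>\<^bsub>E\<^esub> = \<one>\<^bsub>?K\<^esub>"
    and Em: "fst (x \<otimes>\<^bsub>E\<^esub> y) = fst x \<otimes>\<^bsub>?K\<^esub> fst y"
      "snd (x \<otimes>\<^bsub>E\<^esub> y) = (snd x + snd y + F' (fst x, fst y)) mod int p" for x y
    by (simp_all add: E_def split_def)
  interpret E: group E by (rule E)
  have finE: "finite (carrier E)"
    unfolding Ec using finite_rcosets_open[OF compact_T Vsub V(2)] by (simp add: FactGroup_def)
  \<comment> \<open>A lift of the projection on letters. The letters in \<open>V\<close>, which are
    all but finitely many, go to the identity, so the prescribed values have finite support.\<close>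
  define s where "s x = (if x \<in> V then \<one>\<^bsub>E\<^esub> else (V #> x, 0))" for x
  have sE: "s x \<in> carrier E" if "x \<in> X" for x
    using that X_carrier p3 \<kappa>.hom_closed[of x] by (auto simp: s_def Ec E.one_closed[unfolded Ec])
  have fs: "fst (s x) = V #> x" if "x \<in> X" for x
  proof (cases "x \<in> V")
    case True
    then show ?thesis using that X_carrier coset_join2[OF _ Vsub True] by (auto simp: s_def E1 one_FactGroup)
  qed (simp add: s_def)
  have fin: "finite {x \<in> X. s x \<noteq> \<one>\<^bsub>E\<^esub>}"
    by (rule finite_subset[OF _ finite_outside_open_normal[OF V]]) (auto simp: s_def)
  obtain \<Theta> where \<Theta>: "\<Theta> \<in> hom S E" "continuous_map T (discrete_topology (carrier E)) \<Theta>" "\<forall>x\<in>X. \<Theta> x = s x"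
    using extend_to_finite_group[OF E finE sE fin] by auto
  have \<Theta>E: "\<Theta> \<sigma> \<in> carrier E" if "\<sigma> \<in> carrier S" for \<sigma> by (rule hom_in_carrier[OF \<Theta>(1) that])
  have fst\<Theta>: "fst (\<Theta> \<sigma>) = V #> \<sigma>" if "\<sigma> \<in> carrier S" for \<sigma>
  proof -
    have "(fst \<circ> \<Theta>) \<sigma> = V #> \<sigma>"
    proof (rule homs_agree[OF K.is_group _ \<kappa>.homh Hausdorff_space_discrete_topology _ continuous_map_coset_discrete[OF Vsub V(2)] _ that])
      show "fst \<circ> \<Theta> \<in> hom S ?K"
      proof (rule homI)
        show "(fst \<circ> \<Theta>) x \<in> carrier ?K" if "x \<in> carrier S" for x using \<Theta>E[OF that] unfolding Ec by (simp add: mem_Times_iff)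
        show "(fst \<circ> \<Theta>) (x \<otimes> y) = (fst \<circ> \<Theta>) x \<otimes>\<^bsub>?K\<^esub> (fst \<circ> \<Theta>) y" if "x \<in> carrier S" "y \<in> carrier S" for x y
          using hom_mult[OF \<Theta>(1) that] by (simp add: Em)
      qed
      have "continuous_map (discrete_topology (carrier E)) (discrete_topology (carrier ?K)) fst"
        unfolding Ec by (simp add: mem_Times_iff)
      then show "continuous_map T (discrete_topology (carrier ?K)) (fst \<circ> \<Theta>)"
        by (rule continuous_map_compose[OF \<Theta>(2)])
      show "(fst \<circ> \<Theta>) x = V #> x" if "x \<in> X" for x using \<Theta>(3) fs that by simp
    qed
    then show ?thesis by simp
  qed
  \<comment> \<open>The second coordinate of \<Theta> is additive up to the summand
    \<open>F\<close>, while a coboundary has the form b(\<sigma>) + b(\<tau>) - b(\<sigma>\<tau>);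
    hence the sign.\<close>
  define b where "b = (\<lambda>\<sigma>. (- snd (\<Theta> \<sigma>)) mod int p)"
  have "trans_cochain f b"
    unfolding trans_cochain_def
  proof (intro conjI ballI)
    have "continuous_map (discrete_topology (carrier E)) Q.D (\<lambda>e. (- snd e) mod int p)" using p3 by simp
    from continuous_map_compose[OF \<Theta>(2) this] show "continuous_map T Q.D b" by (simp add: b_def o_def)
    fix \<sigma> \<tau> assume st: "\<sigma> \<in> carrier S" "\<tau> \<in> carrier S"
    have "snd (\<Theta> (\<sigma> \<otimes> \<tau>)) = (snd (\<Theta> \<sigma>) + snd (\<Theta> \<tau>) + F (\<sigma>, \<tau>)) mod int p"
      using hom_mult[OF \<Theta>(1) st] st by (simp add: Em fst\<Theta> F')
    then have e: "[snd (\<Theta> (\<sigma> \<otimes> \<tau>)) = snd (\<Theta> \<sigma>) + snd (\<Theta> \<tau>) + F (\<sigma>, \<tau>)] (mod int p)"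
      by (simp add: cong_def)
    have "[b \<sigma> + b \<tau> - b (\<sigma> \<otimes> \<tau>) = - snd (\<Theta> \<sigma>) + - snd (\<Theta> \<tau>) - - snd (\<Theta> (\<sigma> \<otimes> \<tau>))] (mod int p)"
      unfolding b_def by (intro cong_add cong_diff iffD2[OF cong_mod_left] cong_refl)
    also have "[- snd (\<Theta> \<sigma>) + - snd (\<Theta> \<tau>) - - snd (\<Theta> (\<sigma> \<otimes> \<tau>)) =
        - snd (\<Theta> \<sigma>) + - snd (\<Theta> \<tau>) - - (snd (\<Theta> \<sigma>) + snd (\<Theta> \<tau>) + F (\<sigma>, \<tau>))] (mod int p)"
      by (intro cong_diff cong_uminus cong_refl e)
    finally show "[f (\<pi> \<sigma>, \<pi> \<tau>) = b \<sigma> + b \<tau> - b (\<sigma> \<otimes> \<tau>)] (mod int p)"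
      by (simp add: F_def cong_sym)
  qed
  then show ?thesis by (intro exI[of _ b])
qed

text \<open>Comparison with the value at 1 compensates for cocycles that are not normalized. The
  sign is chosen so that the class of a word transgresses to the corner entry itself.\<close>

definition trans_hom :: "('a \<Rightarrow> int) \<Rightarrow> 'a \<Rightarrow> int" where
  "trans_hom b n = (b \<one> - b n) mod int p"

text \<open>An element of \<open>N\<close> has the same image in the quotient as 1, so the
  coboundary equation with \<open>n\<close> may be compared with the one with 1.\<close>

lemma trans_cochain_N:
  assumes b: "trans_cochain f b" and n: "n \<in> N" and g: "g \<in> carrier S"
  shows "[b (g \<otimes> n) = b g + b n - b \<one>] (mod int p)" and "[b (n \<otimes> g) = b n + b g - b \<one>] (mod int p)"
proof -
  note nS = N_carrier[OF n]
  have "[b g + b n - b (g \<otimes> n) = b g + b \<one> - b (g \<otimes> \<one>)] (mod int p)"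
    using cong_trans[OF cong_sym[OF trans_cochainD(2)[OF b g nS]]] trans_cochainD(2)[OF b g one_closed]
      \<pi>_N[OF n] \<pi>_N[OF subgroup.one_closed[OF N_subgroup]] by simp
  then show "[b (g \<otimes> n) = b g + b n - b \<one>] (mod int p)"
    using g by (simp add: cong_iff_dvd_diff algebra_simps dvd_diff_commute)
  have "[b n + b g - b (n \<otimes> g) = b \<one> + b g - b (\<one> \<otimes> g)] (mod int p)"
    using cong_trans[OF cong_sym[OF trans_cochainD(2)[OF b nS g]]] trans_cochainD(2)[OF b one_closed g]
      \<pi>_N[OF n] \<pi>_N[OF subgroup.one_closed[OF N_subgroup]] by simp
  then show "[b (n \<otimes> g) = b n + b g - b \<one>] (mod int p)"
    using g by (simp add: cong_iff_dvd_diff algebra_simps dvd_diff_commute)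
qed

lemma trans_hom_zero_iff:
  assumes "trans_cochain f b" "n \<in> carrier S"
  shows "trans_hom b n = 0 \<longleftrightarrow> b n = b \<one>"
proof
  assume "trans_hom b n = 0"
  then have "[b \<one> = b n] (mod int p)" by (simp add: trans_hom_def cong_iff_dvd_diff dvd_eq_mod_eq_0)
  then show "b n = b \<one>"
    using trans_cochainD(3)[OF assms] trans_cochainD(3)[OF assms(1) one_closed] by (simp add: cong_def)
qed (simp add: trans_hom_def)

lemma trans_hom_invariant:
  assumes b: "trans_cochain f b"
  shows "invariant_hom S T X g_type p (trans_hom b)"
proof (intro invariant_hom.intro invariant_hom_axioms.intro free_profinite_axioms)
  show "odd p" using prime_p p3 prime_odd_nat by force
  show "trans_hom b n \<in> {0..<int p}" for n using p3 by (simp add: trans_hom_def)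
  show "trans_hom b (n \<otimes> n') = (trans_hom b n + trans_hom b n') mod int p" if "n \<in> N" "n' \<in> N" for n n'
  proof -
    have "[b \<one> - b (n \<otimes> n') = b \<one> - (b n + b n' - b \<one>)] (mod int p)"
      by (intro cong_diff cong_refl trans_cochain_N(1)[OF b that(2) N_carrier[OF that(1)]])
    also have "b \<one> - (b n + b n' - b \<one>) = (b \<one> - b n) + (b \<one> - b n')" by simp
    finally show ?thesis unfolding trans_hom_def cong_def by (simp add: mod_add_eq)
  qed
  show "trans_hom b (g \<otimes> n \<otimes> inv g) = trans_hom b n" if g: "g \<in> carrier S" and n: "n \<in> N" for g n
  proof -
    let ?m = "g \<otimes> n \<otimes> inv g"
    have m: "?m \<in> N" using lower_p_central_normal[of p 3] g n by (simp add: normal_inv_iff)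
    \<comment> \<open>Both products are expanded by the two halves of
      \<open>trans_cochain_N\<close>; the values at \<open>g\<close> cancel.\<close>
    have "?m \<otimes> g = g \<otimes> n" using g N_carrier[OF n] by (simp add: grp_norm)
    then have "[b ?m + b g - b \<one> = b g + b n - b \<one>] (mod int p)"
      using cong_trans[OF cong_sym[OF trans_cochain_N(2)[OF b m g]]] trans_cochain_N(1)[OF b n g] by simp
    then have "[b ?m = b n] (mod int p)" by (simp add: cong_iff_dvd_diff)
    then have "[b \<one> - b ?m = b \<one> - b n] (mod int p)" by (intro cong_diff cong_refl)
    then show ?thesis by (simp add: trans_hom_def cong_def)
  qed
  have eq: "{n \<in> N. trans_hom b n = 0} = N \<inter> {g \<in> carrier S. b g \<in> {b \<one>}}"
    using trans_hom_zero_iff[OF b] N_carrier by auto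
  show "closedin T {n \<in> N. trans_hom b n = 0}"
    unfolding eq
    by (rule closedin_Int[OF lower_p_central_closed discrete_preimage(1)[OF trans_cochainD(1)[OF b]]])
qed

text \<open>If \<open>b\<close> is constant on \<open>N\<close>, it is constant on the cosets of
  \<open>N\<close> and descends to the quotient, where it bounds \<open>f\<close>.\<close>

lemma trans_hom_zero_coboundary:
  assumes f: "f \<in> cocycles_2 Q TQ (integer_mod_group p)" and b: "trans_cochain f b"
    and 0: "\<And>n. n \<in> N \<Longrightarrow> trans_hom b n = 0"
  shows "f \<in> Q.B2"
proof -
  define b' where "b' C = b (SOME g. g \<in> carrier S \<and> C = \<pi> g)" for C
  have b': "b' (\<pi> g) = b g" if g: "g \<in> carrier S" for g
  proof -
    define h where "h = (SOME h. h \<in> carrier S \<and> \<pi> g = \<pi> h)"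
    have h: "h \<in> carrier S \<and> \<pi> g = \<pi> h" unfolding h_def by (rule someI[of _ g]) (use g in simp)
    then have "h \<in> \<pi> g" using rcos_self[OF _ N_subgroup, of h] by simp
    then obtain n where n: "n \<in> N" "h = n \<otimes> g" unfolding r_coset_def by auto
    have "b n = b \<one>" using 0[OF n(1)] trans_hom_zero_iff[OF b N_carrier[OF n(1)]] by simp
    then have "[b h = b g] (mod int p)" using trans_cochain_N(2)[OF b n(1) g] n(2) by simp
    then have "b h = b g" using trans_cochainD(3)[OF b, of h] trans_cochainD(3)[OF b g] h by (simp add: cong_def)
    then show ?thesis by (simp add: b'_def h_def)
  qed
  have "continuous_map T Q.D (b' \<circ> (\<lambda>g. N #> g))"
    by (rule continuous_map_eq[OF trans_cochainD(1)[OF b]]) (simp add: b')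
  then have c: "continuous_map TQ Q.D b'" by (rule continuous_compose_quotient_map[OF \<pi>_quotient])
  show ?thesis
    unfolding Q.coboundaries_iff
  proof (intro conjI exI[of _ b'] c ballI)
    show "f \<in> extensional (carrier Q \<times> carrier Q)" by (rule Q.cocycle_extensional[OF f])
    fix C D assume CD: "C \<in> carrier Q" "D \<in> carrier Q"
    obtain g where g: "g \<in> carrier S" "C = \<pi> g" using Q_carrier[OF CD(1)] by auto
    obtain h where h: "h \<in> carrier S" "D = \<pi> h" using Q_carrier[OF CD(2)] by auto
    have "C \<otimes>\<^bsub>Q\<^esub> D = \<pi> (g \<otimes> h)" using g h by (simp add: \<pi>.hom_mult)
    then have m: "b' (C \<otimes>\<^bsub>Q\<^esub> D) = b (g \<otimes> h)" using b'[OF m_closed[OF g(1) h(1)]] by simp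
    have "f (C, D) \<in> {0..<int p}" by (rule Q.cochain_range[OF Q.cocycle_continuous[OF f] CD])
    then show "f (C, D) = (b' C + b' D - b' (C \<otimes>\<^bsub>Q\<^esub> D)) mod int p"
      unfolding m using trans_cochainD(2)[OF b g(1) h(1)] g h by (simp add: b' cong_def)
  qed
qed

text \<open>A character with values in Z/p kills p-th powers and commutators, so already S^(2,p),
  which contains \<open>N\<close>.\<close>

lemma continuous_character_vanishes:
  assumes c: "continuous_map T Q.D d"
    and mult: "\<And>g h. \<lbrakk>g \<in> carrier S; h \<in> carrier S\<rbrakk> \<Longrightarrow> d (g \<otimes> h) = (d g + d h) mod int p" and n: "n \<in> N"
  shows "d n = 0"
proof -
  let ?A = "integer_mod_group p"
  have range: "d g \<in> {0..<int p}" if "g \<in> carrier S" for g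
    using subsetD[OF continuous_map_image_subset_topspace[OF c] imageI, of g] that by simp
  have hom: "d \<in> hom S ?A" using range mult by (intro homI) (simp_all add: Q.A_carrier)
  interpret d: group_hom S ?A d
    by (intro group_hom.intro is_group group_integer_mod_group group_hom_axioms.intro hom)
  have sub: "subgroup {g \<in> carrier S. d g \<in> {0}} S"
    using subgroup_kernel[OF subgroup_self group_integer_mod_group[of p], of d] range mult by (simp add: Q.A_carrier)
  have "lower_p_central S T p (Suc (Suc 0)) \<subseteq> {g \<in> carrier S. d g \<in> {0}}"
  proof (rule lower_p_central_least[OF sub discrete_preimage(1)[OF c]])
    fix h assume "h \<in> lower_p_central S T p (Suc 0)"
    then have h: "h \<in> carrier S" by simp
    show "h [^] p \<in> {g \<in> carrier S. d g \<in> {0}}" using h by (simp add: d.hom_nat_pow)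
    show "grp_comm S g h \<in> {g \<in> carrier S. d g \<in> {0}}" if "g \<in> carrier S" for g
      using that h d.H.grp_comm_eq_one_iff[of "d g" "d h"] by (simp add: d.hom_grp_comm add.commute)
  qed
  then show ?thesis using n lower_p_central_decreasing[of p "Suc 0"] by (auto simp: numeral_3_eq_3)
qed

text \<open>Two cochains with the same coboundary differ by a character of \<open>S\<close>, which
  is trivial on \<open>N\<close>.\<close>

lemma trans_hom_unique:
  assumes b: "trans_cochain f b" and b': "trans_cochain f b'" and n: "n \<in> N"
  shows "trans_hom b n = trans_hom b' n"
proof -
  define d where "d g = (b g - b' g) mod int p" for g
  have "continuous_map T Q.D d"
    unfolding d_def by (rule continuous_map_discrete_op[OF trans_cochainD(1)[OF b] trans_cochainD(1)[OF b']])
      (use p3 in simp)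
  moreover have "d (g \<otimes> h) = (d g + d h) mod int p" if gh: "g \<in> carrier S" "h \<in> carrier S" for g h
  proof -
    have "[b g + b h - b (g \<otimes> h) = b' g + b' h - b' (g \<otimes> h)] (mod int p)"
      by (rule cong_trans[OF cong_sym[OF trans_cochainD(2)[OF b gh]] trans_cochainD(2)[OF b' gh]])
    then have "[b (g \<otimes> h) - b' (g \<otimes> h) = (b g - b' g) + (b h - b' h)] (mod int p)"
      by (simp add: cong_iff_dvd_diff algebra_simps dvd_diff_commute)
    then show ?thesis by (simp add: d_def cong_def mod_add_eq)
  qed
  ultimately have d0: "d n = 0" "d \<one> = 0"
    using continuous_character_vanishes n subgroup.one_closed[OF N_subgroup] by blast+
  then have "[b \<one> - b n = b' \<one> - b' n] (mod int p)"
  proof -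
    have "[b n = b' n] (mod int p)" "[b \<one> = b' \<one>] (mod int p)"
      using d0 by (simp_all add: d_def cong_iff_dvd_diff dvd_eq_mod_eq_0)
    then show ?thesis by (intro cong_diff)
  qed
  then show ?thesis by (simp add: trans_hom_def cong_def)
qed

lemma trans_cochain_mult:
  assumes b: "trans_cochain f b" and b': "trans_cochain f' b'"
  shows "trans_cochain (f \<otimes>\<^bsub>Q.C2\<^esub> f') (\<lambda>g. (b g + b' g) mod int p)"
  unfolding trans_cochain_def
proof (intro conjI ballI)
  show "continuous_map T Q.D (\<lambda>g. (b g + b' g) mod int p)"
    by (rule continuous_map_discrete_op[OF trans_cochainD(1)[OF b] trans_cochainD(1)[OF b']]) (use p3 in simp)
  fix \<sigma> \<tau> assume st: "\<sigma> \<in> carrier S" "\<tau> \<in> carrier S"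
  have "[(f \<otimes>\<^bsub>Q.C2\<^esub> f') (\<pi> \<sigma>, \<pi> \<tau>) = f (\<pi> \<sigma>, \<pi> \<tau>) + f' (\<pi> \<sigma>, \<pi> \<tau>)] (mod int p)"
    using st by (simp add: Q.C2_mult)
  also have "[f (\<pi> \<sigma>, \<pi> \<tau>) + f' (\<pi> \<sigma>, \<pi> \<tau>) =
      (b \<sigma> + b \<tau> - b (\<sigma> \<otimes> \<tau>)) + (b' \<sigma> + b' \<tau> - b' (\<sigma> \<otimes> \<tau>))] (mod int p)"
    by (intro cong_add trans_cochainD(2)[OF b st] trans_cochainD(2)[OF b' st])
  also have "(b \<sigma> + b \<tau> - b (\<sigma> \<otimes> \<tau>)) + (b' \<sigma> + b' \<tau> - b' (\<sigma> \<otimes> \<tau>)) =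
      (b \<sigma> + b' \<sigma>) + (b \<tau> + b' \<tau>) - (b (\<sigma> \<otimes> \<tau>) + b' (\<sigma> \<otimes> \<tau>))" by simp
  also have "[(b \<sigma> + b' \<sigma>) + (b \<tau> + b' \<tau>) - (b (\<sigma> \<otimes> \<tau>) + b' (\<sigma> \<otimes> \<tau>)) =
      (b \<sigma> + b' \<sigma>) mod int p + (b \<tau> + b' \<tau>) mod int p - (b (\<sigma> \<otimes> \<tau>) + b' (\<sigma> \<otimes> \<tau>)) mod int p] (mod int p)"
    by (intro cong_add cong_diff iffD2[OF cong_mod_right] cong_refl)
  finally show "[(f \<otimes>\<^bsub>Q.C2\<^esub> f') (\<pi> \<sigma>, \<pi> \<tau>) = (b \<sigma> + b' \<sigma>) mod int p + (b \<tau> + b' \<tau>) mod int p -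
      (b (\<sigma> \<otimes> \<tau>) + b' (\<sigma> \<otimes> \<tau>)) mod int p] (mod int p)" .
qed

text \<open>The transgression of the class \<open>h\<close> is \<open>\<psi>\<close> modulo \<open>p\<close>.\<close>

definition represents :: "('a set \<times> 'a set \<Rightarrow> int) set \<Rightarrow> ('a \<Rightarrow> int) \<Rightarrow> bool" where
  "represents h \<psi> \<longleftrightarrow> (\<exists>f b. f \<in> cocycles_2 Q TQ (integer_mod_group p) \<and> h = Q.cls f \<and>
     trans_cochain f b \<and> (\<forall>n\<in>N. [trans_hom b n = \<psi> n] (mod int p)))"

lemma representsI:
  assumes "f \<in> cocycles_2 Q TQ (integer_mod_group p)" "h = Q.cls f" "trans_cochain f b"
    "\<And>n. n \<in> N \<Longrightarrow> [trans_hom b n = \<psi> n] (mod int p)"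
  shows "represents h \<psi>"
  unfolding represents_def using assms by (intro exI[of _ f] exI[of _ b]) simp

lemma representsE:
  assumes "represents h \<psi>"
  obtains f b where "f \<in> cocycles_2 Q TQ (integer_mod_group p)" "h = Q.cls f" "trans_cochain f b"
    "\<And>n. n \<in> N \<Longrightarrow> [trans_hom b n = \<psi> n] (mod int p)"
  using assms unfolding represents_def by auto

lemma represents_carrier: "represents h \<psi> \<Longrightarrow> h \<in> carrier Q.H"
  by (elim representsE) (simp add: Q.H_carrier)

lemma represents_cong:
  assumes "represents h \<psi>" "\<And>n. n \<in> N \<Longrightarrow> [\<psi> n = \<phi> n] (mod int p)" shows "represents h \<phi>"
proof -
  obtain f b where f: "f \<in> cocycles_2 Q TQ (integer_mod_group p)" "h = Q.cls f" "trans_cochain f b"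
    "\<And>n. n \<in> N \<Longrightarrow> [trans_hom b n = \<psi> n] (mod int p)" using assms(1) by (rule representsE) blast
  show ?thesis by (rule representsI[OF f(1-3)]) (rule cong_trans[OF f(4) assms(2)])
qed

lemma represents_exists:
  assumes "h \<in> carrier Q.H" obtains f b where "f \<in> cocycles_2 Q TQ (integer_mod_group p)" "h = Q.cls f"
    "trans_cochain f b" "represents h (trans_hom b)"
proof -
  obtain f where f: "f \<in> cocycles_2 Q TQ (integer_mod_group p)" "h = Q.cls f"
    using assms unfolding Q.H_carrier by auto
  obtain b where b: "trans_cochain f b" using trans_cochain_exists[OF f(1)] by auto
  show thesis by (rule that[OF f b representsI[OF f b cong_refl]])
qed

text \<open>This is injectivity of the transgression. A coboundary is bounded by a cochain inflated
  from the quotient, which is constant on \<open>N\<close>; conversely a cochain that is constant on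
  \<open>N\<close> descends.\<close>

lemma represents_one_iff:
  assumes "represents h \<psi>"
  shows "h = \<one>\<^bsub>Q.H\<^esub> \<longleftrightarrow> (\<forall>n\<in>N. [\<psi> n = 0] (mod int p))"
proof -
  obtain f b where f: "f \<in> cocycles_2 Q TQ (integer_mod_group p)" "h = Q.cls f" "trans_cochain f b"
    "\<And>n. n \<in> N \<Longrightarrow> [trans_hom b n = \<psi> n] (mod int p)" using assms by (rule representsE) blast
  have range: "trans_hom b n \<in> {0..<int p}" for n using p3 by (simp add: trans_hom_def)
  show ?thesis
  proof
    assume "h = \<one>\<^bsub>Q.H\<^esub>"
    then have "f \<in> Q.B2" using f Q.cls_one_iff by simp
    then obtain b' where b': "continuous_map TQ Q.D b'"
      "\<forall>C\<in>carrier Q. \<forall>D\<in>carrier Q. f (C, D) = (b' C + b' D - b' (C \<otimes>\<^bsub>Q\<^esub> D)) mod int p"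
      unfolding Q.coboundaries_iff by auto
    have tb: "trans_cochain f (\<lambda>g. b' (\<pi> g))"
      unfolding trans_cochain_def
    proof (intro conjI ballI)
      show "continuous_map T Q.D (\<lambda>g. b' (\<pi> g))"
        using continuous_map_compose[OF quotient_imp_continuous_map[OF \<pi>_quotient] b'(1)] by (simp add: o_def)
      show "[f (\<pi> \<sigma>, \<pi> \<tau>) = b' (\<pi> \<sigma>) + b' (\<pi> \<tau>) - b' (\<pi> (\<sigma> \<otimes> \<tau>))] (mod int p)"
        if "\<sigma> \<in> carrier S" "\<tau> \<in> carrier S" for \<sigma> \<tau>
        using b'(2) that by (simp add: \<pi>.hom_mult)
    qed
    show "\<forall>n\<in>N. [\<psi> n = 0] (mod int p)"
    proof
      fix n assume n: "n \<in> N"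
      have "trans_hom b n = trans_hom (\<lambda>g. b' (\<pi> g)) n" by (rule trans_hom_unique[OF f(3) tb n])
      also have "\<dots> = 0" using \<pi>_N[OF n] by (simp add: trans_hom_def)
      finally show "[\<psi> n = 0] (mod int p)" using f(4)[OF n] by (simp add: cong_sym)
    qed
  next
    assume *: "\<forall>n\<in>N. [\<psi> n = 0] (mod int p)"
    have "trans_hom b n = 0" if "n \<in> N" for n
      using cong_trans[OF f(4)[OF that]] *[rule_format, OF that] range[of n] by (simp add: cong_def)
    then have "f \<in> Q.B2" by (rule trans_hom_zero_coboundary[OF f(1,3)])
    then show "h = \<one>\<^bsub>Q.H\<^esub>" using f(1,2) Q.cls_one_iff by simp
  qed
qed

lemma represents_mult:
  assumes "represents h \<psi>" "represents k \<phi>"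
  shows "represents (h \<otimes>\<^bsub>Q.H\<^esub> k) (\<lambda>n. \<psi> n + \<phi> n)"
proof -
  obtain f b where f: "f \<in> cocycles_2 Q TQ (integer_mod_group p)" "h = Q.cls f" "trans_cochain f b"
    "\<And>n. n \<in> N \<Longrightarrow> [trans_hom b n = \<psi> n] (mod int p)" using assms(1) by (rule representsE) blast
  obtain f' b' where f': "f' \<in> cocycles_2 Q TQ (integer_mod_group p)" "k = Q.cls f'" "trans_cochain f' b'"
    "\<And>n. n \<in> N \<Longrightarrow> [trans_hom b' n = \<phi> n] (mod int p)" using assms(2) by (rule representsE) blast
  show ?thesis
  proof (rule representsI[OF Q.cocycle_mult[OF f(1) f'(1)] _ trans_cochain_mult[OF f(3) f'(3)]])
    show "h \<otimes>\<^bsub>Q.H\<^esub> k = Q.cls (f \<otimes>\<^bsub>Q.C2\<^esub> f')"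
      using Q.cls.hom_mult[of f f'] f(1,2) f'(1,2) by (simp add: Q.C2_carrier)
    fix n assume n: "n \<in> N"
    have "[trans_hom (\<lambda>g. (b g + b' g) mod int p) n = (b \<one> + b' \<one>) - (b n + b' n)] (mod int p)"
      unfolding trans_hom_def by (simp add: mod_simps)
    also have "(b \<one> + b' \<one>) - (b n + b' n) = (b \<one> - b n) + (b' \<one> - b' n)" by simp
    also have "[(b \<one> - b n) + (b' \<one> - b' n) = trans_hom b n + trans_hom b' n] (mod int p)"
      unfolding trans_hom_def by (intro cong_add iffD2[OF cong_mod_right] cong_refl)
    also have "[trans_hom b n + trans_hom b' n = \<psi> n + \<phi> n] (mod int p)"
      by (intro cong_add f(4)[OF n] f'(4)[OF n])
    finally show "[trans_hom (\<lambda>g. (b g + b' g) mod int p) n = \<psi> n + \<phi> n] (mod int p)" .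
  qed
qed

lemma represents_one: "represents \<one>\<^bsub>Q.H\<^esub> (\<lambda>_. 0)"
proof -
  obtain f b where *: "represents \<one>\<^bsub>Q.H\<^esub> (trans_hom b)" using represents_exists[OF Q.H.one_closed] by metis
  show ?thesis by (rule represents_cong[OF *]) (use represents_one_iff[OF *] in simp)
qed

text \<open>Every class has some transgression. For the inverse, its sum with \<psi> represents the
  trivial class and therefore vanishes modulo \<open>p\<close>, which determines it.\<close>

lemma represents_inv:
  assumes h: "represents h \<psi>" shows "represents (inv\<^bsub>Q.H\<^esub> h) (\<lambda>n. - \<psi> n)"
proof -
  note hH = represents_carrier[OF h]
  obtain f b where *: "represents (inv\<^bsub>Q.H\<^esub> h) (trans_hom b)"
    using represents_exists[OF Q.H.inv_closed[OF hH]] by metis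
  have "\<forall>n\<in>N. [\<psi> n + trans_hom b n = 0] (mod int p)"
    using represents_one_iff[OF represents_mult[OF h *]] hH by simp
  then have "[trans_hom b n = - \<psi> n] (mod int p)" if "n \<in> N" for n
    using that by (simp add: cong_iff_dvd_diff add.commute)
  then show ?thesis by (rule represents_cong[OF *])
qed

lemma represents_nat_pow:
  fixes k :: nat
  assumes h: "represents h \<psi>" shows "represents (h [^]\<^bsub>Q.H\<^esub> k) (\<lambda>n. int k * \<psi> n)"
proof (induction k)
  case 0
  then show ?case using represents_one by simp
next
  case (Suc k)
  from represents_mult[OF Suc h] show ?case by (simp add: algebra_simps)
qed

lemma represents_int_pow:
  fixes k :: int
  assumes h: "represents h \<psi>" shows "represents (h [^]\<^bsub>Q.H\<^esub> k) (\<lambda>n. k * \<psi> n)"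
proof (cases k)
  case (nonneg n)
  then show ?thesis using represents_nat_pow[OF h, of n] by (simp add: int_pow_int)
next
  case (neg n)
  then show ?thesis
    using represents_inv[OF represents_nat_pow[OF h, of "Suc n"]] represents_carrier[OF h]
    by (simp only: neg Q.H.int_pow_neg int_pow_int mult_minus_left)
qed

text \<open>The set of words may be infinite, but the exponents vanish outside the finite set
  \<open>W'\<close>, to which the product reduces.\<close>

lemma represents_gfinprod:
  assumes fin: "finite W'" and sub: "W' \<subseteq> W" and h: "\<And>w. w \<in> W \<Longrightarrow> represents (h w) (\<psi> w)"
    and c: "\<And>w. \<lbrakk>w \<in> W; w \<notin> W'\<rbrakk> \<Longrightarrow> c w = (0::int)"
  shows "represents (gfinprod Q.H (\<lambda>w. h w [^]\<^bsub>Q.H\<^esub> c w) W) (\<lambda>n. \<Sum>w\<in>W'. c w * \<psi> w n)"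
proof -
  have hc: "(\<lambda>w. h w [^]\<^bsub>Q.H\<^esub> c w) \<in> W \<rightarrow> carrier Q.H" using represents_carrier[OF h] by simp
  have "gfinprod Q.H (\<lambda>w. h w [^]\<^bsub>Q.H\<^esub> c w) W = gfinprod Q.H (\<lambda>w. h w [^]\<^bsub>Q.H\<^esub> c w) W'"
    by (rule Q.H.gfinprod_mono_neutral_cong_right[OF sub _ _ hc]) (use c in simp_all)
  also have "\<dots> = finprod Q.H (\<lambda>w. h w [^]\<^bsub>Q.H\<^esub> c w) W'"
    by (rule Q.H.gfinprod_eq_finprod[OF fin]) (use hc sub in auto)
  also have "represents \<dots> (\<lambda>n. \<Sum>w\<in>W'. c w * \<psi> w n)"
    using fin sub
  proof (induction W' rule: finite_induct)
    case empty
    then show ?case using represents_one by simp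
  next
    case (insert v V)
    have "finprod Q.H (\<lambda>w. h w [^]\<^bsub>Q.H\<^esub> c w) (insert v V) =
        h v [^]\<^bsub>Q.H\<^esub> c v \<otimes>\<^bsub>Q.H\<^esub> finprod Q.H (\<lambda>w. h w [^]\<^bsub>Q.H\<^esub> c w) V"
      using insert hc by (intro Q.H.finprod_insert) auto
    then show ?case
      using represents_mult[OF represents_int_pow[OF h[of v], of "c v"] insert.IH] insert by simp
  qed
  finally show ?thesis .
qed

end

section \<open>The classes attached to words\<close>

lemma induced_quotient_map_eq:
  assumes G: "group G" and H: "group H" and h: "h \<in> hom G H" and N: "subgroup N G" and M: "subgroup M H"
    and NM: "\<And>n. n \<in> N \<Longrightarrow> h n \<in> M" and g: "g \<in> carrier G"
  shows "induced_quotient_map h G N H M (N #>\<^bsub>G\<^esub> g) = M #>\<^bsub>H\<^esub> h g"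
proof -
  interpret G: group G by (rule G)
  interpret H: group H by (rule H)
  have eq: "M #>\<^bsub>H\<^esub> h x = M #>\<^bsub>H\<^esub> h g" if x: "x \<in> N #>\<^bsub>G\<^esub> g" for x
  proof -
    obtain n where n: "n \<in> N" "x = n \<otimes>\<^bsub>G\<^esub> g" using x by (auto simp: r_coset_def)
    have "h x = h n \<otimes>\<^bsub>H\<^esub> h g" using hom_mult[OF h subgroup.mem_carrier[OF N n(1)] g] n(2) by simp
    then have "h x \<in> M #>\<^bsub>H\<^esub> h g" using NM[OF n(1)] by (auto simp: r_coset_def)
    then show ?thesis using H.repr_independence[OF _ hom_in_carrier[OF h g] M] by simp
  qed
  have "(\<lambda>x. M #>\<^bsub>H\<^esub> h x) ` (N #>\<^bsub>G\<^esub> g) = {M #>\<^bsub>H\<^esub> h g}"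
  proof
    show "(\<lambda>x. M #>\<^bsub>H\<^esub> h x) ` (N #>\<^bsub>G\<^esub> g) \<subseteq> {M #>\<^bsub>H\<^esub> h g}" using eq by auto
    show "{M #>\<^bsub>H\<^esub> h g} \<subseteq> (\<lambda>x. M #>\<^bsub>H\<^esub> h x) ` (N #>\<^bsub>G\<^esub> g)" using G.rcos_self[OF g N] by auto
  qed
  moreover have "N #>\<^bsub>G\<^esub> g \<in> carrier (G Mod N)" using g by (simp add: carrier_FactGroup)
  ultimately show ?thesis by (simp add: induced_quotient_map_def)
qed

lemma H2_pullback_cls:
  assumes G: "coho2 G T p" and K: "coho2 K TK p"
    and hom: "\<phi> \<in> hom G K" and cont: "continuous_map T TK \<phi>"
    and f: "f \<in> cocycles_2 K TK (integer_mod_group p)"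
  defines "f' \<equiv> \<lambda>(g, h)\<in>carrier G \<times> carrier G. f (\<phi> g, \<phi> h)"
  shows "f' \<in> cocycles_2 G T (integer_mod_group p)"
    and "H2_pullback G T K TK (integer_mod_group p) \<phi> (coho2.cls K TK p f) = coho2.cls G T p f'"
proof -
  interpret G: coho2 G T p by (rule G)
  interpret K: coho2 K TK p by (rule K)
  let ?P = "\<lambda>f. \<lambda>(g, h)\<in>carrier G \<times> carrier G. f (\<phi> g, \<phi> h)"
  note \<phi>K = hom_in_carrier[OF hom]
  have P: "?P f \<in> cocycles_2 G T (integer_mod_group p)" if f: "f \<in> cocycles_2 K TK (integer_mod_group p)" for f
    unfolding G.cocycles
  proof (intro conjI ballI)
    have c1: "continuous_map (prod_topology T T) TK (\<lambda>z. \<phi> (fst z))"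
      using continuous_map_compose[OF continuous_map_fst[of T T] cont] by (simp add: o_def)
    have c2: "continuous_map (prod_topology T T) TK (\<lambda>z. \<phi> (snd z))"
      using continuous_map_compose[OF continuous_map_snd[of T T] cont] by (simp add: o_def)
    have "continuous_map (prod_topology T T) G.D (\<lambda>z. f (\<phi> (fst z), \<phi> (snd z)))"
      using continuous_map_compose[OF continuous_map_pairedI[OF c1 c2] K.cocycle_continuous[OF f]]
      by (simp add: o_def)
    then show "continuous_map (prod_topology T T) G.D (?P f)"
      by (rule continuous_map_eq) (simp add: split_def mem_Times_iff)
    fix g h k assume ghk: "g \<in> carrier G" "h \<in> carrier G" "k \<in> carrier G"
    then show "[?P f (h, k) + ?P f (g, h \<otimes>\<^bsub>G\<^esub> k) = ?P f (g \<otimes>\<^bsub>G\<^esub> h, k) + ?P f (g, h)] (mod int p)"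
      using K.cocycle_cong[OF f \<phi>K[OF ghk(1)] \<phi>K[OF ghk(2)] \<phi>K[OF ghk(3)]] hom_mult[OF hom] by simp
  qed simp
  show "f' \<in> cocycles_2 G T (integer_mod_group p)" unfolding f'_def by (rule P[OF f])
  have Phom: "?P \<in> hom K.C2 G.C2"
  proof (rule homI)
    show "?P f \<in> carrier G.C2" if "f \<in> carrier K.C2" for f using P that by (simp add: G.C2_carrier K.C2_carrier)
    show "?P (f \<otimes>\<^bsub>K.C2\<^esub> f') = ?P f \<otimes>\<^bsub>G.C2\<^esub> ?P f'" for f f'
      unfolding K.C2_mult G.C2_mult using \<phi>K by (intro restrict_ext) (auto simp: split_def)
  qed
  have PB: "?P f \<in> G.B2" if fB: "f \<in> K.B2" for f
  proof -
    obtain b where b: "continuous_map TK K.D b"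
      "\<forall>g\<in>carrier K. \<forall>h\<in>carrier K. f (g, h) = (b g + b h - b (g \<otimes>\<^bsub>K\<^esub> h)) mod int p"
      using fB unfolding K.coboundaries_iff by auto
    have c: "continuous_map T G.D (b \<circ> \<phi>)" by (rule continuous_map_compose[OF cont b(1)])
    show ?thesis
      unfolding G.coboundaries_iff
      by (intro conjI exI[of _ "b \<circ> \<phi>"] c) (use b(2) \<phi>K hom_mult[OF hom] in simp_all)
  qed
  show "H2_pullback G T K TK (integer_mod_group p) \<phi> (K.cls f) = G.cls f'"
    unfolding H2_pullback_def K.cls_def G.cls_def f'_def
    by (rule induced_quotient_map_eq[OF K.C2.is_group G.C2.is_group Phom K.B2_subgroup G.B2_subgroup PB])
      (use f in \<open>simp_all add: K.C2_carrier\<close>)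
qed

section \<open>The cocycle of the central extension and its class\<close>

context small_word
begin

abbreviation QU where "QU \<equiv> p_quotient U TU p 3"
abbreviation TQU where "TQU \<equiv> p_quotient_topology U TU p 3"
abbreviation \<kappa> where "\<kappa> u \<equiv> U3 #>\<^bsub>U\<^esub> u"

lemma QU_eq: "QU = U Mod U3" "TQU = coset_topology U TU U3"
  by (simp_all add: p_quotient_def p_quotient_topology_def)

sublocale QU: coho2 QU TQU p
proof (intro coho2.intro coho2_axioms.intro)
  show "top_group QU TQU" unfolding QU_eq by (rule tU.top_group_quotient[OF tU.lower_p_central_normal])
qed (use p in simp)

sublocale \<kappa>: group_hom U QU "\<lambda>u. U3 #>\<^bsub>U\<^esub> u"
  unfolding QU_eq
  by (intro group_hom.intro U.is_group normal.factorgroup_is_group group_hom_axioms.intro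
      normal.r_coset_hom_Mod tU.lower_p_central_normal)

lemma U3_subgroup: "subgroup U3 U" by (rule tU.lower_p_central_subgroup)

lemma QU_carrier: "C \<in> carrier QU \<Longrightarrow> \<exists>u\<in>carrier U. C = \<kappa> u"
  by (auto simp: QU_eq carrier_FactGroup)

lemma TQU_discrete: "TQU = discrete_topology (carrier QU)"
  unfolding topology_eq QU_eq openin_coset_topology carrier_FactGroup by (auto simp: TU_def)

lemma continuous_from_TQU: "f \<in> carrier QU \<rightarrow> topspace Y \<Longrightarrow> continuous_map TQU Y f"
  unfolding TQU_discrete by simp

definition sec :: "(nat \<times> nat \<Rightarrow> int) set \<Rightarrow> nat \<times> nat \<Rightarrow> int" where
  "sec C = (SOME u. u \<in> carrier U \<and> C = \<kappa> u)"

lemma sec: "C \<in> carrier QU \<Longrightarrow> sec C \<in> carrier U \<and> \<kappa> (sec C) = C"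
proof -
  assume "C \<in> carrier QU"
  then have "\<exists>u. u \<in> carrier U \<and> C = \<kappa> u" using QU_carrier by auto
  then have "sec C \<in> carrier U \<and> C = \<kappa> (sec C)" unfolding sec_def by (rule someI_ex)
  then show ?thesis by simp
qed

text \<open>The coordinate of \<open>u\<close> in the fibre over its coset, measured from the chosen
  representative. In these coordinates the multiplication of \<open>U\<close> is twisted by the
  extension cocycle.\<close>

definition defect :: "(nat \<times> nat \<Rightarrow> int) \<Rightarrow> int" where
  "defect u = (SOME t. t \<in> {0..<int p} \<and> u = \<iota> t \<otimes>\<^bsub>U\<^esub> sec (\<kappa> u))"

lemma defect:
  assumes u: "u \<in> carrier U"
  shows "defect u \<in> {0..<int p}" and "u = \<iota> (defect u) \<otimes>\<^bsub>U\<^esub> sec (\<kappa> u)"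
proof -
  have s: "sec (\<kappa> u) \<in> carrier U" "\<kappa> (sec (\<kappa> u)) = \<kappa> u" using sec[OF \<kappa>.hom_closed[OF u]] by simp_all
  have "u \<in> \<kappa> (sec (\<kappa> u))" unfolding s(2) by (rule U.rcos_self[OF u U3_subgroup])
  then obtain v where v: "v \<in> U3" "u = v \<otimes>\<^bsub>U\<^esub> sec (\<kappa> u)" unfolding r_coset_def by auto
  obtain t where "t \<in> {0..<int p}" "v = \<iota> t" using U3_\<iota>[OF v(1)] by auto
  then have "\<exists>t. t \<in> {0..<int p} \<and> u = \<iota> t \<otimes>\<^bsub>U\<^esub> sec (\<kappa> u)" using v(2) by auto
  then have "defect u \<in> {0..<int p} \<and> u = \<iota> (defect u) \<otimes>\<^bsub>U\<^esub> sec (\<kappa> u)" unfolding defect_def by (rule someI_ex)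
  then show "defect u \<in> {0..<int p}" "u = \<iota> (defect u) \<otimes>\<^bsub>U\<^esub> sec (\<kappa> u)" by simp_all
qed

lemma \<iota>_cancel:
  assumes "\<iota> t \<otimes>\<^bsub>U\<^esub> v = \<iota> u \<otimes>\<^bsub>U\<^esub> v" "v \<in> carrier U" shows "[t = u] (mod int p)"
proof -
  have "\<iota> t = \<iota> u" using assms U.right_cancel[OF assms(2) \<iota>_carrier \<iota>_carrier] by simp
  then have "corner (\<iota> t) = corner (\<iota> u)" by simp
  then show ?thesis unfolding corner_\<iota> scale_mod using p by (simp add: cong_def)
qed

lemma \<kappa>_\<iota>: "u \<in> carrier U \<Longrightarrow> \<kappa> (\<iota> t \<otimes>\<^bsub>U\<^esub> u) = \<kappa> u"
proof -
  assume u: "u \<in> carrier U"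
  have "\<kappa> (\<iota> t) = \<one>\<^bsub>QU\<^esub>"
    using U.coset_join2[OF \<iota>_carrier U3_subgroup \<iota>_U3] by (simp add: QU_eq one_FactGroup)
  then show ?thesis using \<kappa>.hom_mult[OF \<iota>_carrier u] u by simp
qed

lemma defect_\<iota>:
  assumes u: "u \<in> carrier U" shows "[defect (\<iota> t \<otimes>\<^bsub>U\<^esub> u) = t + defect u] (mod int p)"
proof -
  let ?v = "\<iota> t \<otimes>\<^bsub>U\<^esub> u" and ?s = "sec (\<kappa> u)"
  have v: "?v \<in> carrier U" using u by (simp add: \<iota>_carrier)
  have s: "?s \<in> carrier U" using sec[OF \<kappa>.hom_closed[OF u]] by simp
  have "\<iota> (defect ?v) \<otimes>\<^bsub>U\<^esub> ?s = ?v" using defect(2)[OF v] unfolding \<kappa>_\<iota>[OF u] by (rule sym)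
  also have "\<dots> = \<iota> t \<otimes>\<^bsub>U\<^esub> (\<iota> (defect u) \<otimes>\<^bsub>U\<^esub> ?s)" using defect(2)[OF u] by simp
  also have "\<dots> = \<iota> ((t + defect u) mod int p) \<otimes>\<^bsub>U\<^esub> ?s"
    using s by (simp add: U.m_assoc[symmetric] \<iota>_carrier \<iota>_mult)
  finally have "[defect ?v = (t + defect u) mod int p] (mod int p)" using s by (rule \<iota>_cancel)
  then show ?thesis by simp
qed

definition ext_cocycle :: "(nat \<times> nat \<Rightarrow> int) set \<times> (nat \<times> nat \<Rightarrow> int) set \<Rightarrow> int" where
  "ext_cocycle = (\<lambda>(C, D)\<in>carrier QU \<times> carrier QU. defect (sec C \<otimes>\<^bsub>U\<^esub> sec D))"

text \<open>Central factors are moved to the left and collected. The formula says that minus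
  \<open>defect\<close> bounds the inflation of the cocycle to \<open>U\<close>, from which the
  transgression is computed later.\<close>

lemma ext_cocycle_defect:
  assumes u: "u \<in> carrier U" and v: "v \<in> carrier U"
  shows "[defect (u \<otimes>\<^bsub>U\<^esub> v) = defect u + defect v + ext_cocycle (\<kappa> u, \<kappa> v)] (mod int p)"
proof -
  let ?s = "sec (\<kappa> u)" and ?t = "sec (\<kappa> v)"
  have s: "?s \<in> carrier U" "?t \<in> carrier U" using sec[OF \<kappa>.hom_closed] u v by simp_all
  note i = \<iota>_carrier[of "defect u"] \<iota>_carrier[of "defect v"]
  have "u \<otimes>\<^bsub>U\<^esub> v = (\<iota> (defect u) \<otimes>\<^bsub>U\<^esub> ?s) \<otimes>\<^bsub>U\<^esub> (\<iota> (defect v) \<otimes>\<^bsub>U\<^esub> ?t)"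
    using defect(2)[OF u] defect(2)[OF v] by simp
  also have "\<dots> = \<iota> (defect u) \<otimes>\<^bsub>U\<^esub> (?s \<otimes>\<^bsub>U\<^esub> \<iota> (defect v)) \<otimes>\<^bsub>U\<^esub> ?t"
    using s i by (simp add: U.m_assoc)
  also have "\<dots> = \<iota> (defect u) \<otimes>\<^bsub>U\<^esub> (\<iota> (defect v) \<otimes>\<^bsub>U\<^esub> ?s) \<otimes>\<^bsub>U\<^esub> ?t"
    unfolding \<iota>_central[OF s(1)] ..
  also have "\<dots> = \<iota> (defect u) \<otimes>\<^bsub>U\<^esub> (\<iota> (defect v) \<otimes>\<^bsub>U\<^esub> (?s \<otimes>\<^bsub>U\<^esub> ?t))"
    using s i by (simp add: U.m_assoc)
  finally have uv: "u \<otimes>\<^bsub>U\<^esub> v = \<iota> (defect u) \<otimes>\<^bsub>U\<^esub> (\<iota> (defect v) \<otimes>\<^bsub>U\<^esub> (?s \<otimes>\<^bsub>U\<^esub> ?t))" .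
  have "[defect (u \<otimes>\<^bsub>U\<^esub> v) = defect u + defect (\<iota> (defect v) \<otimes>\<^bsub>U\<^esub> (?s \<otimes>\<^bsub>U\<^esub> ?t))] (mod int p)"
    unfolding uv using s i by (intro defect_\<iota>) simp
  also have "[defect u + defect (\<iota> (defect v) \<otimes>\<^bsub>U\<^esub> (?s \<otimes>\<^bsub>U\<^esub> ?t)) =
      defect u + (defect v + defect (?s \<otimes>\<^bsub>U\<^esub> ?t))] (mod int p)"
    using s by (intro cong_add cong_refl defect_\<iota>) simp
  also have "defect u + (defect v + defect (?s \<otimes>\<^bsub>U\<^esub> ?t)) = defect u + defect v + ext_cocycle (\<kappa> u, \<kappa> v)"
    using u v by (simp add: ext_cocycle_def)
  finally show ?thesis .
qed

text \<open>Both bracketings of a triple product are expanded by \<open>ext_cocycle_defect\<close>;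
  the defects of the factors cancel and the cocycle relation remains.\<close>

lemma ext_cocycle: "ext_cocycle \<in> cocycles_2 QU TQU (integer_mod_group p)"
  unfolding QU.cocycles
proof (intro conjI ballI)
  have r: "ext_cocycle (C, D) \<in> {0..<int p}" if "C \<in> carrier QU" "D \<in> carrier QU" for C D
    using that defect(1)[OF U.m_closed] sec by (simp add: ext_cocycle_def)
  show "continuous_map (prod_topology TQU TQU) QU.D ext_cocycle"
    unfolding TQU_discrete prod_topology_discrete_topology[symmetric] using r by auto
  fix C D E assume CDE: "C \<in> carrier QU" "D \<in> carrier QU" "E \<in> carrier QU"
  obtain u where u: "u \<in> carrier U" "C = \<kappa> u" using QU_carrier[OF CDE(1)] by auto
  obtain v where v: "v \<in> carrier U" "D = \<kappa> v" using QU_carrier[OF CDE(2)] by auto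
  obtain w where w: "w \<in> carrier U" "E = \<kappa> w" using QU_carrier[OF CDE(3)] by auto
  have m: "D \<otimes>\<^bsub>QU\<^esub> E = \<kappa> (v \<otimes>\<^bsub>U\<^esub> w)" "C \<otimes>\<^bsub>QU\<^esub> D = \<kappa> (u \<otimes>\<^bsub>U\<^esub> v)" using u v w by (simp_all add: \<kappa>.hom_mult)
  have "[defect (u \<otimes>\<^bsub>U\<^esub> v \<otimes>\<^bsub>U\<^esub> w) = defect (u \<otimes>\<^bsub>U\<^esub> v) + defect w + ext_cocycle (\<kappa> (u \<otimes>\<^bsub>U\<^esub> v), \<kappa> w)] (mod int p)"
    using u v w by (intro ext_cocycle_defect) simp_all
  also have "[defect (u \<otimes>\<^bsub>U\<^esub> v) + defect w + ext_cocycle (\<kappa> (u \<otimes>\<^bsub>U\<^esub> v), \<kappa> w) =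
      (defect u + defect v + ext_cocycle (\<kappa> u, \<kappa> v)) + defect w + ext_cocycle (\<kappa> (u \<otimes>\<^bsub>U\<^esub> v), \<kappa> w)] (mod int p)"
    using u v by (intro cong_add cong_refl ext_cocycle_defect)
  finally have 1: "[defect (u \<otimes>\<^bsub>U\<^esub> v \<otimes>\<^bsub>U\<^esub> w) =
      (defect u + defect v + ext_cocycle (\<kappa> u, \<kappa> v)) + defect w + ext_cocycle (\<kappa> (u \<otimes>\<^bsub>U\<^esub> v), \<kappa> w)] (mod int p)" .
  have "[defect (u \<otimes>\<^bsub>U\<^esub> (v \<otimes>\<^bsub>U\<^esub> w)) = defect u + defect (v \<otimes>\<^bsub>U\<^esub> w) + ext_cocycle (\<kappa> u, \<kappa> (v \<otimes>\<^bsub>U\<^esub> w))] (mod int p)"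
    using u v w by (intro ext_cocycle_defect) simp_all
  also have "[defect u + defect (v \<otimes>\<^bsub>U\<^esub> w) + ext_cocycle (\<kappa> u, \<kappa> (v \<otimes>\<^bsub>U\<^esub> w)) =
      defect u + (defect v + defect w + ext_cocycle (\<kappa> v, \<kappa> w)) + ext_cocycle (\<kappa> u, \<kappa> (v \<otimes>\<^bsub>U\<^esub> w))] (mod int p)"
    using v w by (intro cong_add cong_refl ext_cocycle_defect)
  finally have "[defect u + (defect v + defect w + ext_cocycle (\<kappa> v, \<kappa> w)) + ext_cocycle (\<kappa> u, \<kappa> (v \<otimes>\<^bsub>U\<^esub> w)) =
      (defect u + defect v + ext_cocycle (\<kappa> u, \<kappa> v)) + defect w + ext_cocycle (\<kappa> (u \<otimes>\<^bsub>U\<^esub> v), \<kappa> w)] (mod int p)"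
    using cong_trans[OF cong_sym 1] u v w by (simp add: U.m_assoc)
  then show "[ext_cocycle (D, E) + ext_cocycle (C, D \<otimes>\<^bsub>QU\<^esub> E) =
      ext_cocycle (C \<otimes>\<^bsub>QU\<^esub> D, E) + ext_cocycle (C, D)] (mod int p)"
    unfolding m unfolding u(2) v(2) w(2) by (simp add: cong_iff_dvd_diff algebra_simps)
qed (simp add: ext_cocycle_def)

text \<open>Measuring another section \<open>s\<close> against \<open>sec\<close> by the defect
  gives a cochain whose coboundary is the difference of the two factor sets.\<close>

lemma factor_set_cls:
  assumes f: "f \<in> cocycles_2 QU TQU (integer_mod_group p)" and fs: "factor_set \<iota> U TU \<kappa> QU TQU f"
  shows "QU.cls f = QU.cls ext_cocycle"
proof -
  obtain s where s: "continuous_map TQU TU s" "\<forall>C\<in>carrier QU. \<kappa> (s C) = C"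
    "\<forall>C\<in>carrier QU. \<forall>D\<in>carrier QU. s C \<otimes>\<^bsub>U\<^esub> s D = \<iota> (f (C, D)) \<otimes>\<^bsub>U\<^esub> s (C \<otimes>\<^bsub>QU\<^esub> D)"
    using fs unfolding factor_set_def by auto
  have sU: "s C \<in> carrier U" if "C \<in> carrier QU" for C
    using subsetD[OF continuous_map_image_subset_topspace[OF s(1)] imageI, of C] that by simp
  define b where "b C = defect (s C)" for C
  have "continuous_map TQU QU.D b"
    by (rule continuous_from_TQU) (use defect(1)[OF sU] in \<open>auto simp: b_def\<close>)
  then show ?thesis
  proof (rule QU.cls_eqI[OF f ext_cocycle])
    fix C D assume CD: "C \<in> carrier QU" "D \<in> carrier QU"
    have 1: "[defect (s C \<otimes>\<^bsub>U\<^esub> s D) = b C + b D + ext_cocycle (C, D)] (mod int p)"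
      using ext_cocycle_defect[OF sU[OF CD(1)] sU[OF CD(2)]] s(2) CD by (simp add: b_def)
    have 2: "[defect (s C \<otimes>\<^bsub>U\<^esub> s D) = f (C, D) + b (C \<otimes>\<^bsub>QU\<^esub> D)] (mod int p)"
      using defect_\<iota>[OF sU[OF QU.m_closed[OF CD]], of "f (C, D)"] s(3) CD by (simp add: b_def)
    have "[f (C, D) + b (C \<otimes>\<^bsub>QU\<^esub> D) = b C + b D + ext_cocycle (C, D)] (mod int p)"
      by (rule cong_trans[OF cong_sym[OF 2] 1])
    then show "[f (C, D) = ext_cocycle (C, D) + (b C + b D - b (C \<otimes>\<^bsub>QU\<^esub> D))] (mod int p)"
      by (simp add: cong_iff_dvd_diff algebra_simps)
  qed
qed

lemma factor_set_ext_cocycle: "factor_set \<iota> U TU \<kappa> QU TQU ext_cocycle"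
  unfolding factor_set_def
proof (intro exI[of _ sec] conjI ballI)
  show "continuous_map TQU TU sec" by (rule continuous_from_TQU) (use sec in \<open>auto simp: TU_def\<close>)
  show "\<kappa> (sec C) = C" if "C \<in> carrier QU" for C using sec[OF that] by simp
  show "sec C \<otimes>\<^bsub>U\<^esub> sec D = \<iota> (ext_cocycle (C, D)) \<otimes>\<^bsub>U\<^esub> sec (C \<otimes>\<^bsub>QU\<^esub> D)"
    if "C \<in> carrier QU" "D \<in> carrier QU" for C D
  proof -
    have s: "sec C \<in> carrier U" "sec D \<in> carrier U" using sec that by simp_all
    have "\<kappa> (sec C \<otimes>\<^bsub>U\<^esub> sec D) = C \<otimes>\<^bsub>QU\<^esub> D" using s sec that by (simp add: \<kappa>.hom_mult)
    then show ?thesis using defect(2)[OF U.m_closed[OF s]] that by (simp add: ext_cocycle_def)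
  qed
qed

text \<open>The two preceding lemmas provide the uniqueness and the existence behind the definite
  description in \<open>extension_class\<close>.\<close>

lemma gamma_class_eq: "gamma_class p 3 (length w) = QU.cls ext_cocycle"
proof -
  have "(THE c. c \<in> carrier QU.H \<and> (\<exists>f\<in>c. factor_set \<iota> U TU \<kappa> QU TQU f)) = QU.cls ext_cocycle"
  proof (rule the_equality)
    show "QU.cls ext_cocycle \<in> carrier QU.H \<and> (\<exists>f\<in>QU.cls ext_cocycle. factor_set \<iota> U TU \<kappa> QU TQU f)"
      using ext_cocycle QU.mem_cls[OF ext_cocycle] factor_set_ext_cocycle by (auto simp: QU.H_carrier)
    fix c assume "c \<in> carrier QU.H \<and> (\<exists>f\<in>c. factor_set \<iota> U TU \<kappa> QU TQU f)"
    then obtain f g where "g \<in> cocycles_2 QU TQU (integer_mod_group p)" "c = QU.cls g" "f \<in> c"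
      "factor_set \<iota> U TU \<kappa> QU TQU f" by (auto simp: QU.H_carrier)
    then show "c = QU.cls ext_cocycle" using QU.cls_eq[of g f] factor_set_cls by auto
  qed
  then show ?thesis by (simp add: gamma_class_def extension_class_def Let_def U_def[symmetric] TU_def[symmetric])
qed

end

section \<open>Transgression of the classes attached to words\<close>

context free_mod_p
begin

text \<open>On \<open>N\<close> the corner is a multiple of p^(3-|w|), and dividing by this power is
  the identification of the central subgroup with Z/p. Elsewhere the value has no meaning.\<close>

definition pairing :: "'a list \<Rightarrow> 'a \<Rightarrow> int" where
  "pairing w n = (rho_word p 3 S T X w n (1, length w + 1)) div int p ^ (3 - length w)"

text \<open>The class is pulled back from the unitriangular group, and its inflation is bounded by
  minus the defect of \<rho>. On \<open>N\<close> the matrix \<rho> is central, so its defect is the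
  normalized corner up to the defect of 1. Values on basic elements come from the corners of the
  letter matrices.\<close>

lemma alpha_class_represents:
  assumes wX: "w \<in> lists X" and lw: "length w \<in> {1, 2, 3}"
  shows "represents (alpha_class p 3 S T X w) (pairing w)"
    and "x \<in> X \<Longrightarrow> [pairing w (x [^] (p * p)) = letter_pairing w x] (mod int p)"
    and "\<lbrakk>x \<in> X; y \<in> X\<rbrakk> \<Longrightarrow> [pairing w (grp_comm S x y [^] p) = comm_pairing w x y] (mod int p)"
    and "\<lbrakk>x \<in> X; y \<in> X; z \<in> X\<rbrakk> \<Longrightarrow>
           [pairing w (grp_comm S (grp_comm S x y) z) = triple_comm_pairing w x y z] (mod int p)"
proof -
  define U where "U = word_unitriangular p 3 (length w)"
  define TU where "TU = discrete_topology (carrier U)"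
  interpret W: small_word p w U TU
    by unfold_locales (use prime_p p3 lw U_def TU_def in simp_all)
  define \<rho> where "\<rho> = rho_word p 3 S T X w"
  have p1: "p > 1" using p3 by simp
  have \<rho>: "\<rho> \<sigma> = magnus_rep W.modulus w \<sigma>" if "\<sigma> \<in> carrier S" for \<sigma>
    unfolding \<rho>_def W.modulus_def by (rule rho_word_eq[OF p1 wX that])
  have hom: "\<rho> \<in> hom S U"
    using magnus_rep_hom[OF W.modulus(1), of w] \<rho> unfolding W.U_eq[symmetric] hom_def by (auto simp: Pi_iff)
  have cont: "continuous_map T TU \<rho>"
    by (rule continuous_map_eq[OF magnus_rep_continuous[OF W.modulus(1), of w, folded W.U_eq TU_def]]) (simp add: \<rho>)
  interpret \<rho>: group_hom S U \<rho> by (intro group_hom.intro is_group W.U.is_group group_hom_axioms.intro hom)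
  have \<rho>N: "\<rho> n \<in> W.U3" if "n \<in> N" for n
    using hom_lower_p_central[OF top_group_axioms W.tU.top_group_axioms hom cont, of n p "Suc (Suc 0)"] that
    by (simp only: numeral_3_eq_3)
  define \<rho>' where "\<rho>' = induced_quotient_map \<rho> S N U W.U3"
  have \<rho>'_\<pi>: "\<rho>' (\<pi> \<sigma>) = W.\<kappa> (\<rho> \<sigma>)" if "\<sigma> \<in> carrier S" for \<sigma>
    unfolding \<rho>'_def
    by (rule induced_quotient_map_eq[OF is_group W.U.is_group hom N_subgroup W.U3_subgroup \<rho>N that])
  have hom': "\<rho>' \<in> hom Q W.QU"
  proof (rule homI)
    fix C assume "C \<in> carrier Q"
    then obtain \<sigma> where "\<sigma> \<in> carrier S" "C = \<pi> \<sigma>" using Q_carrier by auto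
    then show "\<rho>' C \<in> carrier W.QU" using \<rho>'_\<pi> by simp
  next
    fix C D assume CD: "C \<in> carrier Q" "D \<in> carrier Q"
    obtain \<sigma> where s: "\<sigma> \<in> carrier S" "C = \<pi> \<sigma>" using Q_carrier[OF CD(1)] by auto
    obtain \<tau> where t: "\<tau> \<in> carrier S" "D = \<pi> \<tau>" using Q_carrier[OF CD(2)] by auto
    have "\<rho>' (C \<otimes>\<^bsub>Q\<^esub> D) = \<rho>' (\<pi> (\<sigma> \<otimes> \<tau>))" using s t by (simp add: \<pi>.hom_mult)
    also have "\<dots> = W.\<kappa> (\<rho> (\<sigma> \<otimes> \<tau>))" by (rule \<rho>'_\<pi>) (use s t in simp)
    also have "\<dots> = \<rho>' C \<otimes>\<^bsub>W.QU\<^esub> \<rho>' D" using s t by (simp add: \<rho>'_\<pi>)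
    finally show "\<rho>' (C \<otimes>\<^bsub>Q\<^esub> D) = \<rho>' C \<otimes>\<^bsub>W.QU\<^esub> \<rho>' D" .
  qed
  have cont': "continuous_map TQ W.TQU \<rho>'"
  proof (rule continuous_compose_quotient_map[OF \<pi>_quotient])
    have "continuous_map (discrete_topology (carrier U)) W.TQU (\<lambda>u. W.\<kappa> u)"
      unfolding continuous_map_from_discrete_topology W.QU.topspace_eq using W.\<kappa>.hom_closed by auto
    from continuous_map_compose[OF cont[unfolded TU_def] this] show "continuous_map T W.TQU (\<rho>' \<circ> (\<lambda>g. N #> g))"
      by (rule continuous_map_eq) (simp add: \<rho>'_\<pi>)
  qed
  define f where "f = (\<lambda>(C, D)\<in>carrier Q \<times> carrier Q. W.ext_cocycle (\<rho>' C, \<rho>' D))"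
  note pb = H2_pullback_cls[OF Q.coho2_axioms W.QU.coho2_axioms hom' cont' W.ext_cocycle, folded f_def]
  have alpha: "alpha_class p 3 S T X w = Q.cls f"
    using pb(2) unfolding alpha_class_def Let_def U_def[symmetric] TU_def[symmetric] \<rho>_def[symmetric]
      \<rho>'_def[symmetric] W.gamma_class_eq .
  define b where "b = (\<lambda>\<sigma>. (- W.defect (\<rho> \<sigma>)) mod int p)"
  have b: "trans_cochain f b"
    unfolding trans_cochain_def
  proof (intro conjI ballI)
    have "continuous_map TU Q.D (\<lambda>u. (- W.defect u) mod int p)" unfolding TU_def using p3 by simp
    from continuous_map_compose[OF cont this] show "continuous_map T Q.D b" by (simp add: b_def o_def)
    fix \<sigma> \<tau> assume st: "\<sigma> \<in> carrier S" "\<tau> \<in> carrier S"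
    have e: "[W.defect (\<rho> (\<sigma> \<otimes> \<tau>)) = W.defect (\<rho> \<sigma>) + W.defect (\<rho> \<tau>) + f (\<pi> \<sigma>, \<pi> \<tau>)] (mod int p)"
      using W.ext_cocycle_defect[OF \<rho>.hom_closed[OF st(1)] \<rho>.hom_closed[OF st(2)]] st
      by (simp add: f_def \<rho>'_\<pi>)
    have "[b \<sigma> + b \<tau> - b (\<sigma> \<otimes> \<tau>) = - W.defect (\<rho> \<sigma>) + - W.defect (\<rho> \<tau>) - - W.defect (\<rho> (\<sigma> \<otimes> \<tau>))] (mod int p)"
      unfolding b_def by (intro cong_add cong_diff iffD2[OF cong_mod_left] cong_refl)
    also have "[- W.defect (\<rho> \<sigma>) + - W.defect (\<rho> \<tau>) - - W.defect (\<rho> (\<sigma> \<otimes> \<tau>)) =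
        - W.defect (\<rho> \<sigma>) + - W.defect (\<rho> \<tau>) - - (W.defect (\<rho> \<sigma>) + W.defect (\<rho> \<tau>) + f (\<pi> \<sigma>, \<pi> \<tau>))] (mod int p)"
      by (intro cong_diff cong_uminus cong_refl e)
    finally show "[f (\<pi> \<sigma>, \<pi> \<tau>) = b \<sigma> + b \<tau> - b (\<sigma> \<otimes> \<tau>)] (mod int p)" by (simp add: cong_sym)
  qed
  have pe: "int p ^ (3 - length w) \<noteq> 0" using p3 by simp
  have \<iota>: "W.\<iota> (pairing w n) = \<rho> n" if n: "n \<in> N" for n
  proof -
    obtain t where t: "t \<in> {0..<int p}" "\<rho> n = W.\<iota> t" using W.U3_\<iota>[OF \<rho>N[OF n]] by auto
    have "pairing w n = t"
      unfolding pairing_def \<rho>_def[symmetric] t(2) W.corner_\<iota> W.scale_mod using pe t(1) by simp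
    then show ?thesis using t(2) by simp
  qed
  have pairing_hom: "[trans_hom b n = pairing w n] (mod int p)" if n: "n \<in> N" for n
  proof -
    have "\<rho> n \<in> carrier U" by (rule subgroup.mem_carrier[OF W.U3_subgroup \<rho>N[OF n]])
    then have "[W.defect (\<rho> n) = pairing w n + W.defect \<one>\<^bsub>U\<^esub>] (mod int p)"
      using W.defect_\<iota>[OF W.U.one_closed, of "pairing w n"] by (simp add: \<iota>[OF n])
    then have "[- W.defect \<one>\<^bsub>U\<^esub> - - W.defect (\<rho> n) =
        - W.defect \<one>\<^bsub>U\<^esub> - - (pairing w n + W.defect \<one>\<^bsub>U\<^esub>)] (mod int p)"
      by (intro cong_diff cong_uminus cong_refl)
    moreover have "[trans_hom b n = - W.defect \<one>\<^bsub>U\<^esub> - - W.defect (\<rho> n)] (mod int p)"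
      unfolding trans_hom_def b_def \<rho>.hom_one
      by (intro iffD2[OF cong_mod_left] cong_diff cong_refl)
    ultimately have "[trans_hom b n = - W.defect \<one>\<^bsub>U\<^esub> - - (pairing w n + W.defect \<one>\<^bsub>U\<^esub>)] (mod int p)"
      by (rule cong_trans[rotated])
    then show ?thesis by simp
  qed
  show "represents (alpha_class p 3 S T X w) (pairing w)"
    by (rule representsI[OF pb(1) alpha b pairing_hom])
  \<comment> \<open>A congruence of corners modulo p^(4-|w|) between multiples of p^(3-|w|) becomes
    a congruence modulo \<open>p\<close> after division.\<close>
  have val: "[pairing w n = v] (mod int p)"
    if n: "n \<in> N" and v: "[W.corner (\<rho> n) = int p ^ (3 - length w) * v] (mod W.modulus)" for n v
  proof -
    have "W.corner (\<rho> n) = (pairing w n mod int p) * int p ^ (3 - length w)"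
      unfolding \<iota>[OF n, symmetric] W.corner_\<iota> W.scale_mod ..
    then have "((pairing w n mod int p) * int p ^ (3 - length w)) mod W.modulus = (v * int p ^ (3 - length w)) mod W.modulus"
      using v by (simp add: cong_def mult.commute)
    then show ?thesis unfolding W.scale_mod cong_def using pe p3 by simp
  qed
  note XS = subsetD[OF X_carrier]
  have \<rho>x: "\<rho> x = W.letter x" if "x \<in> X" for x using \<rho>[OF XS[OF that]] magnus_rep_letter[OF W.modulus(1) that] by simp
  show "[pairing w (x [^] (p * p)) = letter_pairing w x] (mod int p)" if x: "x \<in> X"
    by (rule val[OF lower_p_central_3_elements(1)[OF XS[OF x]]])
      (use W.corner_values(1)[of x] XS[OF x] in \<open>simp only: \<rho>.hom_nat_pow \<rho>x[OF x]\<close>)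
  show "[pairing w (grp_comm S x y [^] p) = comm_pairing w x y] (mod int p)" if x: "x \<in> X" and y: "y \<in> X"
    by (rule val[OF lower_p_central_3_elements(2)[OF XS[OF x] XS[OF y]]])
      (use W.corner_values(2)[of x y] XS[OF x] XS[OF y] in
        \<open>simp only: grp_comm_closed \<rho>.hom_nat_pow \<rho>.hom_grp_comm \<rho>x[OF x] \<rho>x[OF y]\<close>)
  show "[pairing w (grp_comm S (grp_comm S x y) z) = triple_comm_pairing w x y z] (mod int p)"
    if x: "x \<in> X" and y: "y \<in> X" and z: "z \<in> X"
    by (rule val[OF lower_p_central_3_elements(3)[OF XS[OF x] XS[OF y] XS[OF z]]])
      (use W.corner_values(3)[of x y z] XS[OF x] XS[OF y] XS[OF z] in
        \<open>simp only: grp_comm_closed \<rho>.hom_grp_comm \<rho>x[OF x] \<rho>x[OF y] \<rho>x[OF z]\<close>)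
qed

end

section \<open>Shuffle relations\<close>

text \<open>The conditions on the coefficients \<open>c\<close> for \<open>\<Sum>\<^sub>w c\<^sub>w \<alpha>\<^sub>w\<close> to pair to \<open>0\<close> with all
  \<open>x\<^bsup>p\<^sup>2\<^esup>\<close>, \<open>[x, y]\<^bsup>p\<^esup>\<close> and \<open>[[x, y], z]\<close>.\<close>

definition lie_trivial :: "nat \<Rightarrow> 'a set \<Rightarrow> ('a list \<Rightarrow> int) \<Rightarrow> bool" where
  "lie_trivial p X c \<longleftrightarrow>
     (\<forall>x\<in>X. [c [x] = 0] (mod int p)) \<and>
     (\<forall>x\<in>X. \<forall>y\<in>X. [c [x, y] - c [y, x] = 0] (mod int p)) \<and>
     (\<forall>x\<in>X. \<forall>y\<in>X. \<forall>z\<in>X. [c [x, y, z] - c [y, x, z] - c [z, x, y] + c [z, y, x] = 0] (mod int p))"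

abbreviation all_words :: "'a set \<Rightarrow> 'a list set" where
  "all_words X \<equiv> words X 1 \<union> words X 2 \<union> words X 3"

abbreviation word_group :: "'a set \<Rightarrow> ('a list \<Rightarrow>\<^sub>0 int) monoid" where
  "word_group X \<equiv> free_Abelian_group (all_words X)"

definition sh2 :: "'a \<Rightarrow> 'a \<Rightarrow> 'a list \<Rightarrow>\<^sub>0 int" where
  "sh2 x y = frag_of [x, y] + frag_of [y, x]"

text \<open>The shuffle product of the word xy with the letter z.\<close>

definition sh3 :: "'a \<Rightarrow> 'a \<Rightarrow> 'a \<Rightarrow> 'a list \<Rightarrow>\<^sub>0 int" where
  "sh3 x y z = frag_of [x, y, z] + frag_of [x, z, y] + frag_of [z, x, y]"

text \<open>Multiples of \<open>p\<close> are included because coefficients are kept in the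
  integers; a congruence modulo \<open>p\<close> thus becomes membership in a subgroup.\<close>

definition shuffle_generators :: "nat \<Rightarrow> 'a set \<Rightarrow> ('a list \<Rightarrow>\<^sub>0 int) set" where
  "shuffle_generators p X = {frag_cmul (int p) (frag_of w) | w. w \<in> all_words X} \<union>
     {sh2 x y | x y. x \<in> X \<and> y \<in> X} \<union> {sh3 x y z | x y z. x \<in> X \<and> y \<in> X \<and> z \<in> X}"

text \<open>An indicator that stays folded under simplification, so that equations between words
  survive inside it and can be matched up to a permutation of the letters.\<close>

definition \<delta> :: "bool \<Rightarrow> int" where "\<delta> b = (if b then 1 else 0)"

lemma lookup_frag_of: "Poly_Mapping.lookup (frag_of a) b = \<delta> (a = b)"
  by (simp add: lookup_single \<delta>_def when_def)

lemma words_simps: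
  "[x] \<in> words X k \<longleftrightarrow> x \<in> X \<and> k = 1"
  "[x, y] \<in> words X k \<longleftrightarrow> x \<in> X \<and> y \<in> X \<and> k = 2"
  "[x, y, z] \<in> words X k \<longleftrightarrow> x \<in> X \<and> y \<in> X \<and> z \<in> X \<and> k = 3"
  by (auto simp: words_def)

lemma all_words_cases:
  assumes "w \<in> all_words X"
  obtains x where "w = [x]" "x \<in> X" | x y where "w = [x, y]" "x \<in> X" "y \<in> X"
    | x y z where "w = [x, y, z]" "x \<in> X" "y \<in> X" "z \<in> X"
  using assms by (auto simp: words_def length_Suc_conv numeral_2_eq_2 numeral_3_eq_3)

lemma keys_sh2: "\<lbrakk>x \<in> X; y \<in> X\<rbrakk> \<Longrightarrow> Poly_Mapping.keys (sh2 x y) \<subseteq> words X 2"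
  unfolding sh2_def using keys_add[of "frag_of [x, y]" "frag_of [y, x]"] by (auto simp: words_simps)

lemma keys_sh3:
  assumes "x \<in> X" "y \<in> X" "z \<in> X" shows "Poly_Mapping.keys (sh3 x y z) \<subseteq> words X 3"
proof -
  have "Poly_Mapping.keys (sh3 x y z) \<subseteq> {[x, y, z]} \<union> {[x, z, y]} \<union> {[z, x, y]}"
    unfolding sh3_def
    using keys_add[of "frag_of [x, y, z] + frag_of [x, z, y]" "frag_of [z, x, y]"]
      keys_add[of "frag_of [x, y, z]" "frag_of [x, z, y]"] by auto
  then show ?thesis using assms by (auto simp: words_simps)
qed

lemma shuffle_generators_carrier: "shuffle_generators p X \<subseteq> carrier (word_group X)"
proof
  fix g assume "g \<in> shuffle_generators p X"
  then consider w where "g = frag_cmul (int p) (frag_of w)" "w \<in> all_words X"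
    | x y where "g = sh2 x y" "x \<in> X" "y \<in> X" | x y z where "g = sh3 x y z" "x \<in> X" "y \<in> X" "z \<in> X"
    unfolding shuffle_generators_def by blast
  then show "g \<in> carrier (word_group X)"
  proof cases
    case 1
    then show ?thesis using keys_cmul[of "int p" "frag_of w"] by auto
  next
    case 2
    then show ?thesis using keys_sh2[of x X y] by auto
  next
    case 3
    then show ?thesis using keys_sh3[of x X y z] by auto
  qed
qed

lemma subgroup_free_Abelian:
  assumes "subgroup K (free_Abelian_group W)"
  shows subgroup_frag_zero: "0 \<in> K"
    and subgroup_frag_add: "\<And>a b. \<lbrakk>a \<in> K; b \<in> K\<rbrakk> \<Longrightarrow> a + b \<in> K"
    and subgroup_frag_diff: "\<And>a b. \<lbrakk>a \<in> K; b \<in> K\<rbrakk> \<Longrightarrow> a - b \<in> K"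
    and subgroup_frag_cmul: "\<And>a n. a \<in> K \<Longrightarrow> frag_cmul n a \<in> K"
    and subgroup_frag_sum: "\<And>f I. (\<And>i. i \<in> I \<Longrightarrow> f i \<in> K) \<Longrightarrow> sum f I \<in> K"
proof -
  show 0: "0 \<in> K" using subgroup.one_closed[OF assms] by simp
  show add: "a + b \<in> K" if "a \<in> K" "b \<in> K" for a b using subgroup.m_closed[OF assms that] by simp
  have neg: "- a \<in> K" if "a \<in> K" for a
    using subgroup.m_inv_closed[OF assms that] subgroup.mem_carrier[OF assms that] by simp
  show "a - b \<in> K" if "a \<in> K" "b \<in> K" for a b using add[OF that(1) neg[OF that(2)]] by simp
  have nat: "frag_cmul (int n) a \<in> K" if "a \<in> K" for a n
    using that 0 add by (induction n) (simp_all add: frag_cmul_distrib)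
  show "frag_cmul n a \<in> K" if "a \<in> K" for a n
  proof (cases n rule: int_cases2)
    case (nonpos m)
    show ?thesis unfolding nonpos using neg[OF nat[OF that, of m]] by simp
  qed (use nat[OF that] in simp)
  show "sum f I \<in> K" if "\<And>i. i \<in> I \<Longrightarrow> f i \<in> K" for f :: "'c \<Rightarrow> 'a \<Rightarrow>\<^sub>0 int" and I
    using that by (induction I rule: infinite_finite_induct) (simp_all add: 0 add)
qed

lemma sum_delta_keys:
  "(\<Sum>w\<in>Poly_Mapping.keys c. Poly_Mapping.lookup c w * \<delta> (w = v)) = Poly_Mapping.lookup c v"
proof -
  have "(\<Sum>w\<in>Poly_Mapping.keys c. Poly_Mapping.lookup c w * \<delta> (w = v)) =
      (\<Sum>w\<in>Poly_Mapping.keys c. if w = v then Poly_Mapping.lookup c w else 0)"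
    by (intro sum.cong) (simp_all add: \<delta>_def)
  then show ?thesis by (simp add: in_keys_iff)
qed

lemma lookup_sum_frag:
  "Poly_Mapping.lookup (\<Sum>i\<in>I. frag_cmul (a i) (f i)) v = (\<Sum>i\<in>I. a i * Poly_Mapping.lookup (f i) v)"
  by (induction I rule: infinite_finite_induct) (simp_all add: lookup_add)

text \<open>For the adjoint \<open>\<ell>\<^sup>*\<close> of the Dynkin operator, \<open>3abe - \<ell>\<^sup>*(abe)\<close> is the combination
  \<open>a\<squnion>be + e\<squnion>ab - a\<squnion>eb\<close> of shuffles, and \<open>2ab - \<ell>\<^sup>*(ab) = a\<squnion>b\<close>; \<open>k2\<close> and \<open>k3\<close> are inverses of
  \<open>2\<close> and \<open>3\<close> modulo \<open>p\<close>.  If \<open>c\<close> is orthogonal to the Lie elements, the terms \<open>\<ell>\<^sup>*\<close> cancel in the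
  sum over \<open>w\<close>.\<close>

definition dynkin_correction :: "int \<Rightarrow> int \<Rightarrow> 'a list \<Rightarrow> 'a list \<Rightarrow>\<^sub>0 int" where
  "dynkin_correction k2 k3 w =
     (if length w = 2 then frag_cmul k2 (sh2 (w ! 0) (w ! 1))
      else if length w = 3 then frag_cmul k3 (sh3 (w ! 1) (w ! 2) (w ! 0) + sh3 (w ! 0) (w ! 1) (w ! 2)
                                              - sh3 (w ! 2) (w ! 1) (w ! 0))
      else 0)"

lemma lookup_dynkin_correction_1: "Poly_Mapping.lookup (dynkin_correction k2 k3 w) [x] = 0"
  by (simp add: dynkin_correction_def sh2_def sh3_def lookup_add lookup_minus lookup_frag_of \<delta>_def)

lemma lookup_dynkin_correction_2:
  "Poly_Mapping.lookup (dynkin_correction k2 k3 w) [x, y] = k2 * (\<delta> (w = [x, y]) + \<delta> (w = [y, x]))"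
proof -
  consider a b where "w = [a, b]" | "length w \<noteq> 2" by (auto simp: length_Suc_conv numeral_2_eq_2)
  then show ?thesis
  proof cases
    case 1
    have "([b, a] = [x, y]) = ([a, b] = [y, x])" by auto
    then have e: "\<delta> ([b, a] = [x, y]) = \<delta> ([a, b] = [y, x])" by (rule arg_cong)
    have dc: "dynkin_correction k2 k3 [a, b] = frag_cmul k2 (sh2 a b)" by (simp add: dynkin_correction_def)
    have l: "Poly_Mapping.lookup (dynkin_correction k2 k3 [a, b]) [x, y] =
        k2 * (\<delta> ([a, b] = [x, y]) + \<delta> ([b, a] = [x, y]))"
      unfolding dc by (simp only: sh2_def lookup_add lookup_frag_of lookup_frag_cmul)
    show ?thesis unfolding 1 l e ..
  next
    case 2
    then have "\<delta> (w = [x, y]) = 0" "\<delta> (w = [y, x]) = 0" by (auto simp: \<delta>_def)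
    then show ?thesis using 2
      by (simp add: dynkin_correction_def sh3_def lookup_add lookup_minus lookup_frag_of; simp add: \<delta>_def)
  qed
qed

text \<open>The right-hand side is \<open>k3\<close> times the difference of three times the
  indicator of xyz and the coefficient of \<open>w\<close> in [[x, y], z]. Summed against an
  orthogonal \<open>c\<close> it therefore returns the coefficient of xyz modulo
  \<open>p\<close>.\<close>

lemma lookup_dynkin_correction_3:
  "Poly_Mapping.lookup (dynkin_correction k2 k3 w) [x, y, z] =
     k3 * (2 * \<delta> (w = [x, y, z]) + \<delta> (w = [z, x, y]) + \<delta> (w = [y, x, z]) - \<delta> (w = [z, y, x]))"
proof -
  consider a b e where "w = [a, b, e]" | "length w \<noteq> 3" by (auto simp: length_Suc_conv numeral_3_eq_3)
  then show ?thesis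
  proof cases
    case 1
    have "([b, e, a] = [x, y, z]) = ([a, b, e] = [z, x, y])" "([b, a, e] = [x, y, z]) = ([a, b, e] = [y, x, z])"
      "([e, b, a] = [x, y, z]) = ([a, b, e] = [z, y, x])" by auto
    then have e: "\<delta> ([b, e, a] = [x, y, z]) = \<delta> ([a, b, e] = [z, x, y])"
      "\<delta> ([b, a, e] = [x, y, z]) = \<delta> ([a, b, e] = [y, x, z])"
      "\<delta> ([e, b, a] = [x, y, z]) = \<delta> ([a, b, e] = [z, y, x])" by (simp_all only:)
    have dc: "dynkin_correction k2 k3 [a, b, e] = frag_cmul k3 (sh3 b e a + sh3 a b e - sh3 e b a)"
      by (simp add: dynkin_correction_def numeral_2_eq_2)
    have l: "Poly_Mapping.lookup (dynkin_correction k2 k3 [a, b, e]) [x, y, z] =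
        k3 * ((\<delta> ([b, e, a] = [x, y, z]) + \<delta> ([b, a, e] = [x, y, z]) + \<delta> ([a, b, e] = [x, y, z])) +
          (\<delta> ([a, b, e] = [x, y, z]) + \<delta> ([a, e, b] = [x, y, z]) + \<delta> ([e, a, b] = [x, y, z])) -
          (\<delta> ([e, b, a] = [x, y, z]) + \<delta> ([e, a, b] = [x, y, z]) + \<delta> ([a, e, b] = [x, y, z])))"
      unfolding dc by (simp only: sh3_def lookup_add lookup_minus lookup_frag_of lookup_frag_cmul)
    show ?thesis unfolding 1 l e by (simp only: algebra_simps)
  next
    case 2
    then have "\<delta> (w = [x, y, z]) = 0" "\<delta> (w = [z, x, y]) = 0" "\<delta> (w = [y, x, z]) = 0" "\<delta> (w = [z, y, x]) = 0"
      by (auto simp: \<delta>_def)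
    then show ?thesis using 2
      by (simp add: dynkin_correction_def sh2_def lookup_add lookup_frag_of; simp add: \<delta>_def)
  qed
qed

lemma inverse_mod_prime:
  fixes p :: nat
  assumes "prime p" "p > 3"
  obtains k2 k3 :: int where "[2 * k2 = 1] (mod int p)" "[3 * k3 = 1] (mod int p)"
proof -
  have pp: "prime (int p)" using assms(1) by simp
  have nd: "\<not> int p dvd 2" "\<not> int p dvd 3" using assms(2) by (auto dest: zdvd_imp_le)
  obtain k2 :: int where k2: "[2 * k2 = 1] (mod int p)"
    using cong_solve_coprime_int[OF iffD1[OF coprime_commute prime_imp_coprime[OF pp nd(1)]]] by blast
  obtain k3 :: int where k3: "[3 * k3 = 1] (mod int p)"
    using cong_solve_coprime_int[OF iffD1[OF coprime_commute prime_imp_coprime[OF pp nd(2)]]] by blast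
  show thesis by (rule that[OF k2 k3])
qed

text \<open>Replacing every word of \<open>c\<close> by its Dynkin correction gives a combination
  \<open>d\<close> of shuffles with the same coefficients modulo \<open>p\<close>; the difference is
  a combination of words with coefficients divisible by \<open>p\<close>.\<close>

lemma lie_trivial_shuffles:
  fixes p :: nat
  assumes p: "prime p" "p > 3" and c: "Poly_Mapping.keys c \<subseteq> all_words X"
    and L: "lie_trivial p X (Poly_Mapping.lookup c)"
  shows "c \<in> generate (word_group X) (shuffle_generators p X)"
proof -
  let ?K = "generate (word_group X) (shuffle_generators p X)" and ?l = "Poly_Mapping.lookup"
  have K: "subgroup ?K (word_group X)"
    by (rule group.generate_is_subgroup[OF group_free_Abelian_group shuffle_generators_carrier])
  obtain k2 k3 :: int where k2: "[2 * k2 = 1] (mod int p)" and k3: "[3 * k3 = 1] (mod int p)"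
    by (rule inverse_mod_prime[OF p])
  define d where "d = (\<Sum>w\<in>Poly_Mapping.keys c. frag_cmul (?l c w) (dynkin_correction k2 k3 w))"
  have sh: "sh2 x y \<in> ?K" "sh3 x y z \<in> ?K" if "x \<in> X" "y \<in> X" "z \<in> X" for x y z
    by (rule generate.incl; unfold shuffle_generators_def; use that in blast)+
  have "dynkin_correction k2 k3 w \<in> ?K" if "w \<in> all_words X" for w
    using that
  proof (cases rule: all_words_cases)
    case (1 x)
    then show ?thesis using subgroup_frag_zero[OF K] by (simp add: dynkin_correction_def)
  next
    case (2 x y)
    then show ?thesis using subgroup_frag_cmul[OF K sh(1)[of x y y]] by (simp add: dynkin_correction_def)
  next
    case (3 x y z)
    have "frag_cmul k3 (sh3 y z x + sh3 x y z - sh3 z y x) \<in> ?K"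
      by (intro subgroup_frag_cmul[OF K] subgroup_frag_diff[OF K] subgroup_frag_add[OF K] sh 3)
    then show ?thesis using 3 by (simp add: dynkin_correction_def numeral_2_eq_2)
  qed
  then have d: "d \<in> ?K"
    unfolding d_def using c by (intro subgroup_frag_sum[OF K] subgroup_frag_cmul[OF K]) auto
  have dl: "?l d v = (\<Sum>w\<in>Poly_Mapping.keys c. ?l c w * ?l (dynkin_correction k2 k3 w) v)" for v
    unfolding d_def by (rule lookup_sum_frag)
  have cd: "int p dvd ?l (c - d) v" if "v \<in> all_words X" for v
    using that
  proof (cases rule: all_words_cases)
    case (1 x)
    then show ?thesis
      using L by (simp add: dl lookup_minus lookup_dynkin_correction_1 lie_trivial_def cong_0_iff)
  next
    case (2 x y)
    have "?l d [x, y] = (\<Sum>w\<in>Poly_Mapping.keys c. k2 * (?l c w * \<delta> (w = [x, y])) + k2 * (?l c w * \<delta> (w = [y, x])))"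
      unfolding dl lookup_dynkin_correction_2 by (intro sum.cong refl) (simp only: algebra_simps)
    also have "\<dots> = k2 * ?l c [x, y] + k2 * ?l c [y, x]"
      unfolding sum.distrib sum_distrib_left[symmetric] sum_delta_keys ..
    finally have l: "?l d [x, y] = k2 * ?l c [x, y] + k2 * ?l c [y, x]" .
    have "[?l c [x, y] - ?l c [y, x] = 0] (mod int p)" using L 2 by (simp add: lie_trivial_def)
    then have A: "int p dvd k2 * (?l c [x, y] - ?l c [y, x])" unfolding cong_0_iff by (rule dvd_mult)
    have B: "int p dvd 2 * k2 * ?l c [x, y] - 1 * ?l c [x, y]"
      by (rule iffD1[OF cong_iff_dvd_diff cong_scalar_right[OF k2]])
    have "int p dvd k2 * (?l c [x, y] - ?l c [y, x]) - (2 * k2 * ?l c [x, y] - 1 * ?l c [x, y])" by (rule dvd_diff[OF A B])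
    also have "k2 * (?l c [x, y] - ?l c [y, x]) - (2 * k2 * ?l c [x, y] - 1 * ?l c [x, y]) = ?l (c - d) v"
      unfolding 2(1) lookup_minus l by (simp add: algebra_simps)
    finally show ?thesis .
  next
    case (3 x y z)
    have "?l d [x, y, z] = (\<Sum>w\<in>Poly_Mapping.keys c. 2 * k3 * (?l c w * \<delta> (w = [x, y, z])) +
        k3 * (?l c w * \<delta> (w = [z, x, y])) + k3 * (?l c w * \<delta> (w = [y, x, z])) - k3 * (?l c w * \<delta> (w = [z, y, x])))"
      unfolding dl lookup_dynkin_correction_3 by (intro sum.cong refl) (simp only: algebra_simps)
    also have "\<dots> = 2 * k3 * ?l c [x, y, z] + k3 * ?l c [z, x, y] + k3 * ?l c [y, x, z] - k3 * ?l c [z, y, x]"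
      unfolding sum.distrib sum_subtractf sum_distrib_left[symmetric] sum_delta_keys ..
    finally have l: "?l d [x, y, z] =
        2 * k3 * ?l c [x, y, z] + k3 * ?l c [z, x, y] + k3 * ?l c [y, x, z] - k3 * ?l c [z, y, x]" .
    let ?s = "?l c [x, y, z] - ?l c [y, x, z] - ?l c [z, x, y] + ?l c [z, y, x]"
    have "[?s = 0] (mod int p)" using L 3 unfolding lie_trivial_def by simp
    then have A: "int p dvd k3 * ?s" unfolding cong_0_iff by (rule dvd_mult)
    have B: "int p dvd 3 * k3 * ?l c [x, y, z] - 1 * ?l c [x, y, z]"
      by (rule iffD1[OF cong_iff_dvd_diff cong_scalar_right[OF k3]])
    have "int p dvd k3 * ?s - (3 * k3 * ?l c [x, y, z] - 1 * ?l c [x, y, z])" by (rule dvd_diff[OF A B])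
    also have "k3 * ?s - (3 * k3 * ?l c [x, y, z] - 1 * ?l c [x, y, z]) = ?l (c - d) v"
      unfolding 3(1) lookup_minus l by (simp add: algebra_simps)
    finally show ?thesis .
  qed
  have dX: "Poly_Mapping.keys d \<subseteq> all_words X" using subgroup.mem_carrier[OF K d] by simp
  have kX: "Poly_Mapping.keys (c - d) \<subseteq> all_words X" using keys_diff[of c d] c dX by blast
  have "c - d = (\<Sum>v\<in>Poly_Mapping.keys (c - d). frag_cmul (?l (c - d) v div int p) (frag_cmul (int p) (frag_of v)))"
  proof (rule poly_mapping_eqI)
    fix u
    have "?l (\<Sum>v\<in>Poly_Mapping.keys (c - d). frag_cmul (?l (c - d) v div int p) (frag_cmul (int p) (frag_of v))) u =
        (\<Sum>v\<in>Poly_Mapping.keys (c - d). ?l (c - d) v * \<delta> (v = u))"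
      unfolding lookup_sum_frag lookup_frag_cmul lookup_frag_of mult.assoc[symmetric]
    proof (rule sum.cong[OF refl])
      fix v assume "v \<in> Poly_Mapping.keys (c - d)"
      then show "?l (c - d) v div int p * int p * \<delta> (v = u) = ?l (c - d) v * \<delta> (v = u)"
        using cd kX by (simp add: subset_iff)
    qed
    then show "?l (c - d) u = ?l (\<Sum>v\<in>Poly_Mapping.keys (c - d).
        frag_cmul (?l (c - d) v div int p) (frag_cmul (int p) (frag_of v))) u"
      by (simp only: sum_delta_keys)
  qed
  also have "\<dots> \<in> ?K"
    by (intro subgroup_frag_sum[OF K] subgroup_frag_cmul[OF K] generate.incl)
      (unfold shuffle_generators_def, use kX in blast)
  finally have "c - d + d \<in> ?K" using d by (rule subgroup_frag_add[OF K])
  then show ?thesis by simp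
qed

lemma lie_trivial_zero: "lie_trivial p X (\<lambda>_. 0)"
  by (simp add: lie_trivial_def)

lemma lie_trivial_add:
  assumes "lie_trivial p X c" "lie_trivial p X d" shows "lie_trivial p X (\<lambda>w. c w + d w)"
proof -
  have *: "[a = 0] (mod m) \<Longrightarrow> [b = 0] (mod m) \<Longrightarrow> e = a + b \<Longrightarrow> [e = 0] (mod m)" for a b e m :: int
    using cong_add[of a 0 m b 0] by simp
  show ?thesis
    unfolding lie_trivial_def
  proof (intro conjI ballI)
    show "[c [x] + d [x] = 0] (mod int p)" if "x \<in> X" for x
      by (rule *[of "c [x]" _ "d [x]"]) (use assms that in \<open>simp_all add: lie_trivial_def\<close>)
    show "[c [x, y] + d [x, y] - (c [y, x] + d [y, x]) = 0] (mod int p)" if "x \<in> X" "y \<in> X" for x y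
      by (rule *[of "c [x, y] - c [y, x]" _ "d [x, y] - d [y, x]"]) (use assms that in \<open>simp_all add: lie_trivial_def\<close>)
    show "[c [x, y, z] + d [x, y, z] - (c [y, x, z] + d [y, x, z]) - (c [z, x, y] + d [z, x, y]) +
        (c [z, y, x] + d [z, y, x]) = 0] (mod int p)" if "x \<in> X" "y \<in> X" "z \<in> X" for x y z
      by (rule *[of "c [x, y, z] - c [y, x, z] - c [z, x, y] + c [z, y, x]" _
            "d [x, y, z] - d [y, x, z] - d [z, x, y] + d [z, y, x]"])
        (use assms that in \<open>simp_all add: lie_trivial_def\<close>)
  qed
qed

lemma lie_trivial_scale:
  assumes "lie_trivial p X c" shows "lie_trivial p X (\<lambda>w. k * c w)"
proof -
  have *: "[a = 0] (mod m) \<Longrightarrow> e = k * a \<Longrightarrow> [e = 0] (mod m)" for a e m :: int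
    using cong_scalar_left[of a 0 m k] by simp
  show ?thesis
    unfolding lie_trivial_def
  proof (intro conjI ballI)
    show "[k * c [x] = 0] (mod int p)" if "x \<in> X" for x
      by (rule *[of "c [x]"]) (use assms that in \<open>simp_all add: lie_trivial_def\<close>)
    show "[k * c [x, y] - k * c [y, x] = 0] (mod int p)" if "x \<in> X" "y \<in> X" for x y
      by (rule *[of "c [x, y] - c [y, x]"]) (use assms that in \<open>simp_all add: lie_trivial_def algebra_simps\<close>)
    show "[k * c [x, y, z] - k * c [y, x, z] - k * c [z, x, y] + k * c [z, y, x] = 0] (mod int p)"
      if "x \<in> X" "y \<in> X" "z \<in> X" for x y z
      by (rule *[of "c [x, y, z] - c [y, x, z] - c [z, x, y] + c [z, y, x]"])
        (use assms that in \<open>simp_all add: lie_trivial_def algebra_simps\<close>)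
  qed
qed

lemma lie_trivial_cong:
  assumes "lie_trivial p X c" and "\<And>w. w \<in> all_words X \<Longrightarrow> [c w = d w] (mod int p)"
  shows "lie_trivial p X d"
proof -
  have s: "[x] \<in> all_words X" "[x, y] \<in> all_words X" "[x, y, z] \<in> all_words X"
    if "x \<in> X" "y \<in> X" "z \<in> X" for x y z using that by (simp_all add: words_simps)
  have d: "[d w = c w] (mod int p)" if "w \<in> all_words X" for w using cong_sym[OF assms(2)[OF that]] .
  show ?thesis
    unfolding lie_trivial_def
  proof (intro conjI ballI)
    show "[d [x] = 0] (mod int p)" if "x \<in> X" for x
      by (rule cong_trans[OF d[OF s(1)]]) (use assms(1) that in \<open>simp_all add: lie_trivial_def\<close>)
    show "[d [x, y] - d [y, x] = 0] (mod int p)" if "x \<in> X" "y \<in> X" for x y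
      by (rule cong_trans[OF cong_diff[OF d[OF s(2)] d[OF s(2)]]])
        (use assms(1) that in \<open>simp_all add: lie_trivial_def\<close>)
    show "[d [x, y, z] - d [y, x, z] - d [z, x, y] + d [z, y, x] = 0] (mod int p)"
      if "x \<in> X" "y \<in> X" "z \<in> X" for x y z
      by (rule cong_trans[OF cong_add[OF cong_diff[OF cong_diff[OF d[OF s(3)] d[OF s(3)]] d[OF s(3)]] d[OF s(3)]]])
        (use assms(1) that in \<open>simp_all add: lie_trivial_def\<close>)
  qed
qed

lemma lie_trivial_sh2: "lie_trivial p X (Poly_Mapping.lookup (sh2 x y))"
proof -
  have l: "Poly_Mapping.lookup (sh2 x y) v = \<delta> ([x, y] = v) + \<delta> ([y, x] = v)" for v
    by (simp only: sh2_def lookup_add lookup_frag_of)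
  have e: "([y, x] = [u, v]) = ([x, y] = [v, u])" for u v by auto
  have 0: "\<delta> ([x, y] = [u]) = 0" "\<delta> ([y, x] = [u]) = 0" "\<delta> ([x, y] = [u, v, t]) = 0" "\<delta> ([y, x] = [u, v, t]) = 0" for u v t
    by (simp_all add: \<delta>_def)
  show ?thesis unfolding lie_trivial_def l 0 e by simp
qed

text \<open>Each of the twelve indicator terms is matched by a permutation of letters with one of
  opposite sign, an instance of the orthogonality of proper shuffles and Lie polynomials.\<close>

lemma lie_trivial_sh3: "lie_trivial p X (Poly_Mapping.lookup (sh3 x y z))"
proof -
  have l: "Poly_Mapping.lookup (sh3 x y z) v = \<delta> ([x, y, z] = v) + \<delta> ([x, z, y] = v) + \<delta> ([z, x, y] = v)" for v
    by (simp only: sh3_def lookup_add lookup_frag_of)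
  have 0: "\<delta> ([a, b, e] = [u]) = 0" "\<delta> ([a, b, e] = [u, v]) = 0" for a b e u v :: 'a by (simp_all add: \<delta>_def)
  have e: "\<delta> ([z, x, y] = [v, u, t]) = \<delta> ([x, z, y] = [u, v, t])" "\<delta> ([x, z, y] = [v, u, t]) = \<delta> ([z, x, y] = [u, v, t])"
    "\<delta> ([z, x, y] = [t, u, v]) = \<delta> ([x, y, z] = [u, v, t])" "\<delta> ([x, y, z] = [t, v, u]) = \<delta> ([x, z, y] = [t, u, v])"
    "\<delta> ([x, z, y] = [t, v, u]) = \<delta> ([x, y, z] = [t, u, v])" "\<delta> ([z, x, y] = [t, v, u]) = \<delta> ([x, y, z] = [v, u, t])" for u v t
    by (rule arg_cong[where f = \<delta>], auto)+
  have "Poly_Mapping.lookup (sh3 x y z) [u, v, t] - Poly_Mapping.lookup (sh3 x y z) [v, u, t] -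
      Poly_Mapping.lookup (sh3 x y z) [t, u, v] + Poly_Mapping.lookup (sh3 x y z) [t, v, u] = 0" for u v t
    unfolding l using e[where u = u and v = v and t = t] by linarith
  then show ?thesis unfolding lie_trivial_def by (simp only: l 0) simp
qed

lemma lie_trivial_generator:
  assumes "g \<in> shuffle_generators p X" shows "lie_trivial p X (Poly_Mapping.lookup g)"
proof -
  from assms consider w where "g = frag_cmul (int p) (frag_of w)"
    | x y where "g = sh2 x y" | x y z where "g = sh3 x y z"
    unfolding shuffle_generators_def by blast
  then show ?thesis
  proof cases
    case 1
    show ?thesis by (rule lie_trivial_cong[OF lie_trivial_zero]) (simp add: 1 cong_def)
  qed (simp_all add: lie_trivial_sh2 lie_trivial_sh3)
qed

lemma subgroup_lie_trivial:
  assumes "W \<subseteq> all_words X"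
  shows "subgroup {c \<in> carrier (free_Abelian_group W). lie_trivial p X (Poly_Mapping.lookup c)} (free_Abelian_group W)"
proof (rule group.subgroupI[OF group_free_Abelian_group])
  have "0 \<in> {c \<in> carrier (free_Abelian_group W). lie_trivial p X (Poly_Mapping.lookup c)}"
    using lie_trivial_zero[of p X] by (simp add: zero_poly_mapping.rep_eq)
  then show "{c \<in> carrier (free_Abelian_group W). lie_trivial p X (Poly_Mapping.lookup c)} \<noteq> {}" by blast
next
  fix a assume a: "a \<in> {c \<in> carrier (free_Abelian_group W). lie_trivial p X (Poly_Mapping.lookup c)}"
  then have "lie_trivial p X (\<lambda>w. - 1 * Poly_Mapping.lookup a w)" by (intro lie_trivial_scale) simp
  then show "inv\<^bsub>free_Abelian_group W\<^esub> a \<in> {c \<in> carrier (free_Abelian_group W). lie_trivial p X (Poly_Mapping.lookup c)}"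
    using a by (simp add: lookup_uminus[abs_def] keys_minus)
next
  fix a b assume ab: "a \<in> {c \<in> carrier (free_Abelian_group W). lie_trivial p X (Poly_Mapping.lookup c)}"
    "b \<in> {c \<in> carrier (free_Abelian_group W). lie_trivial p X (Poly_Mapping.lookup c)}"
  then have "lie_trivial p X (\<lambda>w. Poly_Mapping.lookup a w + Poly_Mapping.lookup b w)" by (intro lie_trivial_add) simp_all
  moreover have "Poly_Mapping.keys (a + b) \<subseteq> W" using ab keys_add[of a b] by auto
  ultimately show "a \<otimes>\<^bsub>free_Abelian_group W\<^esub> b \<in> {c \<in> carrier (free_Abelian_group W). lie_trivial p X (Poly_Mapping.lookup c)}"
    by (simp add: lookup_add[abs_def])
qed auto

section \<open>Tensor products with the integers modulo p\<close>

text \<open>The tensor product with Z/p is the quotient of \<open>M\<close> by its p-th powers. This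
  is obtained below as three facts on the map sending m to m tensor 1: it is surjective, kills p-th
  powers, and kills nothing else.\<close>

locale mod_p_tensor = M: comm_group M for M :: "('a, 'm) monoid_scheme" (structure) +
  fixes p :: nat
  assumes p1: "p > 1"
begin

abbreviation A where "A \<equiv> integer_mod_group p"
abbreviation F where "F \<equiv> free_Abelian_group (carrier M \<times> carrier A)"
abbreviation R where "R \<equiv> tensor_relations M A"
abbreviation tensor where "tensor \<equiv> tensor_product M A"

lemma A_carrier: "carrier A = {0..<int p}" using p1 by (simp add: carrier_integer_mod_group)

sublocale F: comm_group F by (rule abelian_free_Abelian_group)

lemma relators_carrier:
  "({frag_of (g \<otimes> g', h) - frag_of (g, h) - frag_of (g', h) | g g' h.
           g \<in> carrier M \<and> g' \<in> carrier M \<and> h \<in> carrier A} \<union>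
        {frag_of (g, h \<otimes>\<^bsub>A\<^esub> h') - frag_of (g, h) - frag_of (g, h') | g h h'.
           g \<in> carrier M \<and> h \<in> carrier A \<and> h' \<in> carrier A}) \<subseteq> carrier F"
proof -
  have *: "Poly_Mapping.keys (frag_of a - frag_of b - frag_of c) \<subseteq> V" if "a \<in> V" "b \<in> V" "c \<in> V" for a b c :: 'c and V
    using keys_diff[of "frag_of a - frag_of b" "frag_of c"] keys_diff[of "frag_of a" "frag_of b"] that by auto
  have A: "a \<otimes>\<^bsub>A\<^esub> b \<in> carrier A" if "a \<in> carrier A" "b \<in> carrier A" for a b
    by (rule monoid.m_closed[OF group.is_monoid[OF group_integer_mod_group] that])
  show ?thesis
  proof (intro Un_least subsetI; elim CollectE exE conjE; hypsubst)
    show "frag_of (g \<otimes> g', h) - frag_of (g, h) - frag_of (g', h) \<in> carrier F"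
      if "g \<in> carrier M" "g' \<in> carrier M" "h \<in> carrier A" for g g' h
      using *[of "(g \<otimes> g', h)" "carrier M \<times> carrier A" "(g, h)" "(g', h)"] that by simp
    show "frag_of (g, h \<otimes>\<^bsub>A\<^esub> h') - frag_of (g, h) - frag_of (g, h') \<in> carrier F"
      if "g \<in> carrier M" "h \<in> carrier A" "h' \<in> carrier A" for g h h'
      using *[of "(g, h \<otimes>\<^bsub>A\<^esub> h')" "carrier M \<times> carrier A" "(g, h)" "(g, h')"] that A
      by (simp del: mult_integer_mod_group)
  qed
qed

lemma R_subgroup: "subgroup R F"
  unfolding tensor_relations_def by (rule F.generate_is_subgroup[OF relators_carrier])

lemma relators:
  "\<lbrakk>g \<in> carrier M; g' \<in> carrier M; a \<in> carrier A\<rbrakk> \<Longrightarrow> frag_of (g \<otimes> g', a) - frag_of (g, a) - frag_of (g', a) \<in> R"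
  "\<lbrakk>g \<in> carrier M; a \<in> carrier A; b \<in> carrier A\<rbrakk> \<Longrightarrow> frag_of (g, a \<otimes>\<^bsub>A\<^esub> b) - frag_of (g, a) - frag_of (g, b) \<in> R"
  unfolding tensor_relations_def by (rule generate.incl; blast)+

lemma tensor_comm_group: "comm_group tensor"
  unfolding tensor_product_def by (rule F.abelian_FactGroup[OF R_subgroup])

sublocale tensor: comm_group tensor by (rule tensor_comm_group)

abbreviation q where "q f \<equiv> R #>\<^bsub>F\<^esub> f"

sublocale q: group_hom F tensor "\<lambda>f. R #>\<^bsub>F\<^esub> f"
  unfolding tensor_product_def
  by (intro group_hom.intro F.is_group normal.factorgroup_is_group group_hom_axioms.intro
      normal.r_coset_hom_Mod F.subgroup_imp_normal R_subgroup)

lemma q_one: "f \<in> carrier F \<Longrightarrow> q f = \<one>\<^bsub>tensor\<^esub> \<longleftrightarrow> f \<in> R"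
  unfolding tensor_product_def one_FactGroup
  using F.coset_join1[of R f] F.coset_join2[of f R] R_subgroup subgroup.subset[OF R_subgroup] by auto

lemma q_add: "\<lbrakk>f \<in> carrier F; g \<in> carrier F\<rbrakk> \<Longrightarrow> q (f + g) = q f \<otimes>\<^bsub>tensor\<^esub> q g"
  using q.hom_mult[of f g] by simp

lemma q_relator:
  assumes "a - b - c \<in> R" "a \<in> carrier F" "b \<in> carrier F" "c \<in> carrier F"
  shows "q a = q b \<otimes>\<^bsub>tensor\<^esub> q c"
proof -
  have "q a = q ((a - b - c) + (b + c))" by simp
  also have "\<dots> = q (a - b - c) \<otimes>\<^bsub>tensor\<^esub> q (b + c)"
    by (rule q_add) (use subgroup.mem_carrier[OF R_subgroup assms(1)] F.m_closed[OF assms(3,4)] in simp_all)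
  also have "q (a - b - c) = \<one>\<^bsub>tensor\<^esub>"
    using q_one[OF subgroup.mem_carrier[OF R_subgroup assms(1)]] assms(1) by simp
  also have "q (b + c) = q b \<otimes>\<^bsub>tensor\<^esub> q c" by (rule q_add[OF assms(3,4)])
  finally show ?thesis using q.hom_closed[OF assms(3)] q.hom_closed[OF assms(4)] by simp
qed

definition one_tensor where "one_tensor m = pure_tensor M A m 1"

lemma one_tensor_eq: "one_tensor m = q (frag_of (m, 1))"
  by (simp add: one_tensor_def pure_tensor_def)

lemma one_A: "1 \<in> carrier A" using p1 by (simp add: A_carrier)

lemma one_tensor_hom: "one_tensor \<in> hom M tensor"
proof (rule homI)
  show "one_tensor x \<in> carrier tensor" if "x \<in> carrier M" for x
    unfolding one_tensor_eq by (rule q.hom_closed) (use that one_A in simp)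
  show "one_tensor (x \<otimes> y) = one_tensor x \<otimes>\<^bsub>tensor\<^esub> one_tensor y" if "x \<in> carrier M" "y \<in> carrier M" for x y
    unfolding one_tensor_eq by (rule q_relator[OF relators(1)[OF that one_A]]) (use that one_A in simp_all)
qed

sublocale one_tensor: group_hom M tensor one_tensor
  by (intro group_hom.intro M.is_group tensor.is_group group_hom_axioms.intro one_tensor_hom)

text \<open>Additivity in the second argument, starting from m tensor 0, which is trivial because it
  equals its own double. Below \<open>p\<close> no reduction of residues interferes.\<close>

lemma q_frag_nat:
  assumes m: "m \<in> carrier M"
  shows "int a < int p \<Longrightarrow> q (frag_of (m, int a)) = one_tensor m [^]\<^bsub>tensor\<^esub> a"
proof (induction a)
  have fc: "frag_of (m, int a) \<in> carrier F" if "int a < int p" for a using that m by (simp add: A_carrier)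
  case 0
  have "q (frag_of (m, 0)) = q (frag_of (m, 0)) \<otimes>\<^bsub>tensor\<^esub> q (frag_of (m, 0))"
    using q_relator[OF relators(2)[OF m, of 0 0]] fc[of 0] p1 by (simp add: A_carrier)
  then have "q (frag_of (m, 0)) = \<one>\<^bsub>tensor\<^esub>"
    using tensor.l_cancel_one'[OF q.hom_closed q.hom_closed, of "frag_of (m, 0)" "frag_of (m, 0)"] fc[of 0] p1 by simp
  then show ?case by simp
next
  have fc: "frag_of (m, int a) \<in> carrier F" if "int a < int p" for a using that m by (simp add: A_carrier)
  case (Suc a)
  have s: "int a \<otimes>\<^bsub>A\<^esub> 1 = int (Suc a)" using Suc.prems by simp
  have "q (frag_of (m, int (Suc a))) = q (frag_of (m, int a)) \<otimes>\<^bsub>tensor\<^esub> q (frag_of (m, 1))"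
    by (rule q_relator[OF relators(2)[OF m, of "int a" 1, unfolded s]])
      (use Suc.prems fc[of a] fc[of "Suc a"] fc[of 1] one_A in \<open>simp_all add: A_carrier\<close>)
  then show ?case using Suc by (simp add: one_tensor_eq)
qed

lemma one_tensor_surj: "carrier tensor = one_tensor ` carrier M"
proof
  show "one_tensor ` carrier M \<subseteq> carrier tensor" using one_tensor.hom_closed by auto
  show "carrier tensor \<subseteq> one_tensor ` carrier M"
  proof
    fix C assume "C \<in> carrier tensor"
    then obtain f where f: "f \<in> carrier F" "C = q f" by (auto simp: tensor_product_def carrier_FactGroup)
    have "\<exists>m\<in>carrier M. q f = one_tensor m"
    proof (rule free_Abelian_group_induct[of f "carrier M \<times> carrier A"])
      show "Poly_Mapping.keys f \<subseteq> carrier M \<times> carrier A" using f(1) by simp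
      show "\<exists>m\<in>carrier M. q 0 = one_tensor m" using q.hom_one one_tensor.hom_one by (intro bexI[of _ \<one>]) simp_all
    next
      fix x y assume xy: "Poly_Mapping.keys x \<subseteq> carrier M \<times> carrier A" "Poly_Mapping.keys y \<subseteq> carrier M \<times> carrier A"
        "\<exists>m\<in>carrier M. q x = one_tensor m" "\<exists>m\<in>carrier M. q y = one_tensor m"
      then obtain m n where mn: "m \<in> carrier M" "q x = one_tensor m" "n \<in> carrier M" "q y = one_tensor n" by auto
      have "q (x - y) = q x \<otimes>\<^bsub>tensor\<^esub> inv\<^bsub>tensor\<^esub> (q y)"
        using q.hom_mult[of x "- y"] q.hom_inv[of y] xy by (simp add: keys_minus)
      also have "\<dots> = one_tensor (m \<otimes> inv n)" using mn by simp
      finally show "\<exists>m\<in>carrier M. q (x - y) = one_tensor m" using mn by (intro bexI[of _ "m \<otimes> inv n"]) simp_all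
    next
      fix z assume "z \<in> carrier M \<times> carrier A"
      then obtain m a where z: "z = (m, a)" "m \<in> carrier M" "0 \<le> a" "a < int p" by (auto simp: A_carrier)
      from z(3) obtain k where k: "a = int k" by (rule nonneg_int_cases)
      have "q (frag_of z) = one_tensor (m [^] k)"
        using q_frag_nat[OF z(2), of k] z k by (simp add: one_tensor.hom_nat_pow)
      then show "\<exists>m\<in>carrier M. q (frag_of z) = one_tensor m" using z by (intro bexI[of _ "m [^] k"]) simp_all
    qed
    then show "C \<in> one_tensor ` carrier M" using f(2) by auto
  qed
qed

lemma one_tensor_pow:
  assumes m: "m \<in> carrier M" shows "one_tensor (m [^] p) = \<one>\<^bsub>tensor\<^esub>"
proof -
  have fc: "frag_of (m, a) \<in> carrier F" if "0 \<le> a" "a < int p" for a using that m by (simp add: A_carrier)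
  have p': "int (p - 1) = int p - 1" "p = Suc (p - 1)" using p1 by simp_all
  have s: "int (p - 1) \<otimes>\<^bsub>A\<^esub> 1 = 0" using p' by simp
  have "q (frag_of (m, 0)) = q (frag_of (m, int (p - 1))) \<otimes>\<^bsub>tensor\<^esub> q (frag_of (m, 1))"
    by (rule q_relator[OF relators(2)[OF m, of "int (p - 1)" 1, unfolded s]])
      (use fc[of 0] fc[of "int (p - 1)"] fc[of 1] one_A p1 in \<open>simp_all add: A_carrier\<close>)
  also have "\<dots> = one_tensor m [^]\<^bsub>tensor\<^esub> (p - 1) \<otimes>\<^bsub>tensor\<^esub> one_tensor m"
    using q_frag_nat[OF m, of "p - 1"] p1 by (simp add: one_tensor_eq)
  also have "\<dots> = one_tensor m [^]\<^bsub>tensor\<^esub> Suc (p - 1)" by simp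
  also have "\<dots> = one_tensor (m [^] p)" unfolding p'(2)[symmetric] using m by (simp add: one_tensor.hom_nat_pow)
  finally show ?thesis using q_frag_nat[OF m, of 0] p1 by simp
qed

text \<open>Sending the generator (m, a) to the a-th power of m does not respect the relators, since
  a + b is reduced modulo \<open>p\<close>; but every relator goes to a p-th power. So an element
  whose tensor with 1 is trivial must itself be a p-th power.\<close>

lemma one_tensor_trivial:
  assumes m: "m \<in> carrier M" and 1: "one_tensor m = \<one>\<^bsub>tensor\<^esub>"
  shows "\<exists>m'\<in>carrier M. m = m' [^] p"
proof -
  obtain h where h: "h \<in> hom F M" "\<And>z. z \<in> carrier M \<times> carrier A \<Longrightarrow> h (frag_of z) = fst z [^] snd z"
    by (rule M.free_Abelian_group_universal[of "\<lambda>z. fst z [^] snd z" "carrier M \<times> carrier A"]) auto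
  interpret h: group_hom F M h by (intro group_hom.intro F.is_group M.is_group group_hom_axioms.intro h(1))
  let ?P = "{m' [^] p | m'. m' \<in> carrier M}"
  have hd: "h (a - b - c) = h a \<otimes> inv (h b) \<otimes> inv (h c)"
    if abc: "a \<in> carrier F" "b \<in> carrier F" "c \<in> carrier F" for a b c
  proof -
    have "a - b - c = a \<otimes>\<^bsub>F\<^esub> inv\<^bsub>F\<^esub> b \<otimes>\<^bsub>F\<^esub> inv\<^bsub>F\<^esub> c" using abc by simp
    then show ?thesis using abc by (metis F.inv_closed F.m_closed h.hom_inv h.hom_mult)
  qed
  have sub: "subgroup {f \<in> carrier F. h f \<in> ?P} F"
  proof (rule F.subgroupI)
    have "h \<one>\<^bsub>F\<^esub> = \<one> [^] p" by (simp del: one_free_Abelian_group)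
    then have "\<one>\<^bsub>F\<^esub> \<in> {f \<in> carrier F. h f \<in> ?P}" using F.one_closed M.one_closed by blast
    then show "{f \<in> carrier F. h f \<in> ?P} \<noteq> {}" by blast
  next
    fix f assume f: "f \<in> {f \<in> carrier F. h f \<in> ?P}"
    then obtain m' where m': "m' \<in> carrier M" "h f = m' [^] p" by auto
    have "h (inv\<^bsub>F\<^esub> f) = (inv m') [^] p" using f m' by (simp add: M.nat_pow_inv del: inv_free_Abelian_group)
    then show "inv\<^bsub>F\<^esub> f \<in> {f \<in> carrier F. h f \<in> ?P}" using f m'(1) F.inv_closed[of f] by blast
  next
    fix f g assume fg: "f \<in> {f \<in> carrier F. h f \<in> ?P}" "g \<in> {f \<in> carrier F. h f \<in> ?P}"
    then obtain m' n' where mn: "m' \<in> carrier M" "h f = m' [^] p" "n' \<in> carrier M" "h g = n' [^] p" by auto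
    have "h (f \<otimes>\<^bsub>F\<^esub> g) = (m' \<otimes> n') [^] p" using fg mn by (simp add: M.nat_pow_distrib del: mult_free_Abelian_group)
    then show "f \<otimes>\<^bsub>F\<^esub> g \<in> {f \<in> carrier F. h f \<in> ?P}" using fg mn F.m_closed[of f g] by blast
  qed auto
  have "R \<subseteq> {f \<in> carrier F. h f \<in> ?P}"
    unfolding tensor_relations_def
  proof (rule F.generate_subgroup_incl[OF _ sub], intro subsetI)
    fix f assume "f \<in> {frag_of (g \<otimes> g', h) - frag_of (g, h) - frag_of (g', h) | g g' h.
           g \<in> carrier M \<and> g' \<in> carrier M \<and> h \<in> carrier A} \<union>
        {frag_of (g, h \<otimes>\<^bsub>A\<^esub> h') - frag_of (g, h) - frag_of (g, h') | g h h'.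
           g \<in> carrier M \<and> h \<in> carrier A \<and> h' \<in> carrier A}" (is "f \<in> ?X")
    then have fF: "f \<in> carrier F" using relators_carrier by blast
    from \<open>f \<in> ?X\<close> consider g g' a where "f = frag_of (g \<otimes> g', a) - frag_of (g, a) - frag_of (g', a)"
        "g \<in> carrier M" "g' \<in> carrier M" "a \<in> carrier A"
      | g a b where "f = frag_of (g, a \<otimes>\<^bsub>A\<^esub> b) - frag_of (g, a) - frag_of (g, b)"
        "g \<in> carrier M" "a \<in> carrier A" "b \<in> carrier A" by blast
    then have "h f \<in> ?P"
    proof cases
      case 1
      have "h f = (g \<otimes> g') [^] a \<otimes> inv (g [^] a) \<otimes> inv (g' [^] a)"
        unfolding 1(1) using 1(2-4) by (subst hd) (simp_all add: h(2))
      also have "\<dots> = \<one> [^] p" using 1 by (simp add: M.int_pow_distrib M.m_ac M.inv_cancel_left M.cancel_inv_left)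
      finally show ?thesis by blast
    next
      case 2
      have ab: "a \<otimes>\<^bsub>A\<^esub> b \<in> carrier A" by (rule monoid.m_closed[OF group.is_monoid[OF group_integer_mod_group] 2(3,4)])
      have "h f = g [^] (a \<otimes>\<^bsub>A\<^esub> b) \<otimes> inv (g [^] a) \<otimes> inv (g [^] b)"
        unfolding 2(1) using 2(2-4) ab by (subst hd) (simp_all add: h(2) del: mult_integer_mod_group)
      also have "\<dots> = g [^] ((a + b) mod int p - a - b)"
        using 2 by (simp add: M.int_pow_diff)
      \<comment> \<open>Reducing the sum of two residues changes the exponent by a multiple of
        \<open>p\<close>.\<close>
      also have "(a + b) mod int p - a - b = (- ((a + b) div int p)) * int p"
        by (simp add: minus_div_mult_eq_mod[symmetric] algebra_simps)
      also have "g [^] ((- ((a + b) div int p)) * int p) = (g [^] (- ((a + b) div int p))) [^] p"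
        unfolding int_pow_int[symmetric] by (rule M.int_pow_pow[OF 2(2), symmetric])
      finally show ?thesis using 2(2) by blast
    qed
    then show "f \<in> {f \<in> carrier F. h f \<in> ?P}" using fF by blast
  qed
  moreover have "frag_of (m, 1) \<in> R"
    using 1 q_one[of "frag_of (m, 1)"] m one_A by (simp add: one_tensor_eq)
  ultimately have "h (frag_of (m, 1)) \<in> ?P" by blast
  moreover have "h (frag_of (m, 1)) = m" using h(2)[of "(m, 1)"] m one_A by simp
  ultimately show ?thesis by auto
qed

end

section \<open>The relation group and the indexing group\<close>

lemma frag_nat_pow:
  fixes n :: nat
  shows "x [^]\<^bsub>free_Abelian_group W\<^esub> n = frag_cmul (int n) x"
proof -
  interpret F: group "free_Abelian_group W" by simp
  show ?thesis by (induction n) (simp_all add: frag_cmul_distrib add.commute)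
qed

lemma poly_mapping_with_lookup:
  fixes f :: "'a \<Rightarrow> int"
  assumes "finite {w \<in> W. f w \<noteq> 0}"
  obtains c where "Poly_Mapping.keys c \<subseteq> W" "\<And>w. w \<in> W \<Longrightarrow> Poly_Mapping.lookup c w = f w"
proof -
  define g where "g w = (if w \<in> W then f w else 0)" for w
  have "{w. g w \<noteq> 0} = {w \<in> W. f w \<noteq> 0}" by (auto simp: g_def)
  then have l: "Poly_Mapping.lookup (Abs_poly_mapping g) = g" using assms by (intro lookup_Abs_poly_mapping) simp
  show thesis
  proof (rule that[of "Abs_poly_mapping g"])
    show "Poly_Mapping.keys (Abs_poly_mapping g) \<subseteq> W"
      by (rule subsetI) (simp add: in_keys_iff l g_def split: if_splits)
    show "Poly_Mapping.lookup (Abs_poly_mapping g) w = f w" if "w \<in> W" for w using that by (simp add: l g_def)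
  qed
qed

section \<open>Shuffle coefficients of words of total length at most three\<close>

lemma shuffle_coeff_commute: "shuffle_coeff u v w = shuffle_coeff v u w"
proof -
  let ?P = "\<lambda>u v. {(I, J). I \<union> J = {..<length u + length v} \<and> I \<inter> J = {} \<and>
    card I = length u \<and> card J = length v \<and> nths w I = u \<and> nths w J = v}"
  have "?P v u = prod.swap ` ?P u v" by (auto simp: image_iff add.commute Un_commute Int_commute)
  then have "card (?P v u) = card (?P u v)" by (simp only: card_image[OF inj_swap])
  then show ?thesis by (simp add: shuffle_coeff_def add.commute)
qed

text \<open>A letter occupies a single position, so one set of the partition is a singleton and the
  other its complement; the count becomes a sum over positions.\<close>

lemma shuffle_coeff_letter:
  assumes w: "length w = Suc (length v)"
  shows "int (shuffle_coeff [x] v w) =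
    (\<Sum>i<length w. \<delta> (nths w {i} = [x] \<and> nths w ({..<length w} - {i}) = v))"
proof -
  let ?I = "{i \<in> {..<length w}. nths w {i} = [x] \<and> nths w ({..<length w} - {i}) = v}"
  have "{(I, J). I \<union> J = {..<length [x] + length v} \<and> I \<inter> J = {} \<and>
      card I = length [x] \<and> card J = length v \<and> nths w I = [x] \<and> nths w J = v} =
      (\<lambda>i. ({i}, {..<length w} - {i})) ` ?I" (is "?L = ?R")
  proof (intro equalityI subsetI)
    fix z assume "z \<in> ?L"
    then obtain I J where z: "z = (I, J)" "I \<union> J = {..<length w}" "I \<inter> J = {}" "card I = 1"
      "nths w I = [x]" "nths w J = v" using w by auto
    obtain i where i: "I = {i}" using card_1_singletonE[OF z(4)] by blast
    have "i < length w" using z(2) i by auto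
    moreover have J: "J = {..<length w} - {i}" using z(2,3) i by blast
    ultimately have "i \<in> ?I" using z(5,6) i by simp
    then show "z \<in> ?R" using z(1) i J by blast
  next
    fix z assume "z \<in> ?R"
    then obtain i where i: "i < length w" "nths w {i} = [x]" "nths w ({..<length w} - {i}) = v"
      "z = ({i}, {..<length w} - {i})" by blast
    have "{i} \<union> ({..<length w} - {i}) = {..<length w}" "{i} \<inter> ({..<length w} - {i}) = {}"
      using i(1) by auto
    moreover have "card ({..<length w} - {i}) = length v" using i(1) w by simp
    ultimately show "z \<in> ?L" using i w by simp
  qed
  moreover have "inj_on (\<lambda>i. ({i}, {..<length w} - {i})) ?I" by (rule inj_onI) simp
  ultimately have "shuffle_coeff [x] v w = card ?I"
    unfolding shuffle_coeff_def using w by (simp only: card_image) simp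
  also have "int \<dots> = (\<Sum>i\<in>?I. 1)" by simp
  also have "\<dots> = (\<Sum>i<length w. \<delta> (nths w {i} = [x] \<and> nths w ({..<length w} - {i}) = v))"
    unfolding \<delta>_def by (rule sum.inter_filter) simp
  finally show ?thesis .
qed

lemma shuffle_coeff_1_1: "int (shuffle_coeff [x] [y] w) = Poly_Mapping.lookup (sh2 x y) w"
proof -
  have l: "Poly_Mapping.lookup (sh2 x y) v = \<delta> ([x, y] = v) + \<delta> ([y, x] = v)" for v
    by (simp only: sh2_def lookup_add lookup_frag_of)
  consider a b where "w = [a, b]" | "length w \<noteq> 2" by (auto simp: length_Suc_conv numeral_2_eq_2)
  then show ?thesis
  proof cases
    case (1 a b)
    have n: "nths [a, b] {0} = [a]" "nths [a, b] {Suc 0} = [b]"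
      "nths [a, b] ({..<Suc (Suc 0)} - {0}) = [b]" "nths [a, b] ({..<Suc (Suc 0)} - {Suc 0}) = [a]"
      by (simp_all add: nths_Cons)
    have len: "length [a, b] = Suc (Suc 0)" "length [a, b] = Suc (length [y])" by simp_all
    have s: "(\<Sum>i<Suc (Suc 0). f i) = f 0 + f (Suc 0)" for f :: "nat \<Rightarrow> int" by simp
    have e: "\<delta> ([a] = [x] \<and> [b] = [y]) = \<delta> ([x, y] = [a, b])" "\<delta> ([b] = [x] \<and> [a] = [y]) = \<delta> ([y, x] = [a, b])"
      by (rule arg_cong[where f = \<delta>], auto)+
    show ?thesis unfolding l 1 shuffle_coeff_letter[OF len(2)] unfolding len(1) s n e ..
  next
    case 2
    then have "\<delta> ([x, y] = w) = 0" "\<delta> ([y, x] = w) = 0" by (auto simp: \<delta>_def)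
    then show ?thesis unfolding l using 2 by (simp add: shuffle_coeff_def)
  qed
qed

lemma shuffle_coeff_1_2: "int (shuffle_coeff [x] [y, z] w) = Poly_Mapping.lookup (sh3 y z x) w"
proof -
  have l: "Poly_Mapping.lookup (sh3 y z x) v = \<delta> ([y, z, x] = v) + \<delta> ([y, x, z] = v) + \<delta> ([x, y, z] = v)" for v
    by (simp only: sh3_def lookup_add lookup_frag_of)
  consider a b e where "w = [a, b, e]" | "length w \<noteq> 3" by (auto simp: length_Suc_conv numeral_3_eq_3)
  then show ?thesis
  proof cases
    case (1 a b e)
    have n: "nths [a, b, e] {0} = [a]" "nths [a, b, e] {Suc 0} = [b]" "nths [a, b, e] {Suc (Suc 0)} = [e]"
      "nths [a, b, e] ({..<Suc (Suc (Suc 0))} - {0}) = [b, e]"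
      "nths [a, b, e] ({..<Suc (Suc (Suc 0))} - {Suc 0}) = [a, e]"
      "nths [a, b, e] ({..<Suc (Suc (Suc 0))} - {Suc (Suc 0)}) = [a, b]"
      by (simp_all add: nths_Cons)
    have len: "length [a, b, e] = Suc (Suc (Suc 0))" "length [a, b, e] = Suc (length [y, z])" by simp_all
    have s: "(\<Sum>i<Suc (Suc (Suc 0)). f i) = f (Suc (Suc 0)) + f (Suc 0) + f 0" for f :: "nat \<Rightarrow> int" by simp
    have e: "\<delta> ([a] = [x] \<and> [b, e] = [y, z]) = \<delta> ([x, y, z] = [a, b, e])"
      "\<delta> ([b] = [x] \<and> [a, e] = [y, z]) = \<delta> ([y, x, z] = [a, b, e])"
      "\<delta> ([e] = [x] \<and> [a, b] = [y, z]) = \<delta> ([y, z, x] = [a, b, e])"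
      by (rule arg_cong[where f = \<delta>], auto)+
    show ?thesis unfolding l 1 shuffle_coeff_letter[OF len(2)] unfolding len(1) s n e ..
  next
    case 2
    then have "\<delta> ([x, y, z] = w) = 0" "\<delta> ([y, x, z] = w) = 0" "\<delta> ([y, z, x] = w) = 0" by (auto simp: \<delta>_def)
    then show ?thesis unfolding l using 2 by (simp add: shuffle_coeff_def)
  qed
qed

text \<open>The link between two descriptions of combinations of words: computations with shuffles
  are done over the integers, while the relations are stated modulo \<open>p\<close>.\<close>

definition word_reduction :: "nat \<Rightarrow> 'a set \<Rightarrow> ('a list \<Rightarrow>\<^sub>0 int) \<Rightarrow> 'a list \<Rightarrow> int" where
  "word_reduction p X c = (\<lambda>w\<in>all_words X. Poly_Mapping.lookup c w mod int p)"

lemma word_relation_carrier: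
  assumes "p > 1"
  shows "c \<in> carrier (word_relation_group p W) \<longleftrightarrow> c \<in> W \<rightarrow>\<^sub>E {0..<int p} \<and> finite {w \<in> W. c w \<noteq> 0}"
  using assms by (simp add: word_relation_group_def carrier_sum_group carrier_integer_mod_group)

lemma word_reduction_hom:
  assumes p: "p > 1"
  shows "word_reduction p X \<in> hom (word_group X) (word_relation_group p (all_words X))"
proof (rule homI)
  fix c
  have "{w \<in> all_words X. word_reduction p X c w \<noteq> 0} \<subseteq> Poly_Mapping.keys c"
    by (auto simp: word_reduction_def in_keys_iff)
  then have "finite {w \<in> all_words X. word_reduction p X c w \<noteq> 0}" using finite_subset finite_keys by blast
  moreover have "word_reduction p X c \<in> all_words X \<rightarrow>\<^sub>E {0..<int p}"
    unfolding word_reduction_def by (rule restrict_PiE_iff[THEN iffD2]) (use p in simp)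
  ultimately show "word_reduction p X c \<in> carrier (word_relation_group p (all_words X))"
    unfolding word_relation_carrier[OF p] by simp
next
  fix c d
  show "word_reduction p X (c \<otimes>\<^bsub>word_group X\<^esub> d) =
      word_reduction p X c \<otimes>\<^bsub>word_relation_group p (all_words X)\<^esub> word_reduction p X d"
    by (auto simp: word_relation_group_def word_reduction_def lookup_add mod_add_eq fun_eq_iff restrict_def)
qed

text \<open>Of two nonempty words of total length at most 3 one is a single letter, and the shuffle
  coefficient is symmetric in the two words; so only \<open>sh2\<close> and \<open>sh3\<close>
  occur.\<close>

lemma shuffle_relations_eq:
  "{shuffle_relation p (all_words X) u v | u v.
      u \<in> lists X \<and> v \<in> lists X \<and> u \<noteq> [] \<and> v \<noteq> [] \<and> length u + length v \<le> 3} =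
   word_reduction p X ` ({sh2 x y | x y. x \<in> X \<and> y \<in> X} \<union> {sh3 x y z | x y z. x \<in> X \<and> y \<in> X \<and> z \<in> X})"
  (is "?S = ?R")
proof -
  have two: "shuffle_relation p (all_words X) [x] [y] = word_reduction p X (sh2 x y)" for x y
    by (simp add: shuffle_relation_def word_reduction_def shuffle_coeff_1_1)
  have three: "shuffle_relation p (all_words X) [x] [y, z] = word_reduction p X (sh3 y z x)" for x y z
    by (simp add: shuffle_relation_def word_reduction_def shuffle_coeff_1_2)
  have c: "shuffle_relation p (all_words X) u v = shuffle_relation p (all_words X) v u" for u v
    unfolding shuffle_relation_def shuffle_coeff_commute[of u v] ..
  show ?thesis
  proof (intro equalityI subsetI)
    fix r assume "r \<in> ?S"
    then obtain u v where r: "r = shuffle_relation p (all_words X) u v" "u \<in> lists X" "v \<in> lists X"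
      "u \<noteq> []" "v \<noteq> []" "length u + length v \<le> 3" by blast
    then obtain x us y vs where uv: "u = x # us" "v = y # vs" by (meson neq_Nil_conv)
    consider "us = []" "vs = []" | z where "us = []" "vs = [z]" | z where "us = [z]" "vs = []"
      using r(6) uv by (cases us; cases vs) auto
    then show "r \<in> ?R"
    proof cases
      case 1
      then have "r = word_reduction p X (sh2 x y)" "x \<in> X" "y \<in> X" using r(1-3) uv two by simp_all
      then show ?thesis by blast
    next
      case (2 z)
      then have "r = word_reduction p X (sh3 y z x)" "x \<in> X" "y \<in> X" "z \<in> X" using r(1-3) uv three by simp_all
      then show ?thesis by blast
    next
      case (3 z)
      then have "r = word_reduction p X (sh3 x z y)" "x \<in> X" "y \<in> X" "z \<in> X"
        using r(1-3) uv c[of u v] three by simp_all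
      then show ?thesis by blast
    qed
  next
    fix r assume "r \<in> ?R"
    then consider x y where "r = word_reduction p X (sh2 x y)" "x \<in> X" "y \<in> X"
      | x y z where "r = word_reduction p X (sh3 x y z)" "x \<in> X" "y \<in> X" "z \<in> X" by blast
    then show "r \<in> ?S"
    proof cases
      case (1 x y)
      show ?thesis
        by (intro CollectI, rule exI[of _ "[x]"], rule exI[of _ "[y]"]) (use 1 in \<open>simp add: two del: One_nat_def\<close>)
    next
      case (2 x y z)
      show ?thesis
        by (intro CollectI, rule exI[of _ "[z]"], rule exI[of _ "[x, y]"]) (use 2 in \<open>simp add: three del: One_nat_def\<close>)
    qed
  qed
qed

lemma lie_trivial_generate:
  fixes p :: nat
  assumes p: "prime p" "p > 3"
  shows "{c \<in> carrier (word_group X). lie_trivial p X (Poly_Mapping.lookup c)} =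
    generate (word_group X) (shuffle_generators p X)" (is "?K = ?R")
proof
  show "?K \<subseteq> ?R" using lie_trivial_shuffles[OF p] by auto
  show "?R \<subseteq> ?K"
    by (rule group.generate_subgroup_incl[OF group_free_Abelian_group _ subgroup_lie_trivial[OF subset_refl]])
      (use shuffle_generators_carrier[of p X] lie_trivial_generator[of _ p X] in blast)
qed

text \<open>The integral statement is pushed forward along \<open>word_reduction\<close>. The
  generators that are \<open>p\<close> times a word become trivial, which leaves the shuffle
  relations.\<close>

lemma lie_trivial_relations:
  fixes p :: nat
  assumes p: "prime p" "p > 3"
  shows "{c \<in> carrier (word_relation_group p (all_words X)). lie_trivial p X c} =
    generate (word_relation_group p (all_words X))
      {shuffle_relation p (all_words X) u v | u v.
         u \<in> lists X \<and> v \<in> lists X \<and> u \<noteq> [] \<and> v \<noteq> [] \<and> length u + length v \<le> 3}"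
proof -
  let ?G = "word_relation_group p (all_words X)" and ?red = "word_reduction p X"
  let ?S = "{sh2 x y | x y. x \<in> X \<and> y \<in> X} \<union> {sh3 x y z | x y z. x \<in> X \<and> y \<in> X \<and> z \<in> X}"
  have p1: "p > 1" using p by simp
  have G: "group ?G" by (simp add: word_relation_group_def)
  interpret red: group_hom "word_group X" ?G ?red
    by (intro group_hom.intro group_free_Abelian_group G group_hom_axioms.intro word_reduction_hom[OF p1])
  have L: "lie_trivial p X (?red c) \<longleftrightarrow> lie_trivial p X (Poly_Mapping.lookup c)" for c
  proof
    show "lie_trivial p X (Poly_Mapping.lookup c)" if "lie_trivial p X (?red c)"
      by (rule lie_trivial_cong[OF that]) (simp add: word_reduction_def)
    show "lie_trivial p X (?red c)" if "lie_trivial p X (Poly_Mapping.lookup c)"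
      by (rule lie_trivial_cong[OF that]) (simp add: word_reduction_def cong_sym_eq)
  qed
  have "{c \<in> carrier ?G. lie_trivial p X c} = ?red ` {c \<in> carrier (word_group X). lie_trivial p X (Poly_Mapping.lookup c)}"
  proof (intro equalityI subsetI)
    fix c assume c: "c \<in> {c \<in> carrier ?G. lie_trivial p X c}"
    then have cc: "c \<in> all_words X \<rightarrow>\<^sub>E {0..<int p}" "finite {w \<in> all_words X. c w \<noteq> 0}"
      using word_relation_carrier[OF p1, of c] by simp_all
    obtain c' where c': "Poly_Mapping.keys c' \<subseteq> all_words X" "\<And>w. w \<in> all_words X \<Longrightarrow> Poly_Mapping.lookup c' w = c w"
      using poly_mapping_with_lookup[OF cc(2)] by metis
    have "?red c' = c"
    proof (rule extensionalityI[of _ "all_words X"])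
      show "c \<in> extensional (all_words X)" using cc(1) by (simp add: PiE_def)
      show "?red c' w = c w" if "w \<in> all_words X" for w
        using PiE_mem[OF cc(1) that] c'(2)[OF that] that by (simp add: word_reduction_def)
    qed (simp add: word_reduction_def)
    then show "c \<in> ?red ` {c \<in> carrier (word_group X). lie_trivial p X (Poly_Mapping.lookup c)}"
      using c c'(1) L[of c'] by (intro image_eqI[of _ _ c']) simp_all
  next
    fix c assume "c \<in> ?red ` {c \<in> carrier (word_group X). lie_trivial p X (Poly_Mapping.lookup c)}"
    then show "c \<in> {c \<in> carrier ?G. lie_trivial p X c}" using L red.hom_closed by blast
  qed
  also have "\<dots> = generate ?G (?red ` shuffle_generators p X)"
    unfolding lie_trivial_generate[OF p] by (rule red.generate_img[OF shuffle_generators_carrier, symmetric])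
  also have "\<dots> = generate ?G (?red ` ?S)"
  proof
    have SK: "?S \<subseteq> shuffle_generators p X" unfolding shuffle_generators_def by blast
    then show "generate ?G (?red ` ?S) \<subseteq> generate ?G (?red ` shuffle_generators p X)"
      by (intro red.H.mono_generate image_mono)
    have "?red ` ?S \<subseteq> carrier ?G" using SK shuffle_generators_carrier[of p X] red.hom_closed by blast
    then have sub: "subgroup (generate ?G (?red ` ?S)) ?G" by (rule red.H.generate_is_subgroup)
    show "generate ?G (?red ` shuffle_generators p X) \<subseteq> generate ?G (?red ` ?S)"
    proof (rule red.H.generate_subgroup_incl[OF _ sub], rule image_subsetI)
      fix g assume "g \<in> shuffle_generators p X"
      then consider w where "g = frag_cmul (int p) (frag_of w)" | "g \<in> ?S"
        unfolding shuffle_generators_def by blast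
      then show "?red g \<in> generate ?G (?red ` ?S)"
      proof cases
        case 1
        then have "?red g = \<one>\<^bsub>?G\<^esub>" by (simp add: word_reduction_def word_relation_group_def)
        then show ?thesis using subgroup.one_closed[OF sub] by simp
      next
        case 2
        then show ?thesis by (intro generate.incl imageI)
      qed
    qed
  qed
  finally show ?thesis unfolding shuffle_relations_eq .
qed

section \<open>The indexing group as a quotient of the integer combinations of words\<close>

lemma lookup_word_component:
  "Poly_Mapping.lookup (word_component k c) v = (if length v = k then Poly_Mapping.lookup c v else 0)"
proof -
  have "Poly_Mapping.lookup (word_component k c) v =
      (\<Sum>w\<in>{w \<in> Poly_Mapping.keys c. length w = k}. if w = v then Poly_Mapping.lookup c w else 0)"
    unfolding word_component_def lookup_sum_frag lookup_frag_of by (intro sum.cong) (simp_all add: \<delta>_def)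
  then show ?thesis by (simp add: in_keys_iff)
qed

lemma keys_word_component:
  assumes "Poly_Mapping.keys c \<subseteq> all_words X" shows "Poly_Mapping.keys (word_component k c) \<subseteq> words X k"
proof
  fix v assume "v \<in> Poly_Mapping.keys (word_component k c)"
  then have "length v = k" "v \<in> Poly_Mapping.keys c"
    by (simp_all add: in_keys_iff lookup_word_component split: if_splits)
  then show "v \<in> words X k" using assms by (auto simp: words_def)
qed

lemma word_component_add: "word_component k (c + d) = word_component k c + word_component k d"
  by (rule poly_mapping_eqI) (simp add: lookup_word_component lookup_add)

lemma word_component_words:
  assumes "Poly_Mapping.keys c \<subseteq> words X k"
  shows "word_component k c = c" and "j \<noteq> k \<Longrightarrow> word_component j c = 0"
proof -
  have *: "Poly_Mapping.lookup c v = 0" if "length v \<noteq> k" for v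
    using assms that by (auto simp: words_def in_keys_iff subset_iff)
  show "word_component k c = c" by (rule poly_mapping_eqI) (simp add: lookup_word_component *)
  show "word_component j c = 0" if "j \<noteq> k"
    by (rule poly_mapping_eqI) (use that in \<open>simp add: lookup_word_component *\<close>)
qed

text \<open>Degrees 2 and 3 are treated at once: \<open>B\<close> takes the words of length
  \<open>k\<close>, passes to the class modulo \<open>R\<close> and tensors with 1. The last claim
  bounds its kernel, because only p-th powers become trivial after tensoring with 1.\<close>

lemma tensor_component:
  fixes p :: nat
  assumes p1: "p > 1" and R: "subgroup R (free_Abelian_group (words X k))"
  defines "M \<equiv> free_Abelian_group (words X k) Mod R" and "A \<equiv> integer_mod_group p"
  defines "B \<equiv> \<lambda>c. pure_tensor M A (R #>\<^bsub>free_Abelian_group (words X k)\<^esub> word_component k c) 1"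
  shows tensor_component_group: "group (tensor_product M A)"
    and tensor_component_hom: "B \<in> hom (word_group X) (tensor_product M A)"
    and tensor_component_surj: "t \<in> carrier (tensor_product M A) \<Longrightarrow>
      \<exists>f\<in>carrier (free_Abelian_group (words X k)). \<forall>c. word_component k c = f \<longrightarrow> B c = t"
    and tensor_component_relation: "\<And>c. word_component k c \<in> R \<Longrightarrow> B c = \<one>\<^bsub>tensor_product M A\<^esub>"
    and tensor_component_cmul: "\<And>c. c \<in> carrier (word_group X) \<Longrightarrow> B (frag_cmul (int p) c) = \<one>\<^bsub>tensor_product M A\<^esub>"
    and tensor_component_trivial: "\<And>c. \<lbrakk>c \<in> carrier (word_group X); B c = \<one>\<^bsub>tensor_product M A\<^esub>\<rbrakk> \<Longrightarrow>
      \<exists>r. word_component k c - frag_cmul (int p) r \<in> R"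
proof -
  let ?F = "free_Abelian_group (words X k)"
  interpret F: comm_group ?F by (rule abelian_free_Abelian_group)
  have M: "comm_group M" unfolding M_def by (rule F.abelian_FactGroup[OF R])
  interpret MT: mod_p_tensor M p by (intro mod_p_tensor.intro mod_p_tensor_axioms.intro M p1)
  interpret \<kappa>: group_hom ?F M "\<lambda>f. R #>\<^bsub>?F\<^esub> f"
    unfolding M_def
    by (intro group_hom.intro F.is_group normal.factorgroup_is_group group_hom_axioms.intro
        normal.r_coset_hom_Mod F.subgroup_imp_normal R)
  have \<kappa>_one: "R #>\<^bsub>?F\<^esub> f = \<one>\<^bsub>M\<^esub> \<longleftrightarrow> f \<in> R" if "f \<in> carrier ?F" for f
    unfolding M_def one_FactGroup
    using F.coset_join1[of R f] F.coset_join2[of f R] R subgroup.subset[OF R] that by auto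
  have B: "B c = MT.one_tensor (R #>\<^bsub>?F\<^esub> word_component k c)" for c
    by (simp add: B_def MT.one_tensor_def A_def)
  show G: "group (tensor_product M A)" unfolding A_def by (rule MT.tensor.is_group)
  have wc: "word_component k c \<in> carrier ?F" if "c \<in> carrier (word_group X)" for c
    using keys_word_component[of c X k] that by simp
  show hom: "B \<in> hom (word_group X) (tensor_product M A)"
    unfolding A_def
  proof (rule homI)
    show "B c \<in> carrier (tensor_product M (integer_mod_group p))" if "c \<in> carrier (word_group X)" for c
      unfolding B by (intro MT.one_tensor.hom_closed \<kappa>.hom_closed wc that)
    fix c d assume cd: "c \<in> carrier (word_group X)" "d \<in> carrier (word_group X)"
    have "R #>\<^bsub>?F\<^esub> word_component k (c \<otimes>\<^bsub>word_group X\<^esub> d) =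
        (R #>\<^bsub>?F\<^esub> word_component k c) \<otimes>\<^bsub>M\<^esub> (R #>\<^bsub>?F\<^esub> word_component k d)"
      using \<kappa>.hom_mult[OF wc[OF cd(1)] wc[OF cd(2)]] by (simp add: word_component_add)
    then show "B (c \<otimes>\<^bsub>word_group X\<^esub> d) = B c \<otimes>\<^bsub>tensor_product M (integer_mod_group p)\<^esub> B d"
      unfolding B
      by (simp only: MT.one_tensor.hom_mult[OF \<kappa>.hom_closed[OF wc[OF cd(1)]] \<kappa>.hom_closed[OF wc[OF cd(2)]]])
  qed
  interpret B: group_hom "word_group X" "tensor_product M A" B
    by (intro group_hom.intro group_free_Abelian_group G group_hom_axioms.intro hom)
  show "\<exists>f\<in>carrier ?F. \<forall>c. word_component k c = f \<longrightarrow> B c = t" if t: "t \<in> carrier (tensor_product M A)"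
  proof -
    obtain m where m: "m \<in> carrier M" "t = MT.one_tensor m" using t MT.one_tensor_surj by (auto simp: A_def)
    obtain f where "f \<in> carrier ?F" "m = R #>\<^bsub>?F\<^esub> f" using m(1) by (auto simp: M_def carrier_FactGroup)
    then show ?thesis using m(2) by (intro bexI[of _ f]) (simp_all add: B)
  qed
  show "B c = \<one>\<^bsub>tensor_product M A\<^esub>" if "word_component k c \<in> R" for c
    unfolding B A_def using \<kappa>_one[OF subgroup.mem_carrier[OF R that]] that MT.one_tensor.hom_one by simp
  show "B (frag_cmul (int p) c) = \<one>\<^bsub>tensor_product M A\<^esub>" if c: "c \<in> carrier (word_group X)" for c
  proof -
    have "B (frag_cmul (int p) c) = B c [^]\<^bsub>tensor_product M A\<^esub> p"
      using B.hom_nat_pow[OF c, of p] by (simp add: frag_nat_pow)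
    also have "\<dots> = MT.one_tensor ((R #>\<^bsub>?F\<^esub> word_component k c) [^]\<^bsub>M\<^esub> p)"
      unfolding B A_def by (rule MT.one_tensor.hom_nat_pow[OF \<kappa>.hom_closed[OF wc[OF c]], symmetric])
    also have "\<dots> = \<one>\<^bsub>tensor_product M A\<^esub>"
      unfolding A_def by (rule MT.one_tensor_pow[OF \<kappa>.hom_closed[OF wc[OF c]]])
    finally show ?thesis .
  qed
  show "\<exists>r. word_component k c - frag_cmul (int p) r \<in> R"
    if c: "c \<in> carrier (word_group X)" and 1: "B c = \<one>\<^bsub>tensor_product M A\<^esub>" for c
  proof -
    obtain m where m: "m \<in> carrier M" "R #>\<^bsub>?F\<^esub> word_component k c = m [^]\<^bsub>M\<^esub> p"
      using MT.one_tensor_trivial[OF \<kappa>.hom_closed[OF wc[OF c]]] 1 unfolding B A_def by blast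
    obtain r where r: "r \<in> carrier ?F" "m = R #>\<^bsub>?F\<^esub> r" using m(1) by (auto simp: M_def carrier_FactGroup)
    have rp: "frag_cmul (int p) r \<in> carrier ?F" using F.nat_pow_closed[OF r(1), of p] by (simp only: frag_nat_pow)
    have e: "R #>\<^bsub>?F\<^esub> word_component k c = R #>\<^bsub>?F\<^esub> frag_cmul (int p) r"
      unfolding m(2) r(2) \<kappa>.hom_nat_pow[OF r(1), symmetric] frag_nat_pow ..
    have d: "word_component k c - frag_cmul (int p) r = word_component k c \<otimes>\<^bsub>?F\<^esub> inv\<^bsub>?F\<^esub> (frag_cmul (int p) r)"
      using rp by simp
    have dF: "word_component k c - frag_cmul (int p) r \<in> carrier ?F"
      unfolding d by (intro F.m_closed F.inv_closed wc c rp)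
    have "R #>\<^bsub>?F\<^esub> (word_component k c - frag_cmul (int p) r) = \<one>\<^bsub>M\<^esub>"
      unfolding d \<kappa>.hom_mult[OF wc[OF c] F.inv_closed[OF rp]] \<kappa>.hom_inv[OF rp] e
      by (rule MT.M.r_inv[OF \<kappa>.hom_closed[OF rp]])
    then show ?thesis using \<kappa>_one[OF dF] by blast
  qed
qed

lemma relations_2_subgroup: "subgroup (relations_2 X) (free_Abelian_group (words X 2))"
  unfolding relations_2_def sh2_def[symmetric]
  by (rule group.generate_is_subgroup[OF group_free_Abelian_group]) (use keys_sh2[of _ X] in fastforce)

lemma relations_3_subgroup: "subgroup (relations_3 X) (free_Abelian_group (words X 3))"
  unfolding relations_3_def sh3_def[symmetric]
  by (rule group.generate_is_subgroup[OF group_free_Abelian_group]) (use keys_sh3[of _ X] in fastforce)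

lemma sh_relations:
  "\<lbrakk>x \<in> X; y \<in> X\<rbrakk> \<Longrightarrow> sh2 x y \<in> relations_2 X"
  "\<lbrakk>x \<in> X; y \<in> X; z \<in> X\<rbrakk> \<Longrightarrow> sh3 x y z \<in> relations_3 X"
  unfolding relations_2_def sh2_def[symmetric] relations_3_def sh3_def[symmetric]
  by (rule generate.incl; blast)+

lemma relations_lie_trivial:
  shows "r \<in> relations_2 X \<Longrightarrow> lie_trivial p X (Poly_Mapping.lookup r)"
    and "s \<in> relations_3 X \<Longrightarrow> lie_trivial p X (Poly_Mapping.lookup s)"
proof -
  have "relations_2 X \<subseteq> {c \<in> carrier (free_Abelian_group (words X 2)). lie_trivial p X (Poly_Mapping.lookup c)}"
    unfolding relations_2_def sh2_def[symmetric]
    by (rule group.generate_subgroup_incl[OF group_free_Abelian_group _ subgroup_lie_trivial])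
      (use keys_sh2[of _ X] lie_trivial_sh2[of p X] in fastforce, blast)
  then show "r \<in> relations_2 X \<Longrightarrow> lie_trivial p X (Poly_Mapping.lookup r)" by blast
  have "relations_3 X \<subseteq> {c \<in> carrier (free_Abelian_group (words X 3)). lie_trivial p X (Poly_Mapping.lookup c)}"
    unfolding relations_3_def sh3_def[symmetric]
    by (rule group.generate_subgroup_incl[OF group_free_Abelian_group _ subgroup_lie_trivial])
      (use keys_sh3[of _ X] lie_trivial_sh3[of p X] in fastforce, blast)
  then show "s \<in> relations_3 X \<Longrightarrow> lie_trivial p X (Poly_Mapping.lookup s)" by blast
qed

text \<open>The kernel is described by orthogonality to Lie polynomials, so that it can be compared
  with the kernel of the map to cohomology. One inclusion tests the relations against Lie
  polynomials, the other uses that orthogonal combinations are generated by shuffles and multiples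
  of \<open>p\<close>.\<close>

lemma indexing_element:
  fixes p :: nat
  assumes p: "prime p" "p > 3"
  shows indexing_group_group: "group (indexing_group p X)"
    and indexing_element_hom: "indexing_element p X \<in> hom (word_group X) (indexing_group p X)"
    and indexing_element_surj: "indexing_element p X ` carrier (word_group X) = carrier (indexing_group p X)"
    and indexing_element_one_iff: "c \<in> carrier (word_group X) \<Longrightarrow>
      indexing_element p X c = \<one>\<^bsub>indexing_group p X\<^esub> \<longleftrightarrow> lie_trivial p X (Poly_Mapping.lookup c)"
proof -
  let ?A = "integer_mod_group p" and ?I = "indexing_group p X"
  have p1: "p > 1" using p by simp
  note t2 = tensor_component[OF p1 relations_2_subgroup[of X], folded word_module_2_def]
  note t3 = tensor_component[OF p1 relations_3_subgroup[of X], folded word_module_3_def]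
  define B1 where "B1 c = (\<lambda>x\<in>X. Poly_Mapping.lookup c [x] mod int p)" for c :: "'a list \<Rightarrow>\<^sub>0 int"
  define B2 where "B2 c = pure_tensor (word_module_2 X) ?A
    (relations_2 X #>\<^bsub>free_Abelian_group (words X 2)\<^esub> word_component 2 c) 1" for c
  define B3 where "B3 c = pure_tensor (word_module_3 X) ?A
    (relations_3 X #>\<^bsub>free_Abelian_group (words X 3)\<^esub> word_component 3 c) 1" for c
  note t2 = t2[folded B2_def] and t3 = t3[folded B3_def]
  have B: "indexing_element p X c = (B1 c, B2 c, B3 c)" for c
    by (simp add: indexing_element_def B1_def B2_def B3_def)
  have G1: "group (sum_group X (\<lambda>_. ?A))" by simp
  have C1: "s \<in> carrier (sum_group X (\<lambda>_. ?A)) \<longleftrightarrow> s \<in> X \<rightarrow>\<^sub>E {0..<int p} \<and> finite {x \<in> X. s x \<noteq> 0}" for s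
    using p1 by (simp add: carrier_sum_group carrier_integer_mod_group)
  show G: "group ?I" unfolding indexing_group_def by (intro DirProd_group G1 t2(1) t3(1))
  have B1: "B1 \<in> hom (word_group X) (sum_group X (\<lambda>_. ?A))"
  proof (rule homI)
    fix c
    have "{x \<in> X. B1 c x \<noteq> 0} \<subseteq> (\<lambda>x. [x]) -` Poly_Mapping.keys c" by (auto simp: B1_def in_keys_iff)
    moreover have "finite ((\<lambda>x. [x]) -` Poly_Mapping.keys c)" by (intro finite_vimageI finite_keys injI) simp
    ultimately have "finite {x \<in> X. B1 c x \<noteq> 0}" by (rule finite_subset)
    moreover have "B1 c \<in> X \<rightarrow>\<^sub>E {0..<int p}"
      unfolding B1_def by (rule restrict_PiE_iff[THEN iffD2]) (use p1 in simp)
    ultimately show "B1 c \<in> carrier (sum_group X (\<lambda>_. ?A))" unfolding C1 by simp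
  next
    fix c d
    show "B1 (c \<otimes>\<^bsub>word_group X\<^esub> d) = B1 c \<otimes>\<^bsub>sum_group X (\<lambda>_. ?A)\<^esub> B1 d"
      by (auto simp: B1_def lookup_add mod_add_eq fun_eq_iff restrict_def)
  qed
  show hom: "indexing_element p X \<in> hom (word_group X) ?I"
  proof (rule homI)
    show "indexing_element p X c \<in> carrier ?I" if "c \<in> carrier (word_group X)" for c
      unfolding B indexing_group_def carrier_DirProd
      by (intro SigmaI hom_in_carrier[OF B1 that] hom_in_carrier[OF t2(2) that] hom_in_carrier[OF t3(2) that])
    show "indexing_element p X (c \<otimes>\<^bsub>word_group X\<^esub> d) = indexing_element p X c \<otimes>\<^bsub>?I\<^esub> indexing_element p X d"
      if "c \<in> carrier (word_group X)" "d \<in> carrier (word_group X)" for c d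
      unfolding B indexing_group_def mult_DirProd hom_mult[OF B1 that] hom_mult[OF t2(2) that] hom_mult[OF t3(2) that] ..
  qed
  show "indexing_element p X ` carrier (word_group X) = carrier ?I"
  proof
    show "indexing_element p X ` carrier (word_group X) \<subseteq> carrier ?I" using hom by (auto simp: hom_def)
    show "carrier ?I \<subseteq> indexing_element p X ` carrier (word_group X)"
    proof
      fix z assume "z \<in> carrier ?I"
      then obtain s u v where z: "z = (s, u, v)" "s \<in> carrier (sum_group X (\<lambda>_. ?A))"
        "u \<in> carrier (tensor_product (word_module_2 X) ?A)" "v \<in> carrier (tensor_product (word_module_3 X) ?A)"
        unfolding indexing_group_def carrier_DirProd by blast
      obtain f where f: "Poly_Mapping.keys f \<subseteq> words X 2" "\<And>c. word_component 2 c = f \<Longrightarrow> B2 c = u"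
        using t2(3)[OF z(3)] by auto
      obtain g where g: "Poly_Mapping.keys g \<subseteq> words X 3" "\<And>c. word_component 3 c = g \<Longrightarrow> B3 c = v"
        using t3(3)[OF z(4)] by auto
      have s: "s \<in> X \<rightarrow>\<^sub>E {0..<int p}" "finite {x \<in> X. s x \<noteq> 0}" using z(2) C1[of s] by simp_all
      have "{w \<in> words X 1. s (hd w) \<noteq> 0} \<subseteq> (\<lambda>x. [x]) ` {x \<in> X. s x \<noteq> 0}"
        by (auto simp: words_def length_Suc_conv)
      then have "finite {w \<in> words X 1. s (hd w) \<noteq> 0}" using s(2) finite_subset by blast
      then obtain e where e: "Poly_Mapping.keys e \<subseteq> words X 1"
        "\<And>w. w \<in> words X 1 \<Longrightarrow> Poly_Mapping.lookup e w = s (hd w)"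
        by (rule poly_mapping_with_lookup) blast
      define c where "c = e + f + g"
      have cX: "Poly_Mapping.keys c \<subseteq> all_words X"
        unfolding c_def using keys_add[of "e + f" g] keys_add[of e f] e(1) f(1) g(1) by blast
      have "B1 c = s"
      proof (rule extensionalityI[of _ X])
        show "s \<in> extensional X" using s(1) by (simp add: PiE_def)
        fix x assume x: "x \<in> X"
        have "Poly_Mapping.lookup f [x] = 0" "Poly_Mapping.lookup g [x] = 0"
          using f(1) g(1) by (auto simp: words_def in_keys_iff subset_iff)
        then have "Poly_Mapping.lookup c [x] = s x" using e(2)[of "[x]"] x by (simp add: c_def lookup_add words_def)
        then show "B1 c x = s x" using PiE_mem[OF s(1) x] x by (simp add: B1_def)
      qed (simp add: B1_def)
      moreover have "B2 c = u"
        by (rule f(2)) (simp add: c_def word_component_add word_component_words[OF e(1)] word_component_words[OF f(1)] word_component_words[OF g(1)])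
      moreover have "B3 c = v"
        by (rule g(2)) (simp add: c_def word_component_add word_component_words[OF e(1)] word_component_words[OF f(1)] word_component_words[OF g(1)])
      ultimately show "z \<in> indexing_element p X ` carrier (word_group X)"
        using z(1) cX by (intro image_eqI[of _ _ c]) (simp_all add: B)
    qed
  qed
  have one: "\<one>\<^bsub>?I\<^esub> = ((\<lambda>x\<in>X. 0), \<one>\<^bsub>tensor_product (word_module_2 X) ?A\<^esub>, \<one>\<^bsub>tensor_product (word_module_3 X) ?A\<^esub>)"
    by (simp add: indexing_group_def)
  show "indexing_element p X c = \<one>\<^bsub>?I\<^esub> \<longleftrightarrow> lie_trivial p X (Poly_Mapping.lookup c)"
    if c: "c \<in> carrier (word_group X)"
  proof
    assume "indexing_element p X c = \<one>\<^bsub>?I\<^esub>"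
    then have b: "B1 c = (\<lambda>x\<in>X. 0)" "B2 c = \<one>\<^bsub>tensor_product (word_module_2 X) ?A\<^esub>"
      "B3 c = \<one>\<^bsub>tensor_product (word_module_3 X) ?A\<^esub>" unfolding B one by simp_all
    obtain r s where rs: "word_component 2 c - frag_cmul (int p) r \<in> relations_2 X"
      "word_component 3 c - frag_cmul (int p) s \<in> relations_3 X" using t2(6)[OF c b(2)] t3(6)[OF c b(3)] by blast
    \<comment> \<open>The multiple of \<open>p\<close> that the tensor product leaves undetermined
      is invisible to conditions modulo \<open>p\<close>.\<close>
    have m: "[Poly_Mapping.lookup (word_component k c - frag_cmul (int p) r) w = Poly_Mapping.lookup (word_component k c) w] (mod int p)"
      for k r w by (simp add: lookup_minus cong_iff_dvd_diff)
    have L2: "lie_trivial p X (Poly_Mapping.lookup (word_component 2 c))"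
      by (rule lie_trivial_cong[OF relations_lie_trivial(1)[OF rs(1)] m])
    have L3: "lie_trivial p X (Poly_Mapping.lookup (word_component 3 c))"
      by (rule lie_trivial_cong[OF relations_lie_trivial(2)[OF rs(2)] m])
    have "[Poly_Mapping.lookup c [x] = 0] (mod int p)" if "x \<in> X" for x
      using fun_cong[OF b(1), of x] that by (simp add: B1_def cong_def)
    then show "lie_trivial p X (Poly_Mapping.lookup c)"
      using L2 L3 by (simp add: lie_trivial_def lookup_word_component)
  next
    interpret B: group_hom "word_group X" ?I "indexing_element p X"
      by (intro group_hom.intro group_free_Abelian_group G group_hom_axioms.intro hom)
    assume "lie_trivial p X (Poly_Mapping.lookup c)"
    then have "c \<in> generate (word_group X) (shuffle_generators p X)" using lie_trivial_generate[OF p, of X] c by blast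
    moreover have "generate (word_group X) (shuffle_generators p X) \<subseteq> kernel (word_group X) ?I (indexing_element p X)"
    proof (rule B.G.generate_subgroup_incl[OF _ B.subgroup_kernel], rule subsetI)
      fix g assume g: "g \<in> shuffle_generators p X"
      have gc: "g \<in> carrier (word_group X)" using g shuffle_generators_carrier by blast
      from g consider w where "g = frag_cmul (int p) (frag_of w)" "w \<in> all_words X"
        | x y where "g = sh2 x y" "x \<in> X" "y \<in> X" | x y z where "g = sh3 x y z" "x \<in> X" "y \<in> X" "z \<in> X"
        unfolding shuffle_generators_def by blast
      then have "indexing_element p X g = \<one>\<^bsub>?I\<^esub>"
      proof cases
        case (1 w)
        have w: "frag_of w \<in> carrier (word_group X)" using 1(2) by simp
        have "B1 g = (\<lambda>x\<in>X. 0)" unfolding B1_def 1(1) by simp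
        then show ?thesis unfolding B one using t2(5)[OF w] t3(5)[OF w] 1(1) by simp
      next
        case (2 x y)
        note k = keys_sh2[OF 2(2,3)]
        have "B1 g = (\<lambda>x\<in>X. 0)" unfolding B1_def 2(1) by (simp add: sh2_def lookup_add lookup_frag_of \<delta>_def)
        moreover have "B2 g = \<one>\<^bsub>tensor_product (word_module_2 X) ?A\<^esub>"
          by (rule t2(4)) (simp only: 2(1) word_component_words(1)[OF k] sh_relations(1)[OF 2(2,3)])
        moreover have "word_component 3 g = 0" unfolding 2(1) by (rule word_component_words(2)[OF k]) simp
        then have "B3 g = \<one>\<^bsub>tensor_product (word_module_3 X) ?A\<^esub>"
          by (intro t3(4)) (simp add: subgroup_frag_zero[OF relations_3_subgroup])
        ultimately show ?thesis unfolding B one by simp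
      next
        case (3 x y z)
        note k = keys_sh3[OF 3(2,3,4)]
        have "B1 g = (\<lambda>x\<in>X. 0)" unfolding B1_def 3(1) by (simp add: sh3_def lookup_add lookup_frag_of \<delta>_def)
        moreover have "B3 g = \<one>\<^bsub>tensor_product (word_module_3 X) ?A\<^esub>"
          by (rule t3(4)) (simp only: 3(1) word_component_words(1)[OF k] sh_relations(2)[OF 3(2,3,4)])
        moreover have "word_component 2 g = 0" unfolding 3(1) by (rule word_component_words(2)[OF k]) simp
        then have "B2 g = \<one>\<^bsub>tensor_product (word_module_2 X) ?A\<^esub>"
          by (intro t2(4)) (simp add: subgroup_frag_zero[OF relations_2_subgroup])
        ultimately show ?thesis unfolding B one by simp
      qed
      then show "g \<in> kernel (word_group X) ?I (indexing_element p X)" using gc by (simp add: kernel_def)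
    qed
    ultimately show "indexing_element p X c = \<one>\<^bsub>?I\<^esub>" by (auto simp: kernel_def)
  qed
qed

section \<open>The homomorphism from the indexing group\<close>

text \<open>With equal kernels, two elements have the same image under \<open>A\<close> exactly when
  they do under \<open>B\<close>; so the choice of a preimage under \<open>B\<close> does not affect
  its image under \<open>A\<close>.\<close>

lemma iso_of_common_kernel:
  assumes F: "group F" and H: "group H" and I: "group I"
    and A: "A \<in> hom F H" "A ` carrier F = carrier H" and B: "B \<in> hom F I" "B ` carrier F = carrier I"
    and ker: "\<And>c. c \<in> carrier F \<Longrightarrow> A c = \<one>\<^bsub>H\<^esub> \<longleftrightarrow> B c = \<one>\<^bsub>I\<^esub>"
  shows "\<exists>\<Phi>\<in>iso I H. \<forall>c\<in>carrier F. \<Phi> (B c) = A c"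
proof -
  interpret F: group F by (rule F)
  have eq_iff: "f c = f d \<longleftrightarrow> f (c \<otimes>\<^bsub>F\<^esub> inv\<^bsub>F\<^esub> d) = \<one>\<^bsub>K\<^esub>"
    if K: "group K" and f: "f \<in> hom F K" and cd: "c \<in> carrier F" "d \<in> carrier F" for f K c d
  proof -
    interpret f: group_hom F K f by (intro group_hom.intro F K group_hom_axioms.intro f)
    have 1: "f (c \<otimes>\<^bsub>F\<^esub> inv\<^bsub>F\<^esub> d) = f c \<otimes>\<^bsub>K\<^esub> inv\<^bsub>K\<^esub> (f d)" using cd by simp
    have 2: "\<one>\<^bsub>K\<^esub> = f c \<otimes>\<^bsub>K\<^esub> inv\<^bsub>K\<^esub> (f d) \<longleftrightarrow> f c = \<one>\<^bsub>K\<^esub> \<otimes>\<^bsub>K\<^esub> f d"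
      by (rule f.H.inv_solve_right) (use cd in simp_all)
    show ?thesis unfolding 1 eq_commute[of "f c \<otimes>\<^bsub>K\<^esub> inv\<^bsub>K\<^esub> (f d)"] 2 using cd by simp
  qed
  have AB: "A c = A d \<longleftrightarrow> B c = B d" if cd: "c \<in> carrier F" "d \<in> carrier F" for c d
    unfolding eq_iff[OF H A(1) cd] eq_iff[OF I B(1) cd] by (rule ker) (use cd in simp)
  define \<Phi> where "\<Phi> y = A (SOME c. c \<in> carrier F \<and> B c = y)" for y
  have \<Phi>: "\<Phi> (B c) = A c" if c: "c \<in> carrier F" for c
  proof -
    have "(SOME d. d \<in> carrier F \<and> B d = B c) \<in> carrier F \<and> B (SOME d. d \<in> carrier F \<and> B d = B c) = B c"
      by (rule someI[of "\<lambda>d. d \<in> carrier F \<and> B d = B c" c]) (use c in simp)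
    then show ?thesis unfolding \<Phi>_def using AB[OF _ c] by blast
  qed
  have "\<Phi> \<in> hom I H"
  proof (rule homI)
    fix y assume "y \<in> carrier I"
    then obtain c where "c \<in> carrier F" "y = B c" using B(2) by blast
    then show "\<Phi> y \<in> carrier H" using \<Phi> A(2) by blast
  next
    fix y z assume "y \<in> carrier I" "z \<in> carrier I"
    then obtain c d where cd: "c \<in> carrier F" "y = B c" "d \<in> carrier F" "z = B d" using B(2) by blast
    have "\<Phi> (y \<otimes>\<^bsub>I\<^esub> z) = \<Phi> (B (c \<otimes>\<^bsub>F\<^esub> d))" using cd hom_mult[OF B(1)] by simp
    also have "\<dots> = A c \<otimes>\<^bsub>H\<^esub> A d" using cd hom_mult[OF A(1)] by (simp add: \<Phi>)
    finally show "\<Phi> (y \<otimes>\<^bsub>I\<^esub> z) = \<Phi> y \<otimes>\<^bsub>H\<^esub> \<Phi> z" using cd by (simp add: \<Phi>)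
  qed
  moreover have "bij_betw \<Phi> (carrier I) (carrier H)"
    unfolding bij_betw_def
  proof
    show "inj_on \<Phi> (carrier I)" unfolding B(2)[symmetric] by (rule inj_onI) (use \<Phi> AB in auto)
    show "\<Phi> ` carrier I = carrier H" unfolding B(2)[symmetric] A(2)[symmetric] image_image using \<Phi> by simp
  qed
  ultimately have "\<Phi> \<in> iso I H" by (simp add: iso_def)
  then show ?thesis using \<Phi> by blast
qed

lemma sum_mult_of_bool:
  fixes c :: "'b \<Rightarrow> int"
  assumes "finite W" "v \<notin> W \<Longrightarrow> c v = 0"
  shows "(\<Sum>w\<in>W. c w * of_bool (w = v)) = c v"
proof -
  have "(\<Sum>w\<in>W. c w * of_bool (w = v)) = (\<Sum>w\<in>W. if w = v then c w else 0)"
  proof (rule sum.cong[OF refl])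
    show "c w * of_bool (w = v) = (if w = v then c w else 0)" for w by (cases "w = v") simp_all
  qed
  then show ?thesis using assms by auto
qed

section \<open>Combinations of word classes and their transgressions\<close>

context free_mod_p
begin

lemma represents_unique:
  assumes "represents h \<phi>" "represents h \<phi>'" "n \<in> N" shows "[\<phi> n = \<phi>' n] (mod int p)"
proof -
  have "[\<phi> n + - \<phi>' n = 0] (mod int p)"
    using represents_one_iff[OF represents_mult[OF assms(1) represents_inv[OF assms(2)]]]
      represents_carrier[OF assms(1)] assms(3) by simp
  then show ?thesis by (simp add: cong_iff_dvd_diff)
qed

lemma represents_diff_one:
  assumes "represents h \<phi>" "represents k \<phi>'" "h \<otimes>\<^bsub>Q.H\<^esub> inv\<^bsub>Q.H\<^esub> k = \<one>\<^bsub>Q.H\<^esub>" shows "h = k"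
proof -
  note hk = represents_carrier[OF assms(1)] represents_carrier[OF assms(2)]
  have "\<one>\<^bsub>Q.H\<^esub> = h \<otimes>\<^bsub>Q.H\<^esub> inv\<^bsub>Q.H\<^esub> k \<longleftrightarrow> h = \<one>\<^bsub>Q.H\<^esub> \<otimes>\<^bsub>Q.H\<^esub> k"
    by (rule Q.H.inv_solve_right) (use hk in simp_all)
  then show ?thesis using assms(3) hk by simp
qed

lemma represents_inject:
  assumes h: "represents h \<phi>" and k: "represents k \<phi>'" and "\<And>n. n \<in> N \<Longrightarrow> [\<phi> n = \<phi>' n] (mod int p)"
  shows "h = k"
proof (rule represents_diff_one[OF h k])
  show "h \<otimes>\<^bsub>Q.H\<^esub> inv\<^bsub>Q.H\<^esub> k = \<one>\<^bsub>Q.H\<^esub>"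
    unfolding represents_one_iff[OF represents_mult[OF h represents_inv[OF k]]]
    using assms(3) by (simp add: cong_iff_dvd_diff)
qed

lemma basic_elements:
  "x \<in> X \<Longrightarrow> x [^] (p * p) \<in> N"
  "\<lbrakk>x \<in> X; y \<in> X\<rbrakk> \<Longrightarrow> grp_comm S x y [^] p \<in> N"
  "\<lbrakk>x \<in> X; y \<in> X; z \<in> X\<rbrakk> \<Longrightarrow> grp_comm S (grp_comm S x y) z \<in> N"
  using lower_p_central_3_elements X_carrier by (simp_all add: subset_iff)

text \<open>Since \<phi> is known only modulo \<open>p\<close>, it is replaced by an exact
  transgression \<open>trans_hom b\<close>, to which the vanishing theorem for invariant
  homomorphisms applies.\<close>

lemma represents_one_iff_basic:
  assumes h: "represents h \<phi>"
  shows "h = \<one>\<^bsub>Q.H\<^esub> \<longleftrightarrow>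
    (\<forall>x\<in>X. [\<phi> (x [^] (p * p)) = 0] (mod int p)) \<and>
    (\<forall>x\<in>X. \<forall>y\<in>X. [\<phi> (grp_comm S x y [^] p) = 0] (mod int p)) \<and>
    (\<forall>x\<in>X. \<forall>y\<in>X. \<forall>z\<in>X. [\<phi> (grp_comm S (grp_comm S x y) z) = 0] (mod int p))" (is "_ \<longleftrightarrow> ?B")
proof
  assume "h = \<one>\<^bsub>Q.H\<^esub>"
  then show ?B using represents_one_iff[OF h] basic_elements by blast
next
  assume B: ?B
  obtain f b where fb: "trans_cochain f b" "represents h (trans_hom b)"
    by (rule represents_exists[OF represents_carrier[OF h]])
  interpret b: invariant_hom S T X g_type p "trans_hom b" by (rule trans_hom_invariant[OF fb(1)])
  have zero: "trans_hom b n = 0" if n: "n \<in> N" and "[\<phi> n = 0] (mod int p)" for n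
    using cong_trans[OF represents_unique[OF fb(2) h n] that(2)] p3 by (simp add: trans_hom_def cong_def)
  have "trans_hom b n = 0" if "n \<in> N" for n
    by (rule b.vanish[OF _ _ _ that]) (rule zero; use B basic_elements in blast)+
  then show "h = \<one>\<^bsub>Q.H\<^esub>" unfolding represents_one_iff[OF fb(2)] by simp
qed

abbreviation word_product where
  "word_product c \<equiv> gfinprod Q.H (\<lambda>w. alpha_class p 3 S T X w [^]\<^bsub>Q.H\<^esub> (c w :: int)) (all_words X)"

lemma alpha_represents: "w \<in> all_words X \<Longrightarrow> represents (alpha_class p 3 S T X w) (pairing w)"
  by (rule alpha_class_represents(1)) (auto simp: words_def)

lemma word_product_represents:
  assumes "finite W'" "W' \<subseteq> all_words X" "\<forall>w\<in>all_words X - W'. c w = 0"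
  shows "represents (word_product c) (\<lambda>n. \<Sum>w\<in>W'. c w * pairing w n)"
  by (rule represents_gfinprod[OF assms(1,2) alpha_represents]) (use assms(3) in blast)+

text \<open>Each pairing is a signed sum of indicators of words, and summation against
  \<open>c\<close> picks the corresponding coefficients.\<close>

lemma pairing_values:
  fixes c :: "'a list \<Rightarrow> int"
  assumes fin: "finite W'" and sub: "W' \<subseteq> all_words X"
    and c: "\<forall>w\<in>all_words X - W'. c w = 0"
  shows "x \<in> X \<Longrightarrow> [(\<Sum>w\<in>W'. c w * pairing w (x [^] (p * p))) = c [x]] (mod int p)"
    and "\<lbrakk>x \<in> X; y \<in> X\<rbrakk> \<Longrightarrow>
      [(\<Sum>w\<in>W'. c w * pairing w (grp_comm S x y [^] p)) = c [x, y] - c [y, x]] (mod int p)"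
    and "\<lbrakk>x \<in> X; y \<in> X; z \<in> X\<rbrakk> \<Longrightarrow>
      [(\<Sum>w\<in>W'. c w * pairing w (grp_comm S (grp_comm S x y) z)) =
         c [x, y, z] - c [y, x, z] - c [z, x, y] + c [z, y, x]] (mod int p)"
proof -
  have W: "w \<in> lists X" "length w \<in> {1, 2, 3}" if "w \<in> W'" for w using that sub by (auto simp: words_def)
  have s: "(\<Sum>w\<in>W'. c w * of_bool (w = v)) = c v" if "v \<in> all_words X" for v
    by (rule sum_mult_of_bool[OF fin]) (use c that in blast)
  {
    assume x: "x \<in> X"
    have "[(\<Sum>w\<in>W'. c w * pairing w (x [^] (p * p))) = (\<Sum>w\<in>W'. c w * letter_pairing w x)] (mod int p)"
      by (intro cong_sum cong_scalar_left alpha_class_represents(2) W x)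
    also have "(\<Sum>w\<in>W'. c w * letter_pairing w x) = c [x]"
      unfolding letter_pairing_def by (rule s) (use x in \<open>simp add: words_def\<close>)
    finally show "[(\<Sum>w\<in>W'. c w * pairing w (x [^] (p * p))) = c [x]] (mod int p)" .
  next
    assume xy: "x \<in> X" "y \<in> X"
    have v: "[x, y] \<in> all_words X" "[y, x] \<in> all_words X" using xy by (simp_all add: words_def)
    have "[(\<Sum>w\<in>W'. c w * pairing w (grp_comm S x y [^] p)) = (\<Sum>w\<in>W'. c w * comm_pairing w x y)] (mod int p)"
      by (intro cong_sum cong_scalar_left alpha_class_represents(3) W xy)
    also have "(\<Sum>w\<in>W'. c w * comm_pairing w x y) = c [x, y] - c [y, x]"
      unfolding comm_pairing_def right_diff_distrib sum_subtractf s[OF v(1)] s[OF v(2)] ..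
    finally show "[(\<Sum>w\<in>W'. c w * pairing w (grp_comm S x y [^] p)) = c [x, y] - c [y, x]] (mod int p)" .
  next
    assume xyz: "x \<in> X" "y \<in> X" "z \<in> X"
    have v: "[x, y, z] \<in> all_words X" "[y, x, z] \<in> all_words X" "[z, x, y] \<in> all_words X" "[z, y, x] \<in> all_words X"
      using xyz by (simp_all add: words_def)
    have "[(\<Sum>w\<in>W'. c w * pairing w (grp_comm S (grp_comm S x y) z)) =
        (\<Sum>w\<in>W'. c w * triple_comm_pairing w x y z)] (mod int p)"
      by (intro cong_sum cong_scalar_left alpha_class_represents(4) W xyz)
    also have "(\<Sum>w\<in>W'. c w * triple_comm_pairing w x y z) = c [x, y, z] - c [y, x, z] - c [z, x, y] + c [z, y, x]"
      unfolding triple_comm_pairing_def right_diff_distrib distrib_left sum.distrib sum_subtractf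
        s[OF v(1)] s[OF v(2)] s[OF v(3)] s[OF v(4)] ..
    finally show "[(\<Sum>w\<in>W'. c w * pairing w (grp_comm S (grp_comm S x y) z)) =
         c [x, y, z] - c [y, x, z] - c [z, x, y] + c [z, y, x]] (mod int p)" .
  }
qed

text \<open>The three kinds of basic elements give exactly the three conditions of
  \<open>lie_trivial\<close>.\<close>

lemma word_product_one_iff:
  fixes c :: "'a list \<Rightarrow> int"
  assumes "finite {w \<in> all_words X. c w \<noteq> 0}"
  shows "word_product c = \<one>\<^bsub>Q.H\<^esub> \<longleftrightarrow> lie_trivial p X c"
proof -
  let ?W' = "{w \<in> all_words X. c w \<noteq> 0}"
  have W': "?W' \<subseteq> all_words X" "\<forall>w\<in>all_words X - ?W'. c w = 0" by blast+
  note v = pairing_values[where c = c, OF assms W']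
  have z: "[a = b] (mod m) \<Longrightarrow> [a = 0] (mod m) \<longleftrightarrow> [b = 0] (mod m)" for a b m :: int by (simp add: cong_def)
  show ?thesis
    unfolding lie_trivial_def
    by (rule trans[OF represents_one_iff_basic[OF word_product_represents[where c = c, OF assms W']]])
      (intro arg_cong2[where f = "(\<and>)"] ball_cong refl z v; assumption)
qed

lemma word_product_hom: "(\<lambda>c. word_product (Poly_Mapping.lookup c)) \<in> hom (word_group X) Q.H"
proof (rule homI)
  show "word_product (Poly_Mapping.lookup c) \<in> carrier Q.H" if "c \<in> carrier (word_group X)" for c
    by (rule represents_carrier[OF word_product_represents[OF finite_keys, of c]])
      (use that in \<open>simp_all add: in_keys_iff\<close>)
  fix c d assume "c \<in> carrier (word_group X)" "d \<in> carrier (word_group X)"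
  then have W: "Poly_Mapping.keys c \<union> Poly_Mapping.keys d \<subseteq> all_words X" by simp
  \<comment> \<open>The union of the supports is a common index set for \<open>c\<close>,
    \<open>d\<close> and their sum, whose own support may be smaller.\<close>
  have r: "represents (word_product (Poly_Mapping.lookup e))
      (\<lambda>n. \<Sum>w\<in>Poly_Mapping.keys c \<union> Poly_Mapping.keys d. Poly_Mapping.lookup e w * pairing w n)"
    if "Poly_Mapping.keys e \<subseteq> Poly_Mapping.keys c \<union> Poly_Mapping.keys d" for e
    by (rule word_product_represents[OF _ W]) (use that in \<open>auto simp: in_keys_iff subset_iff\<close>)
  show "word_product (Poly_Mapping.lookup (c \<otimes>\<^bsub>word_group X\<^esub> d)) =
      word_product (Poly_Mapping.lookup c) \<otimes>\<^bsub>Q.H\<^esub> word_product (Poly_Mapping.lookup d)"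
    by (rule represents_inject[OF r represents_mult[OF r r]])
      (use keys_add[of c d] in \<open>simp_all add: lookup_add distrib_right sum.distrib\<close>)
qed

text \<open>This provides finiteness for surjectivity: almost all letters lie in \<open>V\<close>,
  so the transgression is zero on all but finitely many basic elements.\<close>

lemma trans_cochain_open_normal:
  assumes "trans_cochain f b"
  obtains V where "V \<lhd> S" "openin T V" "\<And>v. v \<in> V \<Longrightarrow> trans_hom b v = 0"
proof -
  \<comment> \<open>The second coordinate plays the part of the parameter in
    \<open>open_invariance_subgroup\<close>, and the function is constant in it.\<close>
  have c: "continuous_map (prod_topology T T) Q.D (b \<circ> fst)"
    by (rule continuous_map_compose[OF continuous_map_fst trans_cochainD(1)[OF assms]])
  note V = open_invariance_subgroup[OF compact_T compact_T c]
  show thesis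
  proof (rule that[OF V])
    fix v assume v: "v \<in> {v \<in> carrier S. \<forall>a\<in>carrier S. \<forall>c\<in>carrier S. \<forall>y\<in>topspace T.
      (b \<circ> fst) (a \<otimes> v \<otimes> c, y) = (b \<circ> fst) (a \<otimes> c, y)}"
    then have vS: "v \<in> carrier S" and e: "\<forall>a\<in>carrier S. \<forall>c\<in>carrier S. \<forall>y\<in>topspace T.
      (b \<circ> fst) (a \<otimes> v \<otimes> c, y) = (b \<circ> fst) (a \<otimes> c, y)" by blast+
    have "\<one> \<in> topspace T" by simp
    from e[rule_format, OF one_closed one_closed this] show "trans_hom b v = 0"
      using vS by (simp add: trans_hom_def)
  qed
qed

text \<open>A combination of word classes is built with the same basic values as \<open>h\<close>;
  classes with equal basic values coincide. Its coefficients are the basic values of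
  \<open>h\<close> divided by the length of the word, and the comparison rests on antisymmetry and
  the Jacobi identity.\<close>

lemma word_product_surj:
  assumes h: "h \<in> carrier Q.H"
  shows "\<exists>c\<in>carrier (word_group X). word_product (Poly_Mapping.lookup c) = h"
proof -
  obtain f b where fb: "trans_cochain f b" "represents h (trans_hom b)" by (rule represents_exists[OF h])
  interpret b: invariant_hom S T X g_type p "trans_hom b" by (rule trans_hom_invariant[OF fb(1)])
  obtain V where V: "V \<lhd> S" "openin T V" "\<And>v. v \<in> V \<Longrightarrow> trans_hom b v = 0"
    by (rule trans_cochain_open_normal[OF fb(1)]) blast
  have Vs: "subgroup V S" by (rule normal_imp_subgroup[OF V(1)])
  interpret v: group_hom S "S Mod V" "\<lambda>g. V #> g"
    by (intro group_hom.intro is_group normal.factorgroup_is_group group_hom_axioms.intro normal.r_coset_hom_Mod V(1))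
  have v1: "V #> g = \<one>\<^bsub>S Mod V\<^esub> \<longleftrightarrow> g \<in> V" if "g \<in> carrier S" for g
    unfolding one_FactGroup using coset_join1[of V g] coset_join2[of g V] Vs subgroup.subset[OF Vs] that by auto
  note XS = subsetD[OF X_carrier]
  have commV: "grp_comm S g k \<in> V" if "g \<in> carrier S" "k \<in> carrier S" "g \<in> V \<or> k \<in> V" for g k
  proof -
    have "V #> g = \<one>\<^bsub>S Mod V\<^esub> \<or> V #> k = \<one>\<^bsub>S Mod V\<^esub>" using that v1 by blast
    then have "grp_comm (S Mod V) (V #> g) (V #> k) = \<one>\<^bsub>S Mod V\<^esub>"
      using v.H.grp_comm_eq_one_iff[OF v.hom_closed[OF that(1)] v.hom_closed[OF that(2)]]
        v.hom_closed[OF that(1)] v.hom_closed[OF that(2)] by (metis v.H.l_one v.H.r_one)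
    then show ?thesis using v1[of "grp_comm S g k"] v.hom_grp_comm[OF that(1,2)] that(1,2) by simp
  qed
  have powV: "g [^] n \<in> V" if "g \<in> carrier S" "g \<in> V" for g and n :: nat
    using v1[of g] v1[of "g [^] n"] v.hom_nat_pow[OF that(1), of n] that by simp
  define t1 where "t1 x = trans_hom b (x [^] (p * p))" for x
  define t2 where "t2 x y = trans_hom b (grp_comm S x y [^] p)" for x y
  define t3 where "t3 x y z = trans_hom b (grp_comm S (grp_comm S x y) z)" for x y z
  have t1V: "t1 x = 0" if "x \<in> X" "x \<in> V" for x unfolding t1_def by (intro V(3) powV XS that)
  have t2V: "t2 x y = 0" if "x \<in> X" "y \<in> X" "x \<in> V \<or> y \<in> V" for x y
    unfolding t2_def by (intro V(3) powV commV grp_comm_closed XS that)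
  have t3V: "t3 x y z = 0" if "x \<in> X" "y \<in> X" "z \<in> X" "(x \<in> V \<or> y \<in> V) \<or> z \<in> V" for x y z
  proof -
    have "grp_comm S x y \<in> V \<or> z \<in> V" using commV[OF XS[OF that(1)] XS[OF that(2)]] that(4) by blast
    then show ?thesis
      unfolding t3_def
      by (rule V(3)[OF commV[OF grp_comm_closed[OF XS[OF that(1)] XS[OF that(2)]] XS[OF that(3)]]])
  qed
  obtain k2 k3 :: int where k2: "[2 * k2 = 1] (mod int p)" and k3: "[3 * k3 = 1] (mod int p)"
    by (rule inverse_mod_prime[OF prime_p p3])
  \<comment> \<open>The Dynkin operator multiplies a Lie element of degree s by s; the factors
    \<open>k2\<close> and \<open>k3\<close> undo this for s = 2 and s = 3.\<close>
  define c0 where "c0 w = (if length w = 1 then t1 (w ! 0) else if length w = 2 then k2 * t2 (w ! 0) (w ! 1)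
    else k3 * t3 (w ! 0) (w ! 1) (w ! 2))" for w
  have c0: "c0 [x] = t1 x" "c0 [x, y] = k2 * t2 x y" "c0 [x, y, z] = k3 * t3 x y z" for x y z
    by (simp_all add: c0_def numeral_2_eq_2)
  \<comment> \<open>A word with a letter in \<open>V\<close> gets coefficient 0, and only finitely
    many letters lie outside \<open>V\<close>.\<close>
  have "{w \<in> all_words X. c0 w \<noteq> 0} \<subseteq> {w. set w \<subseteq> {x \<in> X. x \<notin> V} \<and> length w \<le> 3}"
  proof
    fix w assume w: "w \<in> {w \<in> all_words X. c0 w \<noteq> 0}"
    then have "w \<in> all_words X" by simp
    then show "w \<in> {w. set w \<subseteq> {x \<in> X. x \<notin> V} \<and> length w \<le> 3}"
    proof (cases rule: all_words_cases)
      case (1 x)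
      then show ?thesis using w c0(1)[of x] t1V[of x] by auto
    next
      case (2 x y)
      then show ?thesis using w c0(2)[of x y] t2V[of x y] by auto
    next
      case (3 x y z)
      then show ?thesis using w c0(3)[of x y z] t3V[of x y z] by auto
    qed
  qed
  then have "finite {w \<in> all_words X. c0 w \<noteq> 0}"
    using finite_lists_length_le[OF finite_outside_open_normal[OF V(1,2)], of 3] by (rule finite_subset)
  then obtain c where c: "Poly_Mapping.keys c \<subseteq> all_words X"
    "\<And>w. w \<in> all_words X \<Longrightarrow> Poly_Mapping.lookup c w = c0 w" by (rule poly_mapping_with_lookup) blast
  have l: "Poly_Mapping.lookup c [x] = t1 x" "Poly_Mapping.lookup c [x, y] = k2 * t2 x y"
    "Poly_Mapping.lookup c [x, y, z] = k3 * t3 x y z" if "x \<in> X" "y \<in> X" "z \<in> X" for x y z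
    using c(2)[of "[x]"] c(2)[of "[x, y]"] c(2)[of "[x, y, z]"] that by (simp_all add: words_def c0)
  define \<sigma> where "\<sigma> n = (\<Sum>w\<in>Poly_Mapping.keys c. Poly_Mapping.lookup c w * pairing w n)" for n
  have out: "\<forall>w\<in>all_words X - Poly_Mapping.keys c. Poly_Mapping.lookup c w = 0"
    by (simp add: in_keys_iff)
  have r: "represents (word_product (Poly_Mapping.lookup c)) \<sigma>"
    unfolding \<sigma>_def by (rule word_product_represents[OF finite_keys c(1) out])
  note val = pairing_values[where c = "Poly_Mapping.lookup c", OF finite_keys c(1) out, folded \<sigma>_def]
  have cancel: "[a + - s = 0] (mod m)" if "[s = e] (mod m)" "m dvd a - e" for a s e m :: int
    using dvd_diff[OF that(2) that(1)[unfolded cong_iff_dvd_diff]] by (simp add: cong_iff_dvd_diff)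
  have "h = word_product (Poly_Mapping.lookup c)"
  proof (rule represents_diff_one[OF fb(2) r])
    show "h \<otimes>\<^bsub>Q.H\<^esub> inv\<^bsub>Q.H\<^esub> word_product (Poly_Mapping.lookup c) = \<one>\<^bsub>Q.H\<^esub>"
      unfolding represents_one_iff_basic[OF represents_mult[OF fb(2) represents_inv[OF r]]]
        t1_def[symmetric] t2_def[symmetric] t3_def[symmetric]
    proof (intro conjI ballI)
      show "[t1 x + - \<sigma> (x [^] (p * p)) = 0] (mod int p)" if x: "x \<in> X" for x
        by (rule cancel[OF val(1)[OF x]]) (simp add: l(1)[OF x x x])
      show "[t2 x y + - \<sigma> (grp_comm S x y [^] p) = 0] (mod int p)" if x: "x \<in> X" and y: "y \<in> X" for x y
      proof (rule cancel[OF val(2)[OF x y]])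
        have s: "int p dvd t2 x y + t2 y x"
          using b.\<psi>_comm_swap[OF XS[OF x] XS[OF y]] by (simp add: t2_def cong_0_iff)
        have "int p dvd k2 * (t2 x y + t2 y x) - (2 * k2 - 1) * t2 x y"
          by (rule dvd_diff[OF dvd_mult[OF s] dvd_mult2[OF k2[unfolded cong_iff_dvd_diff]]])
        also have "k2 * (t2 x y + t2 y x) - (2 * k2 - 1) * t2 x y =
            t2 x y - (Poly_Mapping.lookup c [x, y] - Poly_Mapping.lookup c [y, x])"
          unfolding l(2)[OF x y y] l(2)[OF y x x] by (simp add: algebra_simps)
        finally show "int p dvd t2 x y - (Poly_Mapping.lookup c [x, y] - Poly_Mapping.lookup c [y, x])" .
      qed
      show "[t3 x y z + - \<sigma> (grp_comm S (grp_comm S x y) z) = 0] (mod int p)"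
        if x: "x \<in> X" and y: "y \<in> X" and z: "z \<in> X" for x y z
      proof (rule cancel[OF val(3)[OF x y z]])
        have s1: "int p dvd t3 x y z + t3 y x z" and s2: "int p dvd t3 y z x + t3 z y x"
          using b.\<psi>_triple_swap[OF XS[OF x] XS[OF y] XS[OF z]] b.\<psi>_triple_swap[OF XS[OF y] XS[OF z] XS[OF x]]
          by (simp_all add: t3_def cong_0_iff)
        have j: "int p dvd t3 x y z + t3 y z x + t3 z x y"
          using b.\<psi>_jacobi[OF XS[OF x] XS[OF y] XS[OF z]] by (simp add: t3_def cong_0_iff)
        \<comment> \<open>The combination takes the value k3 (t3(x,y,z) - t3(y,x,z) - t3(z,x,y) +
          t3(z,y,x)). The two swaps and the Jacobi identity turn the bracket into 3 t3(x,y,z), and 3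
          k3 is 1 modulo \<open>p\<close>.\<close>
        have "int p dvd k3 * (t3 x y z + t3 y x z) + k3 * (t3 x y z + t3 y z x + t3 z x y) -
            k3 * (t3 y z x + t3 z y x) - (3 * k3 - 1) * t3 x y z"
          by (rule dvd_diff[OF dvd_diff[OF dvd_add[OF dvd_mult[OF s1] dvd_mult[OF j]] dvd_mult[OF s2]]
                dvd_mult2[OF k3[unfolded cong_iff_dvd_diff]]])
        also have "k3 * (t3 x y z + t3 y x z) + k3 * (t3 x y z + t3 y z x + t3 z x y) -
            k3 * (t3 y z x + t3 z y x) - (3 * k3 - 1) * t3 x y z =
            t3 x y z - (Poly_Mapping.lookup c [x, y, z] - Poly_Mapping.lookup c [y, x, z] -
              Poly_Mapping.lookup c [z, x, y] + Poly_Mapping.lookup c [z, y, x])"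
          unfolding l(3)[OF x y z] l(3)[OF y x z] l(3)[OF z x y] l(3)[OF z y x] by (simp add: algebra_simps)
        finally show "int p dvd t3 x y z - (Poly_Mapping.lookup c [x, y, z] - Poly_Mapping.lookup c [y, x, z] -
              Poly_Mapping.lookup c [z, x, y] + Poly_Mapping.lookup c [z, y, x])" .
      qed
    qed
  qed
  then show ?thesis using c(1) by (intro bexI[of _ c]) simp_all
qed

end

theorem theorem11p3:
  fixes p :: nat
    and S :: "('a, 'm) monoid_scheme" and T :: "'a topology"
    and X :: "'a set" and r :: "'a rel"
  assumes "prime p" and "p > 3"
    and "X \<noteq> {}" and "linear_order_on X r"
    and "free_profinite_group TYPE('g::infinite) S T X"
  defines "W \<equiv> words X 1 \<union> words X 2 \<union> words X 3"
    and "H \<equiv> H2 (p_quotient S T p 3) (p_quotient_topology S T p 3) (integer_mod_group p)"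
    and "\<alpha> \<equiv> alpha_class p 3 S T X"
  shows "(\<exists>\<Phi> \<in> iso (indexing_group p X) H.
            \<forall>c \<in> carrier (free_Abelian_group W).
              \<Phi> (indexing_element p X c) =
                gfinprod H (\<lambda>w. \<alpha> w [^]\<^bsub>H\<^esub> Poly_Mapping.lookup c w) W) \<and>
         {c \<in> carrier (word_relation_group p W).
            gfinprod H (\<lambda>w. \<alpha> w [^]\<^bsub>H\<^esub> c w) W = \<one>\<^bsub>H\<^esub>} =
         generate (word_relation_group p W)
           {shuffle_relation p W u v | u v.
              u \<in> lists X \<and> v \<in> lists X \<and> u \<noteq> [] \<and> v \<noteq> [] \<and> length u + length v \<le> 3}"
proof -
  have S: "topological_group S T" using assms(5) by (simp add: free_profinite_group_def profinite_group_def)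
  then have "group S" by (simp add: topological_group_def)
  then interpret free_mod_p S T X "TYPE('g)" p
    by (intro free_mod_p.intro free_profinite.intro top_group.intro top_group_axioms.intro
        free_profinite_axioms.intro free_mod_p_axioms.intro assms(1,2,5) S)
  have p1: "p > 1" using assms(2) by simp
  show ?thesis
    unfolding W_def H_def \<alpha>_def
  proof
    show "\<exists>\<Phi>\<in>iso (indexing_group p X) Q.H. \<forall>c\<in>carrier (word_group X).
        \<Phi> (indexing_element p X c) = word_product (Poly_Mapping.lookup c)"
    \<comment> \<open>Both groups are images of the integer combinations of words, and both kernels
      consist of the combinations orthogonal to the Lie polynomials.\<close>
    proof (rule iso_of_common_kernel[OF group_free_Abelian_group Q.H.is_group indexing_group_group[OF assms(1,2)]
          word_product_hom _ indexing_element_hom[OF assms(1,2)] indexing_element_surj[OF assms(1,2)]])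
      show "(\<lambda>c. word_product (Poly_Mapping.lookup c)) ` carrier (word_group X) = carrier Q.H"
        using hom_in_carrier[OF word_product_hom] word_product_surj by (intro equalityI subsetI) (auto simp: image_iff)
      fix c assume c: "c \<in> carrier (word_group X)"
      have "finite {w \<in> all_words X. Poly_Mapping.lookup c w \<noteq> 0}"
        by (rule finite_subset[OF _ finite_keys[of c]]) (auto simp: in_keys_iff)
      then show "word_product (Poly_Mapping.lookup c) = \<one>\<^bsub>Q.H\<^esub> \<longleftrightarrow> indexing_element p X c = \<one>\<^bsub>indexing_group p X\<^esub>"
        unfolding indexing_element_one_iff[OF assms(1,2) c] by (rule word_product_one_iff)
    qed
    \<comment> \<open>Elements of the relation group have finite support, so
      \<open>word_product_one_iff\<close> applies to each of them.\<close>
    have "{c \<in> carrier (word_relation_group p (all_words X)). word_product c = \<one>\<^bsub>Q.H\<^esub>} =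
        {c \<in> carrier (word_relation_group p (all_words X)). lie_trivial p X c}"
      using word_product_one_iff word_relation_carrier[OF p1, of _ "all_words X"] by blast
    then show "{c \<in> carrier (word_relation_group p (all_words X)). word_product c = \<one>\<^bsub>Q.H\<^esub>} =
        generate (word_relation_group p (all_words X)) {shuffle_relation p (all_words X) u v | u v.
          u \<in> lists X \<and> v \<in> lists X \<and> u \<noteq> [] \<and> v \<noteq> [] \<and> length u + length v \<le> 3}"
      unfolding lie_trivial_relations[OF assms(1,2)] .
  qed
qed

end
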